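(* Let $X$ be a log-correlated field on $U\subset\mathbb{R}^d$ and let $(X_n)_{n\ge 1}$ be a standard approximation of $X$ (see context). Let $0<\beta<\sqrt d$. Then the functions $$\mu_n(x)=e^{i\beta X_n(x)+\frac{\beta^2}{2}\mathbb{E}[X_n(x)^2]},$$ understood as zero outside of $U$, converge in probability in $H^s(\mathbb{R}^d)$ for every $s<-\frac d2$. The limit $\mu$ is a non-trivial random element of $H^s(\mathbb{R}^d)$, supported on $\overline U$. Moreover, suppose that $(X_n)$ and $(\widetilde X_n)$ are two standard approximations of the same log-correlated field $X$, living on the same probability space and jointly Gaussian, satisfying $$\lim_{n\to\infty}\mathbb{E}X_n(x)\widetilde X_n(y)=C_X(x,y),$$ where the convergence takes place in measure on $U\times U$. Then the corresponding limits $\mu$ and $\widetilde\mu$ (for the same $\beta$) are equal almost surely.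
   Context: Setting: $d\ge1$, $U\subset\mathbb{R}^d$ is a bounded simply connected domain, and $C_X(x,y)=\log|x-y|^{-1}+g(x,y)$ for $x,y\in U$, where $g:U\times U\to\mathbb{R}$ belongs to $L^1(U\times U)\cap C(U\times U)$ and is bounded from above. $C_X$ is extended by $0$ outside $U\times U$ and is assumed to be a covariance kernel: symmetric and $\int\int C_X(x,y)f(x)\overline{f(y)}\,dx\,dy\ge0$ for all $f\in C_c^\infty(\mathbb{R}^d)$. The log-correlated field $X$ with covariance $C_X$ is the centered Gaussian random generalized function with $\mathbb{E}X(f)X(h)=\int\int C_X(x,y)f(x)h(y)\,dx\,dy$ for real test functions $f,h$, realized as a random element of $H^{-\varepsilon}(\mathbb{R}^d)$ for every $\varepsilon>0$. $H^s(\mathbb{R}^d)$ is the space of tempered distributions $\varphi$ with $\int(1+|\xi|^2)^s|\widehat\varphi(\xi)|^2d\xi<\infty$. Standard approximation: a sequence $(X_n)_{n\ge1}$ of continuous jointly Gaussian centered (real) fields on $U$ is a standard approximation of $X$ if (i) $\lim_{(m,n)\to\infty}\mathbb{E}X_m(x)X_n(y)=C_X(x,y)$, with convergence in measure with respect to Lebesgue measure on $U\times U$; (ii) there is a sequence $c_1\ge c_2\ge\dots>0$ with $c_n\to0$ such that for every compact $K\subset U$, $\sup_{n\ge1}\sup_{x,y\in K}\left|\mathbb{E}X_n(x)X_n(y)-\log\frac1{\max(c_n,|x-y|)}\right|<\infty$; (iii) $\sup_{n\ge1}\sup_{x,y\in U}\left[\mathbb{E}X_n(x)X_n(y)-\log\frac1{|x-y|}\right]<\infty$.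 "Non-trivial" means that $\mu$ is not almost surely zero. *)

theory Defs
  imports "HOL-Probability.Probability"
begin

text \<open>
  The space $\mathbb{R}^d$ is an arbitrary type of class \<open>euclidean_space\<close>, with \<open>d = DIM('a)\<close>.
\<close>

section \<open>Schwartz functions and tempered distributions\<close>

text \<open>Iterated partial derivatives; the list holds the directions (basis vectors).\<close>

fun iter_deriv :: "'a list \<Rightarrow> ('a::euclidean_space \<Rightarrow> 'b::real_normed_vector) \<Rightarrow> 'a \<Rightarrow> 'b" where
  "iter_deriv [] f = f"
| "iter_deriv (v # vs) f = (\<lambda>x. frechet_derivative (iter_deriv vs f) (at x) v)"

definition smooth :: "('a::euclidean_space \<Rightarrow> 'b::real_normed_vector) \<Rightarrow> bool" where
  "smooth f \<longleftrightarrow> (\<forall>vs. set vs \<subseteq> Basis \<longrightarrow> iter_deriv vs f differentiable_on UNIV)"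

definition fun_support :: "('a::euclidean_space \<Rightarrow> 'b::real_normed_vector) \<Rightarrow> 'a set" where
  "fun_support f = closure {x. f x \<noteq> 0}"

definition test_functions :: "('a::euclidean_space \<Rightarrow> 'b::real_normed_vector) set" where
  "test_functions = {f. smooth f \<and> compact (fun_support f)}"

definition schwartz_functions :: "('a::euclidean_space \<Rightarrow> complex) set" where
  "schwartz_functions = {f. smooth f \<and>
     (\<forall>k vs. set vs \<subseteq> Basis \<longrightarrow>
        bounded (range (\<lambda>x. (1 + norm x) ^ k * cmod (iter_deriv vs f x))))}"

definition schwartz_seminorm :: "nat \<Rightarrow> 'a list \<Rightarrow> ('a::euclidean_space \<Rightarrow> complex) \<Rightarrow> real" where
  "schwartz_seminorm k vs f = (SUP x. (1 + norm x) ^ k * cmod (iter_deriv vs f x))"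

text \<open>
  A distribution is a functional on all functions that is \<open>0\<close> off the Schwartz space, so that
  equality of functionals is equality of distributions.  The Schwartz space is metrizable, so
  sequential continuity at \<open>0\<close> is continuity.
\<close>

type_synonym 'a distribution = "('a \<Rightarrow> complex) \<Rightarrow> complex"

definition tempered :: "'a::euclidean_space distribution \<Rightarrow> bool" where
  "tempered T \<longleftrightarrow>
     (\<forall>f. f \<notin> schwartz_functions \<longrightarrow> T f = 0) \<and>
     (\<forall>f \<in> schwartz_functions. \<forall>h \<in> schwartz_functions. \<forall>a.
        T (\<lambda>x. a * f x + h x) = a * T f + T h) \<and>
     (\<forall>F. (\<forall>n::nat. F n \<in> schwartz_functions) \<and>
          (\<forall>k vs. set vs \<subseteq> Basis \<longrightarrow> (\<lambda>n. schwartz_seminorm k vs (F n)) \<longlonglongrightarrow> 0)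
          \<longrightarrow> (\<lambda>n. T (F n)) \<longlonglongrightarrow> 0)"

text \<open>The distribution given by the function that equals \<open>f\<close> on \<open>A\<close> and \<open>0\<close> elsewhere.\<close>

definition fun_distribution ::
    "'a::euclidean_space set \<Rightarrow> ('a \<Rightarrow> complex) \<Rightarrow> 'a distribution" where
  "fun_distribution A f =
     (\<lambda>\<phi>. if \<phi> \<in> schwartz_functions then (LINT x:A|lborel. f x * \<phi> x) else 0)"

definition supported_on :: "'a::euclidean_space distribution \<Rightarrow> 'a set \<Rightarrow> bool" where
  "supported_on T A \<longleftrightarrow>
     (\<forall>\<phi> \<in> test_functions. fun_support \<phi> \<inter> A = {} \<longrightarrow> T \<phi> = 0)"

section \<open>Sobolev spaces\<close>

definition fourier :: "('a::euclidean_space \<Rightarrow> complex) \<Rightarrow> 'a \<Rightarrow> complex" where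
  "fourier \<phi> \<xi> = (LINT x|lborel. cis (- 2 * pi * (x \<bullet> \<xi>)) * \<phi> x)"

text \<open>The Fourier transform of \<open>T\<close>, i.e. \<open>\<phi> \<mapsto> T (fourier \<phi>)\<close>, is the function \<open>v\<close>.\<close>

definition is_fourier_transform ::
    "'a::euclidean_space distribution \<Rightarrow> ('a \<Rightarrow> complex) \<Rightarrow> bool" where
  "is_fourier_transform T v \<longleftrightarrow>
     v \<in> borel_measurable lborel \<and>
     (\<forall>\<phi> \<in> schwartz_functions.
        integrable lborel (\<lambda>\<xi>. v \<xi> * \<phi> \<xi>) \<and> T (fourier \<phi>) = (LINT \<xi>|lborel. v \<xi> * \<phi> \<xi>))"

definition sobolev :: "real \<Rightarrow> 'a::euclidean_space distribution set" where
  "sobolev s = {T. tempered T \<and> (\<exists>v. is_fourier_transform T v \<and>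
     integrable lborel (\<lambda>\<xi>. (1 + (norm \<xi>)\<^sup>2) powr s * (cmod (v \<xi>))\<^sup>2))}"

text \<open>The function \<open>v\<close> is unique up to null sets, so the choice below is immaterial.\<close>

definition sobolev_norm :: "real \<Rightarrow> 'a::euclidean_space distribution \<Rightarrow> real" where
  "sobolev_norm s T =
     sqrt (LINT \<xi>|lborel. (1 + (norm \<xi>)\<^sup>2) powr s *
             (cmod ((SOME v. is_fourier_transform T v) \<xi>))\<^sup>2)"

definition sobolev_dist ::
    "real \<Rightarrow> 'a::euclidean_space distribution \<Rightarrow> 'a distribution \<Rightarrow> real" where
  "sobolev_dist s S T = sobolev_norm s (\<lambda>\<phi>. S \<phi> - T \<phi>)"

definition sobolev_borel :: "real \<Rightarrow> 'a::euclidean_space distribution measure" where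
  "sobolev_borel s =
     sigma (sobolev s) {B. openin (Metric_space.mtopology (sobolev s) (sobolev_dist s)) B}"

definition converges_in_probability_sobolev ::
    "'o measure \<Rightarrow> real \<Rightarrow> (nat \<Rightarrow> 'o \<Rightarrow> 'a::euclidean_space distribution)
       \<Rightarrow> ('o \<Rightarrow> 'a distribution) \<Rightarrow> bool" where
  "converges_in_probability_sobolev P s M L \<longleftrightarrow>
     (\<forall>n. M n \<in> P \<rightarrow>\<^sub>M sobolev_borel s) \<and> L \<in> P \<rightarrow>\<^sub>M sobolev_borel s \<and>
     (\<forall>\<epsilon>>0. (\<lambda>n. measure P {\<omega> \<in> space P. \<epsilon> < sobolev_dist s (M n \<omega>) (L \<omega>)}) \<longlonglongrightarrow> 0)"

section \<open>Gaussian families\<close>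

definition centered_gaussian :: "'o measure \<Rightarrow> ('o \<Rightarrow> real) \<Rightarrow> bool" where
  "centered_gaussian P Y \<longleftrightarrow>
     (\<exists>\<sigma>>0. distributed P lborel Y (normal_density 0 \<sigma>)) \<or>
     (Y \<in> borel_measurable P \<and> (AE \<omega> in P. Y \<omega> = 0))"

definition jointly_centered_gaussian ::
    "'o measure \<Rightarrow> 'i set \<Rightarrow> ('i \<Rightarrow> 'o \<Rightarrow> real) \<Rightarrow> bool" where
  "jointly_centered_gaussian P I Z \<longleftrightarrow>
     (\<forall>J a. finite J \<and> J \<subseteq> I \<longrightarrow> centered_gaussian P (\<lambda>\<omega>. \<Sum>j\<in>J. a j * Z j \<omega>))"

section \<open>Log-correlated fields and standard approximations\<close>

definition log_kernel ::
    "'a::euclidean_space set \<Rightarrow> ('a \<Rightarrow> 'a \<Rightarrow> real) \<Rightarrow> 'a \<Rightarrow> 'a \<Rightarrow> real" where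
  "log_kernel U g x y = (if x \<in> U \<and> y \<in> U then ln (1 / dist x y) + g x y else 0)"

definition log_covariance ::
    "'a::euclidean_space set \<Rightarrow> ('a \<Rightarrow> 'a \<Rightarrow> real) \<Rightarrow> bool" where
  "log_covariance U g \<longleftrightarrow>
     open U \<and> connected U \<and> U \<noteq> {} \<and> bounded U \<and> simply_connected U \<and>
     continuous_on (U \<times> U) (\<lambda>(x, y). g x y) \<and>
     set_integrable lborel (U \<times> U) (\<lambda>(x, y). g x y) \<and>
     bdd_above ((\<lambda>(x, y). g x y) ` (U \<times> U)) \<and>
     (\<forall>x y. log_kernel U g x y = log_kernel U g y x) \<and>
     (\<forall>f :: 'a \<Rightarrow> complex. f \<in> test_functions \<longrightarrow>
        (LINT (x, y)|lborel. of_real (log_kernel U g x y) * f x * cnj (f y)) \<in> \<real>\<^sub>\<ge>\<^sub>0)"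

text \<open>
  Joint Gaussianity of the values \<open>X f\<close> follows from the linearity of the distribution
  \<open>X \<omega>\<close> and the Gaussianity of each single value.
\<close>

definition log_correlated_field ::
    "'q measure \<Rightarrow> 'a::euclidean_space set \<Rightarrow> ('a \<Rightarrow> 'a \<Rightarrow> real)
       \<Rightarrow> ('q \<Rightarrow> 'a distribution) \<Rightarrow> bool" where
  "log_correlated_field Q U g X \<longleftrightarrow>
     prob_space Q \<and> log_covariance U g \<and>
     (\<forall>\<epsilon>>0. X \<in> Q \<rightarrow>\<^sub>M sobolev_borel (- \<epsilon>)) \<and>
     (\<forall>f :: 'a \<Rightarrow> real. f \<in> test_functions \<longrightarrow>
        (AE \<omega> in Q. Im (X \<omega> (\<lambda>x. of_real (f x))) = 0) \<and>
        centered_gaussian Q (\<lambda>\<omega>. Re (X \<omega> (\<lambda>x. of_real (f x))))) \<and>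
     (\<forall>f \<in> test_functions. \<forall>h \<in> test_functions.
        (LINT \<omega>|Q. Re (X \<omega> (\<lambda>x. of_real (f x))) * Re (X \<omega> (\<lambda>x. of_real (h x)))) =
        (LINT (x, y)|lborel. log_kernel U g x y * f x * h y))"

definition converges_in_measure_on ::
    "'c::euclidean_space set \<Rightarrow> 'i filter \<Rightarrow> ('i \<Rightarrow> 'c \<Rightarrow> real) \<Rightarrow> ('c \<Rightarrow> real) \<Rightarrow> bool" where
  "converges_in_measure_on A F f h \<longleftrightarrow>
     (\<forall>\<epsilon>>0. ((\<lambda>i. emeasure lborel {z \<in> A. \<epsilon> < \<bar>f i z - h z\<bar>}) \<longlongrightarrow> 0) F)"

definition covar :: "'o measure \<Rightarrow> ('o \<Rightarrow> real) \<Rightarrow> ('o \<Rightarrow> real) \<Rightarrow> real" where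
  "covar P Y Z = (LINT \<omega>|P. Y \<omega> * Z \<omega>)"

text \<open>
  The sequence is indexed by all natural numbers instead of the positive ones.  In the last
  condition the points \<open>x = y\<close>, where the logarithm is \<open>+\<infinity>\<close> and the bound is void, have to be
  left out because \<open>ln (1 / 0) = 0\<close> here.
\<close>

definition standard_approximation ::
    "'o measure \<Rightarrow> 'a::euclidean_space set \<Rightarrow> ('a \<Rightarrow> 'a \<Rightarrow> real)
       \<Rightarrow> (nat \<Rightarrow> 'a \<Rightarrow> 'o \<Rightarrow> real) \<Rightarrow> bool" where
  "standard_approximation P U g X \<longleftrightarrow>
     (\<forall>n. \<forall>\<omega> \<in> space P. continuous_on U (\<lambda>x. X n x \<omega>)) \<and>
     jointly_centered_gaussian P (UNIV \<times> U) (\<lambda>(n, x). X n x) \<and>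
     converges_in_measure_on (U \<times> U) (sequentially \<times>\<^sub>F sequentially)
       (\<lambda>(m, n) (x, y). covar P (X m x) (X n y)) (\<lambda>(x, y). log_kernel U g x y) \<and>
     (\<exists>c :: nat \<Rightarrow> real. decseq c \<and> (\<forall>n. 0 < c n) \<and> c \<longlonglongrightarrow> 0 \<and>
        (\<forall>K. compact K \<and> K \<subseteq> U \<longrightarrow>
           (\<exists>B. \<forall>n. \<forall>x\<in>K. \<forall>y\<in>K.
              \<bar>covar P (X n x) (X n y) - ln (1 / max (c n) (dist x y))\<bar> \<le> B))) \<and>
     (\<exists>B. \<forall>n. \<forall>x\<in>U. \<forall>y\<in>U. x \<noteq> y \<longrightarrow>
        covar P (X n x) (X n y) - ln (1 / dist x y) \<le> B)"

section \<open>Imaginary chaos\<close>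

definition imaginary_chaos ::
    "'o measure \<Rightarrow> real \<Rightarrow> ('a \<Rightarrow> 'o \<Rightarrow> real) \<Rightarrow> 'o \<Rightarrow> 'a \<Rightarrow> complex" where
  "imaginary_chaos P \<beta> Y \<omega> x =
     exp (\<i> * of_real (\<beta> * Y x \<omega>) + of_real (\<beta>\<^sup>2 / 2 * covar P (Y x) (Y x)))"

text \<open>
  \<open>M\<close> is the random distribution given by the random function \<open>F\<close> on \<open>U\<close>, understood as zero
  outside \<open>U\<close>.  If the function is integrable over \<open>U\<close>, this is literally the distribution of
  the function.  A standard approximation may however have a variance that grows so fast at the
  boundary of \<open>U\<close> that the (deterministic) modulus of the chaos is not integrable over \<open>U\<close>; the
  pairing with a test function is then the limit of the integrals over compact subsets of \<open>U\<close>.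
  In the integrable case the second clause follows from the first one, since $L^1$ embeds
  continuously into $H^s$ for $s < -d/2$.
\<close>

definition zero_extension ::
    "'o measure \<Rightarrow> 'a::euclidean_space set \<Rightarrow> ('o \<Rightarrow> 'a \<Rightarrow> complex)
       \<Rightarrow> ('o \<Rightarrow> 'a distribution) \<Rightarrow> bool" where
  "zero_extension P U F M \<longleftrightarrow>
     (\<forall>\<omega> \<in> space P. set_integrable lborel U (F \<omega>) \<longrightarrow> M \<omega> = fun_distribution U (F \<omega>)) \<and>
     (\<forall>K :: nat \<Rightarrow> 'a set. incseq K \<and> (\<forall>j. compact (K j)) \<and> (\<Union>j. K j) = U \<longrightarrow>
        (\<forall>s < - real DIM('a) / 2.
           converges_in_probability_sobolev P s (\<lambda>j \<omega>. fun_distribution (K j) (F \<omega>)) M))"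

definition imaginary_chaos_limit ::
    "'o measure \<Rightarrow> 'a::euclidean_space set \<Rightarrow> real \<Rightarrow> (nat \<Rightarrow> 'a \<Rightarrow> 'o \<Rightarrow> real)
       \<Rightarrow> ('o \<Rightarrow> 'a distribution) \<Rightarrow> bool" where
  "imaginary_chaos_limit P U \<beta> X \<mu> \<longleftrightarrow>
     (\<exists>M. (\<forall>n. zero_extension P U (imaginary_chaos P \<beta> (X n)) (M n)) \<and>
          (\<forall>s < - real DIM('a) / 2. converges_in_probability_sobolev P s M \<mu>))"

end

theory Submission
  imports Defs
begin

text \<open>
  The proof is a second moment computation on the Fourier side. For jointly Gaussian centered
  fields \<open>X\<close> and \<open>Y\<close> the mixed second moment of the two chaoses at
  \<open>x\<close> and \<open>y\<close> is the exponential of \<open>\<beta>\<^sup>2\<close>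
  times the covariance of \<open>X x\<close> and \<open>Y y\<close>
  (\<open>chaos_moment\<close>). Therefore the mean square of the difference of the Fourier
  transforms of the chaoses of \<open>X m\<close> and \<open>X n\<close> is, at every
  frequency, at most the integral of \<open>\<bar>k\<^sub>m\<^sub>m + k\<^sub>n\<^sub>n -
  k\<^sub>m\<^sub>n - k\<^sub>n\<^sub>m\<bar>\<close> over \<open>U \<times> U\<close>, where
  \<open>k\<^sub>m\<^sub>n\<close> is the exponential kernel of \<open>X m\<close> and
  \<open>X n\<close> (\<open>mean_square_le_energy\<close>). This bound is uniform in the
  frequency, and the Sobolev weight of order \<open>s < - d / 2\<close> is integrable, so it
  controls the second moment of the distance in all these Sobolev spaces at once
  (\<open>nn_integral_mean_square_le\<close>). That the transforms form a Cauchy sequence, and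
  that two standard approximations have the same limit, are both reduced to the smallness of
  this integral (\<open>eventually_chaos_discrepancy_small\<close>).

  The kernels converge in measure to \<open>h = exp (\<beta>\<^sup>2 C\<^sub>X)\<close>. The
  diagonal kernels \<open>k\<^sub>n\<^sub>n\<close> are dominated by a multiple of
  \<open>\<bar>x - y\<bar> powr (- \<beta>\<^sup>2)\<close>, which is integrable on the
  bounded set \<open>U \<times> U\<close> because \<open>\<beta>\<^sup>2 < d\<close>, so they
  converge to \<open>h\<close> in \<open>L1\<close>. The hypotheses give no domination of the
  mixed kernels \<open>k\<^sub>m\<^sub>n\<close>; they are handled as in Scheffe's lemma. The
  parts of \<open>h - k\<^sub>m\<^sub>n\<close> that are positive are dominated by
  \<open>h\<close>. The total mass is bounded from above because the second moment of the
  difference of the total masses of two chaoses is nonnegative, which says that the mass of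
  \<open>k\<^sub>m\<^sub>n + k\<^sub>n\<^sub>m\<close> is at most that of
  \<open>k\<^sub>m\<^sub>m + k\<^sub>n\<^sub>n\<close> (\<open>chaos_cross_le\<close>,
  \<open>chaos_discrepancy_le\<close>).

  A single approximating chaos need not be integrable up to the boundary of \<open>U\<close>.
  Its extension by zero is a limit over compact subsets of \<open>U\<close>, obtained from the
  same mean-square bounds (\<open>chaos_extension_exists\<close>); limits in probability being
  unique, it does not matter which version of this random distribution is used
  (\<open>zero_extension_unique\<close>).

  The mean of every chaos is \<open>1\<close>, so the mean of the transform of the limit at a
  low frequency is close to the volume of \<open>U\<close>; hence the limit is not almost
  surely zero (\<open>chaos_limit_nontrivial\<close>). Along a sufficiently fast sequence the
  pairings of the limit with Schwartz functions are almost surely limits of pairings of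
  functions that vanish off compact subsets of \<open>U\<close>, whence the support statement
  (\<open>chaos_limit_supported\<close>).

  The passage between a distribution and its Fourier transform rests on inversion and
  uniqueness for the Fourier transform (\<open>fourier_inversion\<close>,
  \<open>fourier_eq_0_imp_AE_eq_0\<close>), which identify the Sobolev space with a weighted
  \<open>L2\<close> space (\<open>sobolev_eq_synthesis\<close>). The separability of this
  space turns joint measurability of a random transform into Borel measurability
  (\<open>measurable_sobolev_borelI\<close>).
\<close>

section \<open>Integration over euclidean space\<close>

lemma lborel_integrable_affine:
  fixes f :: "'a::euclidean_space \<Rightarrow> 'b::{banach,second_countable_topology}"
  assumes c: "c \<noteq> 0" and f: "integrable lborel f"
  shows "integrable lborel (\<lambda>x. f (t + c *\<^sub>R x))"
proof -
  have [measurable]: "f \<in> borel_measurable borel"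
    using borel_measurable_integrable[OF f] by simp
  have "integrable (density (distr lborel borel (\<lambda>x. t + c *\<^sub>R x)) (\<lambda>_. ennreal (\<bar>c\<bar>^DIM('a)))) f"
    using f lborel_affine[OF c, of t] by (simp add: ennreal_power)
  then have "integrable lborel (\<lambda>x. \<bar>c\<bar>^DIM('a) *\<^sub>R f (t + c *\<^sub>R x))"
    by (subst (asm) integrable_density) (auto simp: integrable_distr_eq)
  then have "integrable lborel (\<lambda>x. (1 / \<bar>c\<bar>^DIM('a)) *\<^sub>R \<bar>c\<bar>^DIM('a) *\<^sub>R f (t + c *\<^sub>R x))"
    by (rule integrable_scaleR_right)
  then show ?thesis
    using c by simp
qed

lemma lborel_integral_affine:
  fixes f :: "'a::euclidean_space \<Rightarrow> 'b::{banach,second_countable_topology}"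
  assumes c: "c \<noteq> 0" and f[measurable]: "f \<in> borel_measurable borel"
  shows "(LINT x|lborel. f x) = \<bar>c\<bar>^DIM('a) *\<^sub>R (LINT x|lborel. f (t + c *\<^sub>R x))"
proof -
  have "(LINT x|lborel. f x) =
      (LINT x|density (distr lborel borel (\<lambda>x. t + c *\<^sub>R x)) (\<lambda>_. ennreal (\<bar>c\<bar>^DIM('a))). f x)"
    using lborel_affine[OF c, of t] by (simp add: ennreal_power)
  also have "\<dots> = (LINT x|lborel. \<bar>c\<bar>^DIM('a) *\<^sub>R f (t + c *\<^sub>R x))"
    by (subst integral_density) (auto simp: integral_distr)
  finally show ?thesis by simp
qed

lemma
  fixes f :: "'a::euclidean_space \<Rightarrow> real \<Rightarrow> 'b::{real_normed_field,banach,second_countable_topology}"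
  assumes f: "\<And>b. b \<in> Basis \<Longrightarrow> integrable lborel (f b)"
  shows lborel_integrable_prod_Basis: "integrable lborel (\<lambda>x. \<Prod>b\<in>Basis. f b (x \<bullet> b))"
    and lborel_integral_prod_Basis:
      "(LINT x|lborel. (\<Prod>b\<in>Basis. f b (x \<bullet> b))) = (\<Prod>b\<in>Basis. (LINT x|lborel. f b x))"
proof -
  interpret product_sigma_finite "\<lambda>_::'a. lborel :: real measure" ..
  have [measurable]: "\<And>b. b \<in> Basis \<Longrightarrow> f b \<in> borel_measurable borel"
    using borel_measurable_integrable[OF f] by simp
  have *: "(\<Prod>b\<in>Basis. f b ((\<Sum>b\<in>Basis. y b *\<^sub>R b) \<bullet> b)) = (\<Prod>b\<in>Basis. f b (y b))" for y :: "'a \<Rightarrow> real"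
    by (rule prod.cong) (auto simp: inner_sum_left inner_Basis if_distrib cong: if_cong)
  show "integrable lborel (\<lambda>x. \<Prod>b\<in>Basis. f b (x \<bullet> b))"
    using product_integrable_prod[of Basis f] f
    by (subst lborel_eq) (simp add: integrable_distr_eq *)
  show "(LINT x|lborel. (\<Prod>b\<in>Basis. f b (x \<bullet> b))) = (\<Prod>b\<in>Basis. (LINT x|lborel. f b x))"
    using product_integral_prod[of Basis f] f
    by (subst lborel_eq) (simp add: integral_distr *)
qed

lemma integrable_powr_abs_Icc:
  fixes a :: real assumes "0 \<le> a" "a < 1" "0 \<le> R"
  shows "integrable lborel (\<lambda>x. indicator {-R..R} x * \<bar>x\<bar> powr (-a))"
proof -
  have "(\<lambda>x. x powr (-a)) integrable_on {0..R}"
    by (rule integrable_on_powr_from_0) (use assms in auto)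
  then have "(\<lambda>x. x powr (-a)) absolutely_integrable_on {0..R}"
    by (intro nonnegative_absolutely_integrable_1) auto
  then have 1: "integrable lborel (\<lambda>x. indicator {0..R} x * x powr (-a))"
    by (simp add: set_integrable_def integrable_completion)
  have 2: "integrable lborel (\<lambda>x. indicator {0..R} (-x) * (-x) powr (-a))"
    using lborel_integrable_real_affine[OF 1, of "-1" 0] by simp
  show ?thesis
    by (rule Bochner_Integration.integrable_bound[OF Bochner_Integration.integrable_add[OF 1 2]])
       (auto simp: indicator_def)
qed

lemma integrable_powr_bracket_real:
  fixes p :: real assumes "p < - 1 / 2"
  shows "integrable lborel (\<lambda>x. (1 + x\<^sup>2) powr p)"
proof -
  have "(\<lambda>x. x powr (2 * p)) integrable_on {1..}"
    using has_integral_powr_to_inf[of "2 * p" 1] assms by (auto simp: integrable_on_def)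
  then have "(\<lambda>x. x powr (2 * p)) absolutely_integrable_on {1..}"
    by (intro nonnegative_absolutely_integrable_1) auto
  then have 1: "integrable lborel (\<lambda>x. indicator {1..} x * x powr (2 * p))"
    by (simp add: set_integrable_def integrable_completion)
  have 2: "integrable lborel (\<lambda>x. indicator {1..} (-x) * (-x) powr (2 * p))"
    using lborel_integrable_real_affine[OF 1, of "-1" 0] by simp
  have 3: "integrable lborel (\<lambda>x. indicator {-1..1::real} x :: real)"
    by simp
  have bound: "(1 + x\<^sup>2) powr p \<le> \<bar>x\<bar> powr (2 * p)" if "1 \<le> \<bar>x\<bar>" for x :: real
  proof -
    have "(1 + x\<^sup>2) powr p \<le> (\<bar>x\<bar>\<^sup>2) powr p"
      using that assms by (intro powr_mono2') auto
    also have "\<dots> = \<bar>x\<bar> powr (2 * p)"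
      using that powr_powr[of "\<bar>x\<bar>" 2 p] by (simp add: powr_numeral)
    finally show ?thesis .
  qed
  have small: "(1 + x\<^sup>2) powr p \<le> 1" for x :: real
    using powr_mono2'[of "p" 1 "1 + x\<^sup>2"] assms by auto
  show ?thesis
  proof (rule Bochner_Integration.integrable_bound[OF
        Bochner_Integration.integrable_add[OF Bochner_Integration.integrable_add[OF 1 2] 3]])
    show "AE x in lborel. norm ((1 + x\<^sup>2) powr p) \<le>
      norm (indicator {1..} x * x powr (2 * p) + indicator {1..} (-x) * (-x) powr (2 * p) + indicator {-1..1} x)"
    proof (rule AE_I2)
      fix x :: real
      show "norm ((1 + x\<^sup>2) powr p) \<le>
        norm (indicator {1..} x * x powr (2 * p) + indicator {1..} (-x) * (-x) powr (2 * p) + indicator {-1..1} x)"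
        using bound[of x] small[of x] by (cases "\<bar>x\<bar> \<le> 1") (auto simp: indicator_def)
    qed
  qed simp
qed

text \<open>
  Each of the \<open>d\<close> coordinate factors \<open>1 + (x \<bullet> b)\<^sup>2\<close> is at most \<open>1 + (norm x)\<^sup>2\<close>.  Hence the radial
  weight is dominated by a product of one-dimensional ones, with the exponent divided by \<open>d\<close>;
  this loses nothing at the critical exponent and replaces polar coordinates.
\<close>

lemma integrable_powr_bracket:
  assumes s: "s < - real DIM('a) / 2"
  shows "integrable lborel (\<lambda>x::'a::euclidean_space. (1 + (norm x)\<^sup>2) powr s)"
proof -
  let ?d = "real DIM('a)"
  have d: "0 < ?d" by simp
  have s0: "s < 0" using s by (auto intro: less_trans)
  have "integrable lborel (\<lambda>x::real. (1 + x\<^sup>2) powr (s / ?d))"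
    using s d by (intro integrable_powr_bracket_real) (auto simp: field_simps)
  then have i: "integrable lborel (\<lambda>x::'a. \<Prod>b\<in>Basis. (1 + (x \<bullet> b)\<^sup>2) powr (s / ?d))"
    using lborel_integrable_prod_Basis[of "\<lambda>_ x. (1 + x\<^sup>2) powr (s / ?d)"] by simp
  show ?thesis
  proof (rule Bochner_Integration.integrable_bound[OF i])
    show "AE x::'a in lborel. norm ((1 + (norm x)\<^sup>2) powr s) \<le> norm (\<Prod>b\<in>Basis. (1 + (x \<bullet> b)\<^sup>2) powr (s / ?d))"
    proof (rule AE_I2)
      fix x :: 'a
      have "(1 + (norm x)\<^sup>2) powr s = (\<Prod>b\<in>(Basis::'a set). (1 + (norm x)\<^sup>2) powr (s / ?d))"
        using powr_power[of "1 + (norm x)\<^sup>2" "s / ?d" "DIM('a)"] d by (simp add: add_nonneg_eq_0_iff)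
      also have "\<dots> \<le> (\<Prod>b\<in>Basis. (1 + (x \<bullet> b)\<^sup>2) powr (s / ?d))"
      proof (rule prod_mono)
        fix b :: 'a assume "b \<in> Basis"
        then have "(x \<bullet> b)\<^sup>2 \<le> (norm x)\<^sup>2"
          using Basis_le_norm[of b x] by (metis abs_le_square_iff abs_norm_cancel)
        then show "0 \<le> (1 + (norm x)\<^sup>2) powr (s / ?d) \<and>
            (1 + (norm x)\<^sup>2) powr (s / ?d) \<le> (1 + (x \<bullet> b)\<^sup>2) powr (s / ?d)"
          using s0 d by (auto intro!: powr_mono2' add_pos_nonneg simp: field_simps)
      qed
      finally show "norm ((1 + (norm x)\<^sup>2) powr s) \<le> norm (\<Prod>b\<in>Basis. (1 + (x \<bullet> b)\<^sup>2) powr (s / ?d))"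
        by simp
    qed
  qed simp
qed

text \<open>
  Again a product dominates: \<open>\<bar>x \<bullet> b\<bar> \<le> norm x\<close> for each of
  the \<open>d\<close> coordinates, and each factor \<open>\<bar>x \<bullet> b\<bar> powr (- a
  / d)\<close> is integrable near \<open>0\<close> since \<open>a / d < 1\<close>. The
  hyperplanes where a coordinate vanishes form a null set.
\<close>

lemma integrable_norm_powr_bounded:
  assumes a: "0 \<le> a" "a < real DIM('a)" and R: "0 \<le> R"
  shows "integrable lborel (\<lambda>x::'a::euclidean_space. indicator (cball 0 R) x * norm x powr (- a))"
proof -
  let ?d = "real DIM('a)"
  have d: "0 < ?d" by simp
  have "integrable lborel (\<lambda>x::real. indicator {-R..R} x * \<bar>x\<bar> powr (- (a / ?d)))"
    using a d R by (intro integrable_powr_abs_Icc) (auto simp: field_simps)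
  then have i: "integrable lborel (\<lambda>x::'a. \<Prod>b\<in>Basis. indicator {-R..R} (x \<bullet> b) * \<bar>x \<bullet> b\<bar> powr (- (a / ?d)))"
    using lborel_integrable_prod_Basis[of "\<lambda>_ x. indicator {-R..R} x * \<bar>x\<bar> powr (- (a / ?d))"] by simp
  have AE0: "AE x::'a in lborel. \<forall>b\<in>Basis. x \<bullet> b \<noteq> 0"
  proof (rule AE_finite_allI)
    fix b :: 'a assume b: "b \<in> Basis"
    have "{x. b \<bullet> x = 0} \<in> null_sets lebesgue"
      using negligible_hyperplane[of b 0] b nonzero_Basis[OF b]
      by (simp add: negligible_iff_null_sets)
    then have "AE x::'a in lborel. b \<bullet> x \<noteq> 0"
      by (subst AE_completion_iff[symmetric]) (auto intro!: AE_I'[of "{x. b \<bullet> x = 0}"])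
    then show "AE x::'a in lborel. x \<bullet> b \<noteq> 0"
      by (simp add: inner_commute)
  qed simp
  have [measurable]: "cball (0::'a) R \<in> sets borel"
    by (intro borel_closed closed_cball)
  show ?thesis
  proof (rule Bochner_Integration.integrable_bound[OF i])
    show "AE x::'a in lborel. norm (indicator (cball 0 R) x * norm x powr (- a)) \<le>
        norm (\<Prod>b\<in>Basis. indicator {-R..R} (x \<bullet> b) * \<bar>x \<bullet> b\<bar> powr (- (a / ?d)))"
      using AE0
    proof eventually_elim
      case (elim x)
      have x: "x \<noteq> 0" using elim by (auto simp: inner_eq_zero_iff)
      have "norm x powr (- a) * indicator (cball 0 R) x =
        (\<Prod>b\<in>(Basis::'a set). indicator (cball 0 R) x * norm x powr (- (a / ?d)))"
        using d x by (cases "x \<in> cball 0 R") (auto simp: powr_power)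
      also have "\<dots> \<le> (\<Prod>b\<in>Basis. indicator {-R..R} (x \<bullet> b) * \<bar>x \<bullet> b\<bar> powr (- (a / ?d)))"
      proof (rule prod_mono)
        fix b :: 'a assume b: "b \<in> Basis"
        have le: "\<bar>x \<bullet> b\<bar> \<le> norm x" using Basis_le_norm[OF b] .
        then have "norm x powr (- (a / ?d)) \<le> \<bar>x \<bullet> b\<bar> powr (- (a / ?d))"
          using elim b a d by (intro powr_mono2') auto
        moreover have "x \<bullet> b \<in> {-R..R}" if "x \<in> cball 0 R"
          using le that by (auto simp: abs_le_iff)
        ultimately show "0 \<le> indicator (cball 0 R) x * norm x powr (- (a / ?d)) \<and>
            indicator (cball 0 R) x * norm x powr (- (a / ?d)) \<le>
            indicator {-R..R} (x \<bullet> b) * \<bar>x \<bullet> b\<bar> powr (- (a / ?d))"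
          by (auto simp: indicator_def)
      qed
      finally show ?case
        by (simp add: mult.commute)
    qed
  qed simp
qed

section \<open>The Schwartz space\<close>

definition partial :: "'a \<Rightarrow> ('a::euclidean_space \<Rightarrow> 'b::real_normed_vector) \<Rightarrow> 'a \<Rightarrow> 'b" where
  "partial b f = (\<lambda>x. frechet_derivative f (at x) b)"

text \<open>
  The recursion of the iterated derivative differentiates last in the first direction of the
  list. Splitting off the innermost direction shows that partial derivatives of smooth
  functions are smooth.
\<close>

lemma iter_deriv_snoc: "iter_deriv (vs @ [b]) f = iter_deriv vs (partial b f)"
  by (induction vs) (simp_all add: partial_def)

lemma partial_eqI: "(\<And>x. (f has_derivative D x) (at x)) \<Longrightarrow> partial b f = (\<lambda>x. D x b)"
  unfolding partial_def by (metis frechet_derivative_at)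

text \<open>
  The Schwartz space is the largest class of rapidly decreasing differentiable functions that is
  closed under partial derivatives.  To show that some operation preserves it, one therefore
  names the class of its values and differentiates once; no Leibniz formula for iterated
  derivatives is needed.
\<close>

lemma schwartz_coinduct:
  assumes f: "f \<in> C"
    and diff: "\<And>f x. f \<in> C \<Longrightarrow> f differentiable (at x)"
    and closed: "\<And>f b. f \<in> C \<Longrightarrow> b \<in> Basis \<Longrightarrow> partial b f \<in> C"
    and decay: "\<And>f k. f \<in> C \<Longrightarrow> \<exists>B. \<forall>x. (1 + norm x) ^ k * cmod (f x) \<le> B"
  shows "f \<in> schwartz_functions"
proof -
  have iter: "iter_deriv vs f \<in> C" if "set vs \<subseteq> Basis" for vs
    using that
  proof (induction vs)
    case (Cons v vs)
    then have "partial v (iter_deriv vs f) \<in> C" by (intro closed) auto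
    then show ?case by (simp add: partial_def)
  qed (simp add: f)
  have "bounded (range (\<lambda>x. (1 + norm x) ^ k * cmod (iter_deriv vs f x)))" if "set vs \<subseteq> Basis" for k vs
    using decay[OF iter[OF that], of k] by (auto simp: bounded_iff)
  then show ?thesis
    using iter diff
    by (auto simp: schwartz_functions_def smooth_def differentiable_on_def differentiable_at_withinI)
qed

lemma schwartz_differentiable: "f \<in> schwartz_functions \<Longrightarrow> f differentiable (at x)"
  unfolding schwartz_functions_def smooth_def differentiable_on_def
  by (auto dest: spec[of _ "[]"])

lemma schwartz_has_derivative:
  "f \<in> schwartz_functions \<Longrightarrow> (f has_derivative (\<lambda>v. frechet_derivative f (at x) v)) (at x)"
  using schwartz_differentiable frechet_derivative_works by blast

lemma schwartz_partial: "f \<in> schwartz_functions \<Longrightarrow> b \<in> Basis \<Longrightarrow> partial b f \<in> schwartz_functions"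
  unfolding schwartz_functions_def smooth_def
  by (auto simp: iter_deriv_snoc[symmetric])

lemma schwartz_seminorm_ge:
  assumes "f \<in> schwartz_functions" "set vs \<subseteq> Basis"
  shows "(1 + norm x) ^ k * cmod (iter_deriv vs f x) \<le> schwartz_seminorm k vs f"
  unfolding schwartz_seminorm_def
  using assms by (intro cSUP_upper) (auto simp: schwartz_functions_def intro: bounded_imp_bdd_above)

lemma schwartz_seminorm_nonneg:
  assumes "f \<in> schwartz_functions" "set vs \<subseteq> Basis"
  shows "0 \<le> schwartz_seminorm k vs f"
  using schwartz_seminorm_ge[OF assms, of 0 k] by (rule order_trans[rotated]) simp

lemma schwartz_seminorm_partial: "schwartz_seminorm k vs (partial b f) = schwartz_seminorm k (vs @ [b]) f"
  by (simp add: schwartz_seminorm_def iter_deriv_snoc)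

lemma schwartz_decay:
  assumes "f \<in> schwartz_functions"
  shows "\<exists>B. \<forall>x. (1 + norm x) ^ k * cmod (f x) \<le> B"
  using schwartz_seminorm_ge[OF assms, of "[]"] by auto

lemma schwartz_continuous: "f \<in> schwartz_functions \<Longrightarrow> continuous_on UNIV f"
  by (auto intro!: continuous_at_imp_continuous_on differentiable_imp_continuous_within
      schwartz_differentiable)

lemma schwartz_measurable: "f \<in> schwartz_functions \<Longrightarrow> f \<in> borel_measurable borel"
  by (rule borel_measurable_continuous_onI) (rule schwartz_continuous)

lemma schwartz_add_scale:
  fixes f :: "'a::euclidean_space \<Rightarrow> complex"
  assumes f: "f \<in> schwartz_functions" and h: "h \<in> schwartz_functions"
  shows "(\<lambda>x. a * f x + h x) \<in> schwartz_functions"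
proof -
  let ?C = "{\<lambda>x::'a. a * f x + h x | f h. f \<in> schwartz_functions \<and> h \<in> schwartz_functions}"
  have D: "((\<lambda>x. a * f x + h x) has_derivative
      (\<lambda>v. a * frechet_derivative f (at x) v + frechet_derivative h (at x) v)) (at x)"
    if "f \<in> schwartz_functions" "h \<in> schwartz_functions" for f h :: "'a \<Rightarrow> complex" and x
    using that by (auto intro!: derivative_eq_intros schwartz_has_derivative)
  show ?thesis
  proof (rule schwartz_coinduct[of _ ?C])
    fix p b assume "p \<in> ?C" and b: "b \<in> (Basis::'a set)"
    then obtain f h where p: "p = (\<lambda>x. a * f x + h x)" "f \<in> schwartz_functions" "h \<in> schwartz_functions"
      by auto
    have "partial b p = (\<lambda>x. a * partial b f x + partial b h x)"
      unfolding p partial_eqI[OF D[OF p(2,3)]] by (simp add: partial_def)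
    then show "partial b p \<in> ?C"
      using p b by (intro CollectI exI[of _ "partial b f"] exI[of _ "partial b h"] conjI schwartz_partial)
  next
    fix p k assume "p \<in> ?C"
    then obtain f h where p: "p = (\<lambda>x. a * f x + h x)" "f \<in> schwartz_functions" "h \<in> schwartz_functions"
      by auto
    obtain B1 B2 where B: "\<And>x. (1 + norm x) ^ k * cmod (f x) \<le> B1" "\<And>x. (1 + norm x) ^ k * cmod (h x) \<le> B2"
      using schwartz_decay p by metis
    have "(1 + norm x) ^ k * cmod (p x) \<le> cmod a * B1 + B2" for x
    proof -
      have "(1 + norm x) ^ k * cmod (p x) \<le> (1 + norm x) ^ k * (cmod a * cmod (f x) + cmod (h x))"
        unfolding p by (intro mult_left_mono order_trans[OF norm_triangle_ineq]) (auto simp: norm_mult)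
      also have "\<dots> = cmod a * ((1 + norm x) ^ k * cmod (f x)) + (1 + norm x) ^ k * cmod (h x)"
        by (simp add: algebra_simps)
      also have "\<dots> \<le> cmod a * B1 + B2"
        using B by (intro add_mono mult_left_mono) auto
      finally show ?thesis .
    qed
    then show "\<exists>B. \<forall>x. (1 + norm x) ^ k * cmod (p x) \<le> B" by blast
  qed (use f h D in \<open>auto simp: differentiable_def\<close>)
qed

lemma schwartz_zero: "(\<lambda>x. 0) \<in> schwartz_functions"
  by (rule schwartz_coinduct[of _ "{\<lambda>x. 0}"]) (auto simp: partial_def)

lemma schwartz_scale: "f \<in> schwartz_functions \<Longrightarrow> (\<lambda>x. a * f x) \<in> schwartz_functions"
  using schwartz_add_scale[of f "\<lambda>x. 0" a] schwartz_zero by simp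

lemma schwartz_mult_coordinate:
  fixes f :: "'a::euclidean_space \<Rightarrow> complex"
  assumes f: "f \<in> schwartz_functions" and b: "b \<in> Basis"
  shows "(\<lambda>x. of_real (x \<bullet> b) * f x) \<in> schwartz_functions"
proof -
  \<comment> \<open>the product rule leaves a summand without the coordinate, so the class has
    to contain it\<close>
  let ?C = "{\<lambda>x::'a. of_real (x \<bullet> b) * f x + h x | f h. f \<in> schwartz_functions \<and> h \<in> schwartz_functions}"
  have D: "((\<lambda>x. of_real (x \<bullet> b) * f x + h x) has_derivative
      (\<lambda>v. of_real (x \<bullet> b) * frechet_derivative f (at x) v +
        (of_real (v \<bullet> b) * f x + frechet_derivative h (at x) v))) (at x)"
    if "f \<in> schwartz_functions" "h \<in> schwartz_functions" for f h :: "'a \<Rightarrow> complex" and x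
    using that by (auto intro!: derivative_eq_intros schwartz_has_derivative)
  have *: "(\<lambda>x. of_real (x \<bullet> b) * f x) \<in> ?C"
    by (intro CollectI exI[of _ f] exI[of _ "\<lambda>x. 0"] conjI f schwartz_zero) simp
  show ?thesis
  proof (rule schwartz_coinduct[OF *])
    fix p c assume "p \<in> ?C" "c \<in> (Basis::'a set)"
    then obtain f h where p: "p = (\<lambda>x. of_real (x \<bullet> b) * f x + h x)" "f \<in> schwartz_functions" "h \<in> schwartz_functions"
      by auto
    have "partial c p = (\<lambda>x. of_real (x \<bullet> b) * partial c f x + (of_real (c \<bullet> b) * f x + partial c h x))"
      unfolding p partial_eqI[OF D[OF p(2,3)]] by (simp add: partial_def)
    then show "partial c p \<in> ?C"
      using p \<open>c \<in> Basis\<close>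
      by (intro CollectI exI[of _ "partial c f"] conjI schwartz_partial schwartz_add_scale
          exI[of _ "\<lambda>x. of_real (c \<bullet> b) * f x + partial c h x"])
  next
    fix p k assume "p \<in> ?C"
    then obtain f h where p: "p = (\<lambda>x. of_real (x \<bullet> b) * f x + h x)" "f \<in> schwartz_functions" "h \<in> schwartz_functions"
      by auto
    obtain B1 B2 where B: "\<And>x. (1 + norm x) ^ Suc k * cmod (f x) \<le> B1" "\<And>x. (1 + norm x) ^ k * cmod (h x) \<le> B2"
      using schwartz_decay p by metis
    have "(1 + norm x) ^ k * cmod (p x) \<le> B1 + B2" for x
    proof -
      have "(1 + norm x) ^ k * cmod (p x) \<le> (1 + norm x) ^ k * ((1 + norm x) * cmod (f x) + cmod (h x))"
        unfolding p
      proof (intro mult_left_mono order_trans[OF norm_triangle_ineq] add_right_mono)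
        show "cmod (of_real (x \<bullet> b) * f x) \<le> (1 + norm x) * cmod (f x)"
          using Basis_le_norm[OF b, of x] by (auto simp: norm_mult intro!: mult_right_mono)
      qed auto
      also have "\<dots> = (1 + norm x) ^ Suc k * cmod (f x) + (1 + norm x) ^ k * cmod (h x)"
        by (simp add: algebra_simps)
      also have "\<dots> \<le> B1 + B2"
        using B by (intro add_mono) auto
      finally show ?thesis .
    qed
    then show "\<exists>B. \<forall>x. (1 + norm x) ^ k * cmod (p x) \<le> B" by blast
  qed (use D in \<open>auto simp: differentiable_def\<close>)
qed

lemma schwartz_reflect:
  fixes f :: "'a::euclidean_space \<Rightarrow> complex"
  assumes f: "f \<in> schwartz_functions"
  shows "(\<lambda>x. f (- x)) \<in> schwartz_functions"
proof -
  let ?C = "{\<lambda>x::'a. f (- x) | f. f \<in> schwartz_functions}"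
  have D: "((\<lambda>x. f (- x)) has_derivative (\<lambda>v. frechet_derivative f (at (- x)) (- v))) (at x)"
    if "f \<in> schwartz_functions" for f :: "'a \<Rightarrow> complex" and x
    using has_derivative_compose[OF has_derivative_minus[OF has_derivative_ident] schwartz_has_derivative[OF that]]
    by simp
  show ?thesis
  proof (rule schwartz_coinduct[of _ ?C])
    fix p b assume "p \<in> ?C" and b: "b \<in> (Basis::'a set)"
    then obtain f where p: "p = (\<lambda>x. f (- x))" "f \<in> schwartz_functions"
      by auto
    have "partial b p = (\<lambda>x. (\<lambda>x. -1 * partial b f x) (- x))"
      unfolding p partial_eqI[OF D[OF p(2)]]
      using linear_neg[OF has_derivative_linear[OF schwartz_has_derivative[OF p(2)]]]
      by (simp add: partial_def)
    then show "partial b p \<in> ?C"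
      by (intro CollectI exI[of _ "\<lambda>x. -1 * partial b f x"] conjI schwartz_scale schwartz_partial p b)
  next
    fix p k assume "p \<in> ?C"
    then obtain f where p: "p = (\<lambda>x. f (- x))" "f \<in> schwartz_functions"
      by auto
    obtain B where "\<And>x. (1 + norm x) ^ k * cmod (f x) \<le> B"
      using schwartz_decay[OF p(2)] by metis
    from this[of "- _"] show "\<exists>B. \<forall>x. (1 + norm x) ^ k * cmod (p x) \<le> B"
      unfolding p by (intro exI[of _ B] allI) simp
  qed (use f D in \<open>auto simp: differentiable_def\<close>)
qed

lemma has_derivative_cis_inner:
  "((\<lambda>x. cis (- 2 * pi * (x \<bullet> \<xi>))) has_derivative
    (\<lambda>v. (- 2 * pi * (v \<bullet> \<xi>)) *\<^sub>R (\<i> * cis (- 2 * pi * (x \<bullet> \<xi>))))) (at x)"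
  by (rule has_derivative_cis) (auto intro!: derivative_eq_intros)

lemma schwartz_mult_cis:
  fixes f :: "'a::euclidean_space \<Rightarrow> complex"
  assumes f: "f \<in> schwartz_functions"
  shows "(\<lambda>x. cis (- 2 * pi * (x \<bullet> \<xi>)) * f x) \<in> schwartz_functions"
proof -
  let ?e = "\<lambda>x. cis (- 2 * pi * (x \<bullet> \<xi>))"
  let ?C = "{\<lambda>x::'a. ?e x * f x | f. f \<in> schwartz_functions}"
  have D: "((\<lambda>x. ?e x * f x) has_derivative (\<lambda>v. ?e x * frechet_derivative f (at x) v +
      (- 2 * pi * (v \<bullet> \<xi>)) *\<^sub>R (\<i> * ?e x) * f x)) (at x)"
    if "f \<in> schwartz_functions" for f :: "'a \<Rightarrow> complex" and x
    using that by (intro has_derivative_mult has_derivative_cis_inner schwartz_has_derivative)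
  show ?thesis
  proof (rule schwartz_coinduct[of _ ?C])
    fix p b assume "p \<in> ?C" and b: "b \<in> (Basis::'a set)"
    then obtain f where p: "p = (\<lambda>x. ?e x * f x)" "f \<in> schwartz_functions"
      by auto
    have "partial b p = (\<lambda>x. ?e x * ((of_real (- 2 * pi * (b \<bullet> \<xi>)) * \<i>) * f x + partial b f x))"
      unfolding p partial_eqI[OF D[OF p(2)]]
      by (simp add: partial_def scaleR_conv_of_real algebra_simps)
    then show "partial b p \<in> ?C"
      by (intro CollectI exI[of _ "\<lambda>x. (of_real (- 2 * pi * (b \<bullet> \<xi>)) * \<i>) * f x + partial b f x"]
          conjI schwartz_add_scale schwartz_partial p b)
  next
    fix p k assume "p \<in> ?C"
    then show "\<exists>B. \<forall>x. (1 + norm x) ^ k * cmod (p x) \<le> B"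
      using schwartz_decay[of _ k] by (auto simp: norm_mult)
  next
    fix p x assume "p \<in> ?C"
    then show "p differentiable (at x)"
      using D by (auto simp only: differentiable_def)
  qed (use f in blast)
qed

text \<open>
  Normalized so as to be its own Fourier transform.
\<close>

definition gaussian :: "'a::euclidean_space \<Rightarrow> complex" where
  "gaussian x = of_real (exp (- pi * (norm x)\<^sup>2))"

text \<open>
  The products of the Gaussian with polynomials. Generating them by multiplication with
  coordinates makes differentiability and decay provable by rule induction.
\<close>

inductive_set gaussian_polynomials :: "('a::euclidean_space \<Rightarrow> complex) set" where
  gaussian: "gaussian \<in> gaussian_polynomials"
| combine: "f \<in> gaussian_polynomials \<Longrightarrow> h \<in> gaussian_polynomials \<Longrightarrow>
    (\<lambda>x. a * f x + c * h x) \<in> gaussian_polynomials"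
| coordinate: "f \<in> gaussian_polynomials \<Longrightarrow> b \<in> Basis \<Longrightarrow>
    (\<lambda>x. of_real (x \<bullet> b) * f x) \<in> gaussian_polynomials"

lemma has_derivative_gaussian:
  "(gaussian has_derivative (\<lambda>v. of_real (- 2 * pi * (x \<bullet> v)) * gaussian x)) (at x)"
proof -
  have "((\<lambda>x. complex_of_real (exp (- pi * (x \<bullet> x)))) has_derivative
      (\<lambda>v. of_real (exp (- pi * (x \<bullet> x)) * (- pi * (x \<bullet> v + v \<bullet> x))))) (at x)"
    by (rule has_derivative_of_real) (auto intro!: derivative_eq_intros)
  then show ?thesis
    by (simp add: gaussian_def[abs_def] power2_norm_eq_inner inner_commute algebra_simps)
qed

text \<open>
  From \<open>(1 + r) ^ k \<le> exp (k r)\<close> and \<open>2 k r \<le> k\<^sup>2 +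
  r\<^sup>2\<close>.
\<close>

lemma gaussian_decay: "(1 + norm x) ^ k * cmod (gaussian x) \<le> exp ((real k)\<^sup>2)"
proof -
  let ?r = "norm x"
  have "(1 + ?r) ^ k \<le> exp (real k * ?r)"
    using power_mono[OF exp_ge_add_one_self[of ?r], of k] by (simp add: exp_of_nat_mult)
  then have "(1 + ?r) ^ k * cmod (gaussian x) \<le> exp (real k * ?r) * exp (- pi * ?r\<^sup>2)"
    unfolding gaussian_def by (intro mult_mono) auto
  also have "\<dots> = exp (real k * ?r - pi * ?r\<^sup>2)"
    by (simp add: exp_add[symmetric])
  also have "\<dots> \<le> exp ((real k)\<^sup>2)"
  proof -
    have "2 * (real k * ?r) \<le> (real k)\<^sup>2 + ?r\<^sup>2"
      using sum_squares_bound[of "real k" ?r] by (simp add: mult.assoc)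
    moreover have "?r\<^sup>2 \<le> pi * ?r\<^sup>2"
      using pi_gt3 by (intro mult_le_cancel_right1[THEN iffD2]) auto
    ultimately have "real k * ?r - pi * ?r\<^sup>2 \<le> (real k)\<^sup>2"
      using zero_le_power2[of ?r] zero_le_power2[of "real k"] by linarith
    then show ?thesis by simp
  qed
  finally show ?thesis .
qed

lemma gaussian_schwartz: "gaussian \<in> schwartz_functions"
proof (rule schwartz_coinduct[OF gaussian_polynomials.gaussian])
  have deriv: "\<exists>D. (\<forall>x. (f has_derivative D x) (at x)) \<and> (\<forall>b\<in>Basis. (\<lambda>x. D x b) \<in> gaussian_polynomials)"
    if "f \<in> gaussian_polynomials" for f :: "'a \<Rightarrow> complex"
    using that
  proof induction
    case gaussian
    show ?case
    proof (intro exI[of _ "\<lambda>x v. of_real (- 2 * pi * (x \<bullet> v)) * gaussian x"] conjI ballI allI has_derivative_gaussian)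
      fix b :: 'a assume "b \<in> Basis"
      have "(\<lambda>x. of_real (- 2 * pi) * (of_real (x \<bullet> b) * gaussian x) + 0 * gaussian x) \<in> gaussian_polynomials"
        using \<open>b \<in> Basis\<close> by (intro gaussian_polynomials.intros)
      then show "(\<lambda>x. of_real (- 2 * pi * (x \<bullet> b)) * gaussian x) \<in> gaussian_polynomials"
        by (simp add: mult.assoc)
    qed
  next
    case (combine f h a c)
    then obtain Df Dh where D: "\<And>x. (f has_derivative Df x) (at x)" "\<And>x. (h has_derivative Dh x) (at x)"
        "\<And>b. b \<in> Basis \<Longrightarrow> (\<lambda>x. Df x b) \<in> gaussian_polynomials"
        "\<And>b. b \<in> Basis \<Longrightarrow> (\<lambda>x. Dh x b) \<in> gaussian_polynomials"
      by blast
    show ?case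
      by (rule exI[of _ "\<lambda>x v. a * Df x v + c * Dh x v"])
        (use D in \<open>auto intro!: has_derivative_add has_derivative_mult_right gaussian_polynomials.combine\<close>)
  next
    case (coordinate f c)
    then obtain D where D: "\<And>x. (f has_derivative D x) (at x)"
        "\<And>b. b \<in> Basis \<Longrightarrow> (\<lambda>x. D x b) \<in> gaussian_polynomials"
      by blast
    show ?case
    proof (rule exI[of _ "\<lambda>x v. of_real (x \<bullet> c) * D x v + of_real (v \<bullet> c) * f x"], intro conjI allI ballI)
      show "((\<lambda>x. of_real (x \<bullet> c) * f x) has_derivative
          (\<lambda>v. of_real (x \<bullet> c) * D x v + of_real (v \<bullet> c) * f x)) (at x)" for x
        by (auto intro!: derivative_eq_intros D)
      fix b :: 'a assume b: "b \<in> Basis"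
      have "(\<lambda>x. 1 * (of_real (x \<bullet> c) * D x b) + of_real (b \<bullet> c) * f x) \<in> gaussian_polynomials"
        using coordinate D(2)[OF b] by (intro gaussian_polynomials.intros)
      then show "(\<lambda>x. of_real (x \<bullet> c) * D x b + of_real (b \<bullet> c) * f x) \<in> gaussian_polynomials"
        by simp
    qed
  qed
  show "f differentiable (at x)" if "f \<in> gaussian_polynomials" for f :: "'a \<Rightarrow> complex" and x
    using deriv[OF that] by (auto simp: differentiable_def)
  show "partial b f \<in> gaussian_polynomials" if f: "f \<in> gaussian_polynomials" and b: "b \<in> Basis"
    for f :: "'a \<Rightarrow> complex" and b
  proof -
    obtain D where D: "\<And>x. (f has_derivative D x) (at x)" "(\<lambda>x. D x b) \<in> gaussian_polynomials"
      using deriv[OF f] b by blast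
    show ?thesis using partial_eqI[OF D(1), of b] D(2) by simp
  qed
  show "\<exists>B. \<forall>x. (1 + norm x) ^ k * cmod (f x) \<le> B" if "f \<in> gaussian_polynomials" for f :: "'a \<Rightarrow> complex" and k
    using that
  proof (induction arbitrary: k)
    case gaussian
    then show ?case using gaussian_decay by blast
  next
    case (combine f h a c)
    obtain B1 B2 where B: "\<And>x. (1 + norm x) ^ k * cmod (f x) \<le> B1" "\<And>x. (1 + norm x) ^ k * cmod (h x) \<le> B2"
      using combine.IH by metis
    have "(1 + norm x) ^ k * cmod (a * f x + c * h x) \<le> cmod a * B1 + cmod c * B2" for x
    proof -
      have "(1 + norm x) ^ k * cmod (a * f x + c * h x) \<le> (1 + norm x) ^ k * (cmod a * cmod (f x) + cmod c * cmod (h x))"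
        by (intro mult_left_mono order_trans[OF norm_triangle_ineq]) (auto simp: norm_mult)
      also have "\<dots> = cmod a * ((1 + norm x) ^ k * cmod (f x)) + cmod c * ((1 + norm x) ^ k * cmod (h x))"
        by (simp add: algebra_simps)
      also have "\<dots> \<le> cmod a * B1 + cmod c * B2"
        using B by (intro add_mono mult_left_mono) auto
      finally show ?thesis .
    qed
    then show ?case by blast
  next
    case (coordinate f b)
    obtain B where B: "\<And>x. (1 + norm x) ^ Suc k * cmod (f x) \<le> B"
      using coordinate.IH by metis
    have "(1 + norm x) ^ k * cmod (of_real (x \<bullet> b) * f x) \<le> B" for x
    proof -
      have "(1 + norm x) ^ k * cmod (of_real (x \<bullet> b) * f x) \<le> (1 + norm x) ^ k * ((1 + norm x) * cmod (f x))"
        using Basis_le_norm[OF coordinate(2), of x]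
        by (auto simp: norm_mult intro!: mult_left_mono mult_right_mono)
      then show ?thesis using B[of x] by (simp add: algebra_simps)
    qed
    then show ?case by blast
  qed
qed

text \<open>The first \<open>d\<close> powers of the weight turn pointwise decay into integrability.\<close>

definition bracket_mass :: "'a::euclidean_space itself \<Rightarrow> real" where
  "bracket_mass _ = (LINT x::'a|lborel. (1 + (norm x)\<^sup>2) powr (- real DIM('a)))"

lemma integrable_bracket_mass: "integrable lborel (\<lambda>x::'a::euclidean_space. (1 + (norm x)\<^sup>2) powr (- real DIM('a)))"
  by (rule integrable_powr_bracket) simp

lemma decay_weight_le:
  fixes x :: "'a::euclidean_space"
  assumes "(1 + norm x) ^ (2 * n) * r \<le> B" "0 \<le> r"
  shows "r \<le> B * (1 + (norm x)\<^sup>2) powr (- real n)"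
proof -
  have "(1 + (norm x)\<^sup>2) ^ n \<le> ((1 + norm x)\<^sup>2) ^ n"
    by (intro power_mono) (auto simp: power2_eq_square algebra_simps)
  then have "(1 + (norm x)\<^sup>2) ^ n * r \<le> B"
    using assms by (metis order_trans mult_right_mono power_mult)
  then show ?thesis
    by (simp add: powr_minus powr_realpow add_pos_nonneg field_simps)
qed

lemma schwartz_integrable_weighted:
  fixes f :: "'a::euclidean_space \<Rightarrow> complex"
  assumes f: "f \<in> schwartz_functions"
  shows "integrable lborel (\<lambda>x. of_real ((1 + norm x) ^ k) * f x)"
proof -
  have [measurable]: "f \<in> borel_measurable borel" using f by (rule schwartz_measurable)
  obtain B where B: "\<And>x. (1 + norm x) ^ (2 * DIM('a) + k) * cmod (f x) \<le> B"
    using schwartz_decay[OF f] by metis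
  show ?thesis
  proof (rule Bochner_Integration.integrable_bound[OF integrable_mult_right[OF integrable_bracket_mass, of B]])
    show "AE x in lborel. norm (of_real ((1 + norm x) ^ k) * f x) \<le> norm (B * (1 + (norm x)\<^sup>2) powr (- real DIM('a)))"
    proof (rule AE_I2)
      fix x :: 'a
      have "(1 + norm x) ^ (2 * DIM('a)) * ((1 + norm x) ^ k * cmod (f x)) \<le> B"
        using B[of x] by (simp add: power_add mult.assoc)
      then have "(1 + norm x) ^ k * cmod (f x) \<le> B * (1 + (norm x)\<^sup>2) powr (- real DIM('a))"
        by (rule decay_weight_le) simp
      moreover have "norm (of_real ((1 + norm x) ^ k) * f x) = (1 + norm x) ^ k * cmod (f x)"
        by (simp only: norm_mult norm_of_real) simp
      ultimately show
        "norm (of_real ((1 + norm x) ^ k) * f x) \<le> norm (B * (1 + (norm x)\<^sup>2) powr (- real DIM('a)))"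
        by simp
    qed
  qed measurable
qed

lemma schwartz_integrable: "f \<in> schwartz_functions \<Longrightarrow> integrable lborel f"
  using schwartz_integrable_weighted[of f 0] by simp

lemma schwartz_L1_le:
  fixes f :: "'a::euclidean_space \<Rightarrow> complex"
  assumes f: "f \<in> schwartz_functions"
  shows "(LINT x|lborel. cmod (f x)) \<le> schwartz_seminorm (2 * DIM('a)) [] f * bracket_mass TYPE('a)"
proof -
  have "(LINT x|lborel. cmod (f x)) \<le>
      (LINT x|lborel. schwartz_seminorm (2 * DIM('a)) [] f * (1 + (norm (x::'a))\<^sup>2) powr (- real DIM('a)))"
    using schwartz_seminorm_ge[OF f, of "[]" _ "2 * DIM('a)"] integrable_bracket_mass
    by (intro integral_mono integrable_norm schwartz_integrable f integrable_mult_right decay_weight_le) auto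
  then show ?thesis by (simp add: bracket_mass_def)
qed

lemma
  fixes h :: "'a::euclidean_space \<Rightarrow> 'c::{banach,second_countable_topology}"
  assumes h: "integrable lborel h"
  shows integrable_translate: "integrable lborel (\<lambda>x. h (x + v))"
    and integral_translate: "(LINT x|lborel. h (x + v)) = (LINT x|lborel. h x)"
  using lborel_integrable_affine[OF _ h, of 1 v] lborel_integral_affine[of 1 h v]
      borel_measurable_integrable[OF h] by (simp_all add: add.commute[of _ v])

text \<open>
  Translation by \<open>b\<close> does not change the integral, and the increment of \<open>f\<close> along \<open>b\<close> is the
  average of the derivative over translates.
\<close>

lemma integral_partial_eq_0:
  fixes f :: "'a::euclidean_space \<Rightarrow> complex"
  assumes f: "f \<in> schwartz_functions" and b: "b \<in> Basis"
  shows "(LINT x|lborel. partial b f x) = 0"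
proof -
  define p where "p = partial b f"
  have p: "p \<in> schwartz_functions" using schwartz_partial[OF f b] by (simp add: p_def)
  have [measurable]: "p \<in> borel_measurable borel"
    using p by (rule schwartz_measurable)
  define I where "I = (indicator {0..1} :: real \<Rightarrow> real)"
  have [measurable]: "I \<in> borel_measurable borel" by (simp add: I_def)
  have FTC: "(LINT t|lborel. I t *\<^sub>R p (x + t *\<^sub>R b)) = f (x + b) - f x" for x
  proof -
    have "((\<lambda>t. f (x + t *\<^sub>R b)) has_vector_derivative p (x + t *\<^sub>R b)) (at t within {0..1})" for t
    proof -
      have "((\<lambda>t. f (x + t *\<^sub>R b)) has_derivative (\<lambda>s. frechet_derivative f (at (x + t *\<^sub>R b)) (s *\<^sub>R b))) (at t within {0..1})"
        by (rule has_derivative_compose[OF _ schwartz_has_derivative[OF f]]) (auto intro!: derivative_eq_intros)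
      moreover have "frechet_derivative f (at (x + t *\<^sub>R b)) (s *\<^sub>R b) = s *\<^sub>R p (x + t *\<^sub>R b)" for s
        unfolding p_def partial_def
        by (rule linear_scale[OF has_derivative_linear[OF schwartz_has_derivative[OF f]]])
      ultimately show ?thesis
        by (simp only: has_vector_derivative_def)
    qed
    moreover have "continuous_on {0..1} (\<lambda>t. p (x + t *\<^sub>R b))"
      by (rule continuous_on_compose2[OF schwartz_continuous[OF p]]) (auto intro!: continuous_intros)
    ultimately have "(LINT t|lborel. indicator {0..1} t *\<^sub>R p (x + t *\<^sub>R b)) = f (x + 1 *\<^sub>R b) - f (x + 0 *\<^sub>R b)"
      by (intro integral_FTC_Icc) auto
    then show ?thesis by (simp add: I_def)
  qed
  have int: "integrable (lborel \<Otimes>\<^sub>M lborel) (\<lambda>(t, x). I t *\<^sub>R p (x + t *\<^sub>R b))"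
  proof (rule lborel_pair.Fubini_integrable)
    have "(\<lambda>t. LINT x|lborel. norm (case (t, x) of (t, x) \<Rightarrow> I t *\<^sub>R p (x + t *\<^sub>R b))) =
        (\<lambda>t. I t * (LINT x|lborel. norm (p x)))"
      using integral_translate[OF integrable_norm[OF schwartz_integrable[OF p]]]
      by (simp add: I_def)
    then show "integrable lborel (\<lambda>t. LINT x|lborel. norm (case (t, x) of (t, x) \<Rightarrow> I t *\<^sub>R p (x + t *\<^sub>R b)))"
      by (simp add: I_def)
    show "AE t in lborel. integrable lborel (\<lambda>x. case (t, x) of (t, x) \<Rightarrow> I t *\<^sub>R p (x + t *\<^sub>R b))"
      using integrable_translate[OF schwartz_integrable[OF p]] by simp
  qed measurable
  have "(LINT x|lborel. p x) = (LINT t|lborel. I t *\<^sub>R (LINT x|lborel. p x))"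
    by (simp add: I_def)
  also have "\<dots> = (LINT t|lborel. (LINT x|lborel. I t *\<^sub>R p (x + t *\<^sub>R b)))"
    by (simp add: integral_translate[OF schwartz_integrable[OF p]])
  also have "\<dots> = (LINT x|lborel. (LINT t|lborel. I t *\<^sub>R p (x + t *\<^sub>R b)))"
    using lborel_pair.Fubini_integral[OF int] by simp
  also have "\<dots> = 0"
    unfolding FTC using schwartz_integrable[OF f]
    by (subst Bochner_Integration.integral_diff)
      (auto simp: integral_translate intro: integrable_translate)
  finally show ?thesis by (simp add: p_def)
qed

section \<open>The Fourier transform\<close>

lemma measurable_cis [measurable]: "cis \<in> borel_measurable borel"
  by (intro borel_measurable_continuous_onI continuous_intros)

lemma integrable_cis_mult:
  assumes f: "integrable M f" and [measurable]: "g \<in> borel_measurable M"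
  shows "integrable M (\<lambda>x. cis (g x) * f x)"
proof -
  have [measurable]: "f \<in> borel_measurable M" using f by simp
  show ?thesis
    by (rule Bochner_Integration.integrable_bound[OF f]) (auto simp: norm_mult)
qed

lemma fourier_measurable:
  assumes [measurable]: "f \<in> borel_measurable borel"
  shows "fourier f \<in> borel_measurable borel"
proof -
  have "fourier f = (\<lambda>\<xi>. LINT x|lborel. cis (- 2 * pi * (x \<bullet> \<xi>)) * f x)"
    by (simp add: fourier_def fun_eq_iff)
  also have "\<dots> \<in> borel_measurable borel" by measurable
  finally show ?thesis .
qed

lemma norm_fourier_le: "cmod (fourier f \<xi>) \<le> (LINT x|lborel. cmod (f x))"
  unfolding fourier_def
  using integral_norm_bound[of lborel "\<lambda>x. cis (- 2 * pi * (x \<bullet> \<xi>)) * f x"] by (simp add: norm_mult)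

lemma fourier_scale: "fourier (\<lambda>x. a * f x) \<xi> = a * fourier f \<xi>"
  unfolding fourier_def by (subst integral_mult_right_zero[symmetric]) (simp add: mult.left_commute)

lemma fourier_add:
  assumes "integrable lborel f" "integrable lborel h"
  shows "fourier (\<lambda>x. f x + h x) \<xi> = fourier f \<xi> + fourier h \<xi>"
  unfolding fourier_def
  using assms by (subst Bochner_Integration.integral_add[symmetric])
    (auto simp: distrib_left intro!: integrable_cis_mult)

lemma fourier_diff:
  assumes "integrable lborel f" "integrable lborel h"
  shows "fourier (\<lambda>x. f x - h x) \<xi> = fourier f \<xi> - fourier h \<xi>"
  unfolding fourier_def
  using assms by (subst Bochner_Integration.integral_diff[symmetric])
    (auto simp: right_diff_distrib intro!: integrable_cis_mult)

text \<open>
  Integration by parts: the integral of a partial derivative of \<open>f\<close> times the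
  exponential vanishes.
\<close>

lemma fourier_partial:
  fixes f :: "'a::euclidean_space \<Rightarrow> complex"
  assumes f: "f \<in> schwartz_functions" and b: "b \<in> Basis"
  shows "fourier (partial b f) \<xi> = 2 * pi * \<i> * of_real (\<xi> \<bullet> b) * fourier f \<xi>"
proof -
  let ?e = "\<lambda>x. cis (- 2 * pi * (x \<bullet> \<xi>))"
  have D: "((\<lambda>x. ?e x * f x) has_derivative (\<lambda>v. ?e x * frechet_derivative f (at x) v +
      (- 2 * pi * (v \<bullet> \<xi>)) *\<^sub>R (\<i> * ?e x) * f x)) (at x)" for x
    using f by (intro has_derivative_mult has_derivative_cis_inner schwartz_has_derivative)
  have "0 = (LINT x|lborel. partial b (\<lambda>x. ?e x * f x) x)"
    using integral_partial_eq_0[OF schwartz_mult_cis[OF f] b] by simp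
  also have "\<dots> = (LINT x|lborel. ?e x * partial b f x - (2 * pi * \<i> * of_real (\<xi> \<bullet> b)) * (?e x * f x))"
    unfolding partial_eqI[OF D]
    by (intro Bochner_Integration.integral_cong)
      (auto simp: partial_def scaleR_conv_of_real algebra_simps inner_commute)
  also have "\<dots> = fourier (partial b f) \<xi> - 2 * pi * \<i> * of_real (\<xi> \<bullet> b) * fourier f \<xi>"
  proof -
    have "integrable lborel (\<lambda>x. ?e x * f x)" "integrable lborel (\<lambda>x. ?e x * partial b f x)"
      using schwartz_integrable[OF schwartz_mult_cis] schwartz_partial[OF f b] f by blast+
    then show ?thesis
      unfolding fourier_def by (simp add: Bochner_Integration.integral_diff)
  qed
  finally show ?thesis by simp
qed

text \<open>
  The remainder of the exponential satisfies \<open>cmod (cis \<delta> - 1 - \<i> \<delta>)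
  \<le> \<delta>\<^sup>2 / 2\<close>. With \<open>\<delta> = - 2 \<pi> (x \<bullet>
  \<eta>)\<close> this is quadratic in the increment \<open>\<eta>\<close>, and the factor
  \<open>(norm x)\<^sup>2\<close> is absorbed by the decay of \<open>f\<close>.
\<close>

lemma has_derivative_fourier:
  fixes f :: "'a::euclidean_space \<Rightarrow> complex"
  assumes f: "f \<in> schwartz_functions"
  shows "(fourier f has_derivative (\<lambda>\<eta>. - 2 * pi * \<i> * fourier (\<lambda>x. of_real (x \<bullet> \<eta>) * f x) \<xi>)) (at \<xi>)"
proof -
  have [measurable]: "f \<in> borel_measurable borel" using f by (rule schwartz_measurable)
  have i1: "integrable lborel (\<lambda>x. of_real (x \<bullet> \<eta>) * f x)" for \<eta>
  proof (rule Bochner_Integration.integrable_bound)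
    show "integrable lborel (\<lambda>x. norm \<eta> *\<^sub>R (of_real ((1 + norm x) ^ 1) * f x))"
      by (intro integrable_scaleR_right schwartz_integrable_weighted f)
    show "AE x in lborel. norm (of_real (x \<bullet> \<eta>) * f x) \<le> norm (norm \<eta> *\<^sub>R (of_real ((1 + norm x) ^ 1) * f x))"
    proof (rule AE_I2)
      fix x :: 'a
      have "\<bar>x \<bullet> \<eta>\<bar> \<le> norm \<eta> * (1 + norm x)"
        by (rule order_trans[OF Cauchy_Schwarz_ineq2]) (simp add: algebra_simps)
      moreover have "cmod (complex_of_real (1 + norm x)) = 1 + norm x"
        by (simp only: norm_of_real) simp
      ultimately show "norm (of_real (x \<bullet> \<eta>) * f x) \<le> norm (norm \<eta> *\<^sub>R (of_real ((1 + norm x) ^ 1) * f x))"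
        unfolding norm_mult norm_scaleR power_one_right
        by (simp only: norm_of_real abs_norm_cancel) (simp add: mult.assoc[symmetric] mult_right_mono)
    qed
  qed measurable
  define C where "C = 2 * pi\<^sup>2 * (LINT x|lborel. cmod (of_real ((1 + norm x) ^ 2) * f x))"
  let ?L = "\<lambda>\<eta>. - 2 * pi * \<i> * fourier (\<lambda>x. of_real (x \<bullet> \<eta>) * f x) \<xi>"
  have "linear ?L"
  proof (rule linearI)
    fix \<eta> \<eta>' :: 'a and r :: real
    show "?L (\<eta> + \<eta>') = ?L \<eta> + ?L \<eta>'"
      using fourier_add[OF i1[of \<eta>] i1[of \<eta>'], of \<xi>]
      by (simp add: inner_add_right algebra_simps)
    show "?L (r *\<^sub>R \<eta>) = r *\<^sub>R ?L \<eta>"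
      using fourier_scale[of "of_real r" "\<lambda>x. of_real (x \<bullet> \<eta>) * f x" \<xi>]
      by (simp add: scaleR_conv_of_real mult_ac)
  qed
  then have lin: "bounded_linear ?L"
    by (simp add: linear_conv_bounded_linear)
  have rem: "norm (fourier f (\<xi> + \<eta>) - fourier f \<xi> - ?L \<eta>) \<le> C * (norm \<eta>)\<^sup>2" for \<eta>
  proof -
    let ?e = "\<lambda>\<xi> x. cis (- 2 * pi * (x \<bullet> \<xi>))"
    let ?r = "\<lambda>x. (?e (\<xi> + \<eta>) x * f x - ?e \<xi> x * f x) - (- 2 * pi * \<i>) * (?e \<xi> x * (of_real (x \<bullet> \<eta>) * f x))"
    have int: "integrable lborel (\<lambda>x. ?e \<xi> x * f x)" for \<xi>
      by (intro integrable_cis_mult schwartz_integrable f) auto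
    have int2: "integrable lborel (\<lambda>x. (- 2 * pi * \<i>) * (?e \<xi> x * (of_real (x \<bullet> \<eta>) * f x)))"
      by (intro integrable_mult_right integrable_cis_mult i1) auto
    have eq: "fourier f (\<xi> + \<eta>) - fourier f \<xi> - ?L \<eta> = (LINT x|lborel. ?r x)"
      unfolding fourier_def using int[of \<xi>] int[of "\<xi> + \<eta>"] int2
      by (simp add: Bochner_Integration.integral_diff)
    have "norm (LINT x|lborel. ?r x) \<le> (LINT x|lborel. (2 * pi\<^sup>2 * (norm \<eta>)\<^sup>2) * cmod (of_real ((1 + norm x) ^ 2) * f x))"
    proof (rule Bochner_Integration.integral_norm_bound_integral)
      show "integrable lborel ?r"
        using int[of \<xi>] int[of "\<xi> + \<eta>"] int2 by (intro Bochner_Integration.integrable_diff)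
      show "integrable lborel (\<lambda>x. (2 * pi\<^sup>2 * (norm \<eta>)\<^sup>2) * cmod (of_real ((1 + norm x) ^ 2) * f x))"
        by (intro integrable_mult_right integrable_norm schwartz_integrable_weighted f)
      fix x :: 'a
      define \<delta> where "\<delta> = - 2 * pi * (x \<bullet> \<eta>)"
      have e: "?e (\<xi> + \<eta>) x = ?e \<xi> x * cis \<delta>"
        unfolding cis_mult by (simp add: \<delta>_def inner_add_right algebra_simps)
      have d: "complex_of_real \<delta> = - 2 * pi * of_real (x \<bullet> \<eta>)"
        by (simp add: \<delta>_def)
      have "?r x = (?e \<xi> x * f x) * (cis \<delta> - 1 - \<i> * \<delta>)"
        unfolding e d by (simp add: algebra_simps)
      then have "norm (?r x) = cmod (f x) * cmod (cis \<delta> - 1 - \<i> * \<delta>)"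
        by (simp add: norm_mult)
      also have "\<dots> \<le> cmod (f x) * (\<delta>\<^sup>2 / 2)"
        using iexp_approx1[of \<delta> 1]
        by (intro mult_left_mono) (auto simp: cis_conv_exp power2_eq_square diff_diff_eq)
      also have "\<dots> \<le> cmod (f x) * (2 * pi\<^sup>2 * ((norm \<eta>)\<^sup>2 * (1 + norm x)\<^sup>2))"
      proof (rule mult_left_mono)
        have "\<bar>x \<bullet> \<eta>\<bar> \<le> norm \<eta> * (1 + norm x)"
          by (rule order_trans[OF Cauchy_Schwarz_ineq2]) (simp add: algebra_simps)
        then have "\<bar>x \<bullet> \<eta>\<bar>\<^sup>2 \<le> (norm \<eta> * (1 + norm x))\<^sup>2"
          by (rule power_mono) simp
        then have "(x \<bullet> \<eta>)\<^sup>2 \<le> (norm \<eta>)\<^sup>2 * (1 + norm x)\<^sup>2"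
          by (simp only: power_mult_distrib power2_abs)
        moreover have "\<delta>\<^sup>2 / 2 = 2 * pi\<^sup>2 * (x \<bullet> \<eta>)\<^sup>2"
          by (simp add: \<delta>_def power_mult_distrib)
        ultimately show "\<delta>\<^sup>2 / 2 \<le> 2 * pi\<^sup>2 * ((norm \<eta>)\<^sup>2 * (1 + norm x)\<^sup>2)"
          by (simp only:) (rule mult_left_mono, auto)
      qed simp
      finally have bd: "norm (?r x) \<le> cmod (f x) * (2 * pi\<^sup>2 * ((norm \<eta>)\<^sup>2 * (1 + norm x)\<^sup>2))" .
      have "cmod (complex_of_real ((1 + norm x) ^ 2)) = (1 + norm x)\<^sup>2"
        by (simp only: norm_of_real) simp
      then have "cmod (of_real ((1 + norm x) ^ 2) * f x) = (1 + norm x)\<^sup>2 * cmod (f x)"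
        by (simp only: norm_mult)
      then have "(2 * pi\<^sup>2 * (norm \<eta>)\<^sup>2) * cmod (of_real ((1 + norm x) ^ 2) * f x) =
          cmod (f x) * (2 * pi\<^sup>2 * ((norm \<eta>)\<^sup>2 * (1 + norm x)\<^sup>2))"
        by (simp only: mult_ac)
      with bd show "norm (?r x) \<le> (2 * pi\<^sup>2 * (norm \<eta>)\<^sup>2) * cmod (of_real ((1 + norm x) ^ 2) * f x)"
        by (simp only:)
    qed
    also have "\<dots> = C * (norm \<eta>)\<^sup>2"
      by (simp add: C_def)
    finally show ?thesis unfolding eq .
  qed
  have "(\<lambda>\<eta>. norm (fourier f (\<xi> + \<eta>) - fourier f \<xi> - ?L \<eta>) / norm \<eta>) \<midarrow>0\<rightarrow> 0"
  proof (rule Lim_null_comparison)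
    show "\<forall>\<^sub>F \<eta> in at 0. norm (norm (fourier f (\<xi> + \<eta>) - fourier f \<xi> - ?L \<eta>) / norm \<eta>) \<le> C * norm \<eta>"
      using eventually_at_filter rem
      by (auto simp: eventually_at_filter divide_le_eq power2_eq_square mult.assoc)
    show "((\<lambda>\<eta>. C * norm \<eta>) \<longlongrightarrow> 0) (at 0)"
      by (auto intro!: tendsto_eq_intros)
  qed
  then show ?thesis using lin by (simp add: has_derivative_at)
qed

lemma partial_fourier:
  fixes f :: "'a::euclidean_space \<Rightarrow> complex"
  assumes f: "f \<in> schwartz_functions"
  shows "partial b (fourier f) = fourier (\<lambda>x. (- 2 * pi * \<i>) * (of_real (x \<bullet> b) * f x))"
  unfolding partial_eqI[OF has_derivative_fourier[OF f]] by (rule ext) (simp only: fourier_scale)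

text \<open>
  One power of \<open>\<xi>\<close> on the transform costs one partial derivative on the function.  The bound is
  kept in terms of finitely many seminorms, since continuity of distributions needs it.
\<close>

lemma fourier_decay:
  "\<exists>A C. finite A \<and> 0 \<le> C \<and> (\<forall>q\<in>A. set (snd q) \<subseteq> Basis) \<and>
     (\<forall>f::'a::euclidean_space \<Rightarrow> complex. f \<in> schwartz_functions \<longrightarrow> (\<forall>\<xi>.
        (1 + norm \<xi>) ^ k * cmod (fourier f \<xi>) \<le> C * (\<Sum>q\<in>A. schwartz_seminorm (fst q) (snd q) f)))"
proof (induction k)
  case 0
  have "0 \<le> bracket_mass TYPE('a)"
    unfolding bracket_mass_def by (intro integral_nonneg_AE) auto
  then show ?case
  proof (intro exI[of _ "{(2 * DIM('a), [])}"] exI[of _ "bracket_mass TYPE('a)"] conjI allI impI)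
    fix f :: "'a \<Rightarrow> complex" and \<xi> :: 'a assume "f \<in> schwartz_functions"
    from order_trans[OF norm_fourier_le schwartz_L1_le[OF this]]
    show "(1 + norm \<xi>) ^ 0 * cmod (fourier f \<xi>) \<le>
        bracket_mass TYPE('a) * (\<Sum>q\<in>{(2 * DIM('a), [])}. schwartz_seminorm (fst q) (snd q) f)"
      by (simp add: mult.commute[of "bracket_mass TYPE('a)"])
  qed simp_all
next
  case (Suc k)
  then obtain A C where A: "finite A" "0 \<le> C" "\<forall>q\<in>A. set (snd q) \<subseteq> Basis"
    and bound: "\<forall>f::'a \<Rightarrow> complex. f \<in> schwartz_functions \<longrightarrow> (\<forall>\<xi>.
        (1 + norm \<xi>) ^ k * cmod (fourier f \<xi>) \<le> C * (\<Sum>q\<in>A. schwartz_seminorm (fst q) (snd q) f))"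
    by blast
  let ?s = "\<lambda>b q. (fst q :: nat, snd q @ [b::'a])"
  define A' where "A' = A \<union> (\<Union>b\<in>Basis. ?s b ` A)"
  have A': "finite A'" "\<forall>q\<in>A'. set (snd q) \<subseteq> Basis"
    using A(1,3) by (simp_all add: A'_def ball_Un)
  show ?case
  proof (intro exI[of _ A'] exI[of _ "C * (1 + DIM('a))"] conjI allI impI A')
    show "0 \<le> C * (1 + DIM('a))" using A(2) by simp
    fix f :: "'a \<Rightarrow> complex" and \<xi> :: 'a assume f: "f \<in> schwartz_functions"
    define N where "N = (\<Sum>q\<in>A'. schwartz_seminorm (fst q) (snd q) f)"
    have nonneg: "0 \<le> schwartz_seminorm (fst q) (snd q) f" if "q \<in> A'" for q
      using A'(2) that f by (intro schwartz_seminorm_nonneg) auto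
    have base: "(\<Sum>q\<in>A. schwartz_seminorm (fst q) (snd q) f) \<le> N"
      unfolding N_def
    proof (rule sum_mono2)
      show "A \<subseteq> A'" unfolding A'_def by (rule Un_upper1)
      show "finite A'" by (rule A'(1))
      show "0 \<le> schwartz_seminorm (fst q) (snd q) f" if "q \<in> A' - A" for q
          using that by (intro nonneg) simp
    qed
    have deriv: "(\<Sum>q\<in>A. schwartz_seminorm (fst q) (snd q) (partial b f)) \<le> N" if b: "b \<in> Basis" for b
    proof -
      have "inj_on (?s b) A"
        by (rule inj_onI) (simp add: prod_eq_iff)
      then have "(\<Sum>q\<in>A. schwartz_seminorm (fst q) (snd q) (partial b f)) = (\<Sum>q\<in>?s b ` A. schwartz_seminorm (fst q) (snd q) f)"
        by (simp add: sum.reindex schwartz_seminorm_partial)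
      also have "\<dots> \<le> N"
        unfolding N_def
      proof (rule sum_mono2)
        show "?s b ` A \<subseteq> A'"
          unfolding A'_def using b by (intro order_trans[OF UN_upper[of b Basis "\<lambda>b. ?s b ` A"] Un_upper2])
        show "finite A'" by (rule A'(1))
        show "0 \<le> schwartz_seminorm (fst q) (snd q) f" if "q \<in> A' - ?s b ` A" for q
          using that by (intro nonneg) simp
      qed
      finally show ?thesis .
    qed
    let ?w = "(1 + norm \<xi>) ^ k"
    have "(1 + norm \<xi>) * cmod (fourier f \<xi>) \<le> cmod (fourier f \<xi>) + (\<Sum>b\<in>Basis. cmod (fourier (partial b f) \<xi>))"
    proof -
      have "norm \<xi> * cmod (fourier f \<xi>) \<le> (\<Sum>b\<in>Basis. \<bar>\<xi> \<bullet> b\<bar>) * cmod (fourier f \<xi>)"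
        by (intro mult_right_mono norm_le_l1) auto
      also have "\<dots> \<le> (\<Sum>b\<in>Basis. cmod (fourier (partial b f) \<xi>))"
        unfolding sum_distrib_right
      proof (rule sum_mono)
        fix b :: 'a assume "b \<in> Basis"
        then have "cmod (fourier (partial b f) \<xi>) = 2 * pi * (\<bar>\<xi> \<bullet> b\<bar> * cmod (fourier f \<xi>))"
          by (simp add: fourier_partial[OF f] norm_mult)
        moreover have "1 * (\<bar>\<xi> \<bullet> b\<bar> * cmod (fourier f \<xi>)) \<le> 2 * pi * (\<bar>\<xi> \<bullet> b\<bar> * cmod (fourier f \<xi>))"
          using pi_gt3 by (intro mult_right_mono) auto
        ultimately show "\<bar>\<xi> \<bullet> b\<bar> * cmod (fourier f \<xi>) \<le> cmod (fourier (partial b f) \<xi>)"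
          by simp
      qed
      finally show ?thesis by (simp add: algebra_simps)
    qed
    then have "?w * ((1 + norm \<xi>) * cmod (fourier f \<xi>)) \<le>
        ?w * (cmod (fourier f \<xi>) + (\<Sum>b\<in>Basis. cmod (fourier (partial b f) \<xi>)))"
      by (rule mult_left_mono) auto
    also have "\<dots> = ?w * cmod (fourier f \<xi>) + (\<Sum>b\<in>Basis. ?w * cmod (fourier (partial b f) \<xi>))"
      by (simp add: distrib_left sum_distrib_left)
    also have "\<dots> \<le> C * N + (\<Sum>b\<in>(Basis::'a set). C * N)"
    proof (intro add_mono sum_mono)
      show "?w * cmod (fourier f \<xi>) \<le> C * N"
        by (rule order_trans[OF bound[rule_format, OF f] mult_left_mono[OF base A(2)]])
      show "?w * cmod (fourier (partial b f) \<xi>) \<le> C * N" if "b \<in> Basis" for b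
        by (rule order_trans[OF bound[rule_format, OF schwartz_partial[OF f that]] mult_left_mono[OF deriv[OF that] A(2)]])
    qed
    also have "\<dots> = (C * (1 + DIM('a))) * N"
      by (simp add: algebra_simps)
    finally show "(1 + norm \<xi>) ^ Suc k * cmod (fourier f \<xi>) \<le> (C * (1 + DIM('a))) * (\<Sum>q\<in>A'. schwartz_seminorm (fst q) (snd q) f)"
      by (simp add: N_def mult_ac)
  qed
qed

text \<open>
  The partial derivative of a transform is again a transform, so the transforms of Schwartz
  functions satisfy the closure condition of the coinduction.
\<close>

lemma fourier_schwartz:
  fixes f :: "'a::euclidean_space \<Rightarrow> complex"
  assumes f: "f \<in> schwartz_functions"
  shows "fourier f \<in> schwartz_functions"
proof (rule schwartz_coinduct[of _ "fourier ` schwartz_functions"])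
  fix p :: "'a \<Rightarrow> complex" and b assume "p \<in> fourier ` schwartz_functions" and b: "b \<in> (Basis::'a set)"
  then obtain f where f: "p = fourier f" "f \<in> schwartz_functions" by auto
  show "partial b p \<in> fourier ` schwartz_functions"
    unfolding f partial_fourier[OF f(2)]
    by (intro imageI schwartz_scale schwartz_mult_coordinate f b)
next
  fix p :: "'a \<Rightarrow> complex" and k assume "p \<in> fourier ` schwartz_functions"
  then obtain f where f: "p = fourier f" "f \<in> schwartz_functions" by auto
  then show "\<exists>B. \<forall>x. (1 + norm x) ^ k * cmod (p x) \<le> B"
    using fourier_decay[where 'a = 'a, of k] by blast
qed (use f in \<open>auto simp: differentiable_def intro: has_derivative_fourier\<close>)

lemma fourier_multiplication:
  fixes f h :: "'a::euclidean_space \<Rightarrow> complex"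
  assumes f: "integrable lborel f" and h: "integrable lborel h"
  shows "(LINT \<xi>|lborel. fourier f \<xi> * h \<xi>) = (LINT x|lborel. f x * fourier h x)"
proof -
  have [measurable]: "f \<in> borel_measurable borel" "h \<in> borel_measurable borel"
    using f h by (auto dest: borel_measurable_integrable)
  have int: "integrable (lborel \<Otimes>\<^sub>M lborel) (\<lambda>(x, \<xi>). cis (- 2 * pi * (x \<bullet> \<xi>)) * f x * h \<xi>)"
  proof (rule lborel_pair.Fubini_integrable)
    show "integrable lborel (\<lambda>x. LINT \<xi>|lborel. norm (case (x, \<xi>) of (x, \<xi>) \<Rightarrow> cis (- 2 * pi * (x \<bullet> \<xi>)) * f x * h \<xi>))"
      using f h by (simp add: norm_mult)
    show "AE x in lborel. integrable lborel (\<lambda>\<xi>. case (x, \<xi>) of (x, \<xi>) \<Rightarrow> cis (- 2 * pi * (x \<bullet> \<xi>)) * f x * h \<xi>)"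
      using h by (simp add: mult.assoc) (intro AE_I2 integrable_cis_mult integrable_mult_right, auto)
  qed measurable
  have "(LINT \<xi>|lborel. fourier f \<xi> * h \<xi>) = (LINT \<xi>|lborel. (LINT x|lborel. cis (- 2 * pi * (x \<bullet> \<xi>)) * f x * h \<xi>))"
    by (simp add: fourier_def)
  also have "\<dots> = (LINT x|lborel. (LINT \<xi>|lborel. cis (- 2 * pi * (x \<bullet> \<xi>)) * f x * h \<xi>))"
    using lborel_pair.Fubini_integral[OF int] by simp
  also have "\<dots> = (LINT x|lborel. f x * fourier h x)"
    unfolding fourier_def integral_mult_right_zero[symmetric]
    by (intro Bochner_Integration.integral_cong) (auto simp: inner_commute mult_ac)
  finally show ?thesis .
qed

subsection \<open>Gaussians and inversion\<close>

text \<open>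
  This is the characteristic function of the standard normal distribution after the
  substitution \<open>x = sqrt (2 \<pi>) u\<close>.
\<close>

lemma fourier_gaussian_real:
  shows "integrable lborel (\<lambda>x::real. cis (- 2 * pi * (x * \<xi>)) * of_real (exp (- pi * x\<^sup>2)))"
    and "(LINT x::real|lborel. cis (- 2 * pi * (x * \<xi>)) * of_real (exp (- pi * x\<^sup>2))) = of_real (exp (- pi * \<xi>\<^sup>2))"
proof -
  let ?c = "sqrt (2 * pi)"
  define F where "F = (\<lambda>x. std_normal_density x *\<^sub>R iexp (- ?c * \<xi> * x))"
  have c: "?c \<noteq> 0" "?c * ?c = 2 * pi" by auto
  have sub: "?c *\<^sub>R F (0 + ?c * u) = cis (- 2 * pi * (u * \<xi>)) * of_real (exp (- pi * u\<^sup>2))" for u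
  proof -
    have "?c * std_normal_density (?c * u) = exp (- pi * u\<^sup>2)"
      by (simp add: std_normal_density_def power_mult_distrib)
    moreover have "iexp (- ?c * \<xi> * (?c * u)) = cis (- 2 * pi * (u * \<xi>))"
      using c(2) by (simp add: cis_conv_exp mult_ac)
    ultimately show ?thesis
      by (simp add: F_def scaleR_conv_of_real flip: of_real_mult)
  qed
  have i: "integrable lborel F"
    unfolding F_def by (rule Bochner_Integration.integrable_bound[OF integrable_normal_density[of 1 0]]) auto
  from integrable_scaleR_right[OF lborel_integrable_real_affine[OF i c(1), of 0], of ?c]
  show "integrable lborel (\<lambda>x::real. cis (- 2 * pi * (x * \<xi>)) * of_real (exp (- pi * x\<^sup>2)))"
    unfolding sub .
  have "(LINT x::real|lborel. cis (- 2 * pi * (x * \<xi>)) * of_real (exp (- pi * x\<^sup>2))) = (LINT x|lborel. F x)"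
    unfolding sub[symmetric] using lborel_integral_real_affine[OF c(1), of F 0] by simp
  also have "\<dots> = char std_normal_distribution (- ?c * \<xi>)"
    unfolding char_def F_def by (subst integral_density) auto
  also have "\<dots> = of_real (exp (- pi * \<xi>\<^sup>2))"
    by (simp add: char_std_normal_distribution power_mult_distrib)
  finally show "(LINT x::real|lborel. cis (- 2 * pi * (x * \<xi>)) * of_real (exp (- pi * x\<^sup>2))) = of_real (exp (- pi * \<xi>\<^sup>2))" .
qed

lemma fourier_gaussian: "fourier gaussian = (gaussian :: 'a::euclidean_space \<Rightarrow> complex)"
proof
  fix \<xi> :: 'a
  have gauss: "gaussian x = (\<Prod>b\<in>Basis. of_real (exp (- pi * (x \<bullet> b)\<^sup>2)))" for x :: 'a
  proof -
    have "(norm x)\<^sup>2 = (\<Sum>b\<in>Basis. (x \<bullet> b)\<^sup>2)"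
      unfolding power2_norm_eq_inner by (subst euclidean_inner) (simp add: power2_eq_square)
    then show ?thesis
      by (simp add: gaussian_def sum_negf[symmetric] sum_distrib_left exp_sum)
  qed
  have "cis (- 2 * pi * (x \<bullet> \<xi>)) = (\<Prod>b\<in>Basis. cis (- 2 * pi * ((x \<bullet> b) * (\<xi> \<bullet> b))))" for x
    by (subst euclidean_inner) (simp add: cis_conv_exp sum_distrib_left sum_negf[symmetric] exp_sum mult_ac)
  then have "fourier gaussian \<xi> = (LINT x|lborel. (\<Prod>b\<in>Basis. cis (- 2 * pi * ((x \<bullet> b) * (\<xi> \<bullet> b))) * of_real (exp (- pi * (x \<bullet> b)\<^sup>2))))"
    unfolding fourier_def gauss by (simp add: prod.distrib)
  also have "\<dots> = (\<Prod>b\<in>Basis. of_real (exp (- pi * (\<xi> \<bullet> b)\<^sup>2)))"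
    by (subst lborel_integral_prod_Basis[of "\<lambda>b t. cis (- 2 * pi * (t * (\<xi> \<bullet> b))) * of_real (exp (- pi * t\<^sup>2))"])
      (rule fourier_gaussian_real, simp only: fourier_gaussian_real)
  finally show "fourier gaussian \<xi> = gaussian \<xi>" by (simp only: gauss)
qed

lemma integral_gaussian: "(LINT x::'a::euclidean_space|lborel. gaussian x) = 1"
  using fun_cong[OF fourier_gaussian, of "0::'a"] by (simp add: fourier_def gaussian_def)

lemma gaussian_measurable [measurable]: "gaussian \<in> borel_measurable borel"
  by (rule schwartz_measurable[OF gaussian_schwartz])

lemma norm_gaussian_le: "cmod (gaussian x) \<le> 1"
  by (simp add: gaussian_def)

text \<open>
  As the Gaussian is its own transform, the multiplication formula expresses the Gaussian
  average of \<open>w\<close> at scale \<open>t\<close> around \<open>a\<close> through the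
  transform of \<open>w\<close>. For \<open>t\<close> tending to \<open>0\<close> this gives
  the inversion formula, and for a vanishing transform the uniqueness theorem.
\<close>

lemma integral_gaussian_smoothing:
  fixes w :: "'a::euclidean_space \<Rightarrow> complex"
  assumes w: "integrable lborel w" and t: "0 < t"
  shows "(LINT z|lborel. w (a + t *\<^sub>R z) * gaussian z) =
    (LINT \<xi>|lborel. fourier w \<xi> * cis (2 * pi * (a \<bullet> \<xi>)) * gaussian (t *\<^sub>R \<xi>))"
proof -
  have [measurable]: "w \<in> borel_measurable borel" using w by auto
  have [measurable]: "fourier w \<in> borel_measurable borel" by (rule fourier_measurable) simp
  have i: "integrable lborel (\<lambda>z. w (a + t *\<^sub>R z))"
    using lborel_integrable_affine[OF _ w] t by auto
  have F: "t ^ DIM('a) *\<^sub>R fourier (\<lambda>z. w (a + t *\<^sub>R z)) (t *\<^sub>R \<xi>) = fourier w \<xi> * cis (2 * pi * (a \<bullet> \<xi>))" for \<xi>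
  proof -
    have "fourier w \<xi> * cis (2 * pi * (a \<bullet> \<xi>)) = (LINT x|lborel. cis (- 2 * pi * (x \<bullet> \<xi>)) * w x * cis (2 * pi * (a \<bullet> \<xi>)))"
      by (simp add: fourier_def)
    also have "\<dots> = t ^ DIM('a) *\<^sub>R (LINT z|lborel. cis (- 2 * pi * ((a + t *\<^sub>R z) \<bullet> \<xi>)) * w (a + t *\<^sub>R z) * cis (2 * pi * (a \<bullet> \<xi>)))"
      using t by (subst lborel_integral_affine[of t _ a]) auto
    also have "(\<lambda>z. cis (- 2 * pi * ((a + t *\<^sub>R z) \<bullet> \<xi>)) * w (a + t *\<^sub>R z) * cis (2 * pi * (a \<bullet> \<xi>))) =
        (\<lambda>z. cis (- 2 * pi * (z \<bullet> (t *\<^sub>R \<xi>))) * w (a + t *\<^sub>R z))"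
    proof
      fix z
      have "cis (- 2 * pi * ((a + t *\<^sub>R z) \<bullet> \<xi>)) * cis (2 * pi * (a \<bullet> \<xi>)) = cis (- 2 * pi * (z \<bullet> (t *\<^sub>R \<xi>)))"
        by (simp add: cis_mult inner_add_left algebra_simps)
      then show "cis (- 2 * pi * ((a + t *\<^sub>R z) \<bullet> \<xi>)) * w (a + t *\<^sub>R z) * cis (2 * pi * (a \<bullet> \<xi>)) =
          cis (- 2 * pi * (z \<bullet> (t *\<^sub>R \<xi>))) * w (a + t *\<^sub>R z)"
        by (metis mult.assoc mult.commute)
    qed
    finally show ?thesis by (simp add: fourier_def)
  qed
  have [measurable]: "fourier (\<lambda>z. w (a + t *\<^sub>R z)) \<in> borel_measurable borel"
    by (rule fourier_measurable) simp
  have "(LINT z|lborel. w (a + t *\<^sub>R z) * gaussian z) = (LINT z|lborel. w (a + t *\<^sub>R z) * fourier gaussian z)"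
    by (simp add: fourier_gaussian)
  also have "\<dots> = (LINT \<eta>|lborel. fourier (\<lambda>z. w (a + t *\<^sub>R z)) \<eta> * gaussian \<eta>)"
    by (rule fourier_multiplication[symmetric, OF i schwartz_integrable[OF gaussian_schwartz]])
  also have "\<dots> = t ^ DIM('a) *\<^sub>R (LINT \<xi>|lborel. fourier (\<lambda>z. w (a + t *\<^sub>R z)) (t *\<^sub>R \<xi>) * gaussian (t *\<^sub>R \<xi>))"
    using t by (subst lborel_integral_affine[of t _ 0]) auto
  also have "\<dots> = (LINT \<xi>|lborel. (t ^ DIM('a) *\<^sub>R fourier (\<lambda>z. w (a + t *\<^sub>R z)) (t *\<^sub>R \<xi>)) * gaussian (t *\<^sub>R \<xi>))"
    by (simp add: mult_scaleR_left)
  finally show ?thesis by (simp only: F)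
qed

lemma fourier_inversion:
  fixes f :: "'a::euclidean_space \<Rightarrow> complex"
  assumes f: "f \<in> schwartz_functions"
  shows "fourier (fourier f) (- a) = f a"
proof -
  have [measurable]: "f \<in> borel_measurable borel" "fourier f \<in> borel_measurable borel"
    using f fourier_schwartz by (auto intro: schwartz_measurable)
  define t where "t n = 1 / real (Suc n)" for n
  have t: "t \<longlonglongrightarrow> 0" "\<And>n. 0 < t n"
    unfolding t_def using LIMSEQ_inverse_real_of_nat by (auto simp: inverse_eq_divide)
  obtain B where B: "\<And>x. cmod (f x) \<le> B"
    using schwartz_decay[OF f, of 0] by auto
  have cont: "continuous (at x) f" for x
    using schwartz_continuous[OF f] by (simp add: continuous_on_eq_continuous_at)
  have "(\<lambda>n. LINT z|lborel. f (a + t n *\<^sub>R z) * gaussian z) \<longlonglongrightarrow> (LINT z::'a|lborel. f a * gaussian z)"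
  proof (rule integral_dominated_convergence)
    show "integrable lborel (\<lambda>z. B * cmod (gaussian (z::'a)))"
      by (intro integrable_mult_right integrable_norm schwartz_integrable gaussian_schwartz)
    show "AE z in lborel. (\<lambda>n. f (a + t n *\<^sub>R z) * gaussian z) \<longlonglongrightarrow> f a * gaussian z"
    proof (rule AE_I2)
      fix z :: 'a
      have "(\<lambda>n. a + t n *\<^sub>R z) \<longlonglongrightarrow> a + 0 *\<^sub>R z"
        by (intro tendsto_intros t)
      then have "(\<lambda>n. f (a + t n *\<^sub>R z)) \<longlonglongrightarrow> f a"
        using continuous_within_tendsto_compose'[of a UNIV f] cont[of a] by simp
      then show "(\<lambda>n. f (a + t n *\<^sub>R z) * gaussian z) \<longlonglongrightarrow> f a * gaussian z"
        by (intro tendsto_intros)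
    qed
    show "AE z in lborel. norm (f (a + t n *\<^sub>R z) * gaussian z) \<le> B * cmod (gaussian z)" for n
      using B by (auto simp: norm_mult intro!: mult_right_mono)
  qed measurable
  then have 1: "(\<lambda>n. LINT z|lborel. f (a + t n *\<^sub>R z) * gaussian z) \<longlonglongrightarrow> f a"
    by (simp add: integral_gaussian)
  have "(\<lambda>n. LINT \<xi>|lborel. fourier f \<xi> * cis (2 * pi * (a \<bullet> \<xi>)) * gaussian (t n *\<^sub>R \<xi>)) \<longlonglongrightarrow>
      (LINT \<xi>|lborel. fourier f \<xi> * cis (2 * pi * (a \<bullet> \<xi>)))"
  proof (rule integral_dominated_convergence)
    show "integrable lborel (\<lambda>\<xi>. cmod (fourier f \<xi>))"
      by (intro integrable_norm schwartz_integrable fourier_schwartz f)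
    show "AE \<xi> in lborel. (\<lambda>n. fourier f \<xi> * cis (2 * pi * (a \<bullet> \<xi>)) * gaussian (t n *\<^sub>R \<xi>)) \<longlonglongrightarrow>
        fourier f \<xi> * cis (2 * pi * (a \<bullet> \<xi>))"
    proof (rule AE_I2)
      fix \<xi> :: 'a
      have "(\<lambda>n. gaussian (t n *\<^sub>R \<xi>)) \<longlonglongrightarrow> of_real (exp (- pi * (norm (0 *\<^sub>R \<xi>))\<^sup>2))"
        unfolding gaussian_def by (intro tendsto_intros t)
      then show "(\<lambda>n. fourier f \<xi> * cis (2 * pi * (a \<bullet> \<xi>)) * gaussian (t n *\<^sub>R \<xi>)) \<longlonglongrightarrow>
          fourier f \<xi> * cis (2 * pi * (a \<bullet> \<xi>))"
        by (auto intro!: tendsto_eq_intros)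
    qed
    show "AE \<xi> in lborel. norm (fourier f \<xi> * cis (2 * pi * (a \<bullet> \<xi>)) * gaussian (t n *\<^sub>R \<xi>)) \<le> cmod (fourier f \<xi>)" for n
      using norm_gaussian_le by (auto simp: norm_mult intro!: AE_I2 mult_left_le)
  qed measurable
  then have "(\<lambda>n. LINT z|lborel. f (a + t n *\<^sub>R z) * gaussian z) \<longlonglongrightarrow>
      (LINT \<xi>|lborel. fourier f \<xi> * cis (2 * pi * (a \<bullet> \<xi>)))"
    using integral_gaussian_smoothing[OF schwartz_integrable[OF f] t(2)] by simp
  from LIMSEQ_unique[OF 1 this] show ?thesis
    by (simp add: fourier_def inner_commute mult.commute)
qed

subsection \<open>Uniqueness\<close>

lemma bounded_borel_approx_continuous:
  fixes f :: "'a::euclidean_space \<Rightarrow> complex"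
  assumes f: "f \<in> borel_measurable borel" and C: "\<And>x. cmod (f x) \<le> C"
  obtains h :: "nat \<Rightarrow> 'a \<Rightarrow> complex" where
    "\<And>n. continuous_on UNIV (h n)" "\<And>n x. cmod (h n x) \<le> C" "AE x in lborel. (\<lambda>n. h n x) \<longlonglongrightarrow> f x"
proof (cases "C = 0")
  case True
  then show ?thesis using C by (intro that[of "\<lambda>_ _. 0"]) auto
next
  case False
  then have C0: "0 < C" using order_trans[OF norm_ge_zero C[of undefined]] by simp
  have "f \<in> borel_measurable lebesgue" using f by (simp add: measurable_completion)
  then have "f measurable_on UNIV"
    by (intro lebesgue_measurable_imp_measurable_on) auto
  then obtain N g where N: "negligible N" and g: "\<And>n::nat. continuous_on UNIV (g n)"
    and lim: "\<And>x. x \<notin> N \<Longrightarrow> (\<lambda>n. g n x) \<longlonglongrightarrow> f x"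
    unfolding measurable_on_def by auto
  \<comment> \<open>radial truncation to the disc of radius \<open>C\<close>: continuous, and
    the identity on the values of \<open>f\<close>\<close>
  let ?cut = "\<lambda>z. of_real (C / max C (cmod z)) * z"
  show ?thesis
  proof (rule that[of "\<lambda>n x. ?cut (g n x)"])
    show "continuous_on UNIV (\<lambda>x. ?cut (g n x))" for n
      using C0 by (intro continuous_intros g) (auto simp: max_def)
    show "cmod (?cut (g n x)) \<le> C" for n x
    proof -
      have "C * cmod (g n x) \<le> C * max C (cmod (g n x))"
        using C0 by (intro mult_left_mono) auto
      then show ?thesis
        using C0 by (simp add: norm_mult norm_divide divide_le_eq)
    qed
    have "AE x in lebesgue. x \<notin> N"
      using N by (intro AE_not_in) (simp add: negligible_iff_null_sets)
    then have "AE x in lborel. x \<notin> N" by (simp add: AE_completion_iff)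
    then show "AE x in lborel. (\<lambda>n. ?cut (g n x)) \<longlonglongrightarrow> f x"
    proof eventually_elim
      case (elim x)
      have "(\<lambda>n. ?cut (g n x)) \<longlonglongrightarrow> ?cut (f x)"
        using C0 by (intro tendsto_intros lim elim) (auto simp: max_def)
      moreover have "?cut (f x) = f x"
        using C[of x] C0 by (simp add: max_absorb1)
      ultimately show ?case by simp
    qed
  qed
qed

text \<open>
  Vanishing of the transform makes all Gaussian averages of \<open>w\<close> vanish.  Integrated against a
  bounded continuous \<open>h\<close> the averages tend to \<open>LINT w * h\<close>, and \<open>h\<close> may approach the conjugate
  sign of \<open>w\<close>.
\<close>

lemma fourier_eq_0_imp_AE_eq_0:
  fixes w :: "'a::euclidean_space \<Rightarrow> complex"
  assumes w: "integrable lborel w" and zero: "\<And>\<xi>. fourier w \<xi> = 0"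
  shows "AE x in lborel. w x = 0"
proof -
  have [measurable]: "w \<in> borel_measurable borel" using w by auto
  have cont: "(LINT x|lborel. w x * h x) = 0"
    if h: "continuous_on UNIV h" "\<And>x. cmod (h x) \<le> 1" for h
  proof -
    have [measurable]: "h \<in> borel_measurable borel"
      using h(1) by (rule borel_measurable_continuous_onI)
    have isc: "isCont h x" for x using h(1) by (simp add: continuous_on_eq_continuous_at)
    define \<Phi> where "\<Phi> y = (LINT x|lborel. w (x + y) * h x)" for y
    have wy: "integrable lborel (\<lambda>x. w (x + y))" for y
      using integrable_translate[OF w] .
    have i: "integrable lborel (\<lambda>x. w (x + y) * h x)" for y
      by (rule Bochner_Integration.integrable_bound[OF wy[of y]])
        (use h(2) in \<open>auto simp: norm_mult intro!: AE_I2 mult_left_le\<close>)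
    have \<Phi>_le: "cmod (\<Phi> y) \<le> (LINT x|lborel. cmod (w x))" for y
    proof -
      have "cmod (\<Phi> y) \<le> (LINT x|lborel. cmod (w (x + y)))"
        unfolding \<Phi>_def using h(2)
        by (intro Bochner_Integration.integral_norm_bound_integral integrable_norm i wy)
          (auto simp: norm_mult intro!: mult_left_le)
      then show ?thesis
        using integral_translate[OF integrable_norm[OF w], of y] by simp
    qed
    have [measurable]: "\<Phi> \<in> borel_measurable borel"
    proof -
      have "(\<lambda>y. LINT x|lborel. w (x + y) * h x) \<in> borel_measurable borel" by measurable
      then show ?thesis by (simp add: \<Phi>_def[abs_def])
    qed
    have avg: "(LINT z|lborel. gaussian z * \<Phi> (t *\<^sub>R z)) = 0" if t: "0 < t" for t
    proof -
      have int: "integrable (lborel \<Otimes>\<^sub>M lborel) (\<lambda>(z, x). gaussian z * (w (x + t *\<^sub>R z) * h x))"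
      proof (rule lborel_pair.Fubini_integrable)
        show "integrable lborel (\<lambda>z. LINT x|lborel. norm (case (z, x) of (z, x) \<Rightarrow> gaussian z * (w (x + t *\<^sub>R z) * h x)))"
        proof (rule Bochner_Integration.integrable_bound)
          show "integrable lborel (\<lambda>z::'a. (LINT x|lborel. cmod (w x)) * cmod (gaussian z))"
            by (intro integrable_mult_right integrable_norm schwartz_integrable gaussian_schwartz)
          show "AE z in lborel. norm (LINT x|lborel. norm (case (z, x) of (z, x) \<Rightarrow> gaussian z * (w (x + t *\<^sub>R z) * h x)))
              \<le> norm ((LINT x|lborel. cmod (w x)) * cmod (gaussian z))"
          proof (rule AE_I2)
            fix z :: 'a
            have "(LINT x|lborel. cmod (w (x + t *\<^sub>R z)) * cmod (h x)) \<le> (LINT x|lborel. cmod (w (x + t *\<^sub>R z)))"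
              using h(2) integrable_norm[OF i[of "t *\<^sub>R z"]] integrable_norm[OF wy[of "t *\<^sub>R z"]]
              by (intro integral_mono mult_left_le) (simp_all add: norm_mult)
            also have "\<dots> = (LINT x|lborel. cmod (w x))"
              using integral_translate[OF integrable_norm[OF w]] by simp
            finally show "norm (LINT x|lborel. norm (case (z, x) of (z, x) \<Rightarrow> gaussian z * (w (x + t *\<^sub>R z) * h x)))
              \<le> norm ((LINT x|lborel. cmod (w x)) * cmod (gaussian z))"
              by (simp add: norm_mult mult.commute mult_left_mono integral_nonneg_AE)
          qed
        qed measurable
        show "AE z in lborel. integrable lborel (\<lambda>x. case (z, x) of (z, x) \<Rightarrow> gaussian z * (w (x + t *\<^sub>R z) * h x))"
          using i by simp
      qed measurable
      have "(LINT z|lborel. gaussian z * \<Phi> (t *\<^sub>R z)) = (LINT z|lborel. (LINT x|lborel. gaussian z * (w (x + t *\<^sub>R z) * h x)))"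
        by (simp add: \<Phi>_def)
      also have "\<dots> = (LINT x|lborel. (LINT z|lborel. gaussian z * (w (x + t *\<^sub>R z) * h x)))"
        using lborel_pair.Fubini_integral[OF int] by simp
      also have "\<dots> = (LINT x|lborel. (LINT z|lborel. w (x + t *\<^sub>R z) * gaussian z) * h x)"
        unfolding integral_mult_left_zero[symmetric] by (simp only: mult_ac)
      also have "\<dots> = 0"
        by (simp add: integral_gaussian_smoothing[OF w t] zero)
      finally show ?thesis .
    qed
    define t where "t n = 1 / real (Suc n)" for n
    have t: "t \<longlonglongrightarrow> 0" "\<And>n. 0 < t n"
      unfolding t_def using LIMSEQ_inverse_real_of_nat by (auto simp: inverse_eq_divide)
    have \<Phi>_lim: "(\<lambda>n. \<Phi> (t n *\<^sub>R z)) \<longlonglongrightarrow> \<Phi> 0" for z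
    proof -
      have \<Phi>_shift: "\<Phi> y = (LINT x|lborel. w x * h (x - y))" for y
        using integral_translate[OF i[of y], of "- y"] by (simp add: \<Phi>_def)
      show ?thesis
        unfolding \<Phi>_shift
      proof (rule integral_dominated_convergence[where w = "\<lambda>x. cmod (w x)"])
        show "AE x in lborel. (\<lambda>n. w x * h (x - t n *\<^sub>R z)) \<longlonglongrightarrow> w x * h (x - 0)"
        proof (rule AE_I2)
          fix x
          have "(\<lambda>n. x - t n *\<^sub>R z) \<longlonglongrightarrow> x - 0 *\<^sub>R z" by (intro tendsto_intros t)
          then have "(\<lambda>n. h (x - t n *\<^sub>R z)) \<longlonglongrightarrow> h x"
            using isCont_tendsto_compose[OF isc[of x]] by simp
          then show "(\<lambda>n. w x * h (x - t n *\<^sub>R z)) \<longlonglongrightarrow> w x * h (x - 0)"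
            by (auto intro: tendsto_intros)
        qed
        show "AE x in lborel. norm (w x * h (x - t n *\<^sub>R z)) \<le> cmod (w x)" for n
          using h(2) by (auto simp: norm_mult intro!: AE_I2 mult_left_le)
      qed (use w in auto)
    qed
    have "(\<lambda>n. LINT z|lborel. gaussian z * \<Phi> (t n *\<^sub>R z)) \<longlonglongrightarrow> (LINT z::'a|lborel. gaussian z * \<Phi> 0)"
    proof (rule integral_dominated_convergence)
      show "integrable lborel (\<lambda>z::'a. cmod (gaussian z) * (LINT x|lborel. cmod (w x)))"
        by (intro integrable_mult_left integrable_norm schwartz_integrable gaussian_schwartz)
      show "AE z in lborel. (\<lambda>n. gaussian z * \<Phi> (t n *\<^sub>R z)) \<longlonglongrightarrow> gaussian z * \<Phi> 0"
        by (intro AE_I2 tendsto_intros \<Phi>_lim)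
      show "AE z in lborel. norm (gaussian z * \<Phi> (t n *\<^sub>R z)) \<le> cmod (gaussian z) * (LINT x|lborel. cmod (w x))" for n
        using \<Phi>_le by (auto simp: norm_mult intro!: AE_I2 mult_left_mono)
    qed measurable
    then have "\<Phi> 0 = 0"
      by (simp add: avg t(2) integral_gaussian LIMSEQ_const_iff)
    then show ?thesis by (simp add: \<Phi>_def)
  qed
  have "(\<lambda>x. cnj (sgn (w x))) \<in> borel_measurable borel"
    unfolding sgn_div_norm by (intro borel_measurable_continuous_on[of cnj]) (auto intro: continuous_intros)
  moreover have "cmod (cnj (sgn (w x))) \<le> 1" for x
    by (simp add: norm_sgn)
  ultimately obtain h where h: "\<And>n. continuous_on UNIV (h n)" "\<And>n x. cmod (h n x) \<le> 1"
    and lim: "AE x in lborel. (\<lambda>n. h n x) \<longlonglongrightarrow> cnj (sgn (w x))"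
    by (rule bounded_borel_approx_continuous) blast
  have [measurable]: "h n \<in> borel_measurable borel" for n
    using h(1) by (rule borel_measurable_continuous_onI)
  have "(\<lambda>n. LINT x|lborel. w x * h n x) \<longlonglongrightarrow> (LINT x|lborel. of_real (cmod (w x)))"
  proof (rule integral_dominated_convergence[where w = "\<lambda>x. cmod (w x)"])
    show "AE x in lborel. (\<lambda>n. w x * h n x) \<longlonglongrightarrow> of_real (cmod (w x))"
      using lim
    proof eventually_elim
      case (elim x)
      have "w x * cnj (sgn (w x)) = of_real (cmod (w x))"
      proof -
        have "w x * cnj (sgn (w x)) = (w x * cnj (w x)) / of_real (cmod (w x))"
          by (simp add: sgn_eq)
        then show ?thesis
          by (simp add: complex_norm_square[symmetric] power2_eq_square)
      qed
      then show ?case using tendsto_mult_left[OF elim, of "w x"] by simp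
    qed
    show "AE x in lborel. norm (w x * h n x) \<le> cmod (w x)" for n
      using h(2) by (auto simp: norm_mult intro!: AE_I2 mult_left_le)
  qed (use w in auto)
  then have "(LINT x|lborel. complex_of_real (cmod (w x))) = 0"
    by (simp add: cont h LIMSEQ_const_iff del: integral_complex_of_real)
  then have "(LINT x|lborel. cmod (w x)) = 0" by simp
  then show ?thesis
    using integral_nonneg_eq_0_iff_AE[of lborel "\<lambda>x. cmod (w x)"] w by simp
qed

text \<open>
  Testing against the Gaussian times all exponentials shows that the transform of \<open>v *
  gaussian\<close> vanishes, and the Gaussian has no zeros.
\<close>

lemma integral_schwartz_eq_0_imp_AE_eq_0:
  fixes v :: "'a::euclidean_space \<Rightarrow> complex"
  assumes v[measurable]: "v \<in> borel_measurable borel"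
    and int: "\<And>\<phi>. \<phi> \<in> schwartz_functions \<Longrightarrow> integrable lborel (\<lambda>x. v x * \<phi> x)"
    and zero: "\<And>\<phi>. \<phi> \<in> schwartz_functions \<Longrightarrow> (LINT x|lborel. v x * \<phi> x) = 0"
  shows "AE x in lborel. v x = 0"
proof -
  have "AE x in lborel. v x * gaussian x = 0"
  proof (rule fourier_eq_0_imp_AE_eq_0[OF int[OF gaussian_schwartz]])
    fix \<xi> :: 'a
    show "fourier (\<lambda>x. v x * gaussian x) \<xi> = 0"
      using zero[OF schwartz_mult_cis[OF gaussian_schwartz, of \<xi>]]
      by (simp add: fourier_def mult.left_commute)
  qed
  then show ?thesis
    by eventually_elim (auto simp: gaussian_def)
qed

section \<open>Sobolev spaces on the Fourier side\<close>

definition bracket :: "real \<Rightarrow> 'a::euclidean_space \<Rightarrow> real" where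
  "bracket s \<xi> = (1 + (norm \<xi>)\<^sup>2) powr s"

lemma bracket_measurable [measurable]: "bracket s \<in> borel_measurable borel"
  unfolding bracket_def[abs_def] by measurable

lemma bracket_pos: "0 < bracket s \<xi>"
proof -
  have "0 < 1 + (norm \<xi>)\<^sup>2" by (simp add: add_pos_nonneg)
  then show ?thesis by (simp add: bracket_def)
qed

lemma bracket_nonneg [simp]: "0 \<le> bracket s \<xi>"
  using bracket_pos[of s \<xi>] by simp

lemma bracket_mono: "s \<le> t \<Longrightarrow> bracket s \<xi> \<le> bracket t \<xi>"
  unfolding bracket_def by (rule powr_mono) auto

lemma integrable_bracket:
  "s < - real DIM('a) / 2 \<Longrightarrow> integrable lborel (bracket s :: 'a::euclidean_space \<Rightarrow> real)"
  unfolding bracket_def[abs_def] by (rule integrable_powr_bracket)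

definition sobolev_integral :: "real \<Rightarrow> ('a::euclidean_space \<Rightarrow> complex) \<Rightarrow> real" where
  "sobolev_integral s v = (LINT \<xi>|lborel. bracket s \<xi> * (cmod (v \<xi>))\<^sup>2)"

definition weighted_L2 :: "real \<Rightarrow> ('a::euclidean_space \<Rightarrow> complex) set" where
  "weighted_L2 s = {v. v \<in> borel_measurable borel \<and>
     integrable lborel (\<lambda>\<xi>. bracket s \<xi> * (cmod (v \<xi>))\<^sup>2)}"

text \<open>The functions for which the pairing with every Schwartz function is absolutely convergent.\<close>

definition temperate :: "('a::euclidean_space \<Rightarrow> complex) \<Rightarrow> bool" where
  "temperate v \<longleftrightarrow> v \<in> borel_measurable borel \<and>
     (\<exists>k. integrable lborel (\<lambda>\<xi>. cmod (v \<xi>) / (1 + norm \<xi>) ^ k))"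

text \<open>
  The distribution with Fourier transform \<open>v\<close>. By inversion a Schwartz function
  \<open>\<psi>\<close> is the transform of the reflection of its own transform, which gives
  the formula.
\<close>

definition synthesis :: "('a::euclidean_space \<Rightarrow> complex) \<Rightarrow> 'a distribution" where
  "synthesis v = (\<lambda>\<psi>. if \<psi> \<in> schwartz_functions then (LINT \<xi>|lborel. v \<xi> * fourier \<psi> (- \<xi>)) else 0)"

lemma sobolev_integral_nonneg: "0 \<le> sobolev_integral s v"
  unfolding sobolev_integral_def by (intro integral_nonneg_AE) simp

lemma weighted_L2_antimono:
  assumes "v \<in> weighted_L2 t" "s \<le> t"
  shows "v \<in> weighted_L2 s"
proof -
  have [measurable]: "v \<in> borel_measurable borel" using assms by (simp add: weighted_L2_def)
  have "integrable lborel (\<lambda>\<xi>. bracket t \<xi> * (cmod (v \<xi>))\<^sup>2)" using assms by (simp add: weighted_L2_def)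
  then have "integrable lborel (\<lambda>\<xi>. bracket s \<xi> * (cmod (v \<xi>))\<^sup>2)"
    by (rule Bochner_Integration.integrable_bound)
      (auto intro!: AE_I2 mult_right_mono bracket_mono assms(2) simp: abs_mult)
  then show ?thesis by (simp add: weighted_L2_def)
qed

lemma weighted_L2_bounded:
  assumes s: "s < - real DIM('a) / 2"
    and v[measurable]: "v \<in> borel_measurable borel" and B: "\<And>\<xi>::'a::euclidean_space. cmod (v \<xi>) \<le> B"
  shows "v \<in> weighted_L2 s"
proof -
  have "integrable lborel (\<lambda>\<xi>. bracket s \<xi> * (cmod (v \<xi>))\<^sup>2)"
    by (rule Bochner_Integration.integrable_bound[OF integrable_mult_left[OF integrable_bracket[OF s], of "B\<^sup>2"]])
      (use B in \<open>auto intro!: AE_I2 mult_left_mono power_mono simp: abs_mult\<close>)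
  then show ?thesis by (simp add: weighted_L2_def)
qed

lemma weighted_L2_add:
  assumes "u \<in> weighted_L2 s" "v \<in> weighted_L2 s"
  shows "(\<lambda>\<xi>. u \<xi> + v \<xi>) \<in> weighted_L2 s"
proof -
  have [measurable]: "u \<in> borel_measurable borel" "v \<in> borel_measurable borel"
    using assms by (auto simp: weighted_L2_def)
  have "integrable lborel (\<lambda>\<xi>. bracket s \<xi> * (cmod (u \<xi> + v \<xi>))\<^sup>2)"
  proof (rule Bochner_Integration.integrable_bound)
    show "integrable lborel (\<lambda>\<xi>. 2 * (bracket s \<xi> * (cmod (u \<xi>))\<^sup>2 + bracket s \<xi> * (cmod (v \<xi>))\<^sup>2))"
      using assms by (auto simp: weighted_L2_def)
    show "AE \<xi> in lborel. norm (bracket s \<xi> * (cmod (u \<xi> + v \<xi>))\<^sup>2) \<le>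
        norm (2 * (bracket s \<xi> * (cmod (u \<xi>))\<^sup>2 + bracket s \<xi> * (cmod (v \<xi>))\<^sup>2))"
    proof (rule AE_I2)
      fix \<xi>
      have "(cmod (u \<xi> + v \<xi>))\<^sup>2 \<le> (cmod (u \<xi>) + cmod (v \<xi>))\<^sup>2"
        by (intro power_mono norm_triangle_ineq) simp
      also have "\<dots> \<le> 2 * ((cmod (u \<xi>))\<^sup>2 + (cmod (v \<xi>))\<^sup>2)"
        using sum_squares_bound[of "cmod (u \<xi>)" "cmod (v \<xi>)"] by (simp add: power2_sum)
      finally have "bracket s \<xi> * (cmod (u \<xi> + v \<xi>))\<^sup>2 \<le> bracket s \<xi> * (2 * ((cmod (u \<xi>))\<^sup>2 + (cmod (v \<xi>))\<^sup>2))"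
        by (rule mult_left_mono) simp
      then show "norm (bracket s \<xi> * (cmod (u \<xi> + v \<xi>))\<^sup>2) \<le>
        norm (2 * (bracket s \<xi> * (cmod (u \<xi>))\<^sup>2 + bracket s \<xi> * (cmod (v \<xi>))\<^sup>2))"
        by (simp add: abs_mult distrib_left mult.left_commute)
    qed
  qed measurable
  then show ?thesis by (simp add: weighted_L2_def)
qed

lemma weighted_L2_uminus: "v \<in> weighted_L2 s \<Longrightarrow> (\<lambda>\<xi>. - v \<xi>) \<in> weighted_L2 s"
  by (simp add: weighted_L2_def)

lemma weighted_L2_diff:
  "u \<in> weighted_L2 s \<Longrightarrow> v \<in> weighted_L2 s \<Longrightarrow> (\<lambda>\<xi>. u \<xi> - v \<xi>) \<in> weighted_L2 s"
  using weighted_L2_add[OF _ weighted_L2_uminus, of u s v] by simp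

text \<open>
  The quotient of \<open>v\<close> by a high power of the weight is a product \<open>x *
  y\<close> with \<open>x\<^sup>2\<close> integrable by assumption and
  \<open>y\<^sup>2\<close> integrable by the choice of the power.
\<close>

lemma weighted_L2_imp_temperate:
  fixes v :: "'a::euclidean_space \<Rightarrow> complex"
  assumes v: "v \<in> weighted_L2 s"
  shows "temperate v"
proof -
  have [measurable]: "v \<in> borel_measurable borel" using v by (simp add: weighted_L2_def)
  obtain k :: nat where k: "real DIM('a) / 2 - s < real k"
    using reals_Archimedean2 by blast
  have "integrable lborel (\<lambda>\<xi>. cmod (v \<xi>) / (1 + norm \<xi>) ^ k)"
  proof (rule Bochner_Integration.integrable_bound)
    show "integrable lborel (\<lambda>\<xi>::'a. bracket s \<xi> * (cmod (v \<xi>))\<^sup>2 + bracket (- s - k) \<xi>)"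
      using v k by (intro Bochner_Integration.integrable_add integrable_bracket) (auto simp: weighted_L2_def)
    show "AE \<xi> in lborel. norm (cmod (v \<xi>) / (1 + norm \<xi>) ^ k) \<le> norm (bracket s \<xi> * (cmod (v \<xi>))\<^sup>2 + bracket (- s - k) \<xi>)"
    proof (rule AE_I2)
      fix \<xi> :: 'a
      define q where "q = 1 + (norm \<xi>)\<^sup>2"
      define r where "r = 1 + norm \<xi>"
      have q: "0 < q" "q \<le> r\<^sup>2" and r: "0 < r"
        by (auto simp: q_def r_def power2_eq_square algebra_simps add_pos_nonneg)
      define x where "x = cmod (v \<xi>) * q powr (s / 2)"
      define y where "y = q powr (- s / 2) / r ^ k"
      have xy: "cmod (v \<xi>) / r ^ k = x * y"
        using q by (simp add: x_def y_def flip: powr_add)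
      have x2: "x\<^sup>2 = bracket s \<xi> * (cmod (v \<xi>))\<^sup>2"
        using q by (simp add: x_def power_mult_distrib powr_power bracket_def q_def)
      have "y\<^sup>2 = q powr (- s) / (r\<^sup>2) ^ k"
        using q by (simp add: y_def power_divide powr_power power_mult[symmetric] mult.commute)
      also have "\<dots> \<le> q powr (- s) / q ^ k"
        using q r by (intro divide_left_mono power_mono mult_pos_pos zero_less_power) auto
      also have "\<dots> = bracket (- s - k) \<xi>"
        using q by (simp add: bracket_def q_def powr_diff powr_realpow)
      finally have y2: "y\<^sup>2 \<le> bracket (- s - k) \<xi>" .
      have "x * y \<le> x\<^sup>2 + y\<^sup>2"
        using sum_squares_bound[of x y] zero_le_power2[of x] zero_le_power2[of y] by linarith
      then have "x * y \<le> bracket s \<xi> * (cmod (v \<xi>))\<^sup>2 + bracket (- s - k) \<xi>"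
        using x2 y2 by linarith
      moreover have "norm (cmod (v \<xi>) / (1 + norm \<xi>) ^ k) = x * y"
        using r by (simp add: xy[symmetric] r_def)
      ultimately show "norm (cmod (v \<xi>) / (1 + norm \<xi>) ^ k) \<le> norm (bracket s \<xi> * (cmod (v \<xi>))\<^sup>2 + bracket (- s - k) \<xi>)"
        by (smt (verit) real_norm_def)
    qed
  qed measurable
  then show ?thesis by (auto simp: temperate_def)
qed

lemma temperate_integrable_schwartz:
  fixes v :: "'a::euclidean_space \<Rightarrow> complex"
  assumes v: "temperate v" and \<phi>: "\<phi> \<in> schwartz_functions"
  shows "integrable lborel (\<lambda>\<xi>. v \<xi> * \<phi> \<xi>)"
proof -
  have [measurable]: "v \<in> borel_measurable borel" "\<phi> \<in> borel_measurable borel"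
    using v \<phi> by (auto simp: temperate_def intro: schwartz_measurable)
  obtain k where k: "integrable lborel (\<lambda>\<xi>. cmod (v \<xi>) / (1 + norm \<xi>) ^ k)"
    using v by (auto simp: temperate_def)
  obtain B where B: "\<And>\<xi>. (1 + norm \<xi>) ^ k * cmod (\<phi> \<xi>) \<le> B"
    using schwartz_decay[OF \<phi>] by metis
  show ?thesis
  proof (rule Bochner_Integration.integrable_bound[OF integrable_mult_right[OF k, of B]])
    show "AE \<xi> in lborel. norm (v \<xi> * \<phi> \<xi>) \<le> norm (B * (cmod (v \<xi>) / (1 + norm \<xi>) ^ k))"
    proof (rule AE_I2)
      fix \<xi> :: 'a
      have p: "0 < (1 + norm \<xi>) ^ k" by (intro zero_less_power add_pos_nonneg) auto
      have "cmod (v \<xi>) * cmod (\<phi> \<xi>) \<le> cmod (v \<xi>) * (B / (1 + norm \<xi>) ^ k)"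
        using B[of \<xi>] p by (intro mult_left_mono) (auto simp: field_simps)
      then have "norm (v \<xi> * \<phi> \<xi>) \<le> B * (cmod (v \<xi>) / (1 + norm \<xi>) ^ k)"
        by (simp add: norm_mult mult.commute)
      then show "norm (v \<xi> * \<phi> \<xi>) \<le> norm (B * (cmod (v \<xi>) / (1 + norm \<xi>) ^ k))"
        by (rule order_trans) (simp only: real_norm_def abs_ge_self)
    qed
  qed measurable
qed

lemma temperate_add:
  assumes "temperate u" "temperate v"
  shows "temperate (\<lambda>\<xi>::'a::euclidean_space. u \<xi> + v \<xi>)"
proof -
  have [measurable]: "u \<in> borel_measurable borel" "v \<in> borel_measurable borel"
    using assms by (auto simp: temperate_def)
  obtain k l where k: "integrable lborel (\<lambda>\<xi>. cmod (u \<xi>) / (1 + norm \<xi>) ^ k)"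
    and l: "integrable lborel (\<lambda>\<xi>. cmod (v \<xi>) / (1 + norm \<xi>) ^ l)"
    using assms by (auto simp: temperate_def)
  have "integrable lborel (\<lambda>\<xi>. cmod (u \<xi> + v \<xi>) / (1 + norm \<xi>) ^ (k + l))"
  proof (rule Bochner_Integration.integrable_bound[OF Bochner_Integration.integrable_add[OF k l]])
    show "AE \<xi> in lborel. norm (cmod (u \<xi> + v \<xi>) / (1 + norm \<xi>) ^ (k + l)) \<le>
        norm (cmod (u \<xi>) / (1 + norm \<xi>) ^ k + cmod (v \<xi>) / (1 + norm \<xi>) ^ l)"
    proof (rule AE_I2)
      fix \<xi> :: 'a
      have p: "0 < (1 + norm \<xi>) ^ j" for j by (intro zero_less_power add_pos_nonneg) auto
      have le: "(1 + norm \<xi>) ^ k \<le> (1 + norm \<xi>) ^ (k + l)" "(1 + norm \<xi>) ^ l \<le> (1 + norm \<xi>) ^ (k + l)"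
        by (intro power_increasing; simp)+
      have "cmod (u \<xi> + v \<xi>) / (1 + norm \<xi>) ^ (k + l) \<le> cmod (u \<xi>) / (1 + norm \<xi>) ^ (k + l) + cmod (v \<xi>) / (1 + norm \<xi>) ^ (k + l)"
        unfolding add_divide_distrib[symmetric] using p[of "k + l"]
        by (intro divide_right_mono norm_triangle_ineq) simp
      also have "\<dots> \<le> cmod (u \<xi>) / (1 + norm \<xi>) ^ k + cmod (v \<xi>) / (1 + norm \<xi>) ^ l"
        using p le by (intro add_mono divide_left_mono) auto
      finally show "norm (cmod (u \<xi> + v \<xi>) / (1 + norm \<xi>) ^ (k + l)) \<le>
        norm (cmod (u \<xi>) / (1 + norm \<xi>) ^ k + cmod (v \<xi>) / (1 + norm \<xi>) ^ l)"
        by simp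
    qed
  qed measurable
  then show ?thesis by (auto simp: temperate_def)
qed

lemma temperate_uminus: "temperate v \<Longrightarrow> temperate (\<lambda>\<xi>. - v \<xi>)"
  by (auto simp: temperate_def)

lemma temperate_diff: "temperate u \<Longrightarrow> temperate v \<Longrightarrow> temperate (\<lambda>\<xi>. u \<xi> - v \<xi>)"
  using temperate_add[OF _ temperate_uminus, of u v] by simp

lemma synthesis_schwartz:
  "\<psi> \<in> schwartz_functions \<Longrightarrow> synthesis v \<psi> = (LINT \<xi>|lborel. v \<xi> * fourier \<psi> (- \<xi>))"
  by (simp add: synthesis_def)

lemma integrable_synthesis:
  "temperate v \<Longrightarrow> \<psi> \<in> schwartz_functions \<Longrightarrow> integrable lborel (\<lambda>\<xi>. v \<xi> * fourier \<psi> (- \<xi>))"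
  by (intro temperate_integrable_schwartz schwartz_reflect fourier_schwartz)

lemma synthesis_diff:
  assumes "temperate u" "temperate v"
  shows "(\<lambda>\<psi>. synthesis u \<psi> - synthesis v \<psi>) = synthesis (\<lambda>\<xi>. u \<xi> - v \<xi>)"
  using integrable_synthesis[OF assms(1)] integrable_synthesis[OF assms(2)]
  by (auto simp: synthesis_def fun_eq_iff left_diff_distrib)

lemma synthesis_cong_AE:
  assumes "AE \<xi> in lborel. u \<xi> = v \<xi>" "u \<in> borel_measurable borel" "v \<in> borel_measurable borel"
  shows "synthesis u = synthesis v"
proof
  fix \<psi> :: "'a \<Rightarrow> complex"
  show "synthesis u \<psi> = synthesis v \<psi>"
  proof (cases "\<psi> \<in> schwartz_functions")
    case True
    then have [measurable]: "fourier \<psi> \<in> borel_measurable borel"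
      by (intro schwartz_measurable fourier_schwartz)
    have [measurable]: "u \<in> borel_measurable borel" "v \<in> borel_measurable borel" by fact+
    show ?thesis
      unfolding synthesis_schwartz[OF True] using assms(1) by (intro integral_cong_AE) auto
  qed (simp add: synthesis_def)
qed

lemma is_fourier_transform_synthesis:
  assumes v: "temperate v"
  shows "is_fourier_transform (synthesis v) v"
  unfolding is_fourier_transform_def
proof (intro conjI ballI)
  show "v \<in> borel_measurable lborel" using v by (simp add: temperate_def)
  fix \<phi> :: "'a \<Rightarrow> complex" assume \<phi>: "\<phi> \<in> schwartz_functions"
  show "integrable lborel (\<lambda>\<xi>. v \<xi> * \<phi> \<xi>)" using v \<phi> by (rule temperate_integrable_schwartz)
  show "synthesis v (fourier \<phi>) = (LINT \<xi>|lborel. v \<xi> * \<phi> \<xi>)"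
    by (simp add: synthesis_schwartz[OF fourier_schwartz[OF \<phi>]] fourier_inversion[OF \<phi>])
qed

text \<open>
  Hence the function chosen in the definition of the Sobolev norm may be replaced by any other
  transform.
\<close>

lemma fourier_transform_unique_AE:
  assumes u: "is_fourier_transform T u" and v: "is_fourier_transform T v"
  shows "AE \<xi> in lborel. u \<xi> = v \<xi>"
proof -
  have "AE \<xi> in lborel. u \<xi> - v \<xi> = 0"
  proof (rule integral_schwartz_eq_0_imp_AE_eq_0)
    show "(\<lambda>\<xi>. u \<xi> - v \<xi>) \<in> borel_measurable borel"
      using u v by (auto simp: is_fourier_transform_def)
    fix \<phi> :: "'a \<Rightarrow> complex" assume "\<phi> \<in> schwartz_functions"
    then have i: "integrable lborel (\<lambda>\<xi>. u \<xi> * \<phi> \<xi>)" "integrable lborel (\<lambda>\<xi>. v \<xi> * \<phi> \<xi>)"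
      and e: "(LINT \<xi>|lborel. u \<xi> * \<phi> \<xi>) = (LINT \<xi>|lborel. v \<xi> * \<phi> \<xi>)"
      using u v by (auto simp: is_fourier_transform_def)
    show "integrable lborel (\<lambda>\<xi>. (u \<xi> - v \<xi>) * \<phi> \<xi>)"
      using i by (simp add: left_diff_distrib)
    show "(LINT \<xi>|lborel. (u \<xi> - v \<xi>) * \<phi> \<xi>) = 0"
      using i e by (simp add: left_diff_distrib)
  qed
  then show ?thesis by eventually_elim simp
qed

lemma fourier_of_reflected_fourier:
  fixes \<psi> :: "'a::euclidean_space \<Rightarrow> complex"
  assumes \<psi>: "\<psi> \<in> schwartz_functions"
  shows "fourier (\<lambda>\<xi>. fourier \<psi> (- \<xi>)) = \<psi>"
proof
  fix x
  have [measurable]: "fourier \<psi> \<in> borel_measurable borel"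
    by (intro schwartz_measurable fourier_schwartz \<psi>)
  have "fourier (fourier \<psi>) (- x) = (LINT \<xi>|lborel. cis (- 2 * pi * (\<xi> \<bullet> (- x))) * fourier \<psi> \<xi>)"
    by (simp add: fourier_def[of "fourier \<psi>"])
  also have "\<dots> = (LINT \<xi>|lborel. cis (- 2 * pi * (\<xi> \<bullet> x)) * fourier \<psi> (- \<xi>))"
    by (subst lborel_integral_affine[of "-1" _ 0]) auto
  finally show "fourier (\<lambda>\<xi>. fourier \<psi> (- \<xi>)) x = \<psi> x"
    by (simp add: fourier_inversion[OF \<psi>] fourier_def[of "\<lambda>\<xi>. fourier \<psi> (- \<xi>)"])
qed

text \<open>The Fourier transform maps the Schwartz space onto itself, so a tempered distribution is
  determined by its transform.\<close>

lemma tempered_eq_synthesis: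
  assumes T: "tempered T" and v: "is_fourier_transform T v"
  shows "T = synthesis v"
proof
  fix \<psi> :: "'a \<Rightarrow> complex"
  show "T \<psi> = synthesis v \<psi>"
  proof (cases "\<psi> \<in> schwartz_functions")
    case True
    then have "(\<lambda>\<xi>. fourier \<psi> (- \<xi>)) \<in> schwartz_functions"
      by (intro schwartz_reflect fourier_schwartz)
    then have "T (fourier (\<lambda>\<xi>. fourier \<psi> (- \<xi>))) = (LINT \<xi>|lborel. v \<xi> * fourier \<psi> (- \<xi>))"
      using v by (auto simp: is_fourier_transform_def)
    then show ?thesis
      using True by (simp add: synthesis_def fourier_of_reflected_fourier)
  next
    case False
    then show ?thesis using T by (simp add: synthesis_def tempered_def)
  qed
qed

text \<open>
  For the continuity, the weighted supremum of a transform is bounded by finitely many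
  seminorms.
\<close>

lemma tempered_synthesis:
  fixes v :: "'a::euclidean_space \<Rightarrow> complex"
  assumes v: "temperate v"
  shows "tempered (synthesis v)"
  unfolding tempered_def
proof (intro conjI allI ballI impI)
  have [measurable]: "v \<in> borel_measurable borel" using v by (simp add: temperate_def)
  show "synthesis v f = 0" if "f \<notin> schwartz_functions" for f
    using that by (simp add: synthesis_def)
  show "synthesis v (\<lambda>x. a * f x + h x) = a * synthesis v f + synthesis v h"
    if f: "f \<in> schwartz_functions" and h: "h \<in> schwartz_functions" for f h a
  proof -
    have "fourier (\<lambda>x. a * f x + h x) \<xi> = a * fourier f \<xi> + fourier h \<xi>" for \<xi>
      using fourier_add[OF schwartz_integrable[OF schwartz_scale[OF f]] schwartz_integrable[OF h], of a \<xi>]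
      by (simp add: fourier_scale)
    then show ?thesis
      using integrable_synthesis[OF v f] integrable_synthesis[OF v h]
      by (simp add: synthesis_schwartz f h schwartz_add_scale distrib_left mult.left_commute)
  qed
  fix F :: "nat \<Rightarrow> 'a \<Rightarrow> complex"
  assume "(\<forall>n. F n \<in> schwartz_functions) \<and>
      (\<forall>k vs. set vs \<subseteq> Basis \<longrightarrow> (\<lambda>n. schwartz_seminorm k vs (F n)) \<longlonglongrightarrow> 0)"
  then have F: "\<And>n. F n \<in> schwartz_functions"
    and lim: "\<And>k vs. set vs \<subseteq> Basis \<Longrightarrow> (\<lambda>n. schwartz_seminorm k vs (F n)) \<longlonglongrightarrow> 0"
    by auto
  obtain k where k: "integrable lborel (\<lambda>\<xi>. cmod (v \<xi>) / (1 + norm \<xi>) ^ k)"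
    using v by (auto simp: temperate_def)
  obtain A C where A: "finite A" "0 \<le> C" "\<forall>q\<in>A. set (snd q) \<subseteq> Basis"
    and bound: "\<forall>f::'a \<Rightarrow> complex. f \<in> schwartz_functions \<longrightarrow> (\<forall>\<xi>.
        (1 + norm \<xi>) ^ k * cmod (fourier f \<xi>) \<le> C * (\<Sum>q\<in>A. schwartz_seminorm (fst q) (snd q) f))"
    using fourier_decay[where 'a = 'a, of k] by blast
  define N where "N n = C * (\<Sum>q\<in>A. schwartz_seminorm (fst q) (snd q) (F n))" for n
  have N0: "N \<longlonglongrightarrow> C * (\<Sum>q\<in>A. 0)"
    unfolding N_def using A(3) by (intro tendsto_intros lim) auto
  have le: "cmod (synthesis v (F n)) \<le> N n * (LINT \<xi>|lborel. cmod (v \<xi>) / (1 + norm \<xi>) ^ k)" for n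
  proof -
    have "cmod (LINT \<xi>|lborel. v \<xi> * fourier (F n) (- \<xi>)) \<le> (LINT \<xi>|lborel. N n * (cmod (v \<xi>) / (1 + norm \<xi>) ^ k))"
    proof (rule Bochner_Integration.integral_norm_bound_integral)
      show "integrable lborel (\<lambda>\<xi>. v \<xi> * fourier (F n) (- \<xi>))" using integrable_synthesis[OF v F] .
      show "integrable lborel (\<lambda>\<xi>. N n * (cmod (v \<xi>) / (1 + norm \<xi>) ^ k))" using k by (rule integrable_mult_right)
      fix \<xi> :: 'a
      have p: "0 < (1 + norm \<xi>) ^ k" by (intro zero_less_power add_pos_nonneg) auto
      have "(1 + norm \<xi>) ^ k * cmod (fourier (F n) (- \<xi>)) \<le> N n"
        using bound[rule_format, OF F[of n], of "- \<xi>"] by (simp add: N_def)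
      then have "cmod (v \<xi>) * cmod (fourier (F n) (- \<xi>)) \<le> cmod (v \<xi>) * (N n / (1 + norm \<xi>) ^ k)"
        using p by (intro mult_left_mono) (auto simp: field_simps)
      then show "norm (v \<xi> * fourier (F n) (- \<xi>)) \<le> N n * (cmod (v \<xi>) / (1 + norm \<xi>) ^ k)"
        by (simp add: norm_mult mult.commute)
    qed
    then show ?thesis unfolding synthesis_schwartz[OF F] by (simp only: integral_mult_right_zero)
  qed
  show "(\<lambda>n. synthesis v (F n)) \<longlonglongrightarrow> 0"
  proof (rule Lim_null_comparison)
    show "\<forall>\<^sub>F n in sequentially. norm (synthesis v (F n)) \<le> N n * (LINT \<xi>|lborel. cmod (v \<xi>) / (1 + norm \<xi>) ^ k)"
      using le by simp
    show "(\<lambda>n. N n * (LINT \<xi>|lborel. cmod (v \<xi>) / (1 + norm \<xi>) ^ k)) \<longlonglongrightarrow> 0"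
      using tendsto_mult_left_zero[of N sequentially "LINT \<xi>|lborel. cmod (v \<xi>) / (1 + norm \<xi>) ^ k"] N0
      by simp
  qed
qed

text \<open>
  This turns statements about the Sobolev space into statements about a weighted
  \<open>L2\<close> space.
\<close>

lemma sobolev_eq_synthesis: "sobolev s = synthesis ` weighted_L2 s"
proof (intro equalityI subsetI)
  fix T :: "'a distribution" assume "T \<in> sobolev s"
  then obtain v where T: "tempered T" and v: "is_fourier_transform T v"
    and i: "integrable lborel (\<lambda>\<xi>. (1 + (norm \<xi>)\<^sup>2) powr s * (cmod (v \<xi>))\<^sup>2)"
    by (auto simp: sobolev_def)
  have "v \<in> weighted_L2 s"
    using v i by (simp add: weighted_L2_def bracket_def is_fourier_transform_def)
  then show "T \<in> synthesis ` weighted_L2 s"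
    using tempered_eq_synthesis[OF T v] by blast
next
  fix T :: "'a distribution" assume "T \<in> synthesis ` weighted_L2 s"
  then obtain v where v: "v \<in> weighted_L2 s" and T: "T = synthesis v" by auto
  then have "temperate v" by (simp add: weighted_L2_imp_temperate)
  then show "T \<in> sobolev s"
    unfolding T sobolev_def using v
    by (auto simp: weighted_L2_def bracket_def intro!: tempered_synthesis is_fourier_transform_synthesis exI[of _ v])
qed

lemma sobolev_integral_cong_AE:
  assumes "AE \<xi> in lborel. cmod (u \<xi>) = cmod (v \<xi>)" "u \<in> borel_measurable borel" "v \<in> borel_measurable borel"
  shows "sobolev_integral s u = sobolev_integral s v"
proof -
  have [measurable]: "u \<in> borel_measurable borel" "v \<in> borel_measurable borel" by fact+
  show ?thesis
    unfolding sobolev_integral_def using assms(1) by (intro integral_cong_AE) auto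
qed

lemma sobolev_norm_eq:
  assumes v: "is_fourier_transform T v"
  shows "sobolev_norm s T = sqrt (sobolev_integral s v)"
proof -
  have some: "is_fourier_transform T (SOME v. is_fourier_transform T v)"
    by (rule someI[of "is_fourier_transform T", OF v])
  have "sobolev_integral s (SOME v. is_fourier_transform T v) = sobolev_integral s v"
    using fourier_transform_unique_AE[OF some v] some v
    by (intro sobolev_integral_cong_AE) (auto simp: is_fourier_transform_def)
  then show ?thesis
    by (simp add: sobolev_norm_def sobolev_integral_def bracket_def)
qed

lemma sobolev_dist_synthesis:
  assumes "temperate u" "temperate v"
  shows "sobolev_dist s (synthesis u) (synthesis v) = sqrt (sobolev_integral s (\<lambda>\<xi>. u \<xi> - v \<xi>))"
  unfolding sobolev_dist_def synthesis_diff[OF assms]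
  by (intro sobolev_norm_eq is_fourier_transform_synthesis temperate_diff assms)

lemma is_fourier_transform_uminus:
  "is_fourier_transform T v \<Longrightarrow> is_fourier_transform (\<lambda>\<phi>. - T \<phi>) (\<lambda>\<xi>. - v \<xi>)"
  by (auto simp: is_fourier_transform_def)

text \<open>
  The symmetry is needed for all functionals, also for those without a transform: then both
  choices in the norm are the same arbitrary function.
\<close>

lemma sobolev_dist_commute: "sobolev_dist s S T = sobolev_dist s T S"
proof (cases "\<exists>v. is_fourier_transform (\<lambda>\<phi>. S \<phi> - T \<phi>) v")
  case True
  then obtain v where v: "is_fourier_transform (\<lambda>\<phi>. S \<phi> - T \<phi>) v" by blast
  have "is_fourier_transform (\<lambda>\<phi>. T \<phi> - S \<phi>) (\<lambda>\<xi>. - v \<xi>)"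
    using is_fourier_transform_uminus[OF v] by simp
  from sobolev_norm_eq[OF this] sobolev_norm_eq[OF v] show ?thesis
    by (simp add: sobolev_dist_def sobolev_integral_def)
next
  case False
  have "\<nexists>v. is_fourier_transform (\<lambda>\<phi>. T \<phi> - S \<phi>) v"
  proof
    assume "\<exists>v. is_fourier_transform (\<lambda>\<phi>. T \<phi> - S \<phi>) v"
    then obtain v where "is_fourier_transform (\<lambda>\<phi>. T \<phi> - S \<phi>) v" by blast
    from is_fourier_transform_uminus[OF this] show False using False by simp
  qed
  then have "is_fourier_transform (\<lambda>\<phi>. T \<phi> - S \<phi>) = (\<lambda>v. False)"
    "is_fourier_transform (\<lambda>\<phi>. S \<phi> - T \<phi>) = (\<lambda>v. False)"
    using False by auto
  then show ?thesis by (simp add: sobolev_dist_def sobolev_norm_def)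
qed

lemma sobolev_dist_nonneg: "0 \<le> sobolev_dist s S T"
  unfolding sobolev_dist_def sobolev_norm_def by (intro real_sqrt_ge_zero integral_nonneg_AE) simp

text \<open>
  Minkowski's inequality from \<open>2 x y \<le> (b / a) x\<^sup>2 + (a / b) y\<^sup>2\<close>, where \<open>a\<close> and \<open>b\<close> are
  slightly larger than the two norms.
\<close>

lemma sobolev_integral_triangle:
  fixes u v :: "'a::euclidean_space \<Rightarrow> complex"
  assumes u: "u \<in> weighted_L2 s" and v: "v \<in> weighted_L2 s"
  shows "sqrt (sobolev_integral s (\<lambda>\<xi>. u \<xi> + v \<xi>)) \<le> sqrt (sobolev_integral s u) + sqrt (sobolev_integral s v)"
proof (rule field_le_epsilon)
  fix e :: real assume e: "0 < e"
  define a where "a = sqrt (sobolev_integral s u) + e / 2"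
  define b where "b = sqrt (sobolev_integral s v) + e / 2"
  have ab: "0 < a" "0 < b"
    using e sobolev_integral_nonneg[of s u] sobolev_integral_nonneg[of s v]
    by (auto simp: a_def b_def intro: add_nonneg_pos)
  have A: "sobolev_integral s u \<le> a\<^sup>2"
    using e sobolev_integral_nonneg[of s u]
    by (metis a_def add_increasing2 less_eq_real_def half_gt_zero order_refl real_sqrt_ge_zero real_sqrt_le_iff real_sqrt_pow2 power_mono)
  have B: "sobolev_integral s v \<le> b\<^sup>2"
    using e sobolev_integral_nonneg[of s v]
    by (metis b_def add_increasing2 less_eq_real_def half_gt_zero order_refl real_sqrt_ge_zero real_sqrt_le_iff real_sqrt_pow2 power_mono)
  have pt: "(cmod (u \<xi> + v \<xi>))\<^sup>2 \<le> (1 + b / a) * (cmod (u \<xi>))\<^sup>2 + (1 + a / b) * (cmod (v \<xi>))\<^sup>2" for \<xi>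
  proof -
    let ?x = "cmod (u \<xi>)" and ?y = "cmod (v \<xi>)"
    have "0 \<le> (b * ?x - a * ?y)\<^sup>2 / (a * b)" using ab by simp
    also have "\<dots> = (b / a) * ?x\<^sup>2 + (a / b) * ?y\<^sup>2 - 2 * ?x * ?y"
      using ab by (simp add: field_simps power2_eq_square)
    finally have "2 * ?x * ?y \<le> (b / a) * ?x\<^sup>2 + (a / b) * ?y\<^sup>2" by simp
    moreover have "(cmod (u \<xi> + v \<xi>))\<^sup>2 \<le> (?x + ?y)\<^sup>2"
      by (intro power_mono norm_triangle_ineq) simp
    ultimately show ?thesis by (simp add: power2_sum distrib_right)
  qed
  have iu: "integrable lborel (\<lambda>\<xi>. bracket s \<xi> * (cmod (u \<xi>))\<^sup>2)"
    and iv: "integrable lborel (\<lambda>\<xi>. bracket s \<xi> * (cmod (v \<xi>))\<^sup>2)"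
    and iw: "integrable lborel (\<lambda>\<xi>. bracket s \<xi> * (cmod (u \<xi> + v \<xi>))\<^sup>2)"
    using u v weighted_L2_add[OF u v] by (auto simp: weighted_L2_def)
  have "sobolev_integral s (\<lambda>\<xi>. u \<xi> + v \<xi>) \<le>
      (LINT \<xi>|lborel. (1 + b / a) * (bracket s \<xi> * (cmod (u \<xi>))\<^sup>2) + (1 + a / b) * (bracket s \<xi> * (cmod (v \<xi>))\<^sup>2))"
    unfolding sobolev_integral_def
  proof (rule integral_mono)
    show "integrable lborel (\<lambda>\<xi>. (1 + b / a) * (bracket s \<xi> * (cmod (u \<xi>))\<^sup>2) + (1 + a / b) * (bracket s \<xi> * (cmod (v \<xi>))\<^sup>2))"
      using iu iv by (intro Bochner_Integration.integrable_add integrable_mult_right)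
    show "bracket s \<xi> * (cmod (u \<xi> + v \<xi>))\<^sup>2 \<le>
        (1 + b / a) * (bracket s \<xi> * (cmod (u \<xi>))\<^sup>2) + (1 + a / b) * (bracket s \<xi> * (cmod (v \<xi>))\<^sup>2)" for \<xi>
      using mult_left_mono[OF pt bracket_nonneg, of s \<xi> \<xi>] by (simp add: algebra_simps)
  qed (rule iw)
  also have "\<dots> = (1 + b / a) * sobolev_integral s u + (1 + a / b) * sobolev_integral s v"
    using iu iv unfolding sobolev_integral_def
    by (subst Bochner_Integration.integral_add) auto
  also have "\<dots> \<le> (1 + b / a) * a\<^sup>2 + (1 + a / b) * b\<^sup>2"
    using ab A B by (intro add_mono mult_left_mono) auto
  also have "\<dots> = (a + b)\<^sup>2"
    using ab by (simp add: field_simps power2_eq_square)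
  finally have "sqrt (sobolev_integral s (\<lambda>\<xi>. u \<xi> + v \<xi>)) \<le> a + b"
    using ab by (simp add: real_le_lsqrt)
  then show "sqrt (sobolev_integral s (\<lambda>\<xi>. u \<xi> + v \<xi>)) \<le> sqrt (sobolev_integral s u) + sqrt (sobolev_integral s v) + e"
    by (simp add: a_def b_def)
qed

lemma sobolev_integral_eq_0:
  fixes v :: "'a::euclidean_space \<Rightarrow> complex"
  assumes "v \<in> weighted_L2 s"
  shows "sobolev_integral s v = 0 \<longleftrightarrow> (AE \<xi> in lborel. v \<xi> = 0)"
proof -
  have "sobolev_integral s v = 0 \<longleftrightarrow> (AE \<xi> in lborel. bracket s \<xi> * (cmod (v \<xi>))\<^sup>2 = 0)"
    unfolding sobolev_integral_def using assms
    by (intro integral_nonneg_eq_0_iff_AE) (auto simp: weighted_L2_def)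
  also have "\<dots> \<longleftrightarrow> (AE \<xi> in lborel. v \<xi> = 0)"
  proof -
    have "bracket s \<xi> \<noteq> 0" for \<xi> :: 'a using bracket_pos[of s \<xi>] by simp
    then show ?thesis by (intro AE_cong) simp
  qed
  finally show ?thesis .
qed

lemma Metric_space_sobolev: "Metric_space (sobolev s) (sobolev_dist s)"
proof
  fix S T R :: "'a distribution"
  show "0 \<le> sobolev_dist s S T" by (rule sobolev_dist_nonneg)
  show "sobolev_dist s S T = sobolev_dist s T S" by (rule sobolev_dist_commute)
  assume "S \<in> sobolev s" "T \<in> sobolev s"
  then obtain u v where S: "S = synthesis u" "u \<in> weighted_L2 s" and T: "T = synthesis v" "v \<in> weighted_L2 s"
    by (auto simp: sobolev_eq_synthesis)
  have tm: "temperate u" "temperate v" using S T by (auto intro: weighted_L2_imp_temperate)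
  show "sobolev_dist s S T = 0 \<longleftrightarrow> S = T"
  proof
    assume "sobolev_dist s S T = 0"
    then have "AE \<xi> in lborel. u \<xi> - v \<xi> = 0"
      using sobolev_integral_eq_0[OF weighted_L2_diff[OF S(2) T(2)]]
      by (simp add: S T sobolev_dist_synthesis tm)
    then have "AE \<xi> in lborel. u \<xi> = v \<xi>" by eventually_elim simp
    then show "S = T"
      unfolding S T by (rule synthesis_cong_AE) (use S T in \<open>auto simp: weighted_L2_def\<close>)
  next
    assume "S = T"
    then have "sobolev_dist s S T = sobolev_dist s (synthesis u) (synthesis u)" by (simp add: S)
    then show "sobolev_dist s S T = 0"
      by (simp add: sobolev_dist_synthesis tm sobolev_integral_def)
  qed
  assume "R \<in> sobolev s"
  then obtain w where R: "R = synthesis w" "w \<in> weighted_L2 s"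
    by (auto simp: sobolev_eq_synthesis)
  then have tw: "temperate w" by (auto intro: weighted_L2_imp_temperate)
  have "sqrt (sobolev_integral s (\<lambda>\<xi>. (u \<xi> - v \<xi>) + (v \<xi> - w \<xi>))) \<le>
      sqrt (sobolev_integral s (\<lambda>\<xi>. u \<xi> - v \<xi>)) + sqrt (sobolev_integral s (\<lambda>\<xi>. v \<xi> - w \<xi>))"
    by (intro sobolev_integral_triangle weighted_L2_diff S T R)
  then show "sobolev_dist s S R \<le> sobolev_dist s S T + sobolev_dist s T R"
    by (simp add: S T R sobolev_dist_synthesis tm tw)
qed

subsection \<open>Separability and measurability\<close>

text \<open>
  For \<open>x\<close> in the closure of the sequence, a measurable choice of a member within
  \<open>1 / (n + 1)\<close> of \<open>x\<close>. The cells on which it is constant serve as a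
  countable partition into small sets.
\<close>

definition nearest_index :: "(nat \<Rightarrow> 'a::metric_space) \<Rightarrow> nat \<Rightarrow> 'a \<Rightarrow> nat" where
  "nearest_index p n x = (LEAST k. dist x (p k) < 1 / real (Suc n))"

lemma dist_nearest_index:
  assumes "x \<in> closure (range p)"
  shows "dist x (p (nearest_index p n x)) < 1 / real (Suc n)"
proof -
  have "\<exists>k. dist x (p k) < 1 / real (Suc n)"
    using assms by (auto simp: closure_approachable dist_commute elim!: allE[of _ "1 / real (Suc n)"])
  then show ?thesis unfolding nearest_index_def by (rule LeastI_ex)
qed

lemma measurable_nearest_index [measurable]:
  fixes p :: "nat \<Rightarrow> 'a::{metric_space, second_countable_topology}"
  shows "nearest_index p n \<in> borel \<rightarrow>\<^sub>M count_space UNIV"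
  unfolding nearest_index_def[abs_def] by measurable

lemma tendsto_nearest_index:
  assumes "x \<in> closure (range p)"
  shows "(\<lambda>n. p (nearest_index p n x)) \<longlonglongrightarrow> x"
proof (rule metric_LIMSEQ_I)
  fix r :: real assume "0 < r"
  then obtain N where N: "1 / real (Suc N) < r"
    using nat_approx_posE by blast
  have "dist (p (nearest_index p n x)) x < r" if "N \<le> n" for n
  proof -
    have "1 / real (Suc n) \<le> 1 / real (Suc N)" using that by (simp add: frac_le)
    then show ?thesis
      using dist_nearest_index[OF assms, of n] N by (simp add: dist_commute)
  qed
  then show "\<exists>N. \<forall>n\<ge>N. dist (p (nearest_index p n x)) x < r" by blast
qed

lemma dense_sequence:
  fixes S :: "'a::{metric_space, second_countable_topology} set"
  assumes "S \<noteq> {}"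
  obtains p :: "nat \<Rightarrow> 'a" where "range p \<subseteq> S" "S \<subseteq> closure (range p)"
proof -
  obtain T where T: "countable T" "T \<subseteq> S" "S \<subseteq> closure T"
    by (rule separable)
  then have "T \<noteq> {}" using assms by auto
  then have "range (from_nat_into T) = T" using T(1) by (simp add: range_from_nat_into)
  then show ?thesis using T by (intro that[of "from_nat_into T"]) auto
qed

lemma sobolev_integral_add_le:
  assumes "u \<in> weighted_L2 s" "v \<in> weighted_L2 s"
  shows "sobolev_integral s (\<lambda>\<xi>. u \<xi> + v \<xi>) \<le> 2 * sobolev_integral s u + 2 * sobolev_integral s v"
proof -
  let ?a = "sqrt (sobolev_integral s u)" and ?b = "sqrt (sobolev_integral s v)"
  have "(sqrt (sobolev_integral s (\<lambda>\<xi>. u \<xi> + v \<xi>)))\<^sup>2 \<le> (?a + ?b)\<^sup>2"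
    using sobolev_integral_triangle[OF assms] by (intro power_mono) (auto intro: sobolev_integral_nonneg)
  also have "\<dots> \<le> 2 * ?a\<^sup>2 + 2 * ?b\<^sup>2"
    using sum_squares_bound[of ?a ?b] by (simp add: power2_sum)
  finally show ?thesis by (simp add: sobolev_integral_nonneg)
qed

lemma sobolev_integral_bounded_tendsto:
  fixes v :: "'a::euclidean_space \<Rightarrow> complex"
  assumes s: "s < - real DIM('a) / 2"
    and [measurable]: "\<And>k::nat. u k \<in> borel_measurable borel" "v \<in> borel_measurable borel"
    and B: "\<And>k \<xi>. cmod (u k \<xi>) \<le> B" "\<And>\<xi>. cmod (v \<xi>) \<le> B"
    and lim: "AE \<xi> in lborel. (\<lambda>k. u k \<xi>) \<longlonglongrightarrow> v \<xi>"
  shows "(\<lambda>k. sobolev_integral s (\<lambda>\<xi>. v \<xi> - u k \<xi>)) \<longlonglongrightarrow> 0"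
proof -
  have "(\<lambda>k. LINT \<xi>|lborel. bracket s \<xi> * (cmod (v \<xi> - u k \<xi>))\<^sup>2) \<longlonglongrightarrow> (LINT (\<xi>::'a)|lborel. (0::real))"
  proof (rule integral_dominated_convergence)
    show "integrable lborel (\<lambda>\<xi>::'a. bracket s \<xi> * (2 * B)\<^sup>2)"
      using integrable_bracket[OF s] by simp
    show "AE \<xi> in lborel. (\<lambda>k. bracket s \<xi> * (cmod (v \<xi> - u k \<xi>))\<^sup>2) \<longlonglongrightarrow> 0"
      using lim
    proof eventually_elim
      case (elim \<xi>)
      have "(\<lambda>k. bracket s \<xi> * (cmod (v \<xi> - u k \<xi>))\<^sup>2) \<longlonglongrightarrow> bracket s \<xi> * (cmod (v \<xi> - v \<xi>))\<^sup>2"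
        by (intro tendsto_intros elim)
      then show ?case by simp
    qed
    show "AE \<xi> in lborel. norm (bracket s \<xi> * (cmod (v \<xi> - u k \<xi>))\<^sup>2) \<le> bracket s \<xi> * (2 * B)\<^sup>2" for k
    proof (rule AE_I2)
      fix \<xi>
      have "cmod (v \<xi> - u k \<xi>) \<le> 2 * B"
        using norm_triangle_ineq4[of "v \<xi>" "u k \<xi>"] B(1)[of k \<xi>] B(2)[of \<xi>] by linarith
      then have "bracket s \<xi> * (cmod (v \<xi> - u k \<xi>))\<^sup>2 \<le> bracket s \<xi> * (2 * B)\<^sup>2"
        by (intro mult_left_mono power_mono) auto
      then show "norm (bracket s \<xi> * (cmod (v \<xi> - u k \<xi>))\<^sup>2) \<le> bracket s \<xi> * (2 * B)\<^sup>2"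
        by (simp add: abs_mult)
    qed
  qed measurable
  then show ?thesis by (simp add: sobolev_integral_def)
qed

text \<open>
  The closure of the step functions with values in a countable dense set contains in turn the
  bounded continuous functions, the bounded measurable functions, and the whole space.
\<close>

lemma weighted_L2_separable:
  fixes s :: real
  assumes s: "s < - real DIM('a::euclidean_space) / 2"
  obtains C :: "nat \<Rightarrow> 'a::euclidean_space \<Rightarrow> complex" where "\<And>n. C n \<in> weighted_L2 s"
    "\<And>v \<epsilon>. v \<in> weighted_L2 s \<Longrightarrow> 0 < \<epsilon> \<Longrightarrow> \<exists>n. sobolev_integral s (\<lambda>\<xi>. v \<xi> - C n \<xi>) < \<epsilon>"
proof -
  obtain p :: "nat \<Rightarrow> 'a" where p: "UNIV \<subseteq> closure (range p)"
    using dense_sequence[of UNIV] by auto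
  obtain e :: "nat \<Rightarrow> complex" where e: "UNIV \<subseteq> closure (range e)"
    using dense_sequence[of UNIV] by auto
  \<comment> \<open>the step function with value \<open>e (cs ! k)\<close> on the
    \<open>k\<close>-th cell of the \<open>n\<close>-th partition; there are only countably
    many\<close>
  define q where "q n cs x = (let k = nearest_index p n x in if k < length cs then e (cs ! k) else 0)"
    for n :: nat and cs :: "nat list" and x
  have q_meas[measurable]: "q n cs \<in> borel_measurable borel" for n cs
  proof -
    have "(\<lambda>k. if k < length cs then e (cs ! k) else 0) \<circ> nearest_index p n \<in> borel_measurable borel"
      by (rule measurable_comp[OF measurable_nearest_index]) simp
    then show ?thesis by (simp add: q_def[abs_def] Let_def comp_def)
  qed
  have q_W: "q n cs \<in> weighted_L2 s" for n cs
  proof (rule weighted_L2_bounded[OF s q_meas])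
    show "cmod (q n cs x) \<le> (\<Sum>j<length cs. cmod (e (cs ! j)))" for x
      unfolding q_def Let_def by (auto intro!: sum_nonneg member_le_sum)
  qed
  define C where "C m = (case from_nat m of (n, cs) \<Rightarrow> q n cs)" for m
  have C: "C (to_nat (n, cs)) = q n cs" for n cs by (simp add: C_def)
  define approx where "approx v \<longleftrightarrow> v \<in> weighted_L2 s \<and>
      (\<forall>\<epsilon>>0. \<exists>n. sobolev_integral s (\<lambda>\<xi>. v \<xi> - C n \<xi>) < \<epsilon>)" for v
  have C_W: "C m \<in> weighted_L2 s" for m
    by (simp add: C_def q_W split: prod.split)
  have closed: "approx v" if v: "v \<in> weighted_L2 s" and u: "\<And>k::nat. approx (u k)"
    and lim: "(\<lambda>k. sobolev_integral s (\<lambda>\<xi>. v \<xi> - u k \<xi>)) \<longlonglongrightarrow> 0" for u v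
    unfolding approx_def
  proof (intro conjI v allI impI)
    fix \<epsilon> :: real assume \<epsilon>: "0 < \<epsilon>"
    then have "\<forall>\<^sub>F k in sequentially. sobolev_integral s (\<lambda>\<xi>. v \<xi> - u k \<xi>) < \<epsilon> / 4"
      using lim by (intro order_tendstoD(2)) auto
    then obtain k where k: "sobolev_integral s (\<lambda>\<xi>. v \<xi> - u k \<xi>) < \<epsilon> / 4"
      by (auto simp: eventually_sequentially)
    have uW: "u k \<in> weighted_L2 s" using u by (simp add: approx_def)
    obtain n where n: "sobolev_integral s (\<lambda>\<xi>. u k \<xi> - C n \<xi>) < \<epsilon> / 4"
      using u[of k] \<epsilon> unfolding approx_def by (metis zero_less_divide_iff zero_less_numeral)
    have "sobolev_integral s (\<lambda>\<xi>. (v \<xi> - u k \<xi>) + (u k \<xi> - C n \<xi>)) \<le>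
        2 * sobolev_integral s (\<lambda>\<xi>. v \<xi> - u k \<xi>) + 2 * sobolev_integral s (\<lambda>\<xi>. u k \<xi> - C n \<xi>)"
      by (intro sobolev_integral_add_le weighted_L2_diff v uW C_W)
    also have "\<dots> < \<epsilon>" using k n by simp
    finally show "\<exists>n. sobolev_integral s (\<lambda>\<xi>. v \<xi> - C n \<xi>) < \<epsilon>" by auto
  qed
  have closed_bounded: "approx v"
    if u: "\<And>k::nat. approx (u k)" and v: "v \<in> borel_measurable borel"
      and B: "\<And>k \<xi>. cmod (u k \<xi>) \<le> B" "\<And>\<xi>. cmod (v \<xi>) \<le> B"
      and lim: "AE \<xi> in lborel. (\<lambda>k. u k \<xi>) \<longlonglongrightarrow> v \<xi>" for u v B
  proof (rule closed[OF weighted_L2_bounded[OF s v B(2)] u])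
    have "u k \<in> borel_measurable borel" for k using u[of k] by (simp add: approx_def weighted_L2_def)
    then show "(\<lambda>k. sobolev_integral s (\<lambda>\<xi>. v \<xi> - u k \<xi>)) \<longlonglongrightarrow> 0"
      using sobolev_integral_bounded_tendsto[OF s _ v B lim] by blast
  qed
  have step: "approx (q n cs)" for n cs
    unfolding approx_def
    by (auto simp: q_W sobolev_integral_def intro!: exI[of _ "to_nat (n, cs)"] simp: C)
  have cont: "approx g" if g: "continuous_on UNIV g" and B: "\<And>x. cmod (g x) \<le> B" for g B
  proof -
    define j where "j n k = nearest_index e n (g (p k))" for n k
    have j: "dist (g (p k)) (e (j n k)) < 1 / real (Suc n)" for n k
      unfolding j_def using e by (intro dist_nearest_index) auto
    define v where "v n x = e (j n (nearest_index p n x))" for n x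
    have j1: "cmod (e (j n k)) \<le> B + 1" for n k
    proof -
      have "1 / real (Suc n) \<le> 1" by simp
      then have "dist (g (p k)) (e (j n k)) \<le> 1" using j[of k n] by linarith
      then show ?thesis
        using B[of "p k"] norm_triangle_ineq3[of "g (p k)" "e (j n k)"] by (simp add: dist_norm)
    qed
    have B0: "0 \<le> B" using B norm_ge_zero order_trans by blast
    have "approx (v n)" for n
    proof (rule closed_bounded[where u = "\<lambda>m. q n (map (j n) [0..<m])" and B = "B + 1"])
      show "v n \<in> borel_measurable borel"
      proof -
        have "(\<lambda>k. e (j n k)) \<circ> nearest_index p n \<in> borel_measurable borel"
          by (rule measurable_comp[OF measurable_nearest_index]) simp
        then show ?thesis by (simp add: v_def[abs_def] comp_def)
      qed
      show "cmod (q n (map (j n) [0..<m]) x) \<le> B + 1" for m x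
        using j1 B0 by (simp add: q_def Let_def)
      show "cmod (v n x) \<le> B + 1" for x
        unfolding v_def by (rule j1)
      show "AE x in lborel. (\<lambda>m. q n (map (j n) [0..<m]) x) \<longlonglongrightarrow> v n x"
      proof (intro AE_I2 tendsto_eventually)
        fix x
        have "q n (map (j n) [0..<m]) x = v n x" if "nearest_index p n x < m" for m
          using that by (simp add: q_def v_def Let_def)
        then show "\<forall>\<^sub>F m in sequentially. q n (map (j n) [0..<m]) x = v n x"
          using eventually_gt_at_top[of "nearest_index p n x"] by (rule eventually_mono[rotated])
      qed
    qed (rule step)
    then show ?thesis
    proof (rule closed_bounded[where u = v and B = "B + 1"])
      show "g \<in> borel_measurable borel" using g by (rule borel_measurable_continuous_onI)
      show "cmod (v n x) \<le> B + 1" for n x unfolding v_def by (rule j1)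
      show "cmod (g x) \<le> B + 1" for x using B[of x] by simp
      show "AE x in lborel. (\<lambda>n. v n x) \<longlonglongrightarrow> g x"
      proof (rule AE_I2)
        fix x
        have "isCont g x" using g by (simp add: continuous_on_eq_continuous_at)
        moreover have "(\<lambda>n. p (nearest_index p n x)) \<longlonglongrightarrow> x"
          using p by (intro tendsto_nearest_index) auto
        ultimately have 1: "(\<lambda>n. g (p (nearest_index p n x))) \<longlonglongrightarrow> g x"
          by (rule isCont_tendsto_compose)
        have 2: "(\<lambda>n. dist (v n x) (g (p (nearest_index p n x)))) \<longlonglongrightarrow> 0"
        proof (rule Lim_null_comparison)
          show "\<forall>\<^sub>F n in sequentially. norm (dist (v n x) (g (p (nearest_index p n x)))) \<le> inverse (real (Suc n))"
            using j by (intro always_eventually allI) (simp add: v_def dist_commute inverse_eq_divide less_imp_le)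
          show "(\<lambda>n. inverse (real (Suc n))) \<longlonglongrightarrow> 0" by (rule LIMSEQ_inverse_real_of_nat)
        qed
        show "(\<lambda>n. v n x) \<longlonglongrightarrow> g x"
          using tendsto_add[OF 1 tendsto_norm_zero_cancel[OF 2[unfolded dist_norm]]] by simp
      qed
    qed
  qed
  have bdd: "approx f" if f: "f \<in> borel_measurable borel" and B: "\<And>x. cmod (f x) \<le> B" for f B
  proof -
    obtain h where h: "\<And>n. continuous_on UNIV (h n)" "\<And>n x. cmod (h n x) \<le> B"
      "AE x in lborel. (\<lambda>n. h n x) \<longlonglongrightarrow> f x"
      using bounded_borel_approx_continuous[OF f B] by blast
    show ?thesis
      by (rule closed_bounded[of h, OF cont[OF h(1) h(2)] f h(2) B h(3)])
  qed
  have all: "approx v" if v: "v \<in> weighted_L2 s" for v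
  proof -
    have [measurable]: "v \<in> borel_measurable borel" using v by (simp add: weighted_L2_def)
    define u where "u k x = (if cmod (v x) \<le> real k then v x else 0)" for k :: nat and x
    have [measurable]: "u k \<in> borel_measurable borel" for k unfolding u_def[abs_def] by measurable
    show ?thesis
    proof (rule closed[OF v, where u = u])
      show "approx (u k)" for k by (rule bdd[where B = "real k"]) (auto simp: u_def)
      have "(\<lambda>k. LINT x|lborel. bracket s x * (cmod (v x - u k x))\<^sup>2) \<longlonglongrightarrow> (LINT (x::'a)|lborel. (0::real))"
      proof (rule integral_dominated_convergence)
        show "integrable lborel (\<lambda>x. bracket s x * (cmod (v x))\<^sup>2)" using v by (simp add: weighted_L2_def)
        show "AE x in lborel. (\<lambda>k. bracket s x * (cmod (v x - u k x))\<^sup>2) \<longlonglongrightarrow> 0"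
        proof (intro AE_I2 tendsto_eventually)
          fix x
          obtain K :: nat where "cmod (v x) \<le> real K" using real_arch_simple by blast
          then show "\<forall>\<^sub>F k in sequentially. bracket s x * (cmod (v x - u k x))\<^sup>2 = 0"
            by (intro eventually_sequentiallyI[of K]) (auto simp: u_def)
        qed
        show "AE x in lborel. norm (bracket s x * (cmod (v x - u k x))\<^sup>2) \<le> bracket s x * (cmod (v x))\<^sup>2" for k
          by (rule AE_I2) (auto simp: u_def abs_mult)
      qed measurable
      then show "(\<lambda>k. sobolev_integral s (\<lambda>\<xi>. v \<xi> - u k \<xi>)) \<longlonglongrightarrow> 0" by (simp add: sobolev_integral_def)
    qed
  qed
  show ?thesis
    by (rule that[of C]) (use C_W all in \<open>auto simp: approx_def\<close>)
qed

lemma sobolev_dense_sequence: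
  fixes s :: real
  assumes s: "s < - real DIM('a::euclidean_space) / 2"
  obtains D :: "nat \<Rightarrow> 'a::euclidean_space distribution" where "\<And>n. D n \<in> sobolev s"
    "\<And>T \<epsilon>. T \<in> sobolev s \<Longrightarrow> 0 < \<epsilon> \<Longrightarrow> \<exists>n. sobolev_dist s T (D n) < \<epsilon>"
proof -
  obtain C :: "nat \<Rightarrow> 'a \<Rightarrow> complex" where C: "\<And>n. C n \<in> weighted_L2 s"
    "\<And>v \<epsilon>. v \<in> weighted_L2 s \<Longrightarrow> 0 < \<epsilon> \<Longrightarrow> \<exists>n. sobolev_integral s (\<lambda>\<xi>. v \<xi> - C n \<xi>) < \<epsilon>"
    using weighted_L2_separable[OF s] by blast
  show ?thesis
  proof (rule that[of "\<lambda>n. synthesis (C n)"])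
    show "synthesis (C n) \<in> sobolev s" for n using C(1) by (auto simp: sobolev_eq_synthesis)
    fix T :: "'a distribution" and \<epsilon> :: real assume "T \<in> sobolev s" and \<epsilon>: "0 < \<epsilon>"
    then obtain v where v: "v \<in> weighted_L2 s" "T = synthesis v" by (auto simp: sobolev_eq_synthesis)
    obtain n where n: "sobolev_integral s (\<lambda>\<xi>. v \<xi> - C n \<xi>) < \<epsilon>\<^sup>2"
      using C(2)[OF v(1), of "\<epsilon>\<^sup>2"] \<epsilon> by auto
    have "sobolev_dist s T (synthesis (C n)) < \<epsilon>"
      unfolding v(2) sobolev_dist_synthesis[OF weighted_L2_imp_temperate[OF v(1)] weighted_L2_imp_temperate[OF C(1)]]
      using n \<epsilon> by (intro real_less_lsqrt) (auto simp: sobolev_integral_nonneg)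
    then show "\<exists>n. sobolev_dist s T (synthesis (C n)) < \<epsilon>" ..
  qed
qed

lemma space_sobolev_borel: "space (sobolev_borel s) = sobolev s"
  unfolding sobolev_borel_def
  by (rule space_measure_of) (use Metric_space.topspace_mtopology[OF Metric_space_sobolev, of s] in \<open>auto dest: openin_subset\<close>)

lemma sets_sobolev_borel_openin:
  "openin (Metric_space.mtopology (sobolev s) (sobolev_dist s)) B \<Longrightarrow> B \<in> sets (sobolev_borel s)"
  unfolding sobolev_borel_def
  by (subst sets_measure_of)
    (use Metric_space.topspace_mtopology[OF Metric_space_sobolev, of s] in \<open>auto dest: openin_subset\<close>)

lemma sobolev_ball_preimage:
  assumes M: "M \<in> P \<rightarrow>\<^sub>M sobolev_borel s" and D: "D \<in> sobolev s"
  shows "{\<omega> \<in> space P. sobolev_dist s (M \<omega>) D < r} \<in> sets P"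
proof -
  interpret Metric_space "sobolev s" "sobolev_dist s" by (rule Metric_space_sobolev)
  have "M -` mball D r \<inter> space P \<in> sets P"
    by (rule measurable_sets[OF M]) (intro sets_sobolev_borel_openin openin_mball)
  also have "M -` mball D r \<inter> space P = {\<omega> \<in> space P. sobolev_dist s (M \<omega>) D < r}"
    using measurable_space[OF M] D by (auto simp: space_sobolev_borel commute)
  finally show ?thesis .
qed

text \<open>
  By separability an open set is a countable union of balls around members of a dense
  sequence, so the distances to fixed elements decide measurability.
\<close>

lemma measurable_sobolev_borelI:
  fixes M :: "'o \<Rightarrow> 'a::euclidean_space distribution"
  assumes s: "s < - real DIM('a) / 2"
    and M: "\<And>\<omega>. \<omega> \<in> space P \<Longrightarrow> M \<omega> \<in> sobolev s"
    and dist_meas: "\<And>D. D \<in> sobolev s \<Longrightarrow> (\<lambda>\<omega>. sobolev_dist s (M \<omega>) D) \<in> borel_measurable P"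
  shows "M \<in> P \<rightarrow>\<^sub>M sobolev_borel s"
  unfolding sobolev_borel_def
proof (rule measurable_measure_of)
  interpret Metric_space "sobolev s" "sobolev_dist s :: 'a distribution \<Rightarrow> _" by (rule Metric_space_sobolev)
  show "{B. openin mtopology B} \<subseteq> Pow (sobolev s)" using openin_subset by fastforce
  show "M \<in> space P \<rightarrow> sobolev s" using M by auto
  fix B assume "B \<in> {B. openin mtopology B}"
  then have B: "B \<subseteq> sobolev s" "\<And>x. x \<in> B \<Longrightarrow> \<exists>r>0. mball x r \<subseteq> B"
    by (auto simp: openin_mtopology)
  obtain D :: "nat \<Rightarrow> 'a distribution" where D: "\<And>n. D n \<in> sobolev s"
    "\<And>T \<epsilon>. T \<in> sobolev s \<Longrightarrow> 0 < \<epsilon> \<Longrightarrow> \<exists>n. sobolev_dist s T (D n) < \<epsilon>"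
    using sobolev_dense_sequence[OF s] by blast
  define I where "I = {(n, k). mball (D n) (1 / real (Suc k)) \<subseteq> B}"
  have "M -` B \<inter> space P = (\<Union>(n, k)\<in>I. {\<omega> \<in> space P. sobolev_dist s (M \<omega>) (D n) < 1 / real (Suc k)})"
  proof (intro equalityI subsetI)
    fix \<omega> assume "\<omega> \<in> M -` B \<inter> space P"
    then have \<omega>: "M \<omega> \<in> B" "\<omega> \<in> space P" by auto
    then obtain r where r: "r > 0" "mball (M \<omega>) r \<subseteq> B" using B by blast
    obtain k where k: "1 / real (Suc k) < r / 2" using r(1) nat_approx_posE[of "r / 2"] by auto
    obtain n where n: "sobolev_dist s (M \<omega>) (D n) < 1 / real (Suc k)"
      using D(2)[OF M[OF \<omega>(2)], of "1 / real (Suc k)"] by auto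
    have "mball (D n) (1 / real (Suc k)) \<subseteq> mball (M \<omega>) r"
    proof (rule mball_subset)
      show "sobolev_dist s (D n) (M \<omega>) + 1 / real (Suc k) \<le> r" using n k commute[of "D n"] by simp
      show "M \<omega> \<in> sobolev s" using M \<omega> by simp
    qed
    then have "(n, k) \<in> I" using r by (auto simp: I_def)
    then show "\<omega> \<in> (\<Union>(n, k)\<in>I. {\<omega> \<in> space P. sobolev_dist s (M \<omega>) (D n) < 1 / real (Suc k)})"
      using n \<omega> by blast
  next
    fix \<omega> assume "\<omega> \<in> (\<Union>(n, k)\<in>I. {\<omega> \<in> space P. sobolev_dist s (M \<omega>) (D n) < 1 / real (Suc k)})"
    then obtain n k where nk: "(n, k) \<in> I" "\<omega> \<in> space P" "sobolev_dist s (M \<omega>) (D n) < 1 / real (Suc k)" by auto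
    have "M \<omega> \<in> mball (D n) (1 / real (Suc k))"
      using nk D(1)[of n] M commute[of "D n"] by simp
    then show "\<omega> \<in> M -` B \<inter> space P" using nk by (auto simp: I_def)
  qed
  also have "\<dots> \<in> sets P"
  proof (rule sets.countable_UN'')
    show "countable I" by simp
    show "(case i of (n, k) \<Rightarrow> {\<omega> \<in> space P. sobolev_dist s (M \<omega>) (D n) < 1 / real (Suc k)}) \<in> sets P" for i
    proof -
      obtain n k where i: "i = (n, k)" by (cases i)
      have [measurable]: "(\<lambda>\<omega>. sobolev_dist s (M \<omega>) (D n)) \<in> borel_measurable P" using dist_meas D by blast
      show ?thesis unfolding i by simp
    qed
  qed
  finally show "M -` B \<inter> space P \<in> sets P" .
qed

text \<open>
  By the triangle inequality the distance is below \<open>a\<close> if and only if some member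
  \<open>D n\<close> of a dense sequence and some rational \<open>q\<close> have distance
  below \<open>q\<close> from \<open>D n\<close> to the first and distance below \<open>a -
  q\<close> from \<open>D n\<close> to the second element.
\<close>

lemma measurable_sobolev_dist:
  fixes M :: "'o \<Rightarrow> 'a::euclidean_space distribution"
  assumes s: "s < - real DIM('a) / 2"
    and M: "M \<in> P \<rightarrow>\<^sub>M sobolev_borel s" and L: "L \<in> P \<rightarrow>\<^sub>M sobolev_borel s"
  shows "(\<lambda>\<omega>. sobolev_dist s (M \<omega>) (L \<omega>)) \<in> borel_measurable P"
  unfolding borel_measurable_iff_less
proof (intro allI)
  interpret Metric_space "sobolev s" "sobolev_dist s :: 'a distribution \<Rightarrow> _" by (rule Metric_space_sobolev)
  fix a :: real
  obtain D :: "nat \<Rightarrow> 'a distribution" where D: "\<And>n. D n \<in> sobolev s"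
    "\<And>T \<epsilon>. T \<in> sobolev s \<Longrightarrow> 0 < \<epsilon> \<Longrightarrow> \<exists>n. sobolev_dist s T (D n) < \<epsilon>"
    using sobolev_dense_sequence[OF s] by blast
  define S where "S n r = {\<omega> \<in> space P. sobolev_dist s (M \<omega>) (D n) < r} \<inter> {\<omega> \<in> space P. sobolev_dist s (L \<omega>) (D n) < a - r}" for n r
  have "{\<omega> \<in> space P. sobolev_dist s (M \<omega>) (L \<omega>) < a} = (\<Union>n. \<Union>q::rat. S n (of_rat q))"
  proof (intro equalityI subsetI)
    fix \<omega> assume "\<omega> \<in> {\<omega> \<in> space P. sobolev_dist s (M \<omega>) (L \<omega>) < a}"
    then have \<omega>: "\<omega> \<in> space P" "sobolev_dist s (M \<omega>) (L \<omega>) < a" by auto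
    have mem: "M \<omega> \<in> sobolev s" "L \<omega> \<in> sobolev s"
      using measurable_space[OF M \<omega>(1)] measurable_space[OF L \<omega>(1)] by (auto simp: space_sobolev_borel)
    define \<epsilon> where "\<epsilon> = (a - sobolev_dist s (M \<omega>) (L \<omega>)) / 3"
    have \<epsilon>: "0 < \<epsilon>" using \<omega> by (simp add: \<epsilon>_def)
    obtain n where n: "sobolev_dist s (M \<omega>) (D n) < \<epsilon>" using D(2)[OF mem(1) \<epsilon>] by blast
    obtain q where q: "\<epsilon> < of_rat q" "of_rat q < 2 * \<epsilon>"
      using of_rat_dense[of \<epsilon> "2 * \<epsilon>"] \<epsilon> by auto
    have "sobolev_dist s (L \<omega>) (D n) \<le> sobolev_dist s (M \<omega>) (L \<omega>) + sobolev_dist s (M \<omega>) (D n)"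
      using triangle[of "L \<omega>" "M \<omega>" "D n"] commute[of "L \<omega>" "M \<omega>"] mem D(1) by simp
    also have "\<dots> < a - 2 * \<epsilon>" using n by (simp add: \<epsilon>_def field_simps)
    finally have "\<omega> \<in> S n (of_rat q)" using n q \<omega> by (auto simp: S_def)
    then show "\<omega> \<in> (\<Union>n. \<Union>q::rat. S n (of_rat q))" by blast
  next
    fix \<omega> assume "\<omega> \<in> (\<Union>n. \<Union>q::rat. S n (of_rat q))"
    then obtain n q where nq: "\<omega> \<in> S n (of_rat q)" by blast
    then have \<omega>: "\<omega> \<in> space P" by (simp add: S_def)
    have mem: "M \<omega> \<in> sobolev s" "L \<omega> \<in> sobolev s"
      using measurable_space[OF M \<omega>] measurable_space[OF L \<omega>] by (auto simp: space_sobolev_borel)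
    have "sobolev_dist s (M \<omega>) (L \<omega>) \<le> sobolev_dist s (M \<omega>) (D n) + sobolev_dist s (L \<omega>) (D n)"
      using triangle'[of "M \<omega>" "L \<omega>" "D n"] mem D(1) commute[of "L \<omega>"] triangle[of "M \<omega>" "D n" "L \<omega>"] by simp
    then show "\<omega> \<in> {\<omega> \<in> space P. sobolev_dist s (M \<omega>) (L \<omega>) < a}"
      using nq by (auto simp: S_def)
  qed
  also have "\<dots> \<in> sets P"
  proof -
    have "S n r \<in> sets P" for n r
      unfolding S_def using D(1) by (intro sets.Int sobolev_ball_preimage M L) auto
    then show ?thesis by (intro sets.countable_UN'') auto
  qed
  finally show "{\<omega> \<in> space P. sobolev_dist s (M \<omega>) (L \<omega>) < a} \<in> sets P" .
qed

lemma measurable_sobolev_integral: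
  assumes [measurable]: "(\<lambda>(\<omega>, \<xi>). v \<omega> \<xi>) \<in> borel_measurable (P \<Otimes>\<^sub>M lborel)"
  shows "(\<lambda>\<omega>. sobolev_integral s (v \<omega>)) \<in> borel_measurable P"
  unfolding sobolev_integral_def by measurable

text \<open>A random transform that is jointly measurable gives a random element of the Sobolev space.\<close>

lemma measurable_synthesis:
  fixes v :: "'o \<Rightarrow> 'a::euclidean_space \<Rightarrow> complex"
  assumes s: "s < - real DIM('a) / 2"
    and v[measurable]: "(\<lambda>(\<omega>, \<xi>). v \<omega> \<xi>) \<in> borel_measurable (P \<Otimes>\<^sub>M lborel)"
    and W: "\<And>\<omega>. \<omega> \<in> space P \<Longrightarrow> v \<omega> \<in> weighted_L2 s"
  shows "(\<lambda>\<omega>. synthesis (v \<omega>)) \<in> P \<rightarrow>\<^sub>M sobolev_borel s"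
proof (rule measurable_sobolev_borelI[OF s])
  show "synthesis (v \<omega>) \<in> sobolev s" if "\<omega> \<in> space P" for \<omega>
    using W[OF that] by (auto simp: sobolev_eq_synthesis)
  fix D :: "'a distribution" assume "D \<in> sobolev s"
  then obtain u where u: "u \<in> weighted_L2 s" "D = synthesis u" by (auto simp: sobolev_eq_synthesis)
  have [measurable]: "u \<in> borel_measurable borel" using u by (simp add: weighted_L2_def)
  have [measurable]: "(\<lambda>\<omega>. sobolev_integral s (\<lambda>\<xi>. v \<omega> \<xi> - u \<xi>)) \<in> borel_measurable P"
    by (rule measurable_sobolev_integral) measurable
  have "(\<lambda>\<omega>. sqrt (sobolev_integral s (\<lambda>\<xi>. v \<omega> \<xi> - u \<xi>))) \<in> borel_measurable P"
    by measurable
  moreover have "sobolev_dist s (synthesis (v \<omega>)) D = sqrt (sobolev_integral s (\<lambda>\<xi>. v \<omega> \<xi> - u \<xi>))"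
    if "\<omega> \<in> space P" for \<omega>
    using u W[OF that] by (simp add: sobolev_dist_synthesis weighted_L2_imp_temperate)
  ultimately show "(\<lambda>\<omega>. sobolev_dist s (synthesis (v \<omega>)) D) \<in> borel_measurable P"
    by (simp cong: measurable_cong)
qed

section \<open>Second moments of the imaginary chaos\<close>

lemma centered_gaussian_measurable: "centered_gaussian P Y \<Longrightarrow> Y \<in> borel_measurable P"
  by (auto simp: centered_gaussian_def dest: distributed_measurable)

lemma centered_gaussian_square_integrable:
  assumes P: "prob_space P" and Y: "centered_gaussian P Y"
  shows "integrable P (\<lambda>\<omega>. (Y \<omega>)\<^sup>2)"
proof (cases "\<exists>\<sigma>>0. distributed P lborel Y (normal_density 0 \<sigma>)")
  case True
  then obtain \<sigma> where \<sigma>: "\<sigma> > 0" and D: "distributed P lborel Y (normal_density 0 \<sigma>)" by blast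
  have "integrable lborel (\<lambda>x. normal_density 0 \<sigma> x * x\<^sup>2)"
    using normal_moment_even[OF \<sigma>, of 0 1] by (auto simp: has_bochner_integral_iff)
  then show ?thesis
    using distributed_integrable[OF D, of "\<lambda>x. x\<^sup>2"] by simp
next
  case False
  then have Y0: "AE \<omega> in P. Y \<omega> = 0" using Y by (auto simp: centered_gaussian_def)
  have [measurable]: "Y \<in> borel_measurable P" using Y by (rule centered_gaussian_measurable)
  have "AE \<omega> in P. (Y \<omega>)\<^sup>2 = 0" using Y0 by eventually_elim simp
  then show ?thesis by (subst integrable_cong_AE[where g = "\<lambda>_. 0"]) auto
qed

text \<open>
  The characteristic function at \<open>1\<close>; the degenerate case is the formula with
  variance \<open>0\<close>.
\<close>

lemma centered_gaussian_cis:
  assumes P: "prob_space P" and Y: "centered_gaussian P Y"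
  shows "(LINT \<omega>|P. cis (Y \<omega>)) = of_real (exp (- (LINT \<omega>|P. (Y \<omega>)\<^sup>2) / 2))"
proof (cases "\<exists>\<sigma>>0. distributed P lborel Y (normal_density 0 \<sigma>)")
  case True
  interpret prob_space P by fact
  obtain \<sigma> where \<sigma>: "\<sigma> > 0" and D: "distributed P lborel Y (normal_density 0 \<sigma>)" using True by blast
  have var: "(LINT \<omega>|P. (Y \<omega>)\<^sup>2) = \<sigma>\<^sup>2"
  proof -
    have "(LINT \<omega>|P. (Y \<omega>)\<^sup>2) = (LINT x|lborel. normal_density 0 \<sigma> x * x\<^sup>2)"
      by (rule distributed_integral[OF D, symmetric]) auto
    also have "\<dots> = \<sigma>\<^sup>2"
      using normal_moment_even[OF \<sigma>, of 0 1] by (simp add: has_bochner_integral_iff)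
    finally show ?thesis .
  qed
  have "distributed P lborel (\<lambda>\<omega>. (Y \<omega> - 0) / \<sigma>) std_normal_density"
    using D normal_standard_normal_convert[OF \<sigma>, of Y 0] by blast
  then have Z: "distr P lborel (\<lambda>\<omega>. Y \<omega> / \<sigma>) = density lborel std_normal_density"
    and [measurable]: "(\<lambda>\<omega>. Y \<omega> / \<sigma>) \<in> borel_measurable P"
    by (auto simp: distributed_distr_eq_density dest: distributed_measurable)
  have "(LINT \<omega>|P. cis (Y \<omega>)) = (LINT \<omega>|P. iexp (\<sigma> * (Y \<omega> / \<sigma>)))"
    using \<sigma> by (simp add: cis_conv_exp)
  also have "\<dots> = (LINT x|distr P lborel (\<lambda>\<omega>. Y \<omega> / \<sigma>). iexp (\<sigma> * x))"
    by (subst integral_distr) auto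
  also have "\<dots> = char std_normal_distribution \<sigma>"
    by (simp add: char_def Z)
  finally show ?thesis
    by (simp add: char_std_normal_distribution var)
next
  case False
  interpret prob_space P by fact
  have Y0: "AE \<omega> in P. Y \<omega> = 0" using Y False by (auto simp: centered_gaussian_def)
  have [measurable]: "Y \<in> borel_measurable P" using Y by (rule centered_gaussian_measurable)
  have "(LINT \<omega>|P. (Y \<omega>)\<^sup>2) = (LINT \<omega>|P. 0)"
    using Y0 by (intro integral_cong_AE) auto
  moreover have "(LINT \<omega>|P. cis (Y \<omega>)) = (LINT \<omega>|P. 1)"
    using Y0 by (intro integral_cong_AE) auto
  ultimately show ?thesis by (simp add: prob_space)
qed

text \<open>
  Second moments of the chaoses involve one point of each field at a time, so joint
  Gaussianity of these pairs is enough.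
\<close>

definition gaussian_pair ::
    "'o measure \<Rightarrow> 'a set \<Rightarrow> ('a \<Rightarrow> 'o \<Rightarrow> real) \<Rightarrow> ('a \<Rightarrow> 'o \<Rightarrow> real) \<Rightarrow> bool" where
  "gaussian_pair P U X Y \<longleftrightarrow>
     (\<forall>x\<in>U. \<forall>y\<in>U. \<forall>a b. centered_gaussian P (\<lambda>\<omega>. a * X x \<omega> + b * Y y \<omega>))"

definition continuous_gaussian_field ::
    "'o measure \<Rightarrow> 'a::euclidean_space set \<Rightarrow> ('a \<Rightarrow> 'o \<Rightarrow> real) \<Rightarrow> bool" where
  "continuous_gaussian_field P U X \<longleftrightarrow> prob_space P \<and> open U \<and> U \<noteq> {} \<and>
     (\<forall>\<omega>\<in>space P. continuous_on U (\<lambda>x. X x \<omega>)) \<and> gaussian_pair P U X X"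

lemma gaussian_pair_sym: "gaussian_pair P U X Y \<Longrightarrow> gaussian_pair P U Y X"
  unfolding gaussian_pair_def by (subst add.commute) blast

lemma covar_sym: "covar P Y Z = covar P Z Y"
  by (simp add: covar_def mult.commute)

lemma continuous_gaussian_field_centered:
  "continuous_gaussian_field P U X \<Longrightarrow> x \<in> U \<Longrightarrow> centered_gaussian P (\<lambda>\<omega>. a * X x \<omega>)"
  unfolding continuous_gaussian_field_def gaussian_pair_def
  by (elim conjE ballE[of _ _ x] allE[of _ a] allE[of _ 0]) auto

lemma continuous_gaussian_field_measurable:
  "continuous_gaussian_field P U X \<Longrightarrow> x \<in> U \<Longrightarrow> X x \<in> borel_measurable P"
  using centered_gaussian_measurable[OF continuous_gaussian_field_centered[of P U X x 1]] by simp

lemma continuous_gaussian_field_square_integrable: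
  "continuous_gaussian_field P U X \<Longrightarrow> x \<in> U \<Longrightarrow> integrable P (\<lambda>\<omega>. (X x \<omega>)\<^sup>2)"
  using centered_gaussian_square_integrable[OF _ continuous_gaussian_field_centered[of P U X x 1]]
  by (simp add: continuous_gaussian_field_def)

definition chaos_kernel ::
    "'o measure \<Rightarrow> real \<Rightarrow> ('a \<Rightarrow> 'o \<Rightarrow> real) \<Rightarrow> ('a \<Rightarrow> 'o \<Rightarrow> real) \<Rightarrow> 'a \<times> 'a \<Rightarrow> real" where
  "chaos_kernel P \<beta> X Y z = exp (\<beta>\<^sup>2 * covar P (X (fst z)) (Y (snd z)))"

text \<open>The modulus of the chaos is deterministic.\<close>

definition chaos_modulus :: "'o measure \<Rightarrow> real \<Rightarrow> ('a \<Rightarrow> 'o \<Rightarrow> real) \<Rightarrow> 'a \<Rightarrow> real" where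
  "chaos_modulus P \<beta> X x = exp (\<beta>\<^sup>2 / 2 * covar P (X x) (X x))"

lemma imaginary_chaos_eq: "imaginary_chaos P \<beta> X \<omega> x = of_real (chaos_modulus P \<beta> X x) * cis (\<beta> * X x \<omega>)"
  by (simp add: imaginary_chaos_def chaos_modulus_def exp_add cis_conv_exp exp_of_real mult.commute
      flip: of_real_mult of_real_power of_real_divide)

lemma norm_imaginary_chaos: "cmod (imaginary_chaos P \<beta> X \<omega> x) = chaos_modulus P \<beta> X x"
  by (simp add: imaginary_chaos_eq norm_mult chaos_modulus_def)

text \<open>
  The product is a deterministic factor times \<open>cis Z\<close> for the centered Gaussian
  variable \<open>Z = \<beta> (X x - Y y)\<close>. In the variance of \<open>Z\<close> the two
  diagonal terms cancel against this factor, and the covariance remains.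
\<close>

lemma chaos_moment:
  assumes X: "continuous_gaussian_field P U X" and Y: "continuous_gaussian_field P U Y"
    and XY: "gaussian_pair P U X Y" and x: "x \<in> U" and y: "y \<in> U"
  shows "integrable P (\<lambda>\<omega>. imaginary_chaos P \<beta> X \<omega> x * cnj (imaginary_chaos P \<beta> Y \<omega> y))"
    and "(LINT \<omega>|P. imaginary_chaos P \<beta> X \<omega> x * cnj (imaginary_chaos P \<beta> Y \<omega> y)) =
      of_real (chaos_kernel P \<beta> X Y (x, y))"
proof -
  interpret prob_space P using X by (simp add: continuous_gaussian_field_def)
  have [measurable]: "X x \<in> borel_measurable P" "Y y \<in> borel_measurable P"
    using continuous_gaussian_field_measurable X Y x y by blast+
  note sq = continuous_gaussian_field_square_integrable[OF X x] continuous_gaussian_field_square_integrable[OF Y y]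
  define Z where "Z \<omega> = \<beta> * X x \<omega> + (- \<beta>) * Y y \<omega>" for \<omega>
  have Z: "centered_gaussian P Z"
    using XY x y unfolding gaussian_pair_def Z_def[abs_def] by blast
  define c where "c = chaos_modulus P \<beta> X x * chaos_modulus P \<beta> Y y"
  have eq: "imaginary_chaos P \<beta> X \<omega> x * cnj (imaginary_chaos P \<beta> Y \<omega> y) = of_real c * cis (Z \<omega>)" for \<omega>
  proof -
    have "cis (\<beta> * X x \<omega>) * cnj (cis (\<beta> * Y y \<omega>)) = cis (Z \<omega>)"
      by (simp add: cis_cnj cis_mult Z_def)
    then show ?thesis
      by (simp add: imaginary_chaos_eq c_def mult_ac)
  qed
  have iXY: "integrable P (\<lambda>\<omega>. X x \<omega> * Y y \<omega>)"
  proof (rule Bochner_Integration.integrable_bound[OF Bochner_Integration.integrable_add[OF sq]])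
    show "AE \<omega> in P. norm (X x \<omega> * Y y \<omega>) \<le> norm ((X x \<omega>)\<^sup>2 + (Y y \<omega>)\<^sup>2)"
    proof (rule AE_I2)
      fix \<omega>
      have "2 * (\<bar>X x \<omega>\<bar> * \<bar>Y y \<omega>\<bar>) \<le> (X x \<omega>)\<^sup>2 + (Y y \<omega>)\<^sup>2"
        using sum_squares_bound[of "\<bar>X x \<omega>\<bar>" "\<bar>Y y \<omega>\<bar>"] by simp
      moreover have "0 \<le> \<bar>X x \<omega>\<bar> * \<bar>Y y \<omega>\<bar>" by simp
      ultimately have "\<bar>X x \<omega>\<bar> * \<bar>Y y \<omega>\<bar> \<le> (X x \<omega>)\<^sup>2 + (Y y \<omega>)\<^sup>2" by linarith
      then show "norm (X x \<omega> * Y y \<omega>) \<le> norm ((X x \<omega>)\<^sup>2 + (Y y \<omega>)\<^sup>2)"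
        by (simp add: abs_mult)
    qed
  qed measurable
  have "(LINT \<omega>|P. (Z \<omega>)\<^sup>2) = (LINT \<omega>|P. \<beta>\<^sup>2 * (X x \<omega>)\<^sup>2 + \<beta>\<^sup>2 * (Y y \<omega>)\<^sup>2 - 2 * \<beta>\<^sup>2 * (X x \<omega> * Y y \<omega>))"
    by (intro Bochner_Integration.integral_cong) (auto simp: Z_def power2_eq_square algebra_simps)
  also have "\<dots> = \<beta>\<^sup>2 * covar P (X x) (X x) + \<beta>\<^sup>2 * covar P (Y y) (Y y) - 2 * \<beta>\<^sup>2 * covar P (X x) (Y y)"
    using sq iXY by (simp add: covar_def power2_eq_square)
  finally have EZ: "(LINT \<omega>|P. (Z \<omega>)\<^sup>2) = \<beta>\<^sup>2 * covar P (X x) (X x) + \<beta>\<^sup>2 * covar P (Y y) (Y y) - 2 * \<beta>\<^sup>2 * covar P (X x) (Y y)" .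
  have [measurable]: "Z \<in> borel_measurable P" unfolding Z_def[abs_def] by measurable
  have icis: "integrable P (\<lambda>\<omega>. cis (Z \<omega>))"
    by (rule integrable_const_bound[where B = 1]) auto
  then show "integrable P (\<lambda>\<omega>. imaginary_chaos P \<beta> X \<omega> x * cnj (imaginary_chaos P \<beta> Y \<omega> y))"
    unfolding eq by (rule integrable_mult_right)
  have "(LINT \<omega>|P. imaginary_chaos P \<beta> X \<omega> x * cnj (imaginary_chaos P \<beta> Y \<omega> y)) =
      of_real (c * exp (- (LINT \<omega>|P. (Z \<omega>)\<^sup>2) / 2))"
    unfolding eq by (simp add: centered_gaussian_cis[OF prob_space_axioms Z])
  also have "c * exp (- (LINT \<omega>|P. (Z \<omega>)\<^sup>2) / 2) = chaos_kernel P \<beta> X Y (x, y)"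
    unfolding EZ by (simp add: c_def chaos_modulus_def chaos_kernel_def field_simps flip: exp_add)
  finally show "(LINT \<omega>|P. imaginary_chaos P \<beta> X \<omega> x * cnj (imaginary_chaos P \<beta> Y \<omega> y)) =
      of_real (chaos_kernel P \<beta> X Y (x, y))" .
qed

lemma chaos_mean:
  assumes X: "continuous_gaussian_field P U X" and x: "x \<in> U"
  shows "integrable P (\<lambda>\<omega>. imaginary_chaos P \<beta> X \<omega> x)" "(LINT \<omega>|P. imaginary_chaos P \<beta> X \<omega> x) = 1"
proof -
  interpret prob_space P using X by (simp add: continuous_gaussian_field_def)
  have [measurable]: "X x \<in> borel_measurable P"
    using continuous_gaussian_field_measurable X x by blast
  have "integrable P (\<lambda>\<omega>. cis (\<beta> * X x \<omega>))"
    by (rule integrable_const_bound[where B = 1]) auto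
  then show "integrable P (\<lambda>\<omega>. imaginary_chaos P \<beta> X \<omega> x)"
    unfolding imaginary_chaos_eq by (rule integrable_mult_right)
  have "(LINT \<omega>|P. (\<beta> * X x \<omega>)\<^sup>2) = \<beta>\<^sup>2 * covar P (X x) (X x)"
    by (simp add: covar_def power_mult_distrib flip: power2_eq_square)
  then have "(LINT \<omega>|P. cis (\<beta> * X x \<omega>)) = of_real (exp (- (\<beta>\<^sup>2 * covar P (X x) (X x)) / 2))"
    using centered_gaussian_cis[OF prob_space_axioms continuous_gaussian_field_centered[OF X x]] by simp
  then have "(LINT \<omega>|P. imaginary_chaos P \<beta> X \<omega> x) =
      of_real (chaos_modulus P \<beta> X x * exp (- (\<beta>\<^sup>2 * covar P (X x) (X x)) / 2))"
    unfolding imaginary_chaos_eq by simp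
  then show "(LINT \<omega>|P. imaginary_chaos P \<beta> X \<omega> x) = 1"
    by (simp add: chaos_modulus_def flip: exp_add)
qed

text \<open>
  A field that is continuous in space and measurable in the random parameter is jointly measurable,
  being the limit of its values at nearby points of a dense sequence.
\<close>

lemma continuous_field_jointly_measurable:
  fixes X :: "'a::euclidean_space \<Rightarrow> 'o \<Rightarrow> real"
  assumes X: "continuous_gaussian_field P U X"
  shows "(\<lambda>(\<omega>, x). indicator U x * X x \<omega>) \<in> borel_measurable (P \<Otimes>\<^sub>M lborel)"
proof -
  have U[measurable]: "U \<in> sets borel" using X by (auto simp: continuous_gaussian_field_def)
  obtain p :: "nat \<Rightarrow> 'a" where p: "range p \<subseteq> U" "U \<subseteq> closure (range p)"
    using dense_sequence[of U] X by (auto simp: continuous_gaussian_field_def)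
  have [measurable]: "X (p k) \<in> borel_measurable P" for k
    using p by (intro continuous_gaussian_field_measurable[OF X]) auto
  let ?f = "\<lambda>n z. indicator U (snd z) * X (p (nearest_index p n (snd z))) (fst z)"
  have "(\<lambda>z. indicator U (snd z) * X (snd z) (fst z)) \<in> borel_measurable (P \<Otimes>\<^sub>M lborel)"
  proof (rule borel_measurable_LIMSEQ_real)
    show "?f n \<in> borel_measurable (P \<Otimes>\<^sub>M lborel)" for n
    proof (rule borel_measurable_times)
      show "(\<lambda>z. X (p (nearest_index p n (snd z))) (fst z)) \<in> borel_measurable (P \<Otimes>\<^sub>M lborel)"
      proof (rule measurable_compose_countable[where f = "\<lambda>k z. X (p k) (fst z)"])
        show "(\<lambda>z. nearest_index p n (snd z)) \<in> (P \<Otimes>\<^sub>M lborel) \<rightarrow>\<^sub>M count_space UNIV"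
          by (rule measurable_compose[OF _ measurable_nearest_index]) measurable
      qed measurable
    qed measurable
    fix z assume "z \<in> space (P \<Otimes>\<^sub>M (lborel :: 'a measure))"
    then have \<omega>: "fst z \<in> space P" by (auto simp: space_pair_measure)
    show "(\<lambda>n. ?f n z) \<longlonglongrightarrow> indicator U (snd z) * X (snd z) (fst z)"
    proof (cases "snd z \<in> U")
      case True
      have "continuous_on U (\<lambda>x. X x (fst z))" using X \<omega> by (simp add: continuous_gaussian_field_def)
      then have "(\<lambda>n. X (p (nearest_index p n (snd z))) (fst z)) \<longlonglongrightarrow> X (snd z) (fst z)"
        by (rule continuous_on_tendsto_compose[OF _ tendsto_nearest_index])
          (use True p in \<open>auto intro!: always_eventually\<close>)
      then show ?thesis by (intro tendsto_intros)
    qed simp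
  qed
  then show ?thesis by (simp add: split_beta')
qed

lemma covar_jointly_measurable:
  fixes X Y :: "'a::euclidean_space \<Rightarrow> 'o \<Rightarrow> real"
  assumes X: "continuous_gaussian_field P U X" and Y: "continuous_gaussian_field P U Y"
  shows "(\<lambda>z. indicator (U \<times> U) z * covar P (X (fst z)) (Y (snd z))) \<in> borel_measurable (lborel \<Otimes>\<^sub>M lborel)"
proof -
  interpret prob_space P using X by (simp add: continuous_gaussian_field_def)
  note [measurable] = continuous_field_jointly_measurable[OF X] continuous_field_jointly_measurable[OF Y]
  have "(\<lambda>z. LINT \<omega>|P. (indicator U (fst z) * X (fst z) \<omega>) * (indicator U (snd z) * Y (snd z) \<omega>))
      \<in> borel_measurable (lborel \<Otimes>\<^sub>M lborel)"
    by measurable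
  moreover have "indicator (U \<times> U) z * covar P (X (fst z)) (Y (snd z)) =
      (LINT \<omega>|P. (indicator U (fst z) * X (fst z) \<omega>) * (indicator U (snd z) * Y (snd z) \<omega>))" for z
    unfolding covar_def integral_mult_right_zero[symmetric]
    by (intro Bochner_Integration.integral_cong) (auto simp: indicator_times)
  ultimately show ?thesis by simp
qed

lemma chaos_kernel_measurable:
  fixes X Y :: "'a::euclidean_space \<Rightarrow> 'o \<Rightarrow> real"
  assumes X: "continuous_gaussian_field P U X" and Y: "continuous_gaussian_field P U Y"
  shows "(\<lambda>z. indicator (U \<times> U) z * chaos_kernel P \<beta> X Y z) \<in> borel_measurable (lborel \<Otimes>\<^sub>M lborel)"
proof -
  have [measurable]: "U \<in> sets borel" using X by (auto simp: continuous_gaussian_field_def)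
  note [measurable] = covar_jointly_measurable[OF X Y]
  have "(\<lambda>z. indicator (U \<times> U) z * exp (\<beta>\<^sup>2 * (indicator (U \<times> U) z * covar P (X (fst z)) (Y (snd z)))))
      \<in> borel_measurable (lborel \<Otimes>\<^sub>M lborel)"
    by measurable
  moreover have "indicator (U \<times> U) z * exp (\<beta>\<^sup>2 * (indicator (U \<times> U) z * covar P (X (fst z)) (Y (snd z)))) =
      indicator (U \<times> U) z * chaos_kernel P \<beta> X Y z" for z
    by (simp add: chaos_kernel_def indicator_def)
  ultimately show ?thesis by simp
qed

lemma variance_measurable:
  fixes X :: "'a::euclidean_space \<Rightarrow> 'o \<Rightarrow> real"
  assumes X: "continuous_gaussian_field P U X"
  shows "(\<lambda>x. indicator U x * covar P (X x) (X x)) \<in> borel_measurable lborel"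
proof -
  note [measurable] = covar_jointly_measurable[OF X X]
  have "(\<lambda>x. (\<lambda>z. indicator (U \<times> U) z * covar P (X (fst z)) (X (snd z))) (x, x)) \<in> borel_measurable lborel"
    by (rule measurable_compose[OF _ covar_jointly_measurable[OF X X]]) measurable
  moreover have "indicator (U \<times> U) (x, x) = (indicator U x :: real)" for x
    by (simp add: indicator_def)
  ultimately show ?thesis by simp
qed

lemma imaginary_chaos_jointly_measurable:
  fixes X :: "'a::euclidean_space \<Rightarrow> 'o \<Rightarrow> real"
  assumes X: "continuous_gaussian_field P U X" and A[measurable]: "A \<in> sets borel" and AU: "A \<subseteq> U"
  shows "(\<lambda>(\<omega>, x). indicator A x * imaginary_chaos P \<beta> X \<omega> x) \<in> borel_measurable (P \<Otimes>\<^sub>M lborel)"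
proof -
  note [measurable] = continuous_field_jointly_measurable[OF X] variance_measurable[OF X]
  have "(\<lambda>(\<omega>, x). indicator A x * (of_real (exp (\<beta>\<^sup>2 / 2 * (indicator U x * covar P (X x) (X x)))) *
      cis (\<beta> * (indicator U x * X x \<omega>)))) \<in> borel_measurable (P \<Otimes>\<^sub>M lborel)"
    by measurable
  moreover have "indicator A x * (of_real (exp (\<beta>\<^sup>2 / 2 * (indicator U x * covar P (X x) (X x)))) *
      cis (\<beta> * (indicator U x * X x \<omega>))) = indicator A x * imaginary_chaos P \<beta> X \<omega> x" for \<omega> x
    using AU by (auto simp: imaginary_chaos_eq chaos_modulus_def indicator_def)
  ultimately show ?thesis by (simp only:)
qed

lemma chaos_modulus_measurable:
  fixes X :: "'a::euclidean_space \<Rightarrow> 'o \<Rightarrow> real"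
  assumes X: "continuous_gaussian_field P U X" and A[measurable]: "A \<in> sets borel" and AU: "A \<subseteq> U"
  shows "(\<lambda>x. indicator A x * chaos_modulus P \<beta> X x) \<in> borel_measurable lborel"
proof -
  note [measurable] = variance_measurable[OF X]
  have "(\<lambda>x. indicator A x * exp (\<beta>\<^sup>2 / 2 * (indicator U x * covar P (X x) (X x)))) \<in> borel_measurable lborel"
    by measurable
  moreover have "indicator A x * exp (\<beta>\<^sup>2 / 2 * (indicator U x * covar P (X x) (X x))) =
      indicator A x * chaos_modulus P \<beta> X x" for x
    using AU by (auto simp: chaos_modulus_def indicator_def)
  ultimately show ?thesis by (simp only:)
qed

lemma measurable_cnj [measurable]: "cnj \<in> borel_measurable borel"
  by (intro borel_measurable_continuous_onI continuous_intros)

text \<open>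
  The squared modulus of an integral is a double integral; the deterministic integrable bound
  \<open>a\<close> permits its exchange with the expectation.
\<close>

lemma second_moment_integral:
  fixes f :: "'o \<Rightarrow> 'a::euclidean_space \<Rightarrow> complex"
  assumes P: "prob_space P" and f[measurable]: "(\<lambda>(\<omega>, x). f \<omega> x) \<in> borel_measurable (P \<Otimes>\<^sub>M lborel)"
    and a: "integrable lborel a" and le: "\<And>\<omega> x. \<omega> \<in> space P \<Longrightarrow> cmod (f \<omega> x) \<le> a x"
  shows "integrable (lborel \<Otimes>\<^sub>M lborel) (\<lambda>z. LINT \<omega>|P. f \<omega> (fst z) * cnj (f \<omega> (snd z)))"
    and "(LINT \<omega>|P. of_real ((cmod (LINT x|lborel. f \<omega> x))\<^sup>2)) =
      (LINT z|(lborel \<Otimes>\<^sub>M lborel). (LINT \<omega>|P. f \<omega> (fst z) * cnj (f \<omega> (snd z))))"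
proof -
  interpret prob_space P by fact
  interpret Q: pair_sigma_finite P "lborel \<Otimes>\<^sub>M (lborel :: 'a measure)" ..
  have a_nonneg: "0 \<le> a x" for x
    using le not_empty by (meson norm_ge_zero order_trans ex_in_conv)
  have [measurable]: "a \<in> borel_measurable borel" using a by auto
  have f_int: "integrable lborel (f \<omega>)" if "\<omega> \<in> space P" for \<omega>
  proof (rule Bochner_Integration.integrable_bound[OF a])
    show "f \<omega> \<in> borel_measurable lborel" using measurable_Pair2[OF f that] by simp
  qed (use le[OF that] a_nonneg in auto)
  have prod_int: "integrable (lborel \<Otimes>\<^sub>M lborel) (\<lambda>z. u (fst z) * w (snd z))"
    if "integrable lborel u" "integrable lborel w" for u w :: "'a \<Rightarrow> 'c::{real_normed_field,banach,second_countable_topology}"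
  proof (rule lborel_pair.Fubini_integrable)
    have [measurable]: "u \<in> borel_measurable borel" "w \<in> borel_measurable borel" using that by auto
    show "(\<lambda>z. u (fst z) * w (snd z)) \<in> borel_measurable (lborel \<Otimes>\<^sub>M lborel)" by measurable
    show "integrable lborel (\<lambda>x. LINT y|lborel. norm (u (fst (x, y)) * w (snd (x, y))))"
      using that by (simp add: norm_mult)
    show "AE x in lborel. integrable lborel (\<lambda>y. u (fst (x, y)) * w (snd (x, y)))"
      using that by simp
  qed
  let ?h = "\<lambda>\<omega> z::'a \<times> 'a. f \<omega> (fst z) * cnj (f \<omega> (snd z))"
  have inner: "of_real ((cmod (LINT x|lborel. f \<omega> x))\<^sup>2) = (LINT z|(lborel \<Otimes>\<^sub>M lborel). ?h \<omega> z)"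
    if "\<omega> \<in> space P" for \<omega>
  proof -
    have i: "integrable (lborel \<Otimes>\<^sub>M lborel) (?h \<omega>)"
      using prod_int[OF f_int[OF that], of "\<lambda>y. cnj (f \<omega> y)"] f_int[OF that] by simp
    have "(LINT z|(lborel \<Otimes>\<^sub>M lborel). ?h \<omega> z) = (LINT x|lborel. (LINT y|lborel. f \<omega> x * cnj (f \<omega> y)))"
      using lborel_pair.integral_fst'[OF i] by simp
    also have "\<dots> = (LINT x|lborel. f \<omega> x) * cnj (LINT y|lborel. f \<omega> y)"
      using f_int[OF that] by simp
    finally show ?thesis by (simp only: complex_norm_square)
  qed
  have int: "integrable (P \<Otimes>\<^sub>M (lborel \<Otimes>\<^sub>M lborel)) (\<lambda>(\<omega>, z). ?h \<omega> z)"
  proof (rule Bochner_Integration.integrable_bound)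
    have "integrable (lborel \<Otimes>\<^sub>M lborel) (\<lambda>z::'a \<times> 'a. a (fst z) * a (snd z))" by (rule prod_int[OF a a])
    then show "integrable (P \<Otimes>\<^sub>M (lborel \<Otimes>\<^sub>M lborel)) (\<lambda>(\<omega>, z::'a \<times> 'a). a (fst z) * a (snd z))"
      by (intro Q.Fubini_integrable) auto
    show "AE q in P \<Otimes>\<^sub>M (lborel \<Otimes>\<^sub>M lborel). norm (case q of (\<omega>, z) \<Rightarrow> ?h \<omega> z) \<le> norm (case q of (\<omega>, z) \<Rightarrow> a (fst z) * a (snd z))"
    proof (rule AE_I2)
      fix q :: "'o \<times> 'a \<times> 'a" assume "q \<in> space (P \<Otimes>\<^sub>M (lborel \<Otimes>\<^sub>M (lborel :: 'a measure)))"
      then obtain \<omega> and z :: "'a \<times> 'a" where q: "q = (\<omega>, z)" "\<omega> \<in> space P" by (auto simp: space_pair_measure)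
      have "cmod (f \<omega> (fst z)) * cmod (f \<omega> (snd z)) \<le> a (fst z) * a (snd z)"
        using le[OF q(2)] a_nonneg by (intro mult_mono) auto
      then show "norm (case q of (\<omega>, z) \<Rightarrow> ?h \<omega> z) \<le> norm (case q of (\<omega>, z) \<Rightarrow> a (fst z) * a (snd z))"
        using a_nonneg by (simp add: q norm_mult)
    qed
  qed measurable
  show "integrable (lborel \<Otimes>\<^sub>M lborel) (\<lambda>z. LINT \<omega>|P. ?h \<omega> z)"
    using Q.integrable_snd[OF int] .
  have "(LINT \<omega>|P. of_real ((cmod (LINT x|lborel. f \<omega> x))\<^sup>2)) = (LINT \<omega>|P. (LINT z|(lborel \<Otimes>\<^sub>M lborel). ?h \<omega> z))"
    by (intro Bochner_Integration.integral_cong refl inner)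
  also have "\<dots> = (LINT z|(lborel \<Otimes>\<^sub>M lborel). (LINT \<omega>|P. ?h \<omega> z))"
    using Q.Fubini_integral[OF int] by simp
  finally show "(LINT \<omega>|P. of_real ((cmod (LINT x|lborel. f \<omega> x))\<^sup>2)) =
      (LINT z|(lborel \<Otimes>\<^sub>M lborel). (LINT \<omega>|P. ?h \<omega> z))" .
qed

section \<open>Random Fourier transforms\<close>

text \<open>
  For a random transform that is bounded in mean square uniformly in the frequency, all Sobolev
  norms of order below \<open>- d / 2\<close> have finite second moment at once.  The uniform mean-square
  distance therefore serves all these orders simultaneously.
\<close>

definition mean_square_close ::
    "'o measure \<Rightarrow> real \<Rightarrow> ('o \<Rightarrow> 'a::euclidean_space \<Rightarrow> complex) \<Rightarrow> ('o \<Rightarrow> 'a \<Rightarrow> complex) \<Rightarrow> bool" where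
  "mean_square_close P \<epsilon> u v \<longleftrightarrow>
     (\<forall>\<xi>. (\<integral>\<^sup>+\<omega>. ennreal ((cmod (u \<omega> \<xi> - v \<omega> \<xi>))\<^sup>2) \<partial>P) \<le> ennreal \<epsilon>)"

definition random_transforms :: "'o measure \<Rightarrow> ('o \<Rightarrow> 'a::euclidean_space \<Rightarrow> complex) set" where
  "random_transforms P = {v. (\<lambda>(\<omega>, \<xi>). v \<omega> \<xi>) \<in> borel_measurable (P \<Otimes>\<^sub>M lborel) \<and>
     (\<forall>\<omega>\<in>space P. \<forall>s < - real DIM('a) / 2. v \<omega> \<in> weighted_L2 s) \<and>
     (\<exists>C. mean_square_close P C v (\<lambda>_ _. 0))}"

lemma random_transforms_measurable:
  "v \<in> random_transforms P \<Longrightarrow> (\<lambda>(\<omega>, \<xi>). v \<omega> \<xi>) \<in> borel_measurable (P \<Otimes>\<^sub>M lborel)"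
  by (simp add: random_transforms_def)

lemma random_transforms_weighted_L2:
  fixes v :: "'o \<Rightarrow> 'a::euclidean_space \<Rightarrow> complex"
  shows "v \<in> random_transforms P \<Longrightarrow> \<omega> \<in> space P \<Longrightarrow> s < - real DIM('a) / 2 \<Longrightarrow> v \<omega> \<in> weighted_L2 s"
  by (simp add: random_transforms_def)

lemma jointly_measurable_section:
  assumes "(\<lambda>(\<omega>, \<xi>). v \<omega> \<xi>) \<in> borel_measurable (P \<Otimes>\<^sub>M lborel)"
  shows "(\<lambda>\<omega>. v \<omega> \<xi>) \<in> borel_measurable P"
  using measurable_Pair1[OF assms, of \<xi>] by simp

lemma random_transforms_section:
  "v \<in> random_transforms P \<Longrightarrow> (\<lambda>\<omega>. v \<omega> \<xi>) \<in> borel_measurable P"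
  by (rule jointly_measurable_section[OF random_transforms_measurable])

lemma mean_square_close_sym: "mean_square_close P \<epsilon> u v \<Longrightarrow> mean_square_close P \<epsilon> v u"
  by (simp add: mean_square_close_def norm_minus_commute)

lemma mean_square_close_mono:
  assumes "mean_square_close P \<epsilon> u v" "\<epsilon> \<le> \<delta>"
  shows "mean_square_close P \<delta> u v"
  unfolding mean_square_close_def
proof
  fix \<xi>
  show "(\<integral>\<^sup>+\<omega>. ennreal ((cmod (u \<omega> \<xi> - v \<omega> \<xi>))\<^sup>2) \<partial>P) \<le> ennreal \<delta>"
    using assms(1)[unfolded mean_square_close_def, rule_format, of \<xi>] ennreal_leI[OF assms(2)]
    by (rule order_trans)
qed

text \<open>
  From \<open>(x + y)\<^sup>2 \<le> 2 x\<^sup>2 + 2 y\<^sup>2\<close>. The relation compares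
  second moments and not their roots, hence the factors \<open>2\<close>.
\<close>

lemma mean_square_close_triangle:
  assumes "\<And>\<xi>. (\<lambda>\<omega>. u \<omega> \<xi>) \<in> borel_measurable P" "\<And>\<xi>. (\<lambda>\<omega>. v \<omega> \<xi>) \<in> borel_measurable P"
    "\<And>\<xi>. (\<lambda>\<omega>. w \<omega> \<xi>) \<in> borel_measurable P"
    and uv: "mean_square_close P a u v" and vw: "mean_square_close P b v w" and ab: "0 \<le> a" "0 \<le> b"
  shows "mean_square_close P (2 * a + 2 * b) u w"
  unfolding mean_square_close_def
proof
  fix \<xi>
  have [measurable]: "(\<lambda>\<omega>. u \<omega> \<xi>) \<in> borel_measurable P" "(\<lambda>\<omega>. v \<omega> \<xi>) \<in> borel_measurable P" "(\<lambda>\<omega>. w \<omega> \<xi>) \<in> borel_measurable P"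
    by fact+
  have pt: "(cmod (u \<omega> \<xi> - w \<omega> \<xi>))\<^sup>2 \<le> 2 * (cmod (u \<omega> \<xi> - v \<omega> \<xi>))\<^sup>2 + 2 * (cmod (v \<omega> \<xi> - w \<omega> \<xi>))\<^sup>2" for \<omega>
  proof -
    let ?x = "cmod (u \<omega> \<xi> - v \<omega> \<xi>)" and ?y = "cmod (v \<omega> \<xi> - w \<omega> \<xi>)"
    have "cmod (u \<omega> \<xi> - w \<omega> \<xi>) \<le> ?x + ?y"
      using norm_triangle_ineq[of "u \<omega> \<xi> - v \<omega> \<xi>" "v \<omega> \<xi> - w \<omega> \<xi>"] by simp
    then have "(cmod (u \<omega> \<xi> - w \<omega> \<xi>))\<^sup>2 \<le> (?x + ?y)\<^sup>2" by (rule power_mono) simp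
    also have "\<dots> \<le> 2 * ?x\<^sup>2 + 2 * ?y\<^sup>2"
      using sum_squares_bound[of ?x ?y] by (simp add: power2_sum)
    finally show ?thesis .
  qed
  have "(\<integral>\<^sup>+\<omega>. ennreal ((cmod (u \<omega> \<xi> - w \<omega> \<xi>))\<^sup>2) \<partial>P) \<le>
      (\<integral>\<^sup>+\<omega>. 2 * ennreal ((cmod (u \<omega> \<xi> - v \<omega> \<xi>))\<^sup>2) + 2 * ennreal ((cmod (v \<omega> \<xi> - w \<omega> \<xi>))\<^sup>2) \<partial>P)"
  proof (rule nn_integral_mono)
    fix \<omega>
    show "ennreal ((cmod (u \<omega> \<xi> - w \<omega> \<xi>))\<^sup>2) \<le>
        2 * ennreal ((cmod (u \<omega> \<xi> - v \<omega> \<xi>))\<^sup>2) + 2 * ennreal ((cmod (v \<omega> \<xi> - w \<omega> \<xi>))\<^sup>2)"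
      using ennreal_leI[OF pt[of \<omega>]] by (simp add: ennreal_mult)
  qed
  also have "\<dots> = 2 * (\<integral>\<^sup>+\<omega>. ennreal ((cmod (u \<omega> \<xi> - v \<omega> \<xi>))\<^sup>2) \<partial>P) +
      2 * (\<integral>\<^sup>+\<omega>. ennreal ((cmod (v \<omega> \<xi> - w \<omega> \<xi>))\<^sup>2) \<partial>P)"
    by (simp add: nn_integral_add nn_integral_cmult)
  also have "\<dots> \<le> 2 * ennreal a + 2 * ennreal b"
    using uv vw unfolding mean_square_close_def by (intro add_mono mult_left_mono) auto
  also have "\<dots> = ennreal (2 * a + 2 * b)"
    using ab by (simp add: ennreal_mult)
  finally show "(\<integral>\<^sup>+\<omega>. ennreal ((cmod (u \<omega> \<xi> - w \<omega> \<xi>))\<^sup>2) \<partial>P) \<le> ennreal (2 * a + 2 * b)" .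
qed

lemma random_transforms_triangle:
  assumes "u \<in> random_transforms P" "v \<in> random_transforms P" "w \<in> random_transforms P"
    and "mean_square_close P a u v" "mean_square_close P b v w" "0 \<le> a" "0 \<le> b"
  shows "mean_square_close P (2 * a + 2 * b) u w"
  by (rule mean_square_close_triangle[where v = v]) (use assms in \<open>simp_all only: random_transforms_section\<close>)

lemma mean_square_close_0:
  assumes "\<And>\<epsilon>. 0 < \<epsilon> \<Longrightarrow> mean_square_close P \<epsilon> u v"
  shows "mean_square_close P 0 u v"
  unfolding mean_square_close_def
proof
  fix \<xi>
  show "(\<integral>\<^sup>+\<omega>. ennreal ((cmod (u \<omega> \<xi> - v \<omega> \<xi>))\<^sup>2) \<partial>P) \<le> ennreal 0"
  proof (rule ennreal_le_epsilon)
    fix e :: real assume "0 < e"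
    from assms[OF this, unfolded mean_square_close_def, rule_format, of \<xi>]
    show "(\<integral>\<^sup>+\<omega>. ennreal ((cmod (u \<omega> \<xi> - v \<omega> \<xi>))\<^sup>2) \<partial>P) \<le> ennreal 0 + ennreal e"
      by (simp only: ennreal_0 add_0)
  qed
qed

definition bracket_integral :: "'a::euclidean_space itself \<Rightarrow> real \<Rightarrow> real" where
  "bracket_integral _ s = (LINT \<xi>::'a|lborel. bracket s \<xi>)"

lemma bracket_integral_nonneg: "0 \<le> bracket_integral T s"
  unfolding bracket_integral_def by (intro integral_nonneg_AE) simp

text \<open>
  By Tonelli's theorem, since the bound does not depend on the frequency and the weight is
  integrable.
\<close>

lemma nn_integral_mean_square_le:
  fixes u :: "'o \<Rightarrow> 'a::euclidean_space \<Rightarrow> complex"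
  assumes P: "prob_space P" and s: "s < - real DIM('a) / 2" and \<epsilon>: "0 \<le> \<epsilon>"
    and u[measurable]: "(\<lambda>(\<omega>, \<xi>). u \<omega> \<xi>) \<in> borel_measurable (P \<Otimes>\<^sub>M lborel)"
    and close: "mean_square_close P \<epsilon> u (\<lambda>_ _. 0)"
  shows "(\<integral>\<^sup>+\<omega>. (\<integral>\<^sup>+\<xi>. ennreal (bracket s \<xi> * (cmod (u \<omega> \<xi>))\<^sup>2) \<partial>lborel) \<partial>P) \<le>
    ennreal (\<epsilon> * bracket_integral TYPE('a) s)"
proof -
  interpret prob_space P by fact
  interpret Q: pair_sigma_finite P "lborel :: 'a measure" ..
  have "(\<integral>\<^sup>+\<omega>. (\<integral>\<^sup>+\<xi>. ennreal (bracket s \<xi> * (cmod (u \<omega> \<xi>))\<^sup>2) \<partial>lborel) \<partial>P) =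
      (\<integral>\<^sup>+\<xi>. (\<integral>\<^sup>+\<omega>. ennreal (bracket s \<xi> * (cmod (u \<omega> \<xi>))\<^sup>2) \<partial>P) \<partial>lborel)"
    by (rule Q.Fubini'[symmetric]) measurable
  also have "\<dots> \<le> (\<integral>\<^sup>+\<xi>. ennreal (\<epsilon> * bracket s (\<xi>::'a)) \<partial>lborel)"
  proof (rule nn_integral_mono)
    fix \<xi> :: 'a
    have [measurable]: "(\<lambda>\<omega>. u \<omega> \<xi>) \<in> borel_measurable P" by (rule jointly_measurable_section[OF u])
    have "(\<integral>\<^sup>+\<omega>. ennreal (bracket s \<xi> * (cmod (u \<omega> \<xi>))\<^sup>2) \<partial>P) =
        ennreal (bracket s \<xi>) * (\<integral>\<^sup>+\<omega>. ennreal ((cmod (u \<omega> \<xi>))\<^sup>2) \<partial>P)"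
      by (simp add: ennreal_mult nn_integral_cmult)
    also have "\<dots> \<le> ennreal (bracket s \<xi>) * ennreal \<epsilon>"
      using close by (intro mult_left_mono) (auto simp: mean_square_close_def)
    finally show "(\<integral>\<^sup>+\<omega>. ennreal (bracket s \<xi> * (cmod (u \<omega> \<xi>))\<^sup>2) \<partial>P) \<le> ennreal (\<epsilon> * bracket s \<xi>)"
      using \<epsilon> by (simp add: ennreal_mult mult.commute)
  qed
  also have "\<dots> = ennreal (LINT \<xi>::'a|lborel. \<epsilon> * bracket s \<xi>)"
    using \<epsilon> integrable_bracket[OF s] by (intro nn_integral_eq_integral) auto
  finally show ?thesis by (simp add: bracket_integral_def)
qed

lemma nn_integral_sobolev_integral_le:
  fixes u v :: "'o \<Rightarrow> 'a::euclidean_space \<Rightarrow> complex"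
  assumes P: "prob_space P" and s: "s < - real DIM('a) / 2" and \<epsilon>: "0 \<le> \<epsilon>"
    and u: "u \<in> random_transforms P" and v: "v \<in> random_transforms P"
    and close: "mean_square_close P \<epsilon> u v"
  shows "(\<integral>\<^sup>+\<omega>. ennreal (sobolev_integral s (\<lambda>\<xi>. u \<omega> \<xi> - v \<omega> \<xi>)) \<partial>P) \<le>
    ennreal (\<epsilon> * bracket_integral TYPE('a) s)"
proof -
  note [measurable] = random_transforms_measurable[OF u] random_transforms_measurable[OF v]
  have "(\<integral>\<^sup>+\<omega>. ennreal (sobolev_integral s (\<lambda>\<xi>. u \<omega> \<xi> - v \<omega> \<xi>)) \<partial>P) =
      (\<integral>\<^sup>+\<omega>. (\<integral>\<^sup>+\<xi>. ennreal (bracket s \<xi> * (cmod (u \<omega> \<xi> - v \<omega> \<xi>))\<^sup>2) \<partial>lborel) \<partial>P)"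
  proof (rule nn_integral_cong)
    fix \<omega> assume "\<omega> \<in> space P"
    then have "(\<lambda>\<xi>. u \<omega> \<xi> - v \<omega> \<xi>) \<in> weighted_L2 s"
      using u v s by (intro weighted_L2_diff random_transforms_weighted_L2)
    then show "ennreal (sobolev_integral s (\<lambda>\<xi>. u \<omega> \<xi> - v \<omega> \<xi>)) =
        (\<integral>\<^sup>+\<xi>. ennreal (bracket s \<xi> * (cmod (u \<omega> \<xi> - v \<omega> \<xi>))\<^sup>2) \<partial>lborel)"
      unfolding sobolev_integral_def by (intro nn_integral_eq_integral[symmetric]) (auto simp: weighted_L2_def)
  qed
  also have "\<dots> \<le> ennreal (\<epsilon> * bracket_integral TYPE('a) s)"
    using close by (intro nn_integral_mean_square_le[OF P s \<epsilon>]) (measurable, simp add: mean_square_close_def)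
  finally show ?thesis .
qed

lemma random_transforms_sobolev_integral_measurable:
  assumes u: "u \<in> random_transforms P" and v: "v \<in> random_transforms P"
  shows "(\<lambda>\<omega>. sobolev_integral s (\<lambda>\<xi>. u \<omega> \<xi> - v \<omega> \<xi>)) \<in> borel_measurable P"
proof -
  note [measurable] = random_transforms_measurable[OF u] random_transforms_measurable[OF v]
  show ?thesis by (rule measurable_sobolev_integral) measurable
qed

lemma random_transforms_synthesis_measurable:
  fixes v :: "'o \<Rightarrow> 'a::euclidean_space \<Rightarrow> complex"
  assumes "v \<in> random_transforms P" "s < - real DIM('a) / 2"
  shows "(\<lambda>\<omega>. synthesis (v \<omega>)) \<in> P \<rightarrow>\<^sub>M sobolev_borel s"
  using assms by (intro measurable_synthesis random_transforms_measurable random_transforms_weighted_L2)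

lemma random_transforms_dist:
  fixes u v :: "'o \<Rightarrow> 'a::euclidean_space \<Rightarrow> complex"
  assumes u: "u \<in> random_transforms P" and v: "v \<in> random_transforms P" and s: "s < - real DIM('a) / 2"
    and \<omega>: "\<omega> \<in> space P"
  shows "sobolev_dist s (synthesis (u \<omega>)) (synthesis (v \<omega>)) = sqrt (sobolev_integral s (\<lambda>\<xi>. u \<omega> \<xi> - v \<omega> \<xi>))"
  using random_transforms_weighted_L2[OF u \<omega> s] random_transforms_weighted_L2[OF v \<omega> s]
  by (intro sobolev_dist_synthesis) (auto intro: weighted_L2_imp_temperate)

text \<open>
  Markov's inequality for the squared Sobolev distance.
\<close>

lemma mean_square_imp_in_probability:
  fixes u :: "'o \<Rightarrow> 'a::euclidean_space \<Rightarrow> complex"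
  assumes P: "prob_space P" and s: "s < - real DIM('a) / 2"
    and v: "\<And>j. v j \<in> random_transforms P" and u: "u \<in> random_transforms P"
    and lim: "\<And>\<epsilon>. 0 < \<epsilon> \<Longrightarrow> \<exists>N. \<forall>j\<ge>N. mean_square_close P \<epsilon> (v j) u"
  shows "converges_in_probability_sobolev P s (\<lambda>j \<omega>. synthesis (v j \<omega>)) (\<lambda>\<omega>. synthesis (u \<omega>))"
  unfolding converges_in_probability_sobolev_def
proof (intro conjI allI impI random_transforms_synthesis_measurable v u s)
  interpret prob_space P by fact
  fix r :: real assume r: "0 < r"
  let ?B = "bracket_integral TYPE('a) s"
  have B: "0 \<le> ?B" by (rule bracket_integral_nonneg)
  show "(\<lambda>j. measure P {\<omega> \<in> space P. r < sobolev_dist s (synthesis (v j \<omega>)) (synthesis (u \<omega>))}) \<longlonglongrightarrow> 0"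
  proof (rule LIMSEQ_I)
    fix e :: real assume e: "0 < e"
    \<comment> \<open>makes the bound \<open>\<epsilon> * ?B / r\<^sup>2\<close> from Markov's
      inequality at most \<open>e / 2\<close>, also if \<open>?B = 0\<close>\<close>
    define \<epsilon> where "\<epsilon> = e * r\<^sup>2 / (2 * (?B + 1))"
    have \<epsilon>: "0 < \<epsilon>" using e r B by (simp add: \<epsilon>_def)
    obtain N where N: "\<And>j. N \<le> j \<Longrightarrow> mean_square_close P \<epsilon> (v j) u" using lim[OF \<epsilon>] by blast
    have "measure P {\<omega> \<in> space P. r < sobolev_dist s (synthesis (v j \<omega>)) (synthesis (u \<omega>))} < e" if j: "N \<le> j" for j
    proof -
      let ?I = "\<lambda>\<omega>. sobolev_integral s (\<lambda>\<xi>. v j \<omega> \<xi> - u \<omega> \<xi>)"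
      have [measurable]: "?I \<in> borel_measurable P"
        by (rule random_transforms_sobolev_integral_measurable[OF v u])
      have "emeasure P {\<omega> \<in> space P. r < sobolev_dist s (synthesis (v j \<omega>)) (synthesis (u \<omega>))} \<le>
          emeasure P {\<omega> \<in> space P. 1 \<le> ennreal (1 / r\<^sup>2) * ennreal (?I \<omega>)}"
      proof (rule emeasure_mono)
        show "{\<omega> \<in> space P. r < sobolev_dist s (synthesis (v j \<omega>)) (synthesis (u \<omega>))} \<subseteq>
            {\<omega> \<in> space P. 1 \<le> ennreal (1 / r\<^sup>2) * ennreal (?I \<omega>)}"
        proof safe
          fix \<omega> assume "\<omega> \<in> space P" "r < sobolev_dist s (synthesis (v j \<omega>)) (synthesis (u \<omega>))"
          then have "r < sqrt (?I \<omega>)" by (simp add: random_transforms_dist[OF v u s])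
          then have "r\<^sup>2 < ?I \<omega>"
            using r by (simp add: real_less_rsqrt less_imp_le real_sqrt_less_iff[symmetric, of "r\<^sup>2"])
          then have "1 \<le> 1 / r\<^sup>2 * ?I \<omega>" using r by (simp add: field_simps)
          moreover have "ennreal (1 / r\<^sup>2) * ennreal (?I \<omega>) = ennreal (1 / r\<^sup>2 * ?I \<omega>)"
            by (rule ennreal_mult[symmetric]) (auto simp: sobolev_integral_nonneg)
          ultimately show "1 \<le> ennreal (1 / r\<^sup>2) * ennreal (?I \<omega>)"
            by (simp only: ennreal_ge_1)
        qed
      qed measurable
      also have "\<dots> \<le> ennreal (1 / r\<^sup>2) * (\<integral>\<^sup>+\<omega>. ennreal (?I \<omega>) * indicator (space P) \<omega> \<partial>P)"
        by (rule nn_integral_Markov_inequality) auto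
      also have "(\<integral>\<^sup>+\<omega>. ennreal (?I \<omega>) * indicator (space P) \<omega> \<partial>P) = (\<integral>\<^sup>+\<omega>. ennreal (?I \<omega>) \<partial>P)"
        by (intro nn_integral_cong) simp
      also have "ennreal (1 / r\<^sup>2) * (\<integral>\<^sup>+\<omega>. ennreal (?I \<omega>) \<partial>P) \<le> ennreal (1 / r\<^sup>2) * ennreal (\<epsilon> * ?B)"
        using \<epsilon> by (intro mult_left_mono nn_integral_sobolev_integral_le[OF P s _ v u N[OF j]]) auto
      also have "\<dots> = ennreal (1 / r\<^sup>2 * (\<epsilon> * ?B))"
        by (rule ennreal_mult[symmetric]) (use \<epsilon> B in auto)
      finally have "measure P {\<omega> \<in> space P. r < sobolev_dist s (synthesis (v j \<omega>)) (synthesis (u \<omega>))} \<le> 1 / r\<^sup>2 * (\<epsilon> * ?B)"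
        using \<epsilon> B by (simp add: emeasure_eq_measure)
      also have "\<dots> = e / 2 * (?B / (?B + 1))"
        using r B by (simp add: \<epsilon>_def field_simps)
      also have "\<dots> \<le> e / 2 * 1"
        using e B by (intro mult_left_mono) auto
      finally show ?thesis using e by simp
    qed
    then show "\<exists>N. \<forall>j\<ge>N. norm (measure P {\<omega> \<in> space P. r < sobolev_dist s (synthesis (v j \<omega>)) (synthesis (u \<omega>))} - 0) < e"
      by auto
  qed
qed

text \<open>
  If the limits are more than \<open>2 r\<close> apart then one of them is more than
  \<open>r\<close> away from the common approximation, an event whose probability tends to
  \<open>0\<close>.
\<close>

lemma converges_in_probability_sobolev_unique:
  fixes L :: "'o \<Rightarrow> 'a::euclidean_space distribution"
  assumes P: "prob_space P" and s: "s < - real DIM('a) / 2"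
    and M: "converges_in_probability_sobolev P s M L" and M': "converges_in_probability_sobolev P s M' L'"
    and eq: "\<And>n. AE \<omega> in P. M n \<omega> = M' n \<omega>"
  shows "AE \<omega> in P. L \<omega> = L' \<omega>"
proof -
  interpret prob_space P by fact
  interpret Metric_space "sobolev s" "sobolev_dist s :: 'a distribution \<Rightarrow> _" by (rule Metric_space_sobolev)
  have meas: "M n \<in> P \<rightarrow>\<^sub>M sobolev_borel s" "L \<in> P \<rightarrow>\<^sub>M sobolev_borel s"
    "M' n \<in> P \<rightarrow>\<^sub>M sobolev_borel s" "L' \<in> P \<rightarrow>\<^sub>M sobolev_borel s" for n
    using M M' by (auto simp: converges_in_probability_sobolev_def)
  note [measurable] = measurable_sobolev_dist[OF s meas(1) meas(2)] measurable_sobolev_dist[OF s meas(3) meas(4)]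
    measurable_sobolev_dist[OF s meas(2) meas(4)]
  have mem: "M n \<omega> \<in> sobolev s" "L \<omega> \<in> sobolev s" "M' n \<omega> \<in> sobolev s" "L' \<omega> \<in> sobolev s"
    if "\<omega> \<in> space P" for \<omega> n
    using measurable_space[OF meas(1) that] measurable_space[OF meas(2) that]
      measurable_space[OF meas(3) that] measurable_space[OF meas(4) that] by (auto simp: space_sobolev_borel)
  have small: "AE \<omega> in P. sobolev_dist s (L \<omega>) (L' \<omega>) \<le> 2 * r" if r: "0 < r" for r
  proof -
    let ?A = "\<lambda>n. {\<omega> \<in> space P. r < sobolev_dist s (M n \<omega>) (L \<omega>)}"
    let ?B = "\<lambda>n. {\<omega> \<in> space P. r < sobolev_dist s (M' n \<omega>) (L' \<omega>)}"
    let ?C = "{\<omega> \<in> space P. 2 * r < sobolev_dist s (L \<omega>) (L' \<omega>)}"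
    have le: "measure P ?C \<le> measure P (?A n) + measure P (?B n)" for n
    proof -
      have "measure P ?C \<le> measure P (?A n \<union> ?B n)"
      proof (rule finite_measure_mono_AE)
        show "AE \<omega> in P. \<omega> \<in> ?C \<longrightarrow> \<omega> \<in> ?A n \<union> ?B n"
          using eq[of n]
        proof (eventually_elim, intro impI)
          fix \<omega> assume *: "M n \<omega> = M' n \<omega>" "\<omega> \<in> ?C"
          then have "sobolev_dist s (L \<omega>) (L' \<omega>) \<le> sobolev_dist s (M n \<omega>) (L \<omega>) + sobolev_dist s (M' n \<omega>) (L' \<omega>)"
            using triangle[of "L \<omega>" "M n \<omega>" "L' \<omega>"] mem(1)[of \<omega> n] mem(2)[of \<omega>] mem(4)[of \<omega>]
              commute[of "L \<omega>"] by simp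
          then show "\<omega> \<in> ?A n \<union> ?B n" using * by auto
        qed
      qed measurable
      also have "\<dots> \<le> measure P (?A n) + measure P (?B n)"
        by (rule measure_Un_le) measurable
      finally show ?thesis .
    qed
    have "(\<lambda>n. measure P (?A n) + measure P (?B n)) \<longlonglongrightarrow> 0 + 0"
      using M M' r unfolding converges_in_probability_sobolev_def by (intro tendsto_add) blast+
    then have "measure P ?C \<le> 0 + 0"
      by (rule LIMSEQ_le_const) (use le in auto)
    then have "measure P ?C = 0" using measure_nonneg[of P ?C] by linarith
    then have "AE \<omega> in P. \<not> 2 * r < sobolev_dist s (L \<omega>) (L' \<omega>)"
      by (intro AE_I[where N = ?C]) (auto simp: emeasure_eq_measure)
    then show ?thesis by eventually_elim simp
  qed
  have "AE \<omega> in P. \<forall>k::nat. sobolev_dist s (L \<omega>) (L' \<omega>) \<le> 2 * (1 / real (Suc k))"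
    unfolding AE_all_countable by (intro allI small) simp
  then show ?thesis
    using AE_space
  proof eventually_elim
    case (elim \<omega>)
    have "sobolev_dist s (L \<omega>) (L' \<omega>) \<le> 0"
    proof (rule field_le_epsilon)
      fix e :: real assume "0 < e"
      then obtain k where "1 / real (Suc k) < e / 2" using nat_approx_posE[of "e / 2"] by auto
      then show "sobolev_dist s (L \<omega>) (L' \<omega>) \<le> 0 + e" using elim(1)[rule_format, of k] by simp
    qed
    then have "sobolev_dist s (L \<omega>) (L' \<omega>) = 0" using sobolev_dist_nonneg[of s "L \<omega>" "L' \<omega>"] by linarith
    then show ?case using mem[OF elim(2)] by simp
  qed
qed

lemma mean_square_close_0_imp_AE_eq:
  fixes u v :: "'o \<Rightarrow> 'a::euclidean_space \<Rightarrow> complex"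
  assumes P: "prob_space P" and u: "u \<in> random_transforms P" and v: "v \<in> random_transforms P"
    and close: "mean_square_close P 0 u v"
  shows "AE \<omega> in P. synthesis (u \<omega>) = synthesis (v \<omega>)"
proof -
  define s where "s = - real DIM('a) / 2 - 1"
  have s: "s < - real DIM('a) / 2" by (simp add: s_def)
  have [measurable]: "(\<lambda>\<omega>. sobolev_integral s (\<lambda>\<xi>. u \<omega> \<xi> - v \<omega> \<xi>)) \<in> borel_measurable P"
    by (rule random_transforms_sobolev_integral_measurable[OF u v])
  have "(\<integral>\<^sup>+\<omega>. ennreal (sobolev_integral s (\<lambda>\<xi>. u \<omega> \<xi> - v \<omega> \<xi>)) \<partial>P) = 0"
    using nn_integral_sobolev_integral_le[OF P s _ u v close] by simp
  then have "AE \<omega> in P. ennreal (sobolev_integral s (\<lambda>\<xi>. u \<omega> \<xi> - v \<omega> \<xi>)) = 0"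
    by (subst (asm) nn_integral_0_iff_AE) auto
  then show ?thesis
    using AE_space
  proof eventually_elim
    case (elim \<omega>)
    then have W: "u \<omega> \<in> weighted_L2 s" "v \<omega> \<in> weighted_L2 s"
      using u v s by (auto intro: random_transforms_weighted_L2)
    have "sobolev_integral s (\<lambda>\<xi>. u \<omega> \<xi> - v \<omega> \<xi>) = 0"
      using elim(1) sobolev_integral_nonneg[of s "\<lambda>\<xi>. u \<omega> \<xi> - v \<omega> \<xi>"] by (simp add: ennreal_eq_0_iff)
    then have "AE \<xi> in lborel. u \<omega> \<xi> - v \<omega> \<xi> = 0"
      using sobolev_integral_eq_0[OF weighted_L2_diff[OF W]] by simp
    then have "AE \<xi> in lborel. u \<omega> \<xi> = v \<omega> \<xi>" by eventually_elim simp
    then show ?case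
      using W by (intro synthesis_cong_AE) (auto simp: weighted_L2_def)
  qed
qed

lemma schwartz_weighted_L2:
  fixes \<phi> :: "'a::euclidean_space \<Rightarrow> complex"
  assumes \<phi>: "\<phi> \<in> schwartz_functions"
  shows "\<phi> \<in> weighted_L2 t"
proof -
  have [measurable]: "\<phi> \<in> borel_measurable borel" using \<phi> by (rule schwartz_measurable)
  obtain k :: nat where k: "t \<le> real k" using real_arch_simple by blast
  obtain B where B: "\<And>x. (1 + norm x) ^ 0 * cmod (\<phi> x) \<le> B" using schwartz_decay[OF \<phi>] by metis
  have "integrable lborel (\<lambda>\<xi>. bracket t \<xi> * (cmod (\<phi> \<xi>))\<^sup>2)"
  proof (rule Bochner_Integration.integrable_bound)
    show "integrable lborel (\<lambda>\<xi>. B * cmod (of_real ((1 + norm \<xi>) ^ (2 * k)) * \<phi> \<xi>))"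
      by (intro integrable_mult_right integrable_norm schwartz_integrable_weighted \<phi>)
    show "AE \<xi> in lborel. norm (bracket t \<xi> * (cmod (\<phi> \<xi>))\<^sup>2) \<le> norm (B * cmod (of_real ((1 + norm \<xi>) ^ (2 * k)) * \<phi> \<xi>))"
    proof (rule AE_I2)
      fix \<xi> :: 'a
      have "bracket t \<xi> \<le> bracket (real k) \<xi>" by (rule bracket_mono[OF k])
      also have "\<dots> = (1 + (norm \<xi>)\<^sup>2) ^ k"
        by (simp add: bracket_def powr_realpow add_pos_nonneg)
      also have "\<dots> \<le> ((1 + norm \<xi>)\<^sup>2) ^ k"
        by (intro power_mono) (auto simp: power2_eq_square algebra_simps)
      finally have b: "bracket t \<xi> \<le> (1 + norm \<xi>) ^ (2 * k)" by (simp add: power_mult)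
      have "bracket t \<xi> * (cmod (\<phi> \<xi>))\<^sup>2 = cmod (\<phi> \<xi>) * (bracket t \<xi> * cmod (\<phi> \<xi>))"
        by (simp add: power2_eq_square)
      also have "\<dots> \<le> B * ((1 + norm \<xi>) ^ (2 * k) * cmod (\<phi> \<xi>))"
        using b B[of \<xi>] order_trans[OF norm_ge_zero, of "\<phi> \<xi>" B] by (intro mult_mono mult_right_mono) auto
      finally have 1: "bracket t \<xi> * (cmod (\<phi> \<xi>))\<^sup>2 \<le> B * ((1 + norm \<xi>) ^ (2 * k) * cmod (\<phi> \<xi>))" .
      have "cmod (complex_of_real ((1 + norm \<xi>) ^ (2 * k))) = (1 + norm \<xi>) ^ (2 * k)"
        by (simp only: norm_of_real) simp
      then have 2: "B * cmod (of_real ((1 + norm \<xi>) ^ (2 * k)) * \<phi> \<xi>) = B * ((1 + norm \<xi>) ^ (2 * k) * cmod (\<phi> \<xi>))"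
        by (simp only: norm_mult)
      have 3: "0 \<le> bracket t \<xi> * (cmod (\<phi> \<xi>))\<^sup>2" by simp
      show "norm (bracket t \<xi> * (cmod (\<phi> \<xi>))\<^sup>2) \<le> norm (B * cmod (of_real ((1 + norm \<xi>) ^ (2 * k)) * \<phi> \<xi>))"
        unfolding real_norm_def 2 using 1 3 by linarith
    qed
  qed measurable
  then show ?thesis by (simp add: weighted_L2_def)
qed

text \<open>
  The weights of orders \<open>s\<close> and \<open>- s\<close> are dual to each other: for
  every \<open>l > 0\<close> one has \<open>2 x y \<le> l b x\<^sup>2 + y\<^sup>2 / (l
  b)\<close> with \<open>b\<close> the weight of order \<open>s\<close>. First
  \<open>l\<close> is chosen large, then the distance small.
\<close>

lemma synthesis_tendsto:
  fixes u :: "'a::euclidean_space \<Rightarrow> complex"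
  assumes v: "\<And>k. v k \<in> weighted_L2 s" and u: "u \<in> weighted_L2 s"
    and lim: "(\<lambda>k. sobolev_integral s (\<lambda>\<xi>. v k \<xi> - u \<xi>)) \<longlonglongrightarrow> 0" and \<phi>: "\<phi> \<in> schwartz_functions"
  shows "(\<lambda>k::nat. synthesis (v k) \<phi>) \<longlonglongrightarrow> synthesis u \<phi>"
proof -
  define \<psi> where "\<psi> \<xi> = fourier \<phi> (- \<xi>)" for \<xi>
  have \<psi>: "\<psi> \<in> schwartz_functions"
    unfolding \<psi>_def[abs_def] by (intro schwartz_reflect fourier_schwartz \<phi>)
  define C where "C = sobolev_integral (- s) \<psi>"
  have C: "0 \<le> C" by (simp add: C_def sobolev_integral_nonneg)
  have bound: "cmod (synthesis (v k) \<phi> - synthesis u \<phi>) \<le> l * sobolev_integral s (\<lambda>\<xi>. v k \<xi> - u \<xi>) + C / l"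
    if l: "0 < l" for k l
  proof -
    let ?w = "\<lambda>\<xi>. v k \<xi> - u \<xi>"
    have W: "?w \<in> weighted_L2 s" by (intro weighted_L2_diff v u)
    have i: "integrable lborel (\<lambda>\<xi>. ?w \<xi> * \<psi> \<xi>)"
      by (rule temperate_integrable_schwartz[OF weighted_L2_imp_temperate[OF W] \<psi>])
    have eq: "synthesis (v k) \<phi> - synthesis u \<phi> = (LINT \<xi>|lborel. ?w \<xi> * \<psi> \<xi>)"
      using fun_cong[OF synthesis_diff[OF weighted_L2_imp_temperate[OF v[of k]] weighted_L2_imp_temperate[OF u]], of \<phi>]
      by (simp add: synthesis_schwartz[OF \<phi>] \<psi>_def)
    have i1: "integrable lborel (\<lambda>\<xi>. bracket s \<xi> * (cmod (?w \<xi>))\<^sup>2)"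
      using W by (simp add: weighted_L2_def)
    have i2: "integrable lborel (\<lambda>\<xi>. bracket (- s) \<xi> * (cmod (\<psi> \<xi>))\<^sup>2)"
      using schwartz_weighted_L2[OF \<psi>, of "- s"] by (simp add: weighted_L2_def)
    have "cmod (LINT \<xi>|lborel. ?w \<xi> * \<psi> \<xi>) \<le>
        (LINT \<xi>|lborel. l * (bracket s \<xi> * (cmod (?w \<xi>))\<^sup>2) + (1 / l) * (bracket (- s) \<xi> * (cmod (\<psi> \<xi>))\<^sup>2))"
    proof (rule Bochner_Integration.integral_norm_bound_integral[OF i])
      show "integrable lborel (\<lambda>\<xi>. l * (bracket s \<xi> * (cmod (?w \<xi>))\<^sup>2) + (1 / l) * (bracket (- s) \<xi> * (cmod (\<psi> \<xi>))\<^sup>2))"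
        using i1 i2 by (intro Bochner_Integration.integrable_add integrable_mult_right)
      fix \<xi> :: 'a
      let ?b = "bracket s \<xi>" and ?x = "cmod (?w \<xi>)" and ?y = "cmod (\<psi> \<xi>)"
      have b: "0 < ?b" by (rule bracket_pos)
      have binv: "bracket (- s) \<xi> = 1 / ?b"
        by (simp add: bracket_def powr_minus_divide)
      have "0 \<le> (l * ?b * ?x - ?y)\<^sup>2 / (l * ?b)" using l b by simp
      also have "\<dots> = l * (?b * ?x\<^sup>2) + (1 / l) * (1 / ?b * ?y\<^sup>2) - 2 * (?x * ?y)"
        using l b by (simp add: field_simps power2_eq_square)
      finally have "2 * (?x * ?y) \<le> l * (?b * ?x\<^sup>2) + (1 / l) * (bracket (- s) \<xi> * ?y\<^sup>2)"
        unfolding binv by simp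
      moreover have "0 \<le> ?x * ?y" by simp
      ultimately have "?x * ?y \<le> l * (?b * ?x\<^sup>2) + (1 / l) * (bracket (- s) \<xi> * ?y\<^sup>2)" by linarith
      then show "norm (?w \<xi> * \<psi> \<xi>) \<le> l * (?b * ?x\<^sup>2) + (1 / l) * (bracket (- s) \<xi> * ?y\<^sup>2)"
        by (simp only: norm_mult)
    qed
    also have "\<dots> = l * sobolev_integral s ?w + (1 / l) * C"
      using i1 i2 unfolding sobolev_integral_def C_def
      by (subst Bochner_Integration.integral_add) auto
    finally show ?thesis unfolding eq by simp
  qed
  show ?thesis
  proof (rule LIMSEQ_I)
    fix e :: real assume e: "0 < e"
    define l where "l = 2 * (C + 1) / e"
    have l: "0 < l" using e C by (simp add: l_def)
    have "C / l = (e / 2) * (C / (C + 1))" using e C by (simp add: l_def field_simps)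
    also have "\<dots> \<le> (e / 2) * 1" using e C by (intro mult_left_mono) auto
    finally have Cl: "C / l \<le> e / 2" by simp
    have "\<forall>\<^sub>F k in sequentially. sobolev_integral s (\<lambda>\<xi>. v k \<xi> - u \<xi>) < e / 2 / l"
      using lim e l by (intro order_tendstoD(2)) auto
    then obtain N where N: "\<And>k. N \<le> k \<Longrightarrow> sobolev_integral s (\<lambda>\<xi>. v k \<xi> - u \<xi>) < e / 2 / l"
      by (auto simp: eventually_sequentially)
    have "norm (synthesis (v k) \<phi> - synthesis u \<phi>) < e" if k: "N \<le> k" for k
    proof -
      have "l * sobolev_integral s (\<lambda>\<xi>. v k \<xi> - u \<xi>) < l * (e / 2 / l)"
        using N[OF k] l by (rule mult_strict_left_mono)
      then have "l * sobolev_integral s (\<lambda>\<xi>. v k \<xi> - u \<xi>) < e / 2" using l by simp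
      then show ?thesis using bound[OF l, of k] Cl by linarith
    qed
    then show "\<exists>N. \<forall>k\<ge>N. norm (synthesis (v k) \<phi> - synthesis u \<phi>) < e" by blast
  qed
qed

text \<open>
  The sum of the squared distances has finite expectation and is therefore almost surely
  finite. The exceptional null set does not depend on the Schwartz function.
\<close>

lemma mean_square_summable_imp_AE_tendsto:
  fixes u :: "'o \<Rightarrow> 'a::euclidean_space \<Rightarrow> complex"
  assumes P: "prob_space P" and v: "\<And>k::nat. v k \<in> random_transforms P" and u: "u \<in> random_transforms P"
    and close: "\<And>k. mean_square_close P ((1 / 2) ^ k) (v k) u"
  shows "AE \<omega> in P. \<forall>\<phi>\<in>schwartz_functions. (\<lambda>k. synthesis (v k \<omega>) \<phi>) \<longlonglongrightarrow> synthesis (u \<omega>) \<phi>"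
proof -
  define s where "s = - real DIM('a) / 2 - 1"
  have s: "s < - real DIM('a) / 2" by (simp add: s_def)
  let ?B = "bracket_integral TYPE('a) s"
  let ?I = "\<lambda>k \<omega>. sobolev_integral s (\<lambda>\<xi>. v k \<omega> \<xi> - u \<omega> \<xi>)"
  have [measurable]: "?I k \<in> borel_measurable P" for k
    by (rule random_transforms_sobolev_integral_measurable[OF v u])
  have "(\<integral>\<^sup>+\<omega>. (\<Sum>k. ennreal (?I k \<omega>)) \<partial>P) = (\<Sum>k. \<integral>\<^sup>+\<omega>. ennreal (?I k \<omega>) \<partial>P)"
    by (rule nn_integral_suminf) measurable
  also have "\<dots> \<le> (\<Sum>k. ennreal ((1 / 2) ^ k * ?B))"
    by (intro suminf_le nn_integral_sobolev_integral_le[OF P s _ v u close]) auto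
  also have "\<dots> = ennreal (\<Sum>k. (1 / 2) ^ k * ?B)"
    using bracket_integral_nonneg[of "TYPE('a)" s] by (intro suminf_ennreal2 summable_mult2 summable_geometric) auto
  also have "\<dots> < \<infinity>" by simp
  finally have "(\<integral>\<^sup>+\<omega>. (\<Sum>k. ennreal (?I k \<omega>)) \<partial>P) \<noteq> \<infinity>" by simp
  then have "AE \<omega> in P. (\<Sum>k. ennreal (?I k \<omega>)) \<noteq> \<infinity>"
    by (intro nn_integral_PInf_AE) measurable
  then show ?thesis
    using AE_space
  proof eventually_elim
    case (elim \<omega>)
    then have "summable (\<lambda>k. ?I k \<omega>)"
      by (intro summable_suminf_not_top) (auto simp: sobolev_integral_nonneg)
    then have "(\<lambda>k. ?I k \<omega>) \<longlonglongrightarrow> 0" by (rule summable_LIMSEQ_zero)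
    then show ?case
      using elim u v s by (intro ballI synthesis_tendsto[where s = s] random_transforms_weighted_L2) auto
  qed
qed

text \<open>
  A sequence that is Cauchy in the uniform mean-square distance has a subsequence that converges
  almost surely at every frequency; the limit is bounded by Fatou's lemma.  On the null set where
  some Sobolev norm is infinite the limit is replaced by \<open>0\<close>.
\<close>

lemma random_transforms_complete:
  fixes v :: "nat \<Rightarrow> 'o \<Rightarrow> 'a::euclidean_space \<Rightarrow> complex"
  assumes P: "prob_space P" and v: "\<And>j. v j \<in> random_transforms P"
    and cauchy: "\<And>\<epsilon>. 0 < \<epsilon> \<Longrightarrow> \<exists>N. \<forall>i\<ge>N. \<forall>j\<ge>N. mean_square_close P \<epsilon> (v i) (v j)"
  obtains u where "u \<in> random_transforms P"
    "\<And>\<epsilon>. 0 < \<epsilon> \<Longrightarrow> \<exists>N. \<forall>j\<ge>N. mean_square_close P \<epsilon> (v j) u"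
proof -
  interpret prob_space P by fact
  note [measurable] = random_transforms_measurable[OF v] random_transforms_section[OF v]
  have "\<forall>k. \<exists>N. \<forall>i\<ge>N. \<forall>j\<ge>N. mean_square_close P ((1 / 4) ^ k) (v i) (v j)"
    by (intro allI cauchy) simp
  then obtain N where N: "\<And>k i j. N k \<le> i \<Longrightarrow> N k \<le> j \<Longrightarrow> mean_square_close P ((1 / 4) ^ k) (v i) (v j)"
    by metis
  \<comment> \<open>an index sequence along which consecutive members are \<open>4 powr (-
    k)\<close> close; the sum makes it monotone\<close>
  define r where "r k = k + (\<Sum>i\<le>k. N i)" for k
  have r1: "N k \<le> r k" "k \<le> r k" for k
    unfolding r_def by (auto intro: trans_le_add2 member_le_sum)
  have r2: "N k \<le> r (Suc k)" for k
    using r1(1)[of k] by (simp add: r_def)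
  define w where "w \<omega> \<xi> = lim (\<lambda>k. v (r k) \<omega> \<xi>)" for \<omega> \<xi>
  have w_meas[measurable]: "(\<lambda>(\<omega>, \<xi>). w \<omega> \<xi>) \<in> borel_measurable (P \<Otimes>\<^sub>M lborel)"
    unfolding w_def by measurable
  have [measurable]: "(\<lambda>\<omega>. w \<omega> \<xi>) \<in> borel_measurable P" for \<xi>
    by (rule jointly_measurable_section[OF w_meas])
  have conv: "AE \<omega> in P. (\<lambda>k. v (r k) \<omega> \<xi>) \<longlonglongrightarrow> w \<omega> \<xi>" for \<xi>
  proof -
    define Z where "Z k \<omega> = cmod (v (r (Suc k)) \<omega> \<xi> - v (r k) \<omega> \<xi>)" for k \<omega>
    have [measurable]: "Z k \<in> borel_measurable P" for k unfolding Z_def[abs_def] by measurable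
    have Z: "(\<integral>\<^sup>+\<omega>. ennreal (Z k \<omega>) \<partial>P) \<le> ennreal (2 * (1 / 2) ^ k)" for k
    proof -
      have "(\<integral>\<^sup>+\<omega>. ennreal (Z k \<omega>) \<partial>P) \<le> (\<integral>\<^sup>+\<omega>. ennreal (2 ^ k) * ennreal ((Z k \<omega>)\<^sup>2) + ennreal ((1 / 2) ^ k) \<partial>P)"
      proof (rule nn_integral_mono)
        fix \<omega>
        let ?z = "Z k \<omega>"
        \<comment> \<open>a first moment bound from the second moment bound: \<open>2 z \<le> 2
          ^ k z\<^sup>2 + (1 / 2) ^ k\<close>\<close>
        have "0 \<le> (2 ^ k * ?z - 1)\<^sup>2 / 2 ^ k" by simp
        also have "\<dots> = 2 ^ k * ?z\<^sup>2 + (1 / 2) ^ k - 2 * ?z"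
          by (simp add: power2_eq_square field_simps)
        finally have "2 * ?z \<le> 2 ^ k * ?z\<^sup>2 + (1 / 2) ^ k" by simp
        moreover have "0 \<le> ?z" by (simp add: Z_def)
        ultimately have "?z \<le> 2 ^ k * ?z\<^sup>2 + (1 / 2) ^ k" by linarith
        then have "ennreal ?z \<le> ennreal (2 ^ k * ?z\<^sup>2 + (1 / 2) ^ k)" by (rule ennreal_leI)
        also have "\<dots> = ennreal (2 ^ k) * ennreal (?z\<^sup>2) + ennreal ((1 / 2) ^ k)"
          by (subst ennreal_plus) (simp_all add: ennreal_mult)
        finally show "ennreal ?z \<le> ennreal (2 ^ k) * ennreal (?z\<^sup>2) + ennreal ((1 / 2) ^ k)" .
      qed
      also have "\<dots> = ennreal (2 ^ k) * (\<integral>\<^sup>+\<omega>. ennreal ((Z k \<omega>)\<^sup>2) \<partial>P) + ennreal ((1 / 2) ^ k)"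
        by (simp add: nn_integral_add nn_integral_cmult emeasure_space_1)
      also have "\<dots> \<le> ennreal (2 ^ k) * ennreal ((1 / 4) ^ k) + ennreal ((1 / 2) ^ k)"
        using N[OF r2 r1(1), of k] unfolding mean_square_close_def Z_def
        by (intro add_right_mono mult_left_mono) auto
      also have "\<dots> = ennreal (2 ^ k * (1 / 4) ^ k + (1 / 2) ^ k)"
        by (subst ennreal_plus) (simp_all add: ennreal_mult)
      also have "(2::real) ^ k * (1 / 4) ^ k + (1 / 2) ^ k = 2 * (1 / 2) ^ k"
        by (simp flip: power_mult_distrib)
      finally show ?thesis .
    qed
    have "(\<integral>\<^sup>+\<omega>. (\<Sum>k. ennreal (Z k \<omega>)) \<partial>P) = (\<Sum>k. \<integral>\<^sup>+\<omega>. ennreal (Z k \<omega>) \<partial>P)"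
      by (rule nn_integral_suminf) measurable
    also have "\<dots> \<le> (\<Sum>k. ennreal (2 * (1 / 2) ^ k))"
      by (intro suminf_le Z) auto
    also have "\<dots> = ennreal (\<Sum>k. 2 * (1 / 2) ^ k)"
      by (intro suminf_ennreal2 summable_mult summable_geometric) auto
    finally have "(\<integral>\<^sup>+\<omega>. (\<Sum>k. ennreal (Z k \<omega>)) \<partial>P) \<noteq> \<infinity>"
      by (auto simp: top_unique)
    then have "AE \<omega> in P. (\<Sum>k. ennreal (Z k \<omega>)) \<noteq> \<infinity>"
      by (intro nn_integral_PInf_AE) measurable
    then show ?thesis
    proof eventually_elim
      case (elim \<omega>)
      then have "summable (\<lambda>k. Z k \<omega>)"
        by (intro summable_suminf_not_top) (auto simp: Z_def)
      then have "summable (\<lambda>k. v (r (Suc k)) \<omega> \<xi> - v (r k) \<omega> \<xi>)"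
        unfolding Z_def by (rule summable_norm_cancel)
      then have "convergent (\<lambda>n. \<Sum>k<n. v (r (Suc k)) \<omega> \<xi> - v (r k) \<omega> \<xi>)"
        by (simp add: summable_iff_convergent)
      then have "convergent (\<lambda>n. v (r n) \<omega> \<xi> - v (r 0) \<omega> \<xi>)"
        by (simp add: sum_lessThan_telescope[where f = "\<lambda>n. v (r n) \<omega> \<xi>"])
      then have "convergent (\<lambda>n. (v (r n) \<omega> \<xi> - v (r 0) \<omega> \<xi>) + v (r 0) \<omega> \<xi>)"
        by (intro convergent_add convergent_const)
      then show ?case by (simp add: w_def convergent_LIMSEQ_iff)
    qed
  qed
  have w_close: "\<exists>N. \<forall>j\<ge>N. mean_square_close P \<epsilon> (v j) w" if \<epsilon>: "0 < \<epsilon>" for \<epsilon>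
  proof -
    obtain N0 where N0: "\<And>i j. N0 \<le> i \<Longrightarrow> N0 \<le> j \<Longrightarrow> mean_square_close P \<epsilon> (v i) (v j)"
      using cauchy[OF \<epsilon>] by metis
    have "mean_square_close P \<epsilon> (v j) w" if j: "N0 \<le> j" for j
      unfolding mean_square_close_def
    proof
      fix \<xi>
      have "(\<integral>\<^sup>+\<omega>. ennreal ((cmod (v j \<omega> \<xi> - w \<omega> \<xi>))\<^sup>2) \<partial>P) \<le>
          (\<integral>\<^sup>+\<omega>. liminf (\<lambda>k. ennreal ((cmod (v j \<omega> \<xi> - v (r k) \<omega> \<xi>))\<^sup>2)) \<partial>P)"
      proof (rule nn_integral_mono_AE)
        show "AE \<omega> in P. ennreal ((cmod (v j \<omega> \<xi> - w \<omega> \<xi>))\<^sup>2) \<le>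
            liminf (\<lambda>k. ennreal ((cmod (v j \<omega> \<xi> - v (r k) \<omega> \<xi>))\<^sup>2))"
          using conv[of \<xi>]
        proof eventually_elim
          case (elim \<omega>)
          have "(\<lambda>k. ennreal ((cmod (v j \<omega> \<xi> - v (r k) \<omega> \<xi>))\<^sup>2)) \<longlonglongrightarrow> ennreal ((cmod (v j \<omega> \<xi> - w \<omega> \<xi>))\<^sup>2)"
            by (intro tendsto_ennrealI tendsto_intros elim)
          from lim_imp_Liminf[OF sequentially_bot this] show ?case by simp
        qed
      qed
      also have "\<dots> \<le> liminf (\<lambda>k. \<integral>\<^sup>+\<omega>. ennreal ((cmod (v j \<omega> \<xi> - v (r k) \<omega> \<xi>))\<^sup>2) \<partial>P)"
        by (rule nn_integral_liminf) measurable
      also have "\<dots> \<le> limsup (\<lambda>k. \<integral>\<^sup>+\<omega>. ennreal ((cmod (v j \<omega> \<xi> - v (r k) \<omega> \<xi>))\<^sup>2) \<partial>P)"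
        by (rule Liminf_le_Limsup) simp
      also have "\<dots> \<le> ennreal \<epsilon>"
      proof (rule Limsup_bounded)
        have "(\<integral>\<^sup>+\<omega>. ennreal ((cmod (v j \<omega> \<xi> - v (r k) \<omega> \<xi>))\<^sup>2) \<partial>P) \<le> ennreal \<epsilon>" if "N0 \<le> k" for k
          using N0[OF j, of "r k"] that r1(2)[of k] unfolding mean_square_close_def by auto
        then show "\<forall>\<^sub>F k in sequentially. (\<integral>\<^sup>+\<omega>. ennreal ((cmod (v j \<omega> \<xi> - v (r k) \<omega> \<xi>))\<^sup>2) \<partial>P) \<le> ennreal \<epsilon>"
          by (rule eventually_sequentiallyI)
      qed
      finally show "(\<integral>\<^sup>+\<omega>. ennreal ((cmod (v j \<omega> \<xi> - w \<omega> \<xi>))\<^sup>2) \<partial>P) \<le> ennreal \<epsilon>" .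
    qed
    then show ?thesis by blast
  qed
  obtain j where j: "mean_square_close P 1 (v j) w"
    using w_close[of 1] by auto
  obtain C where C: "mean_square_close P C (v j) (\<lambda>_ _. 0)"
    using v[of j] by (auto simp: random_transforms_def)
  define C' where "C' = 2 * 1 + 2 * max 0 C"
  have w0: "mean_square_close P C' w (\<lambda>_ _. 0)"
    unfolding C'_def
    by (rule mean_square_close_triangle[where v = "v j"])
      (use j C in \<open>auto intro: mean_square_close_sym mean_square_close_mono\<close>)
  \<comment> \<open>countably many orders, which increase to \<open>- d / 2\<close>, represent
    all smaller ones\<close>
  define \<sigma> where "\<sigma> k = - real DIM('a) / 2 - 1 / real (Suc k)" for k
  define good where "good \<omega> \<longleftrightarrow> (\<forall>k. (\<integral>\<^sup>+\<xi>. ennreal (bracket (\<sigma> k) \<xi> * (cmod (w \<omega> \<xi>))\<^sup>2) \<partial>lborel) \<noteq> \<infinity>)" for \<omega>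
  have [measurable]: "(\<lambda>\<omega>. \<integral>\<^sup>+\<xi>. ennreal (bracket (\<sigma> k) \<xi> * (cmod (w \<omega> \<xi>))\<^sup>2) \<partial>lborel) \<in> borel_measurable P" for k
    by measurable
  have [measurable]: "Measurable.pred P good"
    unfolding good_def[abs_def] by measurable
  have good: "AE \<omega> in P. good \<omega>"
    unfolding good_def AE_all_countable
  proof
    fix k
    have "(\<integral>\<^sup>+\<omega>. (\<integral>\<^sup>+\<xi>. ennreal (bracket (\<sigma> k) \<xi> * (cmod (w \<omega> \<xi>))\<^sup>2) \<partial>lborel) \<partial>P) \<le> ennreal (C' * bracket_integral TYPE('a) (\<sigma> k))"
      by (rule nn_integral_mean_square_le[OF P _ _ w_meas w0]) (auto simp: \<sigma>_def C'_def)
    then have "(\<integral>\<^sup>+\<omega>. (\<integral>\<^sup>+\<xi>. ennreal (bracket (\<sigma> k) \<xi> * (cmod (w \<omega> \<xi>))\<^sup>2) \<partial>lborel) \<partial>P) \<noteq> \<infinity>"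
      by (auto simp: top_unique)
    then show "AE \<omega> in P. (\<integral>\<^sup>+\<xi>. ennreal (bracket (\<sigma> k) \<xi> * (cmod (w \<omega> \<xi>))\<^sup>2) \<partial>lborel) \<noteq> \<infinity>"
      by (intro nn_integral_PInf_AE) measurable
  qed
  define u where "u \<omega> \<xi> = (if good \<omega> then w \<omega> \<xi> else 0)" for \<omega> \<xi>
  have u_meas: "(\<lambda>(\<omega>, \<xi>). u \<omega> \<xi>) \<in> borel_measurable (P \<Otimes>\<^sub>M lborel)"
    unfolding u_def by measurable
  have u_W: "u \<omega> \<in> weighted_L2 s" if \<omega>: "\<omega> \<in> space P" and s: "s < - real DIM('a) / 2" for \<omega> s
  proof (cases "good \<omega>")
    case True
    obtain k where k: "1 / real (Suc k) < - real DIM('a) / 2 - s"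
      using nat_approx_posE[of "- real DIM('a) / 2 - s"] s by auto
    have [measurable]: "w \<omega> \<in> borel_measurable borel" using measurable_Pair2[OF w_meas \<omega>] by simp
    have "integrable lborel (\<lambda>\<xi>. bracket (\<sigma> k) \<xi> * (cmod (w \<omega> \<xi>))\<^sup>2)"
      using True by (intro integrableI_bounded) (auto simp: good_def abs_mult less_top)
    then have "w \<omega> \<in> weighted_L2 (\<sigma> k)" by (simp add: weighted_L2_def)
    then have "w \<omega> \<in> weighted_L2 s"
      by (rule weighted_L2_antimono) (use k in \<open>simp add: \<sigma>_def\<close>)
    then show ?thesis using True by (simp add: u_def[abs_def])
  next
    case False
    then show ?thesis by (simp add: u_def[abs_def] weighted_L2_def)
  qed
  have uw: "mean_square_close P \<epsilon> z u \<longleftrightarrow> mean_square_close P \<epsilon> z w" for \<epsilon> z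
  proof -
    have "(\<integral>\<^sup>+\<omega>. ennreal ((cmod (z \<omega> \<xi> - u \<omega> \<xi>))\<^sup>2) \<partial>P) = (\<integral>\<^sup>+\<omega>. ennreal ((cmod (z \<omega> \<xi> - w \<omega> \<xi>))\<^sup>2) \<partial>P)" for \<xi>
      by (rule nn_integral_cong_AE) (use good in \<open>eventually_elim, simp add: u_def\<close>)
    then show ?thesis by (simp add: mean_square_close_def)
  qed
  have "mean_square_close P C' u (\<lambda>_ _. 0)"
    using mean_square_close_sym[OF w0] uw mean_square_close_sym by blast
  then have "u \<in> random_transforms P"
    using u_meas u_W by (auto simp: random_transforms_def)
  then show ?thesis
    using w_close uw by (intro that) auto
qed

section \<open>The chaos on compact sets and its extension to the domain\<close>

definition chaos_transform ::
    "'o measure \<Rightarrow> real \<Rightarrow> ('a::euclidean_space \<Rightarrow> 'o \<Rightarrow> real) \<Rightarrow> 'a set \<Rightarrow> 'o \<Rightarrow> 'a \<Rightarrow> complex" where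
  "chaos_transform P \<beta> X A \<omega> \<xi> = fourier (\<lambda>x. indicator A x * imaginary_chaos P \<beta> X \<omega> x) \<xi>"

text \<open>
  As the modulus is deterministic, integrability of the chaos over a set does not depend on
  chance.
\<close>

definition chaos_integrable ::
    "'o measure \<Rightarrow> real \<Rightarrow> 'a::euclidean_space set \<Rightarrow> ('a \<Rightarrow> 'o \<Rightarrow> real) \<Rightarrow> 'a set \<Rightarrow> bool" where
  "chaos_integrable P \<beta> U X A \<longleftrightarrow> A \<in> sets borel \<and> A \<subseteq> U \<and>
     integrable lborel (\<lambda>x. indicator A x * chaos_modulus P \<beta> X x)"

lemma chaos_section_measurable:
  assumes X: "continuous_gaussian_field P U X" and A: "A \<in> sets borel" "A \<subseteq> U" and \<omega>: "\<omega> \<in> space P"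
  shows "(\<lambda>x. indicator A x * imaginary_chaos P \<beta> X \<omega> x) \<in> borel_measurable borel"
  using measurable_Pair2[OF imaginary_chaos_jointly_measurable[OF X A] \<omega>] by simp

lemma norm_indicator_chaos:
  "cmod (indicator A x * imaginary_chaos P \<beta> X \<omega> x) = indicator A x * chaos_modulus P \<beta> X x"
  by (simp add: norm_mult norm_imaginary_chaos indicator_def)

lemma chaos_section_integrable:
  assumes X: "continuous_gaussian_field P U X" and A: "chaos_integrable P \<beta> U X A" and \<omega>: "\<omega> \<in> space P"
  shows "integrable lborel (\<lambda>x. indicator A x * imaginary_chaos P \<beta> X \<omega> x)"
proof (rule Bochner_Integration.integrable_bound)
  show "integrable lborel (\<lambda>x. indicator A x * chaos_modulus P \<beta> X x)"
    using A by (simp add: chaos_integrable_def)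
  show "(\<lambda>x. indicator A x * imaginary_chaos P \<beta> X \<omega> x) \<in> borel_measurable lborel"
    using chaos_section_measurable[OF X _ _ \<omega>, of A \<beta>] A by (simp add: chaos_integrable_def)
  show "AE x in lborel. norm (indicator A x * imaginary_chaos P \<beta> X \<omega> x) \<le> norm (indicator A x * chaos_modulus P \<beta> X x)"
    unfolding norm_indicator_chaos by simp
qed

lemma set_integrable_chaos_iff:
  assumes X: "continuous_gaussian_field P U X" and \<omega>: "\<omega> \<in> space P"
  shows "set_integrable lborel U (imaginary_chaos P \<beta> X \<omega>) \<longleftrightarrow> chaos_integrable P \<beta> U X U"
proof -
  have U: "U \<in> sets borel" using X by (auto simp: continuous_gaussian_field_def)
  have eq: "(\<lambda>x. indicat_real U x *\<^sub>R imaginary_chaos P \<beta> X \<omega> x) = (\<lambda>x. indicator U x * imaginary_chaos P \<beta> X \<omega> x)"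
    by (auto simp: indicator_def)
  have "integrable lborel (\<lambda>x. indicator U x * imaginary_chaos P \<beta> X \<omega> x) \<longleftrightarrow>
      integrable lborel (\<lambda>x. cmod (indicator U x * imaginary_chaos P \<beta> X \<omega> x))"
    using chaos_section_measurable[OF X U order_refl \<omega>, of \<beta>] by (intro integrable_norm_iff[symmetric]) simp
  then show ?thesis
    unfolding set_integrable_def eq norm_indicator_chaos using U by (simp add: chaos_integrable_def)
qed

lemma norm_chaos_transform_le:
  "cmod (chaos_transform P \<beta> X A \<omega> \<xi>) \<le> (LINT x|lborel. indicator A x * chaos_modulus P \<beta> X x)"
  unfolding chaos_transform_def by (rule order_trans[OF norm_fourier_le]) (simp only: norm_indicator_chaos order_refl)

lemma chaos_transform_random:
  fixes X :: "'a::euclidean_space \<Rightarrow> 'o \<Rightarrow> real"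
  assumes X: "continuous_gaussian_field P U X" and A: "chaos_integrable P \<beta> U X A"
  shows "chaos_transform P \<beta> X A \<in> random_transforms P"
proof -
  interpret prob_space P using X by (simp add: continuous_gaussian_field_def)
  have Am[measurable]: "A \<in> sets borel" and AU: "A \<subseteq> U" using A by (auto simp: chaos_integrable_def)
  define F where "F \<omega> x = indicator A x * imaginary_chaos P \<beta> X \<omega> x" for \<omega> x
  have [measurable]: "(\<lambda>(\<omega>, x). F \<omega> x) \<in> borel_measurable (P \<Otimes>\<^sub>M lborel)"
    unfolding F_def by (rule imaginary_chaos_jointly_measurable[OF X Am AU])
  have "(\<lambda>(\<omega>, \<xi>). LINT x|lborel. cis (- 2 * pi * (x \<bullet> \<xi>)) * F \<omega> x) \<in> borel_measurable (P \<Otimes>\<^sub>M lborel)"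
    by measurable
  then have meas: "(\<lambda>(\<omega>, \<xi>). chaos_transform P \<beta> X A \<omega> \<xi>) \<in> borel_measurable (P \<Otimes>\<^sub>M lborel)"
    by (simp add: chaos_transform_def fourier_def F_def)
  let ?B = "LINT x|lborel. indicator A x * chaos_modulus P \<beta> X x"
  have "chaos_transform P \<beta> X A \<omega> \<in> weighted_L2 s" if "\<omega> \<in> space P" "s < - real DIM('a) / 2" for \<omega> s
    using measurable_Pair2[OF meas that(1)] that(2)
    by (intro weighted_L2_bounded[where B = ?B] norm_chaos_transform_le) auto
  moreover have "mean_square_close P (?B\<^sup>2) (chaos_transform P \<beta> X A) (\<lambda>_ _. 0)"
    unfolding mean_square_close_def
  proof
    fix \<xi> :: 'a
    have "(\<integral>\<^sup>+\<omega>. ennreal ((cmod (chaos_transform P \<beta> X A \<omega> \<xi> - 0))\<^sup>2) \<partial>P) \<le> (\<integral>\<^sup>+\<omega>. ennreal (?B\<^sup>2) \<partial>P)"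
      using norm_chaos_transform_le[of P \<beta> X A] by (intro nn_integral_mono ennreal_leI power_mono) auto
    then show "(\<integral>\<^sup>+\<omega>. ennreal ((cmod (chaos_transform P \<beta> X A \<omega> \<xi> - 0))\<^sup>2) \<partial>P) \<le> ennreal (?B\<^sup>2)"
      by (simp add: emeasure_space_1)
  qed
  ultimately show ?thesis using meas by (auto simp: random_transforms_def)
qed

text \<open>
  The multiplication formula, applied to the chaos and the reflected transform of the test
  function.
\<close>

lemma fun_distribution_eq_synthesis:
  fixes X :: "'a::euclidean_space \<Rightarrow> 'o \<Rightarrow> real"
  assumes X: "continuous_gaussian_field P U X" and A: "chaos_integrable P \<beta> U X A" and \<omega>: "\<omega> \<in> space P"
  shows "fun_distribution A (imaginary_chaos P \<beta> X \<omega>) = synthesis (chaos_transform P \<beta> X A \<omega>)"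
proof
  fix \<phi> :: "'a \<Rightarrow> complex"
  show "fun_distribution A (imaginary_chaos P \<beta> X \<omega>) \<phi> = synthesis (chaos_transform P \<beta> X A \<omega>) \<phi>"
  proof (cases "\<phi> \<in> schwartz_functions")
    case True
    let ?f = "\<lambda>x. indicator A x * imaginary_chaos P \<beta> X \<omega> x"
    let ?h = "\<lambda>\<xi>. fourier \<phi> (- \<xi>)"
    have "fun_distribution A (imaginary_chaos P \<beta> X \<omega>) \<phi> = (LINT x|lborel. ?f x * fourier ?h x)"
      unfolding fourier_of_reflected_fourier[OF True] using True
      by (auto simp: fun_distribution_def set_lebesgue_integral_def indicator_def intro!: Bochner_Integration.integral_cong)
    also have "\<dots> = (LINT \<xi>|lborel. fourier ?f \<xi> * ?h \<xi>)"
      by (rule fourier_multiplication[symmetric, OF chaos_section_integrable[OF X A \<omega>]])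
        (intro schwartz_integrable schwartz_reflect fourier_schwartz True)
    also have "\<dots> = synthesis (chaos_transform P \<beta> X A \<omega>) \<phi>"
      by (simp add: synthesis_schwartz[OF True] chaos_transform_def)
    finally show ?thesis .
  qed (simp add: fun_distribution_def synthesis_def)
qed

text \<open>
  The covariance of the difference of two chaoses, one on \<open>A\<close> and the other on \<open>B\<close>.  Its \<open>L1\<close> norm
  bounds their mean-square distance at every frequency, and its integral is a second moment.
\<close>

definition energy ::
    "'o measure \<Rightarrow> real \<Rightarrow> ('a \<Rightarrow> 'o \<Rightarrow> real) \<Rightarrow> 'a set \<Rightarrow> ('a \<Rightarrow> 'o \<Rightarrow> real) \<Rightarrow> 'a set \<Rightarrow> 'a \<times> 'a \<Rightarrow> real" where
  "energy P \<beta> X A Y B z =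
     indicator (A \<times> A) z * chaos_kernel P \<beta> X X z + indicator (B \<times> B) z * chaos_kernel P \<beta> Y Y z
     - indicator (A \<times> B) z * chaos_kernel P \<beta> X Y z - indicator (B \<times> A) z * chaos_kernel P \<beta> Y X z"

text \<open>
  The Fourier transform at \<open>\<xi>\<close> multiplies the covariance by a factor of
  modulus \<open>1\<close>, which does not affect the \<open>L1\<close> norm. At \<open>\<xi>
  = 0\<close> the factor is \<open>1\<close>, and the integral of the covariance is the second
  moment of the difference of the total masses.
\<close>

lemma
  fixes X Y :: "'a::euclidean_space \<Rightarrow> 'o \<Rightarrow> real"
  assumes X: "continuous_gaussian_field P U X" and Y: "continuous_gaussian_field P U Y"
    and XY: "gaussian_pair P U X Y"
    and A: "chaos_integrable P \<beta> U X A" and B: "chaos_integrable P \<beta> U Y B"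
  shows energy_integrable: "integrable (lborel \<Otimes>\<^sub>M lborel) (energy P \<beta> X A Y B)"
    and mean_square_le_energy:
      "mean_square_close P (LINT z|(lborel \<Otimes>\<^sub>M lborel). \<bar>energy P \<beta> X A Y B z\<bar>)
         (chaos_transform P \<beta> X A) (chaos_transform P \<beta> Y B)"
    and energy_nonneg: "0 \<le> (LINT z|(lborel \<Otimes>\<^sub>M lborel). energy P \<beta> X A Y B z)"
proof -
  have P: "prob_space P" using X by (simp add: continuous_gaussian_field_def)
  interpret prob_space P by fact
  have Am[measurable]: "A \<in> sets borel" and AU: "A \<subseteq> U" using A by (auto simp: chaos_integrable_def)
  have Bm[measurable]: "B \<in> sets borel" and BU: "B \<subseteq> U" using B by (auto simp: chaos_integrable_def)
  define F where "F \<omega> x = indicator A x * imaginary_chaos P \<beta> X \<omega> x" for \<omega> x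
  define G where "G \<omega> x = indicator B x * imaginary_chaos P \<beta> Y \<omega> x" for \<omega> x
  have [measurable]: "(\<lambda>(\<omega>, x). F \<omega> x) \<in> borel_measurable (P \<Otimes>\<^sub>M lborel)"
    unfolding F_def by (rule imaginary_chaos_jointly_measurable[OF X Am AU])
  have [measurable]: "(\<lambda>(\<omega>, x). G \<omega> x) \<in> borel_measurable (P \<Otimes>\<^sub>M lborel)"
    unfolding G_def by (rule imaginary_chaos_jointly_measurable[OF Y Bm BU])
  define a where "a x = indicator A x * chaos_modulus P \<beta> X x + indicator B x * chaos_modulus P \<beta> Y x" for x
  have a: "integrable lborel a"
    unfolding a_def[abs_def] using A B by (auto simp: chaos_integrable_def)
  have Fint: "integrable lborel (F \<omega>)" "integrable lborel (G \<omega>)" if "\<omega> \<in> space P" for \<omega>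
    unfolding F_def[abs_def] G_def[abs_def]
    using chaos_section_integrable[OF X A that] chaos_section_integrable[OF Y B that] by auto
  define f where "f \<xi> \<omega> x = cis (- 2 * pi * (x \<bullet> \<xi>)) * (F \<omega> x - G \<omega> x)" for \<xi> \<omega> x
  have f_meas: "(\<lambda>(\<omega>, x). f \<xi> \<omega> x) \<in> borel_measurable (P \<Otimes>\<^sub>M lborel)" for \<xi>
    unfolding f_def by measurable
  have f_le: "cmod (f \<xi> \<omega> x) \<le> a x" for \<xi> \<omega> x
  proof -
    have "cmod (f \<xi> \<omega> x) = cmod (F \<omega> x - G \<omega> x)" by (simp add: f_def norm_mult)
    also have "\<dots> \<le> cmod (F \<omega> x) + cmod (G \<omega> x)" by (rule norm_triangle_ineq4)
    also have "\<dots> = a x" by (simp only: F_def G_def a_def norm_indicator_chaos)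
    finally show ?thesis .
  qed
  have f_int: "(LINT x|lborel. f \<xi> \<omega> x) = chaos_transform P \<beta> X A \<omega> \<xi> - chaos_transform P \<beta> Y B \<omega> \<xi>"
    if "\<omega> \<in> space P" for \<xi> \<omega>
    using fourier_diff[OF Fint[OF that], of \<xi>]
    by (simp add: chaos_transform_def fourier_def f_def F_def G_def)
  define e where "e \<xi> z = cis (- 2 * pi * (fst z \<bullet> \<xi>)) * cnj (cis (- 2 * pi * (snd z \<bullet> \<xi>)))" for \<xi> and z :: "'a \<times> 'a"
  have YX: "gaussian_pair P U Y X" by (rule gaussian_pair_sym[OF XY])
  have XX: "gaussian_pair P U X X" and YY: "gaussian_pair P U Y Y"
    using X Y by (auto simp: continuous_gaussian_field_def)
  have moment: "integrable P (\<lambda>\<omega>. indicator A' x * imaginary_chaos P \<beta> X' \<omega> x * cnj (indicator B' y * imaginary_chaos P \<beta> Y' \<omega> y)) \<and>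
      (LINT \<omega>|P. indicator A' x * imaginary_chaos P \<beta> X' \<omega> x * cnj (indicator B' y * imaginary_chaos P \<beta> Y' \<omega> y)) =
      of_real (indicator (A' \<times> B') (x, y) * chaos_kernel P \<beta> X' Y' (x, y))"
    if "continuous_gaussian_field P U X'" "continuous_gaussian_field P U Y'" "gaussian_pair P U X' Y'"
      "A' \<subseteq> U" "B' \<subseteq> U" for X' Y' A' B' and x y :: 'a
  proof (cases "x \<in> A' \<and> y \<in> B'")
    case True
    then show ?thesis
      using chaos_moment[OF that(1-3), of x y \<beta>] that(4,5) by (auto simp: indicator_def)
  next
    case False
    then show ?thesis by (auto simp: indicator_def)
  qed
  have E: "(LINT \<omega>|P. f \<xi> \<omega> (fst z) * cnj (f \<xi> \<omega> (snd z))) = e \<xi> z * of_real (energy P \<beta> X A Y B z)" for \<xi> z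
  proof -
    obtain x y where z: "z = (x, y)" by (cases z)
    note m = moment[OF X X XX AU AU, of x y] moment[OF Y Y YY BU BU, of x y]
      moment[OF X Y XY AU BU, of x y] moment[OF Y X YX BU AU, of x y]
    have "(LINT \<omega>|P. f \<xi> \<omega> x * cnj (f \<xi> \<omega> y)) =
        (LINT \<omega>|P. e \<xi> z * (F \<omega> x * cnj (F \<omega> y) + G \<omega> x * cnj (G \<omega> y) - F \<omega> x * cnj (G \<omega> y) - G \<omega> x * cnj (F \<omega> y)))"
      by (intro Bochner_Integration.integral_cong) (auto simp: f_def e_def z algebra_simps)
    also have "\<dots> = e \<xi> z * (LINT \<omega>|P. F \<omega> x * cnj (F \<omega> y) + G \<omega> x * cnj (G \<omega> y) - F \<omega> x * cnj (G \<omega> y) - G \<omega> x * cnj (F \<omega> y))"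
      by (rule integral_mult_right_zero)
    also have "(LINT \<omega>|P. F \<omega> x * cnj (F \<omega> y) + G \<omega> x * cnj (G \<omega> y) - F \<omega> x * cnj (G \<omega> y) - G \<omega> x * cnj (F \<omega> y)) =
        of_real (energy P \<beta> X A Y B z)"
      using m unfolding F_def G_def energy_def z
      by (simp only: Bochner_Integration.integral_diff Bochner_Integration.integral_add
          Bochner_Integration.integrable_diff Bochner_Integration.integrable_add of_real_add of_real_diff)
    finally show ?thesis by (simp add: z)
  qed
  have norm_e: "cmod (e \<xi> z) = 1" for \<xi> z by (simp add: e_def norm_mult)
  have e0: "e 0 z = 1" for z by (simp add: e_def)
  note sm = second_moment_integral[OF P f_meas a f_le]
  have "integrable (lborel \<Otimes>\<^sub>M lborel) (\<lambda>z. of_real (energy P \<beta> X A Y B z) :: complex)"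
    using sm(1)[of 0] unfolding E e0 by simp
  then show int: "integrable (lborel \<Otimes>\<^sub>M lborel) (energy P \<beta> X A Y B)"
    by (simp add: complex_of_real_integrable_eq)
  let ?V = "\<lambda>\<xi> \<omega>. (cmod (chaos_transform P \<beta> X A \<omega> \<xi> - chaos_transform P \<beta> Y B \<omega> \<xi>))\<^sup>2"
  have V: "complex_of_real (LINT \<omega>|P. ?V \<xi> \<omega>) = (LINT z|(lborel \<Otimes>\<^sub>M lborel). e \<xi> z * of_real (energy P \<beta> X A Y B z))" for \<xi>
  proof -
    have "complex_of_real (LINT \<omega>|P. ?V \<xi> \<omega>) = (LINT \<omega>|P. of_real ((cmod (LINT x|lborel. f \<xi> \<omega> x))\<^sup>2))"
      unfolding integral_complex_of_real[symmetric]
      by (intro Bochner_Integration.integral_cong) (simp_all only: f_int)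
    then show ?thesis unfolding sm(2) E .
  qed
  have RT: "chaos_transform P \<beta> X A \<in> random_transforms P" "chaos_transform P \<beta> Y B \<in> random_transforms P"
    by (rule chaos_transform_random[OF X A], rule chaos_transform_random[OF Y B])
  show "mean_square_close P (LINT z|(lborel \<Otimes>\<^sub>M lborel). \<bar>energy P \<beta> X A Y B z\<bar>)
      (chaos_transform P \<beta> X A) (chaos_transform P \<beta> Y B)"
    unfolding mean_square_close_def
  proof
    fix \<xi> :: 'a
    note [measurable] = random_transforms_section[OF RT(1)] random_transforms_section[OF RT(2)]
    have bd: "cmod (chaos_transform P \<beta> X A \<omega> \<xi> - chaos_transform P \<beta> Y B \<omega> \<xi>) \<le>
        (LINT x|lborel. indicator A x * chaos_modulus P \<beta> X x) + (LINT x|lborel. indicator B x * chaos_modulus P \<beta> Y x)" for \<omega>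
      by (rule order_trans[OF norm_triangle_ineq4]) (intro add_mono norm_chaos_transform_le)
    have iV: "integrable P (?V \<xi>)"
      by (rule integrable_const_bound[where B = "((LINT x|lborel. indicator A x * chaos_modulus P \<beta> X x) +
            (LINT x|lborel. indicator B x * chaos_modulus P \<beta> Y x))\<^sup>2"])
        (use bd in \<open>auto intro!: AE_I2 power_mono\<close>)
    have "(LINT \<omega>|P. ?V \<xi> \<omega>) \<le> cmod (complex_of_real (LINT \<omega>|P. ?V \<xi> \<omega>))"
      by (simp only: norm_of_real abs_ge_self)
    also have "\<dots> \<le> (LINT z|(lborel \<Otimes>\<^sub>M lborel). cmod (e \<xi> z * of_real (energy P \<beta> X A Y B z)))"
      unfolding V by (rule integral_norm_bound)
    also have "\<dots> = (LINT z|(lborel \<Otimes>\<^sub>M lborel). \<bar>energy P \<beta> X A Y B z\<bar>)"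
      by (simp add: norm_mult norm_e)
    finally have "ennreal (LINT \<omega>|P. ?V \<xi> \<omega>) \<le> ennreal (LINT z|(lborel \<Otimes>\<^sub>M lborel). \<bar>energy P \<beta> X A Y B z\<bar>)"
      by (rule ennreal_leI)
    then show "(\<integral>\<^sup>+\<omega>. ennreal (?V \<xi> \<omega>) \<partial>P) \<le> ennreal (LINT z|(lborel \<Otimes>\<^sub>M lborel). \<bar>energy P \<beta> X A Y B z\<bar>)"
      by (subst nn_integral_eq_integral[OF iV]) auto
  qed
  have "complex_of_real (LINT \<omega>|P. ?V 0 \<omega>) = complex_of_real (LINT z|(lborel \<Otimes>\<^sub>M lborel). energy P \<beta> X A Y B z)"
    unfolding V e0 by simp
  then have "(LINT z|(lborel \<Otimes>\<^sub>M lborel). energy P \<beta> X A Y B z) = (LINT \<omega>|P. ?V 0 \<omega>)"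
    by (simp only: of_real_eq_iff)
  then show "0 \<le> (LINT z|(lborel \<Otimes>\<^sub>M lborel). energy P \<beta> X A Y B z)"
    by (simp add: integral_nonneg_AE)
qed

text \<open>
  The standing assumptions on one approximating field: its variance is locally bounded, and the
  second moment of the total mass of its chaos is finite.
\<close>

definition chaos_field ::
    "'o measure \<Rightarrow> real \<Rightarrow> 'a::euclidean_space set \<Rightarrow> ('a \<Rightarrow> 'o \<Rightarrow> real) \<Rightarrow> bool" where
  "chaos_field P \<beta> U X \<longleftrightarrow> continuous_gaussian_field P U X \<and>
     (\<forall>K. compact K \<and> K \<subseteq> U \<longrightarrow> (\<exists>B. \<forall>x\<in>K. covar P (X x) (X x) \<le> B)) \<and>
     integrable (lborel \<Otimes>\<^sub>M lborel) (\<lambda>z. indicator (U \<times> U) z * chaos_kernel P \<beta> X X z)"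

text \<open>
  The second moment of the total mass of the chaos outside \<open>K\<close>.
\<close>

definition chaos_tail ::
    "'o measure \<Rightarrow> real \<Rightarrow> 'a::euclidean_space set \<Rightarrow> ('a \<Rightarrow> 'o \<Rightarrow> real) \<Rightarrow> 'a set \<Rightarrow> real" where
  "chaos_tail P \<beta> U X K = (LINT z|(lborel \<Otimes>\<^sub>M lborel). indicator ((U - K) \<times> (U - K)) z * chaos_kernel P \<beta> X X z)"

lemma chaos_field_continuous: "chaos_field P \<beta> U X \<Longrightarrow> continuous_gaussian_field P U X"
  by (simp add: chaos_field_def)

lemma chaos_kernel_nonneg: "0 \<le> chaos_kernel P \<beta> X Y z"
  by (simp add: chaos_kernel_def)

lemma chaos_tail_nonneg: "0 \<le> chaos_tail P \<beta> U X K"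
  unfolding chaos_tail_def by (intro integral_nonneg_AE) (simp add: chaos_kernel_nonneg)

lemma chaos_integrable_compact:
  fixes X :: "'a::euclidean_space \<Rightarrow> 'o \<Rightarrow> real"
  assumes X: "chaos_field P \<beta> U X" and K: "compact K" "K \<subseteq> U"
  shows "chaos_integrable P \<beta> U X K"
proof -
  have Km: "K \<in> sets borel" using K by (simp add: borel_compact)
  have "\<exists>B. \<forall>x\<in>K. covar P (X x) (X x) \<le> B"
    using X K by (simp add: chaos_field_def)
  then obtain B where B: "\<And>x. x \<in> K \<Longrightarrow> covar P (X x) (X x) \<le> B"
    by blast
  have "integrable lborel (\<lambda>x. indicator K x * chaos_modulus P \<beta> X x)"
  proof (rule Bochner_Integration.integrable_bound)
    show "integrable lborel (\<lambda>x. exp (\<beta>\<^sup>2 / 2 * B) * indicator K x :: real)"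
      using Km emeasure_compact_finite[OF K(1)] by (intro integrable_mult_right integrable_real_indicator) auto
    show "(\<lambda>x. indicator K x * chaos_modulus P \<beta> X x) \<in> borel_measurable lborel"
      by (rule chaos_modulus_measurable[OF chaos_field_continuous[OF X] Km K(2)])
    show "AE x in lborel. norm (indicator K x * chaos_modulus P \<beta> X x) \<le> norm (exp (\<beta>\<^sup>2 / 2 * B) * indicator K x :: real)"
      using B by (intro AE_I2) (auto simp: chaos_modulus_def indicator_def intro!: mult_left_mono)
  qed
  then show ?thesis using Km K by (simp add: chaos_integrable_def)
qed

lemma chaos_kernel_integrable_subset:
  fixes X :: "'a::euclidean_space \<Rightarrow> 'o \<Rightarrow> real"
  assumes X: "chaos_field P \<beta> U X" and A[measurable]: "A \<in> sets borel" and AU: "A \<subseteq> U"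
  shows "integrable (lborel \<Otimes>\<^sub>M lborel) (\<lambda>z. indicator (A \<times> A) z * chaos_kernel P \<beta> X X z)"
proof (rule Bochner_Integration.integrable_bound)
  show "integrable (lborel \<Otimes>\<^sub>M lborel) (\<lambda>z. indicator (U \<times> U) z * chaos_kernel P \<beta> X X z)"
    using X by (simp add: chaos_field_def)
  have eq: "(\<lambda>z. indicator (A \<times> A) z * chaos_kernel P \<beta> X X z) =
      (\<lambda>z. indicator (A \<times> A) z * (indicator (U \<times> U) z * chaos_kernel P \<beta> X X z))"
    using AU by (auto simp: indicator_def fun_eq_iff)
  note [measurable] = chaos_kernel_measurable[OF chaos_field_continuous[OF X] chaos_field_continuous[OF X], of \<beta>]
  show "(\<lambda>z. indicator (A \<times> A) z * chaos_kernel P \<beta> X X z) \<in> borel_measurable (lborel \<Otimes>\<^sub>M lborel)"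
    unfolding eq by measurable
  show "AE z in lborel \<Otimes>\<^sub>M lborel. norm (indicator (A \<times> A) z * chaos_kernel P \<beta> X X z) \<le>
      norm (indicator (U \<times> U) z * chaos_kernel P \<beta> X X z)"
    using AU by (intro AE_I2) (auto simp: indicator_def)
qed

text \<open>
  Dominated convergence, with the kernel on \<open>U \<times> U\<close> as the dominating
  function.
\<close>

lemma chaos_tail_tendsto:
  fixes X :: "'a::euclidean_space \<Rightarrow> 'o \<Rightarrow> real"
  assumes X: "chaos_field P \<beta> U X" and K: "incseq K" "\<And>j. compact (K j)" "(\<Union>j. K j) = U"
  shows "(\<lambda>j. chaos_tail P \<beta> U X (K j)) \<longlonglongrightarrow> 0"
proof -
  let ?D = "(lborel :: 'a measure) \<Otimes>\<^sub>M (lborel :: 'a measure)"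
  have U[measurable]: "U \<in> sets borel" using X by (auto simp: chaos_field_def continuous_gaussian_field_def)
  have Km[measurable]: "K j \<in> sets borel" for j using K(2) by (simp add: borel_compact)
  have "(\<lambda>j. LINT z|?D. indicator ((U - K j) \<times> (U - K j)) z * chaos_kernel P \<beta> X X z) \<longlonglongrightarrow> (LINT z|?D. (0::real))"
  proof (rule integral_dominated_convergence)
    show "integrable ?D (\<lambda>z. indicator (U \<times> U) z * chaos_kernel P \<beta> X X z)"
      using X by (simp add: chaos_field_def)
    show "(\<lambda>z. indicator ((U - K j) \<times> (U - K j)) z * chaos_kernel P \<beta> X X z) \<in> borel_measurable ?D" for j
      using chaos_kernel_integrable_subset[OF X, of "U - K j"] by auto
    show "AE z in ?D. (\<lambda>j. indicator ((U - K j) \<times> (U - K j)) z * chaos_kernel P \<beta> X X z) \<longlonglongrightarrow> 0"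
    proof (intro AE_I2 tendsto_eventually)
      fix z :: "'a \<times> 'a"
      show "\<forall>\<^sub>F j in sequentially. indicator ((U - K j) \<times> (U - K j)) z * chaos_kernel P \<beta> X X z = 0"
      proof (cases "fst z \<in> U")
        case True
        then obtain i where i: "fst z \<in> K i" using K(3) by auto
        have "fst z \<in> K j" if "i \<le> j" for j using i monoD[OF K(1) that] by auto
        then show ?thesis
          by (intro eventually_sequentiallyI[of i]) (auto simp: indicator_def mem_Times_iff)
      next
        case False
        then show ?thesis by (intro always_eventually allI) (auto simp: indicator_def mem_Times_iff)
      qed
    qed
    show "AE z in ?D. norm (indicator ((U - K j) \<times> (U - K j)) z * chaos_kernel P \<beta> X X z) \<le>
        indicator (U \<times> U) z * chaos_kernel P \<beta> X X z" for j
      by (intro AE_I2) (auto simp: indicator_def chaos_kernel_nonneg)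
  qed simp
  then show ?thesis by (simp add: chaos_tail_def)
qed

lemma mean_square_le_tail:
  fixes X :: "'a::euclidean_space \<Rightarrow> 'o \<Rightarrow> real"
  assumes X: "chaos_field P \<beta> U X" and A: "chaos_integrable P \<beta> U X A" and B: "chaos_integrable P \<beta> U X B"
    and BA: "B \<subseteq> A"
  shows "mean_square_close P (chaos_tail P \<beta> U X B) (chaos_transform P \<beta> X A) (chaos_transform P \<beta> X B)"
proof -
  let ?D = "(lborel :: 'a measure) \<Otimes>\<^sub>M (lborel :: 'a measure)"
  have XX: "gaussian_pair P U X X" using X by (simp add: chaos_field_def continuous_gaussian_field_def)
  have U[measurable]: "U \<in> sets borel" using X by (auto simp: chaos_field_def continuous_gaussian_field_def)
  have [measurable]: "A \<in> sets borel" "B \<in> sets borel" and AU: "A \<subseteq> U"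
    using A B by (auto simp: chaos_integrable_def)
  note close = mean_square_le_energy[OF chaos_field_continuous[OF X] chaos_field_continuous[OF X] XX A B]
  have "(LINT z|?D. \<bar>energy P \<beta> X A X B z\<bar>) \<le> chaos_tail P \<beta> U X B"
    unfolding chaos_tail_def
  proof (rule integral_mono)
    show "integrable ?D (\<lambda>z. \<bar>energy P \<beta> X A X B z\<bar>)"
      by (intro integrable_abs energy_integrable[OF chaos_field_continuous[OF X] chaos_field_continuous[OF X] XX A B])
    show "integrable ?D (\<lambda>z. indicator ((U - B) \<times> (U - B)) z * chaos_kernel P \<beta> X X z)"
      by (intro chaos_kernel_integrable_subset[OF X]) auto
    show "\<bar>energy P \<beta> X A X B z\<bar> \<le> indicator ((U - B) \<times> (U - B)) z * chaos_kernel P \<beta> X X z" for z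
      using BA AU by (cases z) (auto simp: energy_def indicator_def chaos_kernel_nonneg)
  qed
  from mean_square_close_mono[OF close this] show ?thesis .
qed

text \<open>
  The transform of the extension by zero, characterized by a quantitative bound for every
  compact set at once. The factor \<open>4\<close> comes from two triangle inequalities, and
  \<open>\<delta>\<close> from the passage to the limit.
\<close>

definition chaos_extension ::
    "'o measure \<Rightarrow> real \<Rightarrow> 'a::euclidean_space set \<Rightarrow> ('a \<Rightarrow> 'o \<Rightarrow> real) \<Rightarrow> ('o \<Rightarrow> 'a \<Rightarrow> complex) \<Rightarrow> bool" where
  "chaos_extension P \<beta> U X v \<longleftrightarrow> v \<in> random_transforms P \<and>
     (\<forall>K \<delta>. compact K \<and> K \<subseteq> U \<and> 0 < \<delta> \<longrightarrow>
        mean_square_close P (4 * chaos_tail P \<beta> U X K + \<delta>) (chaos_transform P \<beta> X K) v)"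

lemma compact_exhaustion:
  fixes U :: "'a::euclidean_space set"
  assumes "open U"
  obtains L :: "nat \<Rightarrow> 'a set" where "incseq L" "\<And>j. compact (L j)" "\<And>j. L j \<subseteq> U" "(\<Union>j. L j) = U"
proof -
  obtain L :: "nat \<Rightarrow> 'a set" where L: "\<And>j. compact (L j)" "\<And>j. L j \<subseteq> U"
      "\<And>j. L j \<subseteq> interior (L (Suc j))" "(\<Union>j. L j) = U"
    by (rule open_Union_compact_subsets[OF assms]) (rule that)
  have "L j \<subseteq> L (Suc j)" for j using L(3)[of j] interior_subset by blast
  then have "incseq L" by (rule incseq_SucI)
  then show ?thesis by (rule that[OF _ L(1,2,4)])
qed

text \<open>
  If the modulus is integrable over the whole domain then the extension is the chaos on the
  domain itself; otherwise it is the limit over compact sets.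
\<close>

lemma chaos_extension_exists:
  fixes X :: "'a::euclidean_space \<Rightarrow> 'o \<Rightarrow> real"
  assumes X: "chaos_field P \<beta> U X"
  obtains v where "chaos_extension P \<beta> U X v"
    "chaos_integrable P \<beta> U X U \<Longrightarrow> v = chaos_transform P \<beta> X U"
proof (cases "chaos_integrable P \<beta> U X U")
  case True
  have "chaos_extension P \<beta> U X (chaos_transform P \<beta> X U)"
    unfolding chaos_extension_def
  proof (intro conjI allI impI)
    show "chaos_transform P \<beta> X U \<in> random_transforms P"
      by (rule chaos_transform_random[OF chaos_field_continuous[OF X] True])
    fix K and \<delta> :: real assume K: "compact K \<and> K \<subseteq> U \<and> 0 < \<delta>"
    then have "mean_square_close P (chaos_tail P \<beta> U X K) (chaos_transform P \<beta> X U) (chaos_transform P \<beta> X K)"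
      by (intro mean_square_le_tail[OF X True chaos_integrable_compact[OF X]]) auto
    then have "mean_square_close P (chaos_tail P \<beta> U X K) (chaos_transform P \<beta> X K) (chaos_transform P \<beta> X U)"
      by (rule mean_square_close_sym)
    then show "mean_square_close P (4 * chaos_tail P \<beta> U X K + \<delta>) (chaos_transform P \<beta> X K) (chaos_transform P \<beta> X U)"
      by (rule mean_square_close_mono) (use K chaos_tail_nonneg[of P \<beta> U X K] in auto)
  qed
  then show ?thesis by (rule that) simp
next
  case False
  have P: "prob_space P" and U: "open U" using X by (auto simp: chaos_field_def continuous_gaussian_field_def)
  obtain L where L: "incseq L" "\<And>j. compact (L j)" "\<And>j. L j \<subseteq> U" "(\<Union>j. L j) = U"
    by (rule compact_exhaustion[OF U]) (rule that)
  note LI = chaos_integrable_compact[OF X L(2) L(3)]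
  note RT = chaos_transform_random[OF chaos_field_continuous[OF X]]
  let ?V = "\<lambda>K. chaos_transform P \<beta> X K"
  have small: "\<exists>N. \<forall>j\<ge>N. chaos_tail P \<beta> U X (L j) < \<epsilon>" if "0 < \<epsilon>" for \<epsilon>
    using order_tendstoD(2)[OF chaos_tail_tendsto[OF X L(1) L(2) L(4)] that]
    by (simp add: eventually_sequentially)
  have cauchy: "\<exists>N. \<forall>i\<ge>N. \<forall>j\<ge>N. mean_square_close P \<epsilon> (?V (L i)) (?V (L j))" if \<epsilon>: "0 < \<epsilon>" for \<epsilon>
  proof -
    obtain N where N: "\<And>j. N \<le> j \<Longrightarrow> chaos_tail P \<beta> U X (L j) < \<epsilon>" using small[OF \<epsilon>] by blast
    have ord: "mean_square_close P \<epsilon> (?V (L j)) (?V (L i))" if "N \<le> i" "i \<le> j" for i j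
      by (rule mean_square_close_mono[OF mean_square_le_tail[OF X LI LI]])
        (use N[OF that(1)] monoD[OF L(1) that(2)] in auto)
    have "mean_square_close P \<epsilon> (?V (L i)) (?V (L j))" if "N \<le> i" "N \<le> j" for i j
    proof (cases "i \<le> j")
      case True
      show ?thesis by (rule mean_square_close_sym[OF ord[OF that(1) True]])
    next
      case False
      then show ?thesis by (intro ord that) simp
    qed
    then show ?thesis by blast
  qed
  have VRT: "?V (L j) \<in> random_transforms P" for j by (rule RT[OF LI])
  obtain v where v: "v \<in> random_transforms P"
    and lim: "\<And>\<epsilon>. 0 < \<epsilon> \<Longrightarrow> \<exists>N. \<forall>j\<ge>N. mean_square_close P \<epsilon> (?V (L j)) v"
    by (rule random_transforms_complete[OF P VRT cauchy]) (assumption, rule that, assumption+)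
  have "chaos_extension P \<beta> U X v"
    unfolding chaos_extension_def
  proof (intro conjI allI impI v)
    fix K and \<delta> :: real assume K: "compact K \<and> K \<subseteq> U \<and> 0 < \<delta>"
    let ?t = "chaos_tail P \<beta> U X"
    have \<delta>: "0 < \<delta> / 8" using K by simp
    obtain N1 where N1: "\<And>j. N1 \<le> j \<Longrightarrow> ?t (L j) < \<delta> / 8" using small[OF \<delta>] by blast
    obtain N2 where N2: "\<And>j. N2 \<le> j \<Longrightarrow> mean_square_close P (\<delta> / 8) (?V (L j)) v" using lim[OF \<delta>] by blast
    define j where "j = max N1 N2"
    have tj: "?t (L j) < \<delta> / 8" by (rule N1) (simp add: j_def)
    have Lv: "mean_square_close P (\<delta> / 8) (?V (L j)) v" by (rule N2) (simp add: j_def)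
    have KI: "chaos_integrable P \<beta> U X K" using K by (intro chaos_integrable_compact[OF X]) auto
    \<comment> \<open>\<open>K\<close> and \<open>L j\<close> need not be nested, so they are
      compared through their union\<close>
    have KL: "chaos_integrable P \<beta> U X (K \<union> L j)"
      using K L by (intro chaos_integrable_compact[OF X] compact_Un) auto
    have 1: "mean_square_close P (?t K) (?V K) (?V (K \<union> L j))"
      by (rule mean_square_close_sym[OF mean_square_le_tail[OF X KL KI]]) simp
    have 2: "mean_square_close P (?t (L j)) (?V (K \<union> L j)) (?V (L j))"
      by (rule mean_square_le_tail[OF X KL LI]) simp
    have 3: "mean_square_close P (2 * ?t K + 2 * ?t (L j)) (?V K) (?V (L j))"
      by (rule random_transforms_triangle[OF RT[OF KI] RT[OF KL] RT[OF LI] 1 2]) (rule chaos_tail_nonneg)+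
    have "mean_square_close P (2 * (2 * ?t K + 2 * ?t (L j)) + 2 * (\<delta> / 8)) (?V K) v"
      by (rule random_transforms_triangle[OF RT[OF KI] RT[OF LI] v 3 Lv])
        (use \<delta> chaos_tail_nonneg[of P \<beta> U X] in auto)
    then show "mean_square_close P (4 * ?t K + \<delta>) (?V K) v"
      by (rule mean_square_close_mono) (use tj \<delta> in auto)
  qed
  then show ?thesis by (rule that) (use False in simp)
qed

lemma converges_in_probability_sobolev_cong:
  assumes "\<And>n \<omega>. \<omega> \<in> space P \<Longrightarrow> M n \<omega> = M' n \<omega>"
  shows "converges_in_probability_sobolev P s M L \<longleftrightarrow> converges_in_probability_sobolev P s M' L"
proof -
  have "M n \<in> P \<rightarrow>\<^sub>M sobolev_borel s \<longleftrightarrow> M' n \<in> P \<rightarrow>\<^sub>M sobolev_borel s" for n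
    using assms by (intro measurable_cong) auto
  moreover have "{\<omega> \<in> space P. \<epsilon> < sobolev_dist s (M n \<omega>) (L \<omega>)} = {\<omega> \<in> space P. \<epsilon> < sobolev_dist s (M' n \<omega>) (L \<omega>)}" for n \<epsilon>
    using assms by auto
  ultimately show ?thesis by (simp add: converges_in_probability_sobolev_def)
qed

lemma chaos_extension_converges:
  fixes X :: "'a::euclidean_space \<Rightarrow> 'o \<Rightarrow> real"
  assumes X: "chaos_field P \<beta> U X" and v: "chaos_extension P \<beta> U X v"
    and K: "incseq K" "\<And>j. compact (K j)" "(\<Union>j. K j) = U" and s: "s < - real DIM('a) / 2"
  shows "converges_in_probability_sobolev P s (\<lambda>j \<omega>. fun_distribution (K j) (imaginary_chaos P \<beta> X \<omega>))
    (\<lambda>\<omega>. synthesis (v \<omega>))"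
proof -
  have P: "prob_space P" using X by (auto simp: chaos_field_def continuous_gaussian_field_def)
  have KU: "K j \<subseteq> U" for j using K(3) by auto
  note KI = chaos_integrable_compact[OF X K(2) KU]
  have "converges_in_probability_sobolev P s (\<lambda>j \<omega>. synthesis (chaos_transform P \<beta> X (K j) \<omega>)) (\<lambda>\<omega>. synthesis (v \<omega>))"
  proof (rule mean_square_imp_in_probability[OF P s])
    show "chaos_transform P \<beta> X (K j) \<in> random_transforms P" for j
      by (rule chaos_transform_random[OF chaos_field_continuous[OF X] KI])
    show "v \<in> random_transforms P" using v by (simp add: chaos_extension_def)
    fix \<epsilon> :: real assume \<epsilon>: "0 < \<epsilon>"
    have "\<forall>\<^sub>F j in sequentially. chaos_tail P \<beta> U X (K j) < \<epsilon> / 8"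
      using \<epsilon> by (intro order_tendstoD(2)[OF chaos_tail_tendsto[OF X K]]) simp
    then obtain N where N: "\<And>j. N \<le> j \<Longrightarrow> chaos_tail P \<beta> U X (K j) < \<epsilon> / 8"
      by (auto simp: eventually_sequentially)
    have "mean_square_close P \<epsilon> (chaos_transform P \<beta> X (K j)) v" if "N \<le> j" for j
    proof (rule mean_square_close_mono)
      show "mean_square_close P (4 * chaos_tail P \<beta> U X (K j) + \<epsilon> / 2) (chaos_transform P \<beta> X (K j)) v"
        using v K(2) KU \<epsilon> by (simp add: chaos_extension_def)
      show "4 * chaos_tail P \<beta> U X (K j) + \<epsilon> / 2 \<le> \<epsilon>" using N[OF that] by simp
    qed
    then show "\<exists>N. \<forall>j\<ge>N. mean_square_close P \<epsilon> (chaos_transform P \<beta> X (K j)) v" by blast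
  qed
  moreover have "converges_in_probability_sobolev P s (\<lambda>j \<omega>. fun_distribution (K j) (imaginary_chaos P \<beta> X \<omega>))
        (\<lambda>\<omega>. synthesis (v \<omega>)) \<longleftrightarrow>
      converges_in_probability_sobolev P s (\<lambda>j \<omega>. synthesis (chaos_transform P \<beta> X (K j) \<omega>)) (\<lambda>\<omega>. synthesis (v \<omega>))"
    by (rule converges_in_probability_sobolev_cong) (rule fun_distribution_eq_synthesis[OF chaos_field_continuous[OF X] KI])
  ultimately show ?thesis by (rule iffD2[rotated])
qed

lemma zero_extension_synthesis:
  fixes X :: "'a::euclidean_space \<Rightarrow> 'o \<Rightarrow> real"
  assumes X: "chaos_field P \<beta> U X" and v: "chaos_extension P \<beta> U X v"
    and vU: "chaos_integrable P \<beta> U X U \<Longrightarrow> v = chaos_transform P \<beta> X U"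
  shows "zero_extension P U (imaginary_chaos P \<beta> X) (\<lambda>\<omega>. synthesis (v \<omega>))"
  unfolding zero_extension_def
proof (intro conjI ballI allI impI)
  fix \<omega> assume \<omega>: "\<omega> \<in> space P" and "set_integrable lborel U (imaginary_chaos P \<beta> X \<omega>)"
  then have U: "chaos_integrable P \<beta> U X U"
    by (simp add: set_integrable_chaos_iff[OF chaos_field_continuous[OF X]])
  then show "synthesis (v \<omega>) = fun_distribution U (imaginary_chaos P \<beta> X \<omega>)"
    by (simp add: vU fun_distribution_eq_synthesis[OF chaos_field_continuous[OF X] U \<omega>])
next
  fix K :: "nat \<Rightarrow> 'a set" and s :: real
  assume "incseq K \<and> (\<forall>j. compact (K j)) \<and> (\<Union>j. K j) = U" "s < - real DIM('a) / 2"
  then show "converges_in_probability_sobolev P s (\<lambda>j \<omega>. fun_distribution (K j) (imaginary_chaos P \<beta> X \<omega>))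
      (\<lambda>\<omega>. synthesis (v \<omega>))"
    by (intro chaos_extension_converges[OF X v]) auto
qed

text \<open>
  Two versions are limits in probability of the same sequence along one exhaustion by compact
  sets.
\<close>

lemma zero_extension_unique:
  fixes X :: "'a::euclidean_space \<Rightarrow> 'o \<Rightarrow> real"
  assumes X: "chaos_field P \<beta> U X" and v: "chaos_extension P \<beta> U X v"
    and M: "zero_extension P U (imaginary_chaos P \<beta> X) M"
  shows "AE \<omega> in P. M \<omega> = synthesis (v \<omega>)"
proof -
  have P: "prob_space P" and U: "open U" using X by (auto simp: chaos_field_def continuous_gaussian_field_def)
  obtain L where L: "incseq L" "\<And>j. compact (L j)" "\<And>j. L j \<subseteq> U" "(\<Union>j. L j) = U"
    by (rule compact_exhaustion[OF U]) (rule that)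
  define s where "s = - real DIM('a) / 2 - 1"
  have s: "s < - real DIM('a) / 2" by (simp add: s_def)
  have 1: "converges_in_probability_sobolev P s (\<lambda>j \<omega>. fun_distribution (L j) (imaginary_chaos P \<beta> X \<omega>)) M"
    using M[unfolded zero_extension_def, THEN conjunct2, rule_format, of L s] L(1,2,4) s by simp
  have 2: "converges_in_probability_sobolev P s (\<lambda>j \<omega>. fun_distribution (L j) (imaginary_chaos P \<beta> X \<omega>))
      (\<lambda>\<omega>. synthesis (v \<omega>))"
    by (rule chaos_extension_converges[OF X v L(1) L(2) L(4) s])
  show ?thesis by (rule converges_in_probability_sobolev_unique[OF P s 1 2]) simp
qed

text \<open>
  The kernel of two different fields need not be dominated by a fixed integrable function. But
  on a compact set the second moment of the difference of the total masses of the two chaoses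
  is nonnegative, which bounds the integral of the mixed kernels by that of the diagonal ones;
  monotone convergence extends the bound to \<open>U\<close>.
\<close>

lemma
  fixes X Y :: "'a::euclidean_space \<Rightarrow> 'o \<Rightarrow> real"
  assumes X: "chaos_field P \<beta> U X" and Y: "chaos_field P \<beta> U Y" and XY: "gaussian_pair P U X Y"
  defines "S \<equiv> \<lambda>z. indicator (U \<times> U) z * (chaos_kernel P \<beta> X Y z + chaos_kernel P \<beta> Y X z)"
  shows chaos_cross_integrable: "integrable (lborel \<Otimes>\<^sub>M lborel) S"
    and chaos_cross_le: "(LINT z|(lborel \<Otimes>\<^sub>M lborel). S z) \<le>
      (LINT z|(lborel \<Otimes>\<^sub>M lborel). indicator (U \<times> U) z * chaos_kernel P \<beta> X X z) +
      (LINT z|(lborel \<Otimes>\<^sub>M lborel). indicator (U \<times> U) z * chaos_kernel P \<beta> Y Y z)"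
proof -
  let ?D = "(lborel :: 'a measure) \<Otimes>\<^sub>M (lborel :: 'a measure)"
  let ?X = "\<lambda>A z. indicator (A \<times> A) z * chaos_kernel P \<beta> X X z"
  let ?Y = "\<lambda>A z. indicator (A \<times> A) z * chaos_kernel P \<beta> Y Y z"
  have U: "open U" using X by (auto simp: chaos_field_def continuous_gaussian_field_def)
  then have [measurable]: "U \<in> sets borel" by simp
  obtain L where L: "incseq L" "\<And>j. compact (L j)" "\<And>j. L j \<subseteq> U" "(\<Union>j. L j) = U"
    by (rule compact_exhaustion[OF U]) (rule that)
  have Lm[measurable]: "L j \<in> sets borel" for j using L(2) by (simp add: borel_compact)
  note [measurable] = chaos_kernel_measurable[OF chaos_field_continuous[OF X] chaos_field_continuous[OF Y], of \<beta>]
    chaos_kernel_measurable[OF chaos_field_continuous[OF Y] chaos_field_continuous[OF X], of \<beta>]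
  have S_eq: "S = (\<lambda>z. indicator (U \<times> U) z * chaos_kernel P \<beta> X Y z + indicator (U \<times> U) z * chaos_kernel P \<beta> Y X z)"
    by (simp add: S_def distrib_left fun_eq_iff)
  have S_meas[measurable]: "S \<in> borel_measurable ?D" unfolding S_eq by measurable
  have S_nonneg: "0 \<le> S z" for z by (simp add: S_def chaos_kernel_nonneg)
  let ?c = "(LINT z|?D. ?X U z) + (LINT z|?D. ?Y U z)"
  let ?T = "\<lambda>j z. indicator (L j \<times> L j) z * S z"
  have T: "integrable ?D (?T j) \<and> (LINT z|?D. ?T j z) \<le> ?c" for j
  proof -
    note AI = chaos_integrable_compact[OF X L(2) L(3), of j] chaos_integrable_compact[OF Y L(2) L(3), of j]
    note en = energy_integrable[OF chaos_field_continuous[OF X] chaos_field_continuous[OF Y] XY AI]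
      energy_nonneg[OF chaos_field_continuous[OF X] chaos_field_continuous[OF Y] XY AI]
    have iX: "integrable ?D (?X A)" and iY: "integrable ?D (?Y A)" if "A \<in> sets borel" "A \<subseteq> U" for A
      using chaos_kernel_integrable_subset[OF X that] chaos_kernel_integrable_subset[OF Y that] by auto
    have eq: "?T j = (\<lambda>z. ?X (L j) z + ?Y (L j) z - energy P \<beta> X (L j) Y (L j) z)"
      using L(3)[of j] by (auto simp: S_def energy_def indicator_def fun_eq_iff)
    have i: "integrable ?D (?T j)"
      unfolding eq by (intro Bochner_Integration.integrable_diff Bochner_Integration.integrable_add iX iY Lm L(3) en(1))
    have "(LINT z|?D. ?T j z) = (LINT z|?D. ?X (L j) z) + (LINT z|?D. ?Y (L j) z) - (LINT z|?D. energy P \<beta> X (L j) Y (L j) z)"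
      unfolding eq using iX[OF Lm L(3), of j] iY[OF Lm L(3), of j] en(1) by simp
    also have "\<dots> \<le> (LINT z|?D. ?X (L j) z) + (LINT z|?D. ?Y (L j) z)" using en(2) by simp
    also have "\<dots> \<le> ?c"
      using L(3)[of j] by (intro add_mono integral_mono iX iY Lm L(3))
        (auto simp: indicator_def chaos_kernel_nonneg)
    finally show ?thesis using i by blast
  qed
  have nn: "(\<integral>\<^sup>+z. ennreal (S z) \<partial>?D) \<le> ennreal ?c"
  proof -
    have sup: "(SUP j. ennreal (?T j z)) = ennreal (S z)" for z
    proof (cases "z \<in> U \<times> U")
      case True
      obtain i k where ik: "fst z \<in> L i" "snd z \<in> L k" using True L(4) by auto
      have "z \<in> L (max i k) \<times> L (max i k)"
        using ik monoD[OF L(1), of i "max i k"] monoD[OF L(1), of k "max i k"] by (auto simp: mem_Times_iff)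
      then have "ennreal (S z) \<le> ennreal (?T (max i k) z)" by simp
      moreover have "ennreal (?T j z) \<le> ennreal (S z)" for j
        using S_nonneg[of z] by (intro ennreal_leI) (auto simp: indicator_def)
      ultimately show ?thesis
        by (intro antisym SUP_least) (auto intro: SUP_upper2)
    next
      case False
      then show ?thesis by (simp add: S_def)
    qed
    have "(\<integral>\<^sup>+z. ennreal (S z) \<partial>?D) = (SUP j. \<integral>\<^sup>+z. ennreal (?T j z) \<partial>?D)"
      unfolding sup[symmetric]
    proof (rule nn_integral_monotone_convergence_SUP)
      show "incseq (\<lambda>j z. ennreal (?T j z))"
      proof (intro incseq_SucI le_funI ennreal_leI mult_right_mono S_nonneg)
        fix j z
        have "L j \<subseteq> L (Suc j)" using L(1) by (simp add: incseq_SucD)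
        then show "indicator (L j \<times> L j) z \<le> (indicator (L (Suc j) \<times> L (Suc j)) z :: real)"
          by (auto simp: indicator_def)
      qed
    qed measurable
    also have "\<dots> \<le> ennreal ?c"
    proof (rule SUP_least)
      fix j
      have "(\<integral>\<^sup>+z. ennreal (?T j z) \<partial>?D) = ennreal (LINT z|?D. ?T j z)"
        using T[of j] S_nonneg by (intro nn_integral_eq_integral) auto
      also have "\<dots> \<le> ennreal ?c" using T[of j] by (intro ennreal_leI) simp
      finally show "(\<integral>\<^sup>+z. ennreal (?T j z) \<partial>?D) \<le> ennreal ?c" .
    qed
    finally show ?thesis .
  qed
  show int: "integrable ?D S"
    using nn S_nonneg by (intro integrableI_bounded) (auto simp: abs_of_nonneg intro: le_less_trans)
  have "ennreal (LINT z|?D. S z) \<le> ennreal ?c"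
    using nn nn_integral_eq_integral[OF int] S_nonneg by simp
  then show "(LINT z|?D. S z) \<le> ?c"
    by (subst (asm) ennreal_le_iff) (auto intro!: add_nonneg_nonneg integral_nonneg_AE simp: chaos_kernel_nonneg)
qed

text \<open>
  The \<open>L1\<close> norm of the covariance of the difference of the two chaoses on all of
  \<open>U\<close>.
\<close>

definition chaos_discrepancy ::
    "'o measure \<Rightarrow> real \<Rightarrow> 'a::euclidean_space set \<Rightarrow> ('a \<Rightarrow> 'o \<Rightarrow> real) \<Rightarrow> ('a \<Rightarrow> 'o \<Rightarrow> real) \<Rightarrow> real" where
  "chaos_discrepancy P \<beta> U X Y = (LINT z|(lborel \<Otimes>\<^sub>M lborel). indicator (U \<times> U) z *
     \<bar>chaos_kernel P \<beta> X X z + chaos_kernel P \<beta> Y Y z - chaos_kernel P \<beta> X Y z - chaos_kernel P \<beta> Y X z\<bar>)"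

lemma chaos_discrepancy_nonneg: "0 \<le> chaos_discrepancy P \<beta> U X Y"
  unfolding chaos_discrepancy_def by (intro integral_nonneg_AE) simp

lemma chaos_discrepancy_integrable:
  fixes X Y :: "'a::euclidean_space \<Rightarrow> 'o \<Rightarrow> real"
  assumes X: "chaos_field P \<beta> U X" and Y: "chaos_field P \<beta> U Y" and XY: "gaussian_pair P U X Y"
  shows "integrable (lborel \<Otimes>\<^sub>M lborel) (\<lambda>z. indicator (U \<times> U) z *
     \<bar>chaos_kernel P \<beta> X X z + chaos_kernel P \<beta> Y Y z - chaos_kernel P \<beta> X Y z - chaos_kernel P \<beta> Y X z\<bar>)"
proof -
  have "integrable (lborel \<Otimes>\<^sub>M lborel) (\<lambda>z. \<bar>indicator (U \<times> U) z * chaos_kernel P \<beta> X X z +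
      indicator (U \<times> U) z * chaos_kernel P \<beta> Y Y z - indicator (U \<times> U) z * (chaos_kernel P \<beta> X Y z + chaos_kernel P \<beta> Y X z)\<bar>)"
    using X Y unfolding chaos_field_def
    by (intro integrable_abs Bochner_Integration.integrable_diff Bochner_Integration.integrable_add
        chaos_cross_integrable[OF X Y XY]) auto
  moreover have "(\<lambda>z. \<bar>indicator (U \<times> U) z * chaos_kernel P \<beta> X X z +
      indicator (U \<times> U) z * chaos_kernel P \<beta> Y Y z - indicator (U \<times> U) z * (chaos_kernel P \<beta> X Y z + chaos_kernel P \<beta> Y X z)\<bar>) =
    (\<lambda>z. indicator (U \<times> U) z *
     \<bar>chaos_kernel P \<beta> X X z + chaos_kernel P \<beta> Y Y z - chaos_kernel P \<beta> X Y z - chaos_kernel P \<beta> Y X z\<bar>)"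
    by (auto simp: indicator_def fun_eq_iff algebra_simps)
  ultimately show ?thesis by (simp only:)
qed

text \<open>
  Both extensions are compared with the chaoses on one compact set whose complement carries
  little mass of either field; there the \<open>L1\<close> bound for the covariance applies.
\<close>

lemma chaos_extension_close:
  fixes X Y :: "'a::euclidean_space \<Rightarrow> 'o \<Rightarrow> real"
  assumes X: "chaos_field P \<beta> U X" and Y: "chaos_field P \<beta> U Y" and XY: "gaussian_pair P U X Y"
    and v: "chaos_extension P \<beta> U X v" and w: "chaos_extension P \<beta> U Y w" and \<delta>: "0 < \<delta>"
  shows "mean_square_close P (4 * chaos_discrepancy P \<beta> U X Y + \<delta>) v w"
proof -
  let ?D = "(lborel :: 'a measure) \<Otimes>\<^sub>M (lborel :: 'a measure)"
  let ?\<Delta> = "chaos_discrepancy P \<beta> U X Y"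
  have U: "open U" using X by (auto simp: chaos_field_def continuous_gaussian_field_def)
  obtain L where L: "incseq L" "\<And>j. compact (L j)" "\<And>j. L j \<subseteq> U" "(\<Union>j. L j) = U"
    by (rule compact_exhaustion[OF U]) (rule that)
  have e: "0 < \<delta> / 100" using \<delta> by simp
  obtain N1 where N1: "\<And>j. N1 \<le> j \<Longrightarrow> chaos_tail P \<beta> U X (L j) < \<delta> / 100"
    using order_tendstoD(2)[OF chaos_tail_tendsto[OF X L(1) L(2) L(4)] e] by (auto simp: eventually_sequentially)
  obtain N2 where N2: "\<And>j. N2 \<le> j \<Longrightarrow> chaos_tail P \<beta> U Y (L j) < \<delta> / 100"
    using order_tendstoD(2)[OF chaos_tail_tendsto[OF Y L(1) L(2) L(4)] e] by (auto simp: eventually_sequentially)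
  define K where "K = L (max N1 N2)"
  have K: "compact K" "K \<subseteq> U" using L by (auto simp: K_def)
  have t: "chaos_tail P \<beta> U X K < \<delta> / 100" "chaos_tail P \<beta> U Y K < \<delta> / 100"
    unfolding K_def by (rule N1, simp, rule N2, simp)
  note KX = chaos_integrable_compact[OF X K] and KY = chaos_integrable_compact[OF Y K]
  let ?V = "chaos_transform P \<beta> X K" and ?W = "chaos_transform P \<beta> Y K"
  have RT: "?V \<in> random_transforms P" "?W \<in> random_transforms P" "v \<in> random_transforms P" "w \<in> random_transforms P"
    using v w chaos_transform_random[OF chaos_field_continuous[OF X] KX] chaos_transform_random[OF chaos_field_continuous[OF Y] KY]
    by (auto simp: chaos_extension_def)
  have "mean_square_close P (4 * chaos_tail P \<beta> U X K + \<delta> / 100) ?V v"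
    using v K e by (simp add: chaos_extension_def)
  then have "mean_square_close P (5 * \<delta> / 100) ?V v"
    by (rule mean_square_close_mono) (use t in auto)
  then have vV: "mean_square_close P (5 * \<delta> / 100) v ?V"
    by (rule mean_square_close_sym)
  have "mean_square_close P (4 * chaos_tail P \<beta> U Y K + \<delta> / 100) ?W w"
    using w K e by (simp add: chaos_extension_def)
  then have Ww: "mean_square_close P (5 * \<delta> / 100) ?W w"
    by (rule mean_square_close_mono) (use t in auto)
  have "(LINT z|?D. \<bar>energy P \<beta> X K Y K z\<bar>) \<le> ?\<Delta>"
    unfolding chaos_discrepancy_def
  proof (rule integral_mono)
    show "integrable ?D (\<lambda>z. \<bar>energy P \<beta> X K Y K z\<bar>)"
      by (intro integrable_abs energy_integrable[OF chaos_field_continuous[OF X] chaos_field_continuous[OF Y] XY KX KY])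
    show "\<bar>energy P \<beta> X K Y K z\<bar> \<le> indicator (U \<times> U) z *
        \<bar>chaos_kernel P \<beta> X X z + chaos_kernel P \<beta> Y Y z - chaos_kernel P \<beta> X Y z - chaos_kernel P \<beta> Y X z\<bar>" for z
      using K(2) by (auto simp: energy_def indicator_def)
  qed (rule chaos_discrepancy_integrable[OF X Y XY])
  from mean_square_close_mono[OF mean_square_le_energy[OF chaos_field_continuous[OF X] chaos_field_continuous[OF Y] XY KX KY] this]
  have VW: "mean_square_close P ?\<Delta> ?V ?W" .
  have 1: "mean_square_close P (2 * ?\<Delta> + 2 * (5 * \<delta> / 100)) ?V w"
    by (rule random_transforms_triangle[OF RT(1,2,4) VW Ww]) (use \<delta> chaos_discrepancy_nonneg in auto)
  have "mean_square_close P (2 * (5 * \<delta> / 100) + 2 * (2 * ?\<Delta> + 2 * (5 * \<delta> / 100))) v w"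
    by (rule random_transforms_triangle[OF RT(3,1,4) vV 1]) (use \<delta> chaos_discrepancy_nonneg[of P \<beta> U X Y] in auto)
  then show ?thesis
    by (rule mean_square_close_mono) (use \<delta> in auto)
qed

section \<open>Convergence of the covariance kernels\<close>

text \<open>
  Absolute continuity of the integral: the part of \<open>h\<close> above a high level has a
  small integral, and the part below this level contributes at most the level times the
  measure of the set.
\<close>

lemma integral_indicator_small:
  fixes h :: "'z \<Rightarrow> real"
  assumes h: "integrable M h" and nonneg: "\<And>z. 0 \<le> h z" and \<epsilon>: "0 < \<epsilon>"
  shows "\<exists>\<delta>>0. \<forall>E\<in>sets M. emeasure M E < ennreal \<delta> \<longrightarrow> (LINT z|M. indicator E z * h z) < \<epsilon>"
proof -
  have [measurable]: "h \<in> borel_measurable M" using h by simp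
  let ?t = "\<lambda>N z. if real N < h z then h z else 0"
  have "(\<lambda>N. LINT z|M. ?t N z) \<longlonglongrightarrow> (LINT z|M. (0::real))"
  proof (rule integral_dominated_convergence[OF _ _ h])
    show "AE z in M. (\<lambda>N. ?t N z) \<longlonglongrightarrow> 0"
    proof (intro AE_I2 tendsto_eventually)
      fix z
      obtain K :: nat where "h z \<le> real K" using real_arch_simple by blast
      then show "\<forall>\<^sub>F N in sequentially. ?t N z = 0"
        by (intro eventually_sequentiallyI[of K]) auto
    qed
    show "AE z in M. norm (?t N z) \<le> h z" for N using nonneg by (intro AE_I2) auto
  qed measurable
  then have "\<forall>\<^sub>F N in sequentially. (LINT z|M. ?t N z) < \<epsilon> / 2"
    using \<epsilon> by (intro order_tendstoD(2)) auto
  then have "\<exists>N. \<forall>n\<ge>N. (LINT z|M. ?t n z) < \<epsilon> / 2"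
    by (simp only: eventually_sequentially)
  then obtain N where "\<forall>n\<ge>N. (LINT z|M. ?t n z) < \<epsilon> / 2" ..
  from this[rule_format, of "Suc N"] have N: "(LINT z|M. ?t (Suc N) z) < \<epsilon> / 2" by simp
  define \<delta> where "\<delta> = \<epsilon> / (2 * real (Suc N))"
  have \<delta>: "0 < \<delta>" using \<epsilon> by (simp add: \<delta>_def)
  have "(LINT z|M. indicator E z * h z) < \<epsilon>" if E[measurable]: "E \<in> sets M" and small: "emeasure M E < ennreal \<delta>" for E
  proof -
    have fin: "emeasure M E < \<infinity>" using small by (rule less_trans) simp
    have it: "integrable M (?t (Suc N))"
      by (rule Bochner_Integration.integrable_bound[OF h]) (use nonneg in auto)
    have ie: "integrable M (\<lambda>z. real (Suc N) * indicator E z)"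
      using fin by (intro integrable_mult_right integrable_real_indicator E)
    have "(LINT z|M. indicator E z * h z) \<le> (LINT z|M. real (Suc N) * indicator E z + ?t (Suc N) z)"
    proof (rule integral_mono)
      show "integrable M (\<lambda>z. indicator E z * h z)"
        by (rule Bochner_Integration.integrable_bound[OF h]) (use nonneg in \<open>auto simp: indicator_def\<close>)
      show "integrable M (\<lambda>z. real (Suc N) * indicator E z + ?t (Suc N) z)"
        by (rule Bochner_Integration.integrable_add[OF ie it])
      show "indicator E z * h z \<le> real (Suc N) * indicator E z + ?t (Suc N) z" for z
        using nonneg[of z] by (auto simp: indicator_def)
    qed
    also have "\<dots> = (LINT z|M. real (Suc N) * indicator E z) + (LINT z|M. ?t (Suc N) z)"
      by (rule Bochner_Integration.integral_add[OF ie it])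
    also have "(LINT z|M. real (Suc N) * indicator E z) = real (Suc N) * measure M E"
      by simp
    also have "\<dots> < \<epsilon> / 2"
    proof -
      have "emeasure M E = ennreal (measure M E)" using fin by (intro emeasure_eq_ennreal_measure) auto
      then have "measure M E < \<delta>" using small \<delta> by (simp add: ennreal_less_iff)
      then have "real (Suc N) * measure M E < real (Suc N) * \<delta>" by (intro mult_strict_left_mono) auto
      also have "real (Suc N) * \<delta> = \<epsilon> / 2" unfolding \<delta>_def by (simp add: field_simps)
      finally show ?thesis .
    qed
    finally show ?thesis using N by simp
  qed
  then show ?thesis using \<delta> by blast
qed

text \<open>
  A dominated error of exponentials tends to \<open>0\<close> in mean when the exponents converge in measure:
  off a small set the relative error is small, and on the small set the dominating function is.
\<close>

lemma eventually_integral_exp_small: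
  fixes c :: "'i \<Rightarrow> 'z \<Rightarrow> real"
  assumes b: "0 < b" and h: "integrable M (\<lambda>z. indicator A z * exp (b * l z))"
    and conv: "\<And>\<eta>. 0 < \<eta> \<Longrightarrow> ((\<lambda>i. emeasure M {z \<in> A. \<eta> < \<bar>c i z - l z\<bar>}) \<longlongrightarrow> 0) F"
    and sets: "\<And>i \<eta>. {z \<in> A. \<eta> < \<bar>c i z - l z\<bar>} \<in> sets M"
    and k: "integrable M k" "\<And>z. 0 \<le> k z"
    and g: "\<And>i. integrable M (g i)" "\<And>i z. z \<notin> A \<Longrightarrow> g i z = 0"
      "\<And>i z. z \<in> A \<Longrightarrow> g i z \<le> \<bar>exp (b * c i z) - exp (b * l z)\<bar>" "\<And>i. AE z in M. g i z \<le> k z"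
    and \<epsilon>: "0 < \<epsilon>"
  shows "\<forall>\<^sub>F i in F. (LINT z|M. g i z) < \<epsilon>"
proof -
  let ?h = "\<lambda>z. indicator A z * exp (b * l z)"
  have h0: "0 \<le> (LINT z|M. ?h z)" by (intro integral_nonneg_AE) simp
  define t where "t = \<epsilon> / (2 * ((LINT z|M. ?h z) + 1))"
  have t: "0 < t"
    unfolding t_def by (intro divide_pos_pos \<epsilon> mult_pos_pos add_nonneg_pos h0) auto
  \<comment> \<open>exponents within \<open>\<eta>\<close> of each other have exponentials with
    relative error at most \<open>t\<close>\<close>
  define \<eta> where "\<eta> = ln (1 + t) / b"
  have \<eta>: "0 < \<eta>" using t b by (simp add: \<eta>_def)
  have exp_\<eta>: "exp (b * \<eta>) = 1 + t" using t b by (simp add: \<eta>_def)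
  obtain \<delta> where \<delta>: "0 < \<delta>" and small: "\<And>E. E \<in> sets M \<Longrightarrow> emeasure M E < ennreal \<delta> \<Longrightarrow> (LINT z|M. indicator E z * k z) < \<epsilon> / 2"
    using integral_indicator_small[OF k, of "\<epsilon> / 2"] \<epsilon> by auto
  have "\<forall>\<^sub>F i in F. emeasure M {z \<in> A. \<eta> < \<bar>c i z - l z\<bar>} < ennreal \<delta>"
    using conv[OF \<eta>] \<delta> by (intro order_tendstoD(2)) auto
  then show ?thesis
  proof eventually_elim
    case (elim i)
    let ?E = "{z \<in> A. \<eta> < \<bar>c i z - l z\<bar>}"
    have Em[measurable]: "?E \<in> sets M" by (rule sets)
    have near: "\<bar>exp (b * c i z) - exp (b * l z)\<bar> \<le> t * exp (b * l z)" if "\<bar>c i z - l z\<bar> \<le> \<eta>" for z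
    proof -
      have "b * (c i z - l z) \<le> b * \<eta>"
        using that b by (intro mult_left_mono) auto
      moreover have "b * (- \<eta>) \<le> b * (c i z - l z)"
        using that b by (intro mult_left_mono) auto
      ultimately have "b * (c i z - l z) \<le> b * \<eta>" "- (b * \<eta>) \<le> b * (c i z - l z)"
        by simp_all
      then have up: "exp (b * (c i z - l z)) \<le> 1 + t" and lo: "exp (- (b * \<eta>)) \<le> exp (b * (c i z - l z))"
        unfolding exp_\<eta>[symmetric] exp_le_cancel_iff by blast+
      have "1 - t \<le> exp (- (b * \<eta>))"
      proof -
        have "(1 - t) * (1 + t) \<le> 1" by (simp add: algebra_simps)
        then have "1 - t \<le> 1 / (1 + t)" using t by (simp add: field_simps)
        then show ?thesis by (simp add: exp_minus exp_\<eta> inverse_eq_divide)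
      qed
      then have "\<bar>exp (b * (c i z - l z)) - 1\<bar> \<le> t" using up lo by linarith
      then have "exp (b * l z) * \<bar>exp (b * (c i z - l z)) - 1\<bar> \<le> exp (b * l z) * t"
        by (intro mult_left_mono) auto
      moreover have "exp (b * l z) * \<bar>exp (b * (c i z - l z)) - 1\<bar> = \<bar>exp (b * l z) * (exp (b * (c i z - l z)) - 1)\<bar>"
        by (simp add: abs_mult)
      moreover have "exp (b * l z) * (exp (b * (c i z - l z)) - 1) = exp (b * c i z) - exp (b * l z)"
        by (simp add: right_diff_distrib flip: exp_add)
      ultimately show ?thesis by (simp add: mult.commute)
    qed
    have iE: "integrable M (\<lambda>z. indicator ?E z * k z)"
      using integrable_mult_indicator[OF Em k(1)] by (simp only: real_scaleR_def)
    have "(LINT z|M. g i z) \<le> (LINT z|M. t * ?h z + indicator ?E z * k z)"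
    proof (rule integral_mono_AE)
      show "integrable M (g i)" by (rule g)
      show "integrable M (\<lambda>z. t * ?h z + indicator ?E z * k z)"
        using h iE by (intro Bochner_Integration.integrable_add integrable_mult_right)
      show "AE z in M. g i z \<le> t * ?h z + indicator ?E z * k z"
        using g(4)[of i]
      proof eventually_elim
        case (elim z)
        consider "z \<notin> A" | "z \<in> ?E" | "z \<in> A" "\<bar>c i z - l z\<bar> \<le> \<eta>" by fastforce
        then show ?case
        proof cases
          case 1 then show ?thesis using g(2) by simp
        next
          case 2 then show ?thesis using elim t by (simp add: add_increasing)
        next
          case 3
          then show ?thesis using g(3)[OF 3(1), of i] near[OF 3(2)] k(2)[of z] by (simp add: indicator_def)
        qed
      qed
    qed
    also have "\<dots> = t * (LINT z|M. ?h z) + (LINT z|M. indicator ?E z * k z)"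
      using h iE by (subst Bochner_Integration.integral_add) auto
    also have "t * (LINT z|M. ?h z) \<le> \<epsilon> / 2"
    proof -
      have "t * (LINT z|M. ?h z) = (\<epsilon> / 2) * ((LINT z|M. ?h z) / ((LINT z|M. ?h z) + 1))"
        using h0 by (simp add: t_def field_simps)
      also have "\<dots> \<le> (\<epsilon> / 2) * 1"
      proof (rule mult_left_mono)
        show "(LINT z|M. ?h z) / ((LINT z|M. ?h z) + 1) \<le> 1"
          using h0 by (subst divide_le_eq_1_pos) (rule add_nonneg_pos, simp_all)
      qed (use \<epsilon> in simp)
      finally show ?thesis by simp
    qed
    finally show ?case using small[OF Em elim] by simp
  qed
qed

lemma AE_off_diagonal: "AE z in (lborel :: 'a::euclidean_space measure) \<Otimes>\<^sub>M lborel. fst z \<noteq> snd z"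
proof (rule lborel_pair.AE_pair_measure)
  show "{z \<in> space ((lborel :: 'a measure) \<Otimes>\<^sub>M lborel). fst z \<noteq> snd z} \<in> sets (lborel \<Otimes>\<^sub>M lborel)"
    by measurable
  show "AE x in lborel. AE y in lborel. fst (x::'a, y) \<noteq> snd (x, y)"
    using AE_lborel_singleton by (auto simp: eq_commute)
qed

text \<open>
  Differences of points of \<open>U\<close> lie in a fixed ball, on which \<open>norm x powr
  (- a)\<close> is integrable.
\<close>

lemma integrable_dist_powr:
  fixes U :: "'a::euclidean_space set"
  assumes U[measurable]: "U \<in> sets borel" and bdd: "bounded U" and a: "0 \<le> a" "a < real DIM('a)"
  shows "integrable (lborel \<Otimes>\<^sub>M lborel) (\<lambda>z. indicator (U \<times> U) z * dist (fst z) (snd z) powr (- a))"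
proof -
  obtain R where R: "0 \<le> R" "\<And>x. x \<in> U \<Longrightarrow> norm x \<le> R"
    using bdd by (meson bounded_pos less_imp_le)
  have Um: "emeasure lborel U < \<infinity>"
    using emeasure_mono[of U "cball 0 R" lborel] R emeasure_lborel_cball_finite[of "0::'a" R] U
    by (auto simp: subset_iff intro: le_less_trans)
  define \<psi> where "\<psi> x = indicator (cball 0 (2 * R)) x * norm (x::'a) powr (- a)" for x
  have \<psi>: "integrable lborel \<psi>"
    unfolding \<psi>_def[abs_def] using a R by (intro integrable_norm_powr_bounded) auto
  have [measurable]: "\<psi> \<in> borel_measurable borel" using \<psi> by auto
  have \<psi>_nonneg: "0 \<le> \<psi> x" for x by (simp add: \<psi>_def)
  have shift: "integrable lborel (\<lambda>y. \<psi> (x - y))" "(LINT y|lborel. \<psi> (x - y)) = (LINT y|lborel. \<psi> y)" for x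
    using lborel_integrable_affine[OF _ \<psi>, of "-1" x] lborel_integral_affine[of "-1" \<psi> x] by auto
  have k: "integrable (lborel \<Otimes>\<^sub>M lborel) (\<lambda>(x, y). indicator U x * \<psi> (x - y))"
  proof (rule lborel_pair.Fubini_integrable)
    have "(\<lambda>x. LINT y|lborel. norm (case (x, y) of (x, y) \<Rightarrow> indicator U x * \<psi> (x - y))) =
        (\<lambda>x. indicator U x * (LINT y|lborel. \<psi> y))"
      using shift(2) \<psi>_nonneg by (simp add: abs_mult)
    then show "integrable lborel (\<lambda>x. LINT y|lborel. norm (case (x, y) of (x, y) \<Rightarrow> indicator U x * \<psi> (x - y)))"
      using Um by simp
    show "AE x in lborel. integrable lborel (\<lambda>y. case (x, y) of (x, y) \<Rightarrow> indicator U x * \<psi> (x - y))"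
      using shift(1) by simp
  qed measurable
  show ?thesis
  proof (rule Bochner_Integration.integrable_bound[OF k])
    show "AE z in lborel \<Otimes>\<^sub>M lborel. norm (indicator (U \<times> U) z * dist (fst z) (snd z) powr (- a)) \<le>
        norm (case z of (x, y) \<Rightarrow> indicator U x * \<psi> (x - y))"
    proof (rule AE_I2)
      fix z :: "'a \<times> 'a"
      obtain x y where z: "z = (x, y)" by (cases z)
      have "x - y \<in> cball 0 (2 * R)" if "x \<in> U" "y \<in> U"
        using norm_triangle_ineq4[of x y] R(2)[OF that(1)] R(2)[OF that(2)] by simp
      then show "norm (indicator (U \<times> U) z * dist (fst z) (snd z) powr (- a)) \<le>
        norm (case z of (x, y) \<Rightarrow> indicator U x * \<psi> (x - y))"
        by (auto simp: z \<psi>_def indicator_def dist_norm)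
    qed
  qed measurable
qed

lemma log_kernel_measurable:
  fixes U :: "'a::euclidean_space set"
  assumes "log_covariance U g"
  shows "(\<lambda>z. log_kernel U g (fst z) (snd z)) \<in> borel_measurable (lborel \<Otimes>\<^sub>M lborel)"
proof -
  have U: "open U" and g: "continuous_on (U \<times> U) (\<lambda>(x, y). g x y)"
    using assms by (auto simp: log_covariance_def)
  have [measurable]: "U \<in> sets borel" using U by simp
  have "(\<lambda>z. indicator (U \<times> U) z *\<^sub>R (case z of (x, y) \<Rightarrow> g x y)) \<in> borel_measurable borel"
    using U g by (intro borel_measurable_continuous_on_indicator borel_open open_Times)
  then have [measurable]: "(\<lambda>z. indicator (U \<times> U) z *\<^sub>R (case z of (x, y) \<Rightarrow> g x y)) \<in> borel_measurable (lborel \<Otimes>\<^sub>M lborel)"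
    by (simp add: lborel_prod)
  have "(\<lambda>z. indicator (U \<times> U) z * ln (1 / dist (fst z) (snd z)) + indicator (U \<times> U) z *\<^sub>R (case z of (x, y) \<Rightarrow> g x y))
      \<in> borel_measurable (lborel \<Otimes>\<^sub>M lborel)"
    by measurable
  moreover have "indicator (U \<times> U) z * ln (1 / dist (fst z) (snd z)) + indicator (U \<times> U) z *\<^sub>R (case z of (x, y) \<Rightarrow> g x y) =
      log_kernel U g (fst z) (snd z)" for z
    by (cases z) (simp add: log_kernel_def indicator_def)
  ultimately show ?thesis by (simp only:)
qed

lemma exp_log_bound:
  fixes r :: real
  assumes "0 < r" "t \<le> ln (1 / r) + B"
  shows "exp (b\<^sup>2 * t) \<le> exp (b\<^sup>2 * B) * r powr (- b\<^sup>2)"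
proof -
  have "b\<^sup>2 * t \<le> b\<^sup>2 * (ln (1 / r) + B)" using assms by (intro mult_left_mono) auto
  also have "\<dots> = b\<^sup>2 * B + (- b\<^sup>2) * ln r" using assms by (simp add: ln_div algebra_simps)
  finally have "exp (b\<^sup>2 * t) \<le> exp (b\<^sup>2 * B + (- b\<^sup>2) * ln r)" by (simp only: exp_le_cancel_iff)
  moreover have "exp (b\<^sup>2 * B + (- b\<^sup>2) * ln r) = exp (b\<^sup>2 * B) * r powr (- b\<^sup>2)"
    using assms(1) by (simp only: exp_add powr_def) simp
  ultimately show ?thesis by (simp only:)
qed

definition limit_kernel :: "real \<Rightarrow> 'a::euclidean_space set \<Rightarrow> ('a \<Rightarrow> 'a \<Rightarrow> real) \<Rightarrow> 'a \<times> 'a \<Rightarrow> real" where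
  "limit_kernel \<beta> U g z = exp (\<beta>\<^sup>2 * log_kernel U g (fst z) (snd z))"

lemma limit_kernel_integrable:
  fixes U :: "'a::euclidean_space set"
  assumes U: "log_covariance U g" and \<beta>: "\<beta>\<^sup>2 < real DIM('a)"
  shows "integrable (lborel \<Otimes>\<^sub>M lborel) (\<lambda>z. indicator (U \<times> U) z * limit_kernel \<beta> U g z)"
proof -
  have [measurable]: "U \<in> sets borel" and bdd: "bounded U" using U by (auto simp: log_covariance_def)
  note [measurable] = log_kernel_measurable[OF U]
  obtain B where B: "\<And>x y. x \<in> U \<Longrightarrow> y \<in> U \<Longrightarrow> g x y \<le> B"
    using U unfolding log_covariance_def bdd_above_def by auto
  show ?thesis
  proof (rule Bochner_Integration.integrable_bound)
    show "integrable (lborel \<Otimes>\<^sub>M lborel) (\<lambda>z. exp (\<beta>\<^sup>2 * B) * (indicator (U \<times> U) z * dist (fst z) (snd z) powr (- \<beta>\<^sup>2)))"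
      by (intro integrable_mult_right integrable_dist_powr bdd \<beta>) auto
    show "(\<lambda>z. indicator (U \<times> U) z * limit_kernel \<beta> U g z) \<in> borel_measurable (lborel \<Otimes>\<^sub>M lborel)"
      unfolding limit_kernel_def by measurable
    show "AE z in lborel \<Otimes>\<^sub>M lborel. norm (indicator (U \<times> U) z * limit_kernel \<beta> U g z) \<le>
        norm (exp (\<beta>\<^sup>2 * B) * (indicator (U \<times> U) z * dist (fst z) (snd z) powr (- \<beta>\<^sup>2)))"
      using AE_off_diagonal
    proof eventually_elim
      case (elim z)
      show ?case
      proof (cases "z \<in> U \<times> U")
        case True
        then have "log_kernel U g (fst z) (snd z) \<le> ln (1 / dist (fst z) (snd z)) + B"
          using B by (auto simp: log_kernel_def mem_Times_iff)
        from exp_log_bound[OF _ this, of \<beta>] elim show ?thesis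
          using True by (simp add: limit_kernel_def)
      qed simp
    qed
  qed
qed

text \<open>
  The identity \<open>\<bar>r\<bar> = r + 2 max 0 (- r)\<close> for \<open>r = x + y - 2
  h\<close>, with \<open>- r\<close> split into two differences. No absolute value of \<open>x
  - h\<close> or \<open>y - h\<close> occurs on the right.
\<close>

lemma abs_discrepancy_le:
  fixes a b x y h :: real
  shows "\<bar>a + b - x - y\<bar> \<le> \<bar>a - h\<bar> + \<bar>b - h\<bar> + (x + y - 2 * h) + 2 * max 0 (h - x) + 2 * max 0 (h - y)"
proof -
  have "\<bar>a + b - x - y\<bar> \<le> \<bar>a - h\<bar> + \<bar>b - h\<bar> + \<bar>x + y - 2 * h\<bar>" by linarith
  moreover have "\<bar>x + y - 2 * h\<bar> \<le> (x + y - 2 * h) + 2 * max 0 (h - x) + 2 * max 0 (h - y)"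
    unfolding max_def by (auto simp: abs_le_iff)
  ultimately show ?thesis by linarith
qed

text \<open>
  Scheffe's argument: with the bound for the total mass of the mixed kernels, only the
  positive parts of \<open>h\<close> minus a mixed kernel remain, and these are dominated by
  \<open>h\<close>.
\<close>

lemma chaos_discrepancy_le:
  fixes X Y :: "'a::euclidean_space \<Rightarrow> 'o \<Rightarrow> real"
  assumes X: "chaos_field P \<beta> U X" and Y: "chaos_field P \<beta> U Y" and XY: "gaussian_pair P U X Y"
    and H: "integrable (lborel \<Otimes>\<^sub>M lborel) (\<lambda>z. indicator (U \<times> U) z * h z)"
  shows "chaos_discrepancy P \<beta> U X Y \<le>
    2 * (LINT z|(lborel \<Otimes>\<^sub>M lborel). indicator (U \<times> U) z * \<bar>chaos_kernel P \<beta> X X z - h z\<bar>) +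
    2 * (LINT z|(lborel \<Otimes>\<^sub>M lborel). indicator (U \<times> U) z * \<bar>chaos_kernel P \<beta> Y Y z - h z\<bar>) +
    2 * (LINT z|(lborel \<Otimes>\<^sub>M lborel). indicator (U \<times> U) z * max 0 (h z - chaos_kernel P \<beta> X Y z)) +
    2 * (LINT z|(lborel \<Otimes>\<^sub>M lborel). indicator (U \<times> U) z * max 0 (h z - chaos_kernel P \<beta> Y X z))"
proof -
  let ?D = "(lborel :: 'a measure) \<Otimes>\<^sub>M (lborel :: 'a measure)"
  define u where "u z = (indicator (U \<times> U) z :: real)" for z
  have u01: "u z = 0 \<or> u z = 1" for z by (simp add: u_def indicator_def)
  have U[measurable]: "U \<in> sets borel" using X by (auto simp: chaos_field_def continuous_gaussian_field_def)
  have iX: "integrable ?D (\<lambda>z. u z * chaos_kernel P \<beta> X X z)" and iY: "integrable ?D (\<lambda>z. u z * chaos_kernel P \<beta> Y Y z)"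
    using X Y by (auto simp: chaos_field_def u_def)
  have iH: "integrable ?D (\<lambda>z. u z * h z)" using H by (simp add: u_def)
  have iS: "integrable ?D (\<lambda>z. u z * (chaos_kernel P \<beta> X Y z + chaos_kernel P \<beta> Y X z))"
    using chaos_cross_integrable[OF X Y XY] by (simp add: u_def)
  have iA: "integrable ?D (\<lambda>z. u z * \<bar>chaos_kernel P \<beta> X X z - h z\<bar>)"
  proof -
    have "integrable ?D (\<lambda>z. \<bar>u z * chaos_kernel P \<beta> X X z - u z * h z\<bar>)" using iX iH by (intro integrable_abs Bochner_Integration.integrable_diff)
    moreover have "\<bar>u z * chaos_kernel P \<beta> X X z - u z * h z\<bar> = u z * \<bar>chaos_kernel P \<beta> X X z - h z\<bar>" for z
      using u01[of z] by auto
    ultimately show ?thesis by (simp only:)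
  qed
  have iB: "integrable ?D (\<lambda>z. u z * \<bar>chaos_kernel P \<beta> Y Y z - h z\<bar>)"
  proof -
    have "integrable ?D (\<lambda>z. \<bar>u z * chaos_kernel P \<beta> Y Y z - u z * h z\<bar>)" using iY iH by (intro integrable_abs Bochner_Integration.integrable_diff)
    moreover have "\<bar>u z * chaos_kernel P \<beta> Y Y z - u z * h z\<bar> = u z * \<bar>chaos_kernel P \<beta> Y Y z - h z\<bar>" for z
      using u01[of z] by auto
    ultimately show ?thesis by (simp only:)
  qed
  have iM: "integrable ?D (\<lambda>z. u z * max 0 (h z - chaos_kernel P \<beta> X' Y' z))"
    if "continuous_gaussian_field P U X'" "continuous_gaussian_field P U Y'" for X' Y'
  proof (rule Bochner_Integration.integrable_bound[OF iH])
    have [measurable]: "(\<lambda>z. u z * chaos_kernel P \<beta> X' Y' z) \<in> borel_measurable ?D"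
      unfolding u_def by (rule chaos_kernel_measurable[OF that])
    have [measurable]: "(\<lambda>z. u z * h z) \<in> borel_measurable ?D" using iH by simp
    have "(\<lambda>z. max 0 (u z * h z - u z * chaos_kernel P \<beta> X' Y' z)) \<in> borel_measurable ?D" by measurable
    moreover have "max 0 (u z * h z - u z * chaos_kernel P \<beta> X' Y' z) = u z * max 0 (h z - chaos_kernel P \<beta> X' Y' z)" for z
      using u01[of z] by auto
    ultimately show "(\<lambda>z. u z * max 0 (h z - chaos_kernel P \<beta> X' Y' z)) \<in> borel_measurable ?D" by (simp only:)
    show "AE z in ?D. norm (u z * max 0 (h z - chaos_kernel P \<beta> X' Y' z)) \<le> norm (u z * h z)"
    proof (rule AE_I2)
      fix z
      show "norm (u z * max 0 (h z - chaos_kernel P \<beta> X' Y' z)) \<le> norm (u z * h z)"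
        using u01[of z] chaos_kernel_nonneg[of P \<beta> X' Y' z] by auto
    qed
  qed
  note iM1 = iM[OF chaos_field_continuous[OF X] chaos_field_continuous[OF Y]] and iM2 = iM[OF chaos_field_continuous[OF Y] chaos_field_continuous[OF X]]
  define A where "A = (LINT z|?D. u z * \<bar>chaos_kernel P \<beta> X X z - h z\<bar>)"
  define B where "B = (LINT z|?D. u z * \<bar>chaos_kernel P \<beta> Y Y z - h z\<bar>)"
  define M1 where "M1 = (LINT z|?D. u z * max 0 (h z - chaos_kernel P \<beta> X Y z))"
  define M2 where "M2 = (LINT z|?D. u z * max 0 (h z - chaos_kernel P \<beta> Y X z))"
  define S where "S = (LINT z|?D. u z * (chaos_kernel P \<beta> X Y z + chaos_kernel P \<beta> Y X z))"
  define K where "K = (LINT z|?D. u z * h z)"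
  have "chaos_discrepancy P \<beta> U X Y \<le> (LINT z|?D. u z * \<bar>chaos_kernel P \<beta> X X z - h z\<bar> + u z * \<bar>chaos_kernel P \<beta> Y Y z - h z\<bar> +
      (u z * (chaos_kernel P \<beta> X Y z + chaos_kernel P \<beta> Y X z) - 2 * (u z * h z)) +
      2 * (u z * max 0 (h z - chaos_kernel P \<beta> X Y z)) + 2 * (u z * max 0 (h z - chaos_kernel P \<beta> Y X z)))"
    unfolding chaos_discrepancy_def
  proof (rule integral_mono[OF chaos_discrepancy_integrable[OF X Y XY]])
    show "integrable ?D (\<lambda>z. u z * \<bar>chaos_kernel P \<beta> X X z - h z\<bar> + u z * \<bar>chaos_kernel P \<beta> Y Y z - h z\<bar> +
      (u z * (chaos_kernel P \<beta> X Y z + chaos_kernel P \<beta> Y X z) - 2 * (u z * h z)) +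
      2 * (u z * max 0 (h z - chaos_kernel P \<beta> X Y z)) + 2 * (u z * max 0 (h z - chaos_kernel P \<beta> Y X z)))"
      by (intro Bochner_Integration.integrable_add Bochner_Integration.integrable_diff integrable_mult_right iA iB iS iH iM1 iM2)
    fix z
    show "indicator (U \<times> U) z * \<bar>chaos_kernel P \<beta> X X z + chaos_kernel P \<beta> Y Y z - chaos_kernel P \<beta> X Y z - chaos_kernel P \<beta> Y X z\<bar> \<le>
      u z * \<bar>chaos_kernel P \<beta> X X z - h z\<bar> + u z * \<bar>chaos_kernel P \<beta> Y Y z - h z\<bar> +
      (u z * (chaos_kernel P \<beta> X Y z + chaos_kernel P \<beta> Y X z) - 2 * (u z * h z)) +
      2 * (u z * max 0 (h z - chaos_kernel P \<beta> X Y z)) + 2 * (u z * max 0 (h z - chaos_kernel P \<beta> Y X z))"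
      using mult_left_mono[OF abs_discrepancy_le, of "u z" "chaos_kernel P \<beta> X X z" "chaos_kernel P \<beta> Y Y z"
          "chaos_kernel P \<beta> X Y z" "chaos_kernel P \<beta> Y X z" "h z"] u01[of z]
      unfolding u_def[symmetric] by (auto simp: algebra_simps)
  qed
  also have "\<dots> = A + B + (S - 2 * K) + 2 * M1 + 2 * M2"
    unfolding A_def B_def S_def K_def M1_def M2_def
    using iA iB iS iH iM1 iM2 by simp
  also have "S \<le> (LINT z|?D. u z * chaos_kernel P \<beta> X X z) + (LINT z|?D. u z * chaos_kernel P \<beta> Y Y z)"
    unfolding S_def u_def by (rule chaos_cross_le[OF X Y XY])
  also have "(LINT z|?D. u z * chaos_kernel P \<beta> X X z) \<le> A + K"
  proof -
    have "(LINT z|?D. u z * chaos_kernel P \<beta> X X z) \<le> (LINT z|?D. u z * \<bar>chaos_kernel P \<beta> X X z - h z\<bar> + u z * h z)"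
    proof (rule integral_mono[OF iX Bochner_Integration.integrable_add[OF iA iH]])
      show "u z * chaos_kernel P \<beta> X X z \<le> u z * \<bar>chaos_kernel P \<beta> X X z - h z\<bar> + u z * h z" for z
        using u01[of z] by auto
    qed
    then show ?thesis using iA iH by (simp add: A_def K_def)
  qed
  also have "(LINT z|?D. u z * chaos_kernel P \<beta> Y Y z) \<le> B + K"
  proof -
    have "(LINT z|?D. u z * chaos_kernel P \<beta> Y Y z) \<le> (LINT z|?D. u z * \<bar>chaos_kernel P \<beta> Y Y z - h z\<bar> + u z * h z)"
    proof (rule integral_mono[OF iY Bochner_Integration.integrable_add[OF iB iH]])
      show "u z * chaos_kernel P \<beta> Y Y z \<le> u z * \<bar>chaos_kernel P \<beta> Y Y z - h z\<bar> + u z * h z" for z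
        using u01[of z] by auto
    qed
    then show ?thesis using iB iH by (simp add: B_def K_def)
  qed
  finally show ?thesis
    by (simp add: A_def B_def M1_def M2_def u_def)
qed

section \<open>Standard approximations\<close>

lemma jointly_centered_gaussian_pair:
  assumes Z: "jointly_centered_gaussian P I Z" and ij: "i \<in> I" "j \<in> I"
  shows "centered_gaussian P (\<lambda>\<omega>. a * Z i \<omega> + b * Z j \<omega>)"
proof (cases "i = j")
  case True
  have "centered_gaussian P (\<lambda>\<omega>. \<Sum>k\<in>{i}. (a + b) * Z k \<omega>)"
    using Z[unfolded jointly_centered_gaussian_def, rule_format, of "{i}" "\<lambda>_. a + b"] ij by simp
  then show ?thesis using True by (simp add: distrib_right)
next
  case False
  have "centered_gaussian P (\<lambda>\<omega>. \<Sum>k\<in>{i, j}. (if k = i then a else b) * Z k \<omega>)"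
    using Z[unfolded jointly_centered_gaussian_def, rule_format, of "{i, j}" "\<lambda>k. if k = i then a else b"] ij by simp
  then show ?thesis using False by simp
qed

lemma standard_approximation_gaussian_pair:
  assumes X: "standard_approximation P U g X"
  shows "gaussian_pair P U (X m) (X n)"
  unfolding gaussian_pair_def
proof (intro ballI allI)
  fix x y and a b :: real assume xy: "x \<in> U" "y \<in> U"
  have "jointly_centered_gaussian P (UNIV \<times> U) (\<lambda>(n, x). X n x)"
    using X by (simp add: standard_approximation_def)
  from jointly_centered_gaussian_pair[OF this, of "(m, x)" "(n, y)" a b] xy
  show "centered_gaussian P (\<lambda>\<omega>. a * X m x \<omega> + b * X n y \<omega>)" by simp
qed

lemma standard_approximation_continuous:
  assumes P: "prob_space P" and U: "log_covariance U g" and X: "standard_approximation P U g X"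
  shows "continuous_gaussian_field P U (X n)"
  using P U X standard_approximation_gaussian_pair[OF X, of n n]
  by (simp add: continuous_gaussian_field_def log_covariance_def standard_approximation_def)

text \<open>
  Off the diagonal of \<open>U \<times> U\<close>, the exponential of \<open>\<beta>\<^sup>2
  ln (1 / dist x y)\<close>.
\<close>

definition log_majorant :: "real \<Rightarrow> 'a::euclidean_space set \<Rightarrow> 'a \<times> 'a \<Rightarrow> real" where
  "log_majorant \<beta> U z = indicator (U \<times> U) z * dist (fst z) (snd z) powr (- \<beta>\<^sup>2)"

lemma log_majorant_integrable:
  fixes U :: "'a::euclidean_space set"
  assumes U: "log_covariance U g" and \<beta>: "\<beta>\<^sup>2 < real DIM('a)"
  shows "integrable (lborel \<Otimes>\<^sub>M lborel) (log_majorant \<beta> U)"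
  unfolding log_majorant_def[abs_def] using U \<beta>
  by (intro integrable_dist_powr) (auto simp: log_covariance_def)

lemma log_majorant_nonneg: "0 \<le> log_majorant \<beta> U z"
  by (simp add: log_majorant_def)

text \<open>
  The uniform upper bound on the covariances holds off the diagonal, which is a null set.
\<close>

lemma standard_approximation_dominated:
  fixes U :: "'a::euclidean_space set"
  assumes X: "standard_approximation P U g X"
  obtains C where "0 \<le> C"
    "\<And>n. AE z in lborel \<Otimes>\<^sub>M lborel. indicator (U \<times> U) z * chaos_kernel P \<beta> (X n) (X n) z \<le> C * log_majorant \<beta> U z"
proof -
  have "\<exists>B. \<forall>n. \<forall>x\<in>U. \<forall>y\<in>U. x \<noteq> y \<longrightarrow> covar P (X n x) (X n y) - ln (1 / dist x y) \<le> B"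
    using X by (simp add: standard_approximation_def)
  then obtain B where B: "\<forall>n. \<forall>x\<in>U. \<forall>y\<in>U. x \<noteq> y \<longrightarrow> covar P (X n x) (X n y) - ln (1 / dist x y) \<le> B" ..
  show ?thesis
  proof (rule that[of "exp (\<beta>\<^sup>2 * B)"])
    fix n
    show "AE z in lborel \<Otimes>\<^sub>M lborel. indicator (U \<times> U) z * chaos_kernel P \<beta> (X n) (X n) z \<le> exp (\<beta>\<^sup>2 * B) * log_majorant \<beta> U z"
      using AE_off_diagonal
    proof eventually_elim
      case (elim z)
      show ?case
      proof (cases "z \<in> U \<times> U")
        case True
        then have "fst z \<in> U" "snd z \<in> U" by auto
        then have "covar P (X n (fst z)) (X n (snd z)) \<le> ln (1 / dist (fst z) (snd z)) + B"
          using B[rule_format, of "fst z" "snd z" n] elim by simp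
        from exp_log_bound[OF _ this, of \<beta>] elim show ?thesis
          using True by (simp add: chaos_kernel_def log_majorant_def)
      next
        case False
        then show ?thesis by (simp add: log_majorant_def)
      qed
    qed
  qed simp
qed

lemma standard_approximation_chaos_field:
  fixes U :: "'a::euclidean_space set"
  assumes P: "prob_space P" and U: "log_covariance U g" and X: "standard_approximation P U g X"
    and \<beta>: "\<beta>\<^sup>2 < real DIM('a)"
  shows "chaos_field P \<beta> U (X n)"
  unfolding chaos_field_def
proof (intro conjI allI impI)
  show cont: "continuous_gaussian_field P U (X n)" by (rule standard_approximation_continuous[OF P U X])
  fix K assume K: "compact K \<and> K \<subseteq> U"
  obtain c :: "nat \<Rightarrow> real" where
    "\<forall>K. compact K \<and> K \<subseteq> U \<longrightarrow> (\<exists>B. \<forall>n. \<forall>x\<in>K. \<forall>y\<in>K.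
       \<bar>covar P (X n x) (X n y) - ln (1 / max (c n) (dist x y))\<bar> \<le> B)"
    using X unfolding standard_approximation_def by (elim conjE exE) (rule that)
  then have "\<exists>B. \<forall>n. \<forall>x\<in>K. \<forall>y\<in>K. \<bar>covar P (X n x) (X n y) - ln (1 / max (c n) (dist x y))\<bar> \<le> B"
    using K by simp
  then obtain B where B: "\<forall>n. \<forall>x\<in>K. \<forall>y\<in>K. \<bar>covar P (X n x) (X n y) - ln (1 / max (c n) (dist x y))\<bar> \<le> B" ..
  show "\<exists>B. \<forall>x\<in>K. covar P (X n x) (X n x) \<le> B"
  proof (intro exI ballI)
    fix x assume "x \<in> K"
    then have "\<bar>covar P (X n x) (X n x) - ln (1 / max (c n) (dist x x))\<bar> \<le> B" using B by blast
    \<comment> \<open>on the diagonal the local estimate bounds the variance by \<open>B + ln (1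
      / c\<^sub>n)\<close>\<close>
    then show "covar P (X n x) (X n x) \<le> B + ln (1 / max (c n) 0)" by simp
  qed
next
  have cont: "continuous_gaussian_field P U (X n)" by (rule standard_approximation_continuous[OF P U X])
  obtain C where C: "0 \<le> C"
    "\<And>n. AE z in lborel \<Otimes>\<^sub>M lborel. indicator (U \<times> U) z * chaos_kernel P \<beta> (X n) (X n) z \<le> C * log_majorant \<beta> U z"
    by (rule standard_approximation_dominated[OF X, of \<beta>]) (rule that)
  show "integrable (lborel \<Otimes>\<^sub>M lborel) (\<lambda>z. indicator (U \<times> U) z * chaos_kernel P \<beta> (X n) (X n) z)"
  proof (rule Bochner_Integration.integrable_bound)
    show "integrable (lborel \<Otimes>\<^sub>M lborel) (\<lambda>z. C * log_majorant \<beta> U z)"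
      by (intro integrable_mult_right log_majorant_integrable[OF U \<beta>])
    show "(\<lambda>z. indicator (U \<times> U) z * chaos_kernel P \<beta> (X n) (X n) z) \<in> borel_measurable (lborel \<Otimes>\<^sub>M lborel)"
      by (rule chaos_kernel_measurable[OF cont cont])
    show "AE z in lborel \<Otimes>\<^sub>M lborel. norm (indicator (U \<times> U) z * chaos_kernel P \<beta> (X n) (X n) z) \<le> norm (C * log_majorant \<beta> U z)"
      using C(2)[of n]
    proof eventually_elim
      case (elim z)
      have "0 \<le> C * log_majorant \<beta> U z" using C(1) log_majorant_nonneg[of \<beta> U z] by simp
      then show ?case using elim by (simp add: chaos_kernel_nonneg)
    qed
  qed
qed

definition covariances_converge ::
    "'o measure \<Rightarrow> 'a::euclidean_space set \<Rightarrow> ('a \<Rightarrow> 'a \<Rightarrow> real) \<Rightarrow> 'i filter \<Rightarrow>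
       ('i \<Rightarrow> 'a \<Rightarrow> 'o \<Rightarrow> real) \<Rightarrow> ('i \<Rightarrow> 'a \<Rightarrow> 'o \<Rightarrow> real) \<Rightarrow> bool" where
  "covariances_converge P U g F X Y \<longleftrightarrow>
     (\<forall>\<eta>>0. ((\<lambda>i. emeasure (lborel \<Otimes>\<^sub>M lborel)
        {z \<in> U \<times> U. \<eta> < \<bar>covar P (X i (fst z)) (Y i (snd z)) - log_kernel U g (fst z) (snd z)\<bar>}) \<longlongrightarrow> 0) F)"

lemma covariances_converge_compose:
  assumes "covariances_converge P U g F X Y" "filterlim p F G"
  shows "covariances_converge P U g G (\<lambda>i. X (p i)) (\<lambda>i. Y (p i))"
  using assms(1) unfolding covariances_converge_def
  by (auto intro: filterlim_compose[OF _ assms(2)])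

lemma covariance_error_sets:
  fixes U :: "'a::euclidean_space set"
  assumes X: "continuous_gaussian_field P U X" and Y: "continuous_gaussian_field P U Y" and U: "log_covariance U g"
  shows "{z \<in> U \<times> U. \<eta> < \<bar>covar P (X (fst z)) (Y (snd z)) - log_kernel U g (fst z) (snd z)\<bar>} \<in> sets (lborel \<Otimes>\<^sub>M lborel)"
proof -
  have [measurable]: "U \<in> sets borel" using U by (simp add: log_covariance_def)
  note [measurable] = covar_jointly_measurable[OF X Y] log_kernel_measurable[OF U]
  have "{z \<in> space (lborel \<Otimes>\<^sub>M lborel). z \<in> U \<times> U \<and>
      \<eta> < \<bar>indicator (U \<times> U) z * covar P (X (fst z)) (Y (snd z)) - log_kernel U g (fst z) (snd z)\<bar>} \<in> sets (lborel \<Otimes>\<^sub>M lborel)"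
    by measurable
  moreover have "{z \<in> space (lborel \<Otimes>\<^sub>M lborel). z \<in> U \<times> U \<and>
      \<eta> < \<bar>indicator (U \<times> U) z * covar P (X (fst z)) (Y (snd z)) - log_kernel U g (fst z) (snd z)\<bar>} =
    {z \<in> U \<times> U. \<eta> < \<bar>covar P (X (fst z)) (Y (snd z)) - log_kernel U g (fst z) (snd z)\<bar>}"
    by (auto simp: space_pair_measure)
  ultimately show ?thesis by (simp only:)
qed

text \<open>
  Exchanging the coordinates preserves Lebesgue measure and the symmetric limit.
\<close>

lemma covariances_converge_sym:
  fixes U :: "'a::euclidean_space set"
  assumes X: "\<And>i. continuous_gaussian_field P U (X i)" and Y: "\<And>i. continuous_gaussian_field P U (Y i)"
    and U: "log_covariance U g" and conv: "covariances_converge P U g F X Y"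
  shows "covariances_converge P U g F Y X"
proof -
  let ?D = "(lborel :: 'a measure) \<Otimes>\<^sub>M (lborel :: 'a measure)"
  let ?E = "\<lambda>X Y i \<eta>. {z \<in> U \<times> U. \<eta> < \<bar>covar P (X i (fst z)) (Y i (snd z)) - log_kernel U g (fst z) (snd z)\<bar>}"
  have sym: "log_kernel U g x y = log_kernel U g y x" for x y using U by (simp add: log_covariance_def)
  have "emeasure ?D (?E Y X i \<eta>) = emeasure ?D (?E X Y i \<eta>)" for i \<eta>
  proof -
    have m: "?E X Y i \<eta> \<in> sets ?D" by (rule covariance_error_sets[OF X Y U])
    have "emeasure ?D (?E X Y i \<eta>) = emeasure (distr ?D ?D (\<lambda>(x, y). (y, x))) (?E X Y i \<eta>)"
      using lborel_pair.distr_pair_swap[where 'a = 'a and 'b = 'a] by simp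
    also have "\<dots> = emeasure ?D ((\<lambda>(x, y). (y, x)) -` ?E X Y i \<eta> \<inter> space ?D)"
      by (rule emeasure_distr[OF _ m]) measurable
    also have "(\<lambda>(x, y). (y, x)) -` ?E X Y i \<eta> \<inter> space ?D = ?E Y X i \<eta>"
      using sym by (auto simp: space_pair_measure covar_sym[of P "Y i _"])
    finally show ?thesis by simp
  qed
  then show ?thesis using conv by (simp add: covariances_converge_def)
qed

text \<open>
  The positive part of the limit minus the kernel is dominated by the limit itself, whatever
  the kernel is. The absolute difference needs a majorant of the kernels, which exists for the
  covariances of a field with itself.
\<close>

lemma
  fixes U :: "'a::euclidean_space set"
  assumes U: "log_covariance U g" and \<beta>: "0 < \<beta>" "\<beta>\<^sup>2 < real DIM('a)"
    and X: "\<And>i. chaos_field P \<beta> U (X i)" and Y: "\<And>i. chaos_field P \<beta> U (Y i)"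
    and conv: "covariances_converge P U g F X Y" and \<epsilon>: "0 < \<epsilon>"
  shows eventually_kernel_below:
      "\<forall>\<^sub>F i in F. (LINT z|(lborel \<Otimes>\<^sub>M lborel). indicator (U \<times> U) z *
         max 0 (limit_kernel \<beta> U g z - chaos_kernel P \<beta> (X i) (Y i) z)) < \<epsilon>"
    and eventually_kernel_close: "0 \<le> C \<Longrightarrow>
      (\<And>i. AE z in lborel \<Otimes>\<^sub>M lborel. indicator (U \<times> U) z * chaos_kernel P \<beta> (X i) (Y i) z \<le> C * log_majorant \<beta> U z) \<Longrightarrow>
      \<forall>\<^sub>F i in F. (LINT z|(lborel \<Otimes>\<^sub>M lborel). indicator (U \<times> U) z *
         \<bar>chaos_kernel P \<beta> (X i) (Y i) z - limit_kernel \<beta> U g z\<bar>) < \<epsilon>"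
proof -
  let ?D = "(lborel :: 'a measure) \<Otimes>\<^sub>M (lborel :: 'a measure)"
  have H: "integrable ?D (\<lambda>z. indicator (U \<times> U) z * limit_kernel \<beta> U g z)"
    by (rule limit_kernel_integrable[OF U \<beta>(2)])
  then have H': "integrable ?D (\<lambda>z. indicator (U \<times> U) z * exp (\<beta>\<^sup>2 * log_kernel U g (fst z) (snd z)))"
    by (simp add: limit_kernel_def)
  have b: "0 < \<beta>\<^sup>2" using \<beta>(1) by simp
  have H0: "0 \<le> limit_kernel \<beta> U g z" for z by (simp add: limit_kernel_def)
  have m1[measurable]: "(\<lambda>z. indicator (U \<times> U) z * chaos_kernel P \<beta> (X i) (Y i) z) \<in> borel_measurable ?D" for i
    by (rule chaos_kernel_measurable[OF chaos_field_continuous[OF X] chaos_field_continuous[OF Y]])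
  have m2[measurable]: "(\<lambda>z. indicator (U \<times> U) z * limit_kernel \<beta> U g z) \<in> borel_measurable ?D"
    using H by simp
  note small = eventually_integral_exp_small[OF b H', where c = "\<lambda>i z. covar P (X i (fst z)) (Y i (snd z))" and F = F]
  have cv: "((\<lambda>i. emeasure ?D {z \<in> U \<times> U. \<eta> < \<bar>covar P (X i (fst z)) (Y i (snd z)) - log_kernel U g (fst z) (snd z)\<bar>}) \<longlongrightarrow> 0) F"
    if "0 < \<eta>" for \<eta>
    using conv that by (simp add: covariances_converge_def)
  note sets = covariance_error_sets[OF chaos_field_continuous[OF X] chaos_field_continuous[OF Y] U]
  show "\<forall>\<^sub>F i in F. (LINT z|?D. indicator (U \<times> U) z * max 0 (limit_kernel \<beta> U g z - chaos_kernel P \<beta> (X i) (Y i) z)) < \<epsilon>"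
  proof (rule small[OF cv sets H _ _ _ _ _ \<epsilon>])
    show "0 \<le> indicator (U \<times> U) z * limit_kernel \<beta> U g z" for z using H0 by simp
    show bound: "AE z in ?D. indicator (U \<times> U) z * max 0 (limit_kernel \<beta> U g z - chaos_kernel P \<beta> (X i) (Y i) z)
        \<le> indicator (U \<times> U) z * limit_kernel \<beta> U g z" for i
    proof (rule AE_I2)
      fix z
      show "indicator (U \<times> U) z * max 0 (limit_kernel \<beta> U g z - chaos_kernel P \<beta> (X i) (Y i) z)
        \<le> indicator (U \<times> U) z * limit_kernel \<beta> U g z"
        using H0[of z] chaos_kernel_nonneg[of P \<beta> "X i" "Y i" z] by (intro mult_left_mono) auto
    qed
    show "integrable ?D (\<lambda>z. indicator (U \<times> U) z * max 0 (limit_kernel \<beta> U g z - chaos_kernel P \<beta> (X i) (Y i) z))" for i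
    proof (rule Bochner_Integration.integrable_bound[OF H])
      have "(\<lambda>z. max 0 (indicator (U \<times> U) z * limit_kernel \<beta> U g z - indicator (U \<times> U) z * chaos_kernel P \<beta> (X i) (Y i) z))
          \<in> borel_measurable ?D" by measurable
      moreover have "max 0 (indicator (U \<times> U) z * limit_kernel \<beta> U g z - indicator (U \<times> U) z * chaos_kernel P \<beta> (X i) (Y i) z) =
          indicator (U \<times> U) z * max 0 (limit_kernel \<beta> U g z - chaos_kernel P \<beta> (X i) (Y i) z)" for z
        by (simp add: indicator_def)
      ultimately show "(\<lambda>z. indicator (U \<times> U) z * max 0 (limit_kernel \<beta> U g z - chaos_kernel P \<beta> (X i) (Y i) z)) \<in> borel_measurable ?D"
        by (simp only:)
      show "AE z in ?D. norm (indicator (U \<times> U) z * max 0 (limit_kernel \<beta> U g z - chaos_kernel P \<beta> (X i) (Y i) z))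
          \<le> norm (indicator (U \<times> U) z * limit_kernel \<beta> U g z)"
        using bound[of i] by eventually_elim (simp add: H0)
    qed
    show "indicator (U \<times> U) z * max 0 (limit_kernel \<beta> U g z - chaos_kernel P \<beta> (X i) (Y i) z) = 0" if "z \<notin> U \<times> U" for i z
      using that by simp
    show "indicator (U \<times> U) z * max 0 (limit_kernel \<beta> U g z - chaos_kernel P \<beta> (X i) (Y i) z)
        \<le> \<bar>exp (\<beta>\<^sup>2 * covar P (X i (fst z)) (Y i (snd z))) - exp (\<beta>\<^sup>2 * log_kernel U g (fst z) (snd z))\<bar>" if "z \<in> U \<times> U" for i z
      using that by (simp add: limit_kernel_def chaos_kernel_def)
  qed
  assume C: "0 \<le> C"
    and dom: "\<And>i. AE z in lborel \<Otimes>\<^sub>M lborel. indicator (U \<times> U) z * chaos_kernel P \<beta> (X i) (Y i) z \<le> C * log_majorant \<beta> U z"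
  let ?k = "\<lambda>z. C * log_majorant \<beta> U z + indicator (U \<times> U) z * limit_kernel \<beta> U g z"
  have k: "integrable ?D ?k"
    by (intro Bochner_Integration.integrable_add integrable_mult_right log_majorant_integrable[OF U \<beta>(2)] H)
  have k0: "0 \<le> ?k z" for z using C log_majorant_nonneg[of \<beta> U z] H0[of z] by simp
  show "\<forall>\<^sub>F i in F. (LINT z|?D. indicator (U \<times> U) z * \<bar>chaos_kernel P \<beta> (X i) (Y i) z - limit_kernel \<beta> U g z\<bar>) < \<epsilon>"
  proof (rule small[OF cv sets k k0 _ _ _ _ \<epsilon>])
    show bound: "AE z in ?D. indicator (U \<times> U) z * \<bar>chaos_kernel P \<beta> (X i) (Y i) z - limit_kernel \<beta> U g z\<bar> \<le> ?k z" for i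
      using dom[of i]
    proof eventually_elim
      case (elim z)
      have "indicator (U \<times> U) z * \<bar>chaos_kernel P \<beta> (X i) (Y i) z - limit_kernel \<beta> U g z\<bar> \<le>
          indicator (U \<times> U) z * (chaos_kernel P \<beta> (X i) (Y i) z + limit_kernel \<beta> U g z)"
        using H0[of z] chaos_kernel_nonneg[of P \<beta> "X i" "Y i" z] by (intro mult_left_mono) auto
      then show ?case using elim by (simp add: distrib_left)
    qed
    show "integrable ?D (\<lambda>z. indicator (U \<times> U) z * \<bar>chaos_kernel P \<beta> (X i) (Y i) z - limit_kernel \<beta> U g z\<bar>)" for i
    proof (rule Bochner_Integration.integrable_bound[OF k])
      have "(\<lambda>z. \<bar>indicator (U \<times> U) z * chaos_kernel P \<beta> (X i) (Y i) z - indicator (U \<times> U) z * limit_kernel \<beta> U g z\<bar>)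
          \<in> borel_measurable ?D" by measurable
      moreover have "\<bar>indicator (U \<times> U) z * chaos_kernel P \<beta> (X i) (Y i) z - indicator (U \<times> U) z * limit_kernel \<beta> U g z\<bar> =
          indicator (U \<times> U) z * \<bar>chaos_kernel P \<beta> (X i) (Y i) z - limit_kernel \<beta> U g z\<bar>" for z
        by (simp add: indicator_def)
      ultimately show "(\<lambda>z. indicator (U \<times> U) z * \<bar>chaos_kernel P \<beta> (X i) (Y i) z - limit_kernel \<beta> U g z\<bar>) \<in> borel_measurable ?D"
        by (simp only:)
      show "AE z in ?D. norm (indicator (U \<times> U) z * \<bar>chaos_kernel P \<beta> (X i) (Y i) z - limit_kernel \<beta> U g z\<bar>) \<le> norm (?k z)"
        using bound[of i]
      proof eventually_elim
        case (elim z)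
        then show ?case using k0[of z] by (simp add: abs_mult)
      qed
    qed
    show "indicator (U \<times> U) z * \<bar>chaos_kernel P \<beta> (X i) (Y i) z - limit_kernel \<beta> U g z\<bar> = 0" if "z \<notin> U \<times> U" for i z
      using that by simp
    show "indicator (U \<times> U) z * \<bar>chaos_kernel P \<beta> (X i) (Y i) z - limit_kernel \<beta> U g z\<bar>
        \<le> \<bar>exp (\<beta>\<^sup>2 * covar P (X i (fst z)) (Y i (snd z))) - exp (\<beta>\<^sup>2 * log_kernel U g (fst z) (snd z))\<bar>" if "z \<in> U \<times> U" for i z
      using that by (simp add: limit_kernel_def chaos_kernel_def)
  qed
qed

lemma eventually_chaos_discrepancy_small:
  fixes U :: "'a::euclidean_space set"
  assumes U: "log_covariance U g" and \<beta>: "0 < \<beta>" "\<beta>\<^sup>2 < real DIM('a)"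
    and X: "\<And>i. chaos_field P \<beta> U (X i)" and Y: "\<And>i. chaos_field P \<beta> U (Y i)"
    and XY: "\<And>i. gaussian_pair P U (X i) (Y i)"
    and conv: "covariances_converge P U g F X X" "covariances_converge P U g F Y Y" "covariances_converge P U g F X Y"
    and C: "0 \<le> C"
    and domX: "\<And>i. AE z in lborel \<Otimes>\<^sub>M lborel. indicator (U \<times> U) z * chaos_kernel P \<beta> (X i) (X i) z \<le> C * log_majorant \<beta> U z"
    and D: "0 \<le> D"
    and domY: "\<And>i. AE z in lborel \<Otimes>\<^sub>M lborel. indicator (U \<times> U) z * chaos_kernel P \<beta> (Y i) (Y i) z \<le> D * log_majorant \<beta> U z"
    and \<epsilon>: "0 < \<epsilon>"
  shows "\<forall>\<^sub>F i in F. chaos_discrepancy P \<beta> U (X i) (Y i) < \<epsilon>"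
proof -
  have e: "0 < \<epsilon> / 8" using \<epsilon> by simp
  have YX: "covariances_converge P U g F Y X"
    by (rule covariances_converge_sym[OF chaos_field_continuous[OF X] chaos_field_continuous[OF Y] U conv(3)])
  show ?thesis
    using eventually_kernel_close[OF U \<beta> X X conv(1) e C domX] eventually_kernel_close[OF U \<beta> Y Y conv(2) e D domY]
      eventually_kernel_below[OF U \<beta> X Y conv(3) e] eventually_kernel_below[OF U \<beta> Y X YX e]
  proof eventually_elim
    case (elim i)
    then show ?case
      using chaos_discrepancy_le[OF X Y XY limit_kernel_integrable[OF U \<beta>(2)], of i] by linarith
  qed
qed

lemma converges_in_measure_imp_covariances_converge:
  fixes U :: "'a::euclidean_space set"
  assumes "converges_in_measure_on (U \<times> U) F (\<lambda>i (x, y). covar P (X i x) (Y i y)) (\<lambda>(x, y). log_kernel U g x y)"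
  shows "covariances_converge P U g F X Y"
  using assms by (simp add: converges_in_measure_on_def covariances_converge_def lborel_prod case_prod_beta)

lemma standard_approximation_covariances_converge:
  assumes X: "standard_approximation P U g X"
  shows "covariances_converge P U g (sequentially \<times>\<^sub>F sequentially) (\<lambda>p. X (fst p)) (\<lambda>p. X (snd p))"
proof (rule converges_in_measure_imp_covariances_converge)
  have "converges_in_measure_on (U \<times> U) (sequentially \<times>\<^sub>F sequentially)
       (\<lambda>(m, n) (x, y). covar P (X m x) (X n y)) (\<lambda>(x, y). log_kernel U g x y)"
    using X by (simp add: standard_approximation_def)
  then show "converges_in_measure_on (U \<times> U) (sequentially \<times>\<^sub>F sequentially)
     (\<lambda>p (x, y). covar P (X (fst p) x) (X (snd p) y)) (\<lambda>(x, y). log_kernel U g x y)"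
    by (simp add: case_prod_beta')
qed

lemma standard_approximation_diagonal_converges:
  assumes X: "standard_approximation P U g X"
  shows "covariances_converge P U g sequentially X X"
proof -
  have "filterlim (\<lambda>n::nat. (n, n)) (sequentially \<times>\<^sub>F sequentially) sequentially"
    by (intro filterlim_Pair filterlim_ident)
  from covariances_converge_compose[OF standard_approximation_covariances_converge[OF X] this]
  show ?thesis by simp
qed

section \<open>The limit of the chaos\<close>

text \<open>
  Here \<open>v n\<close> is the transform of the extension of the \<open>n\<close>-th chaos
  and \<open>u\<close> that of the limit.
\<close>

definition chaos_limit ::
    "'o measure \<Rightarrow> real \<Rightarrow> 'a::euclidean_space set \<Rightarrow> (nat \<Rightarrow> 'a \<Rightarrow> 'o \<Rightarrow> real) \<Rightarrow>
       (nat \<Rightarrow> 'o \<Rightarrow> 'a \<Rightarrow> complex) \<Rightarrow> ('o \<Rightarrow> 'a \<Rightarrow> complex) \<Rightarrow> bool" where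
  "chaos_limit P \<beta> U X v u \<longleftrightarrow> (\<forall>n. chaos_extension P \<beta> U (X n) (v n)) \<and> u \<in> random_transforms P \<and>
     (\<forall>\<epsilon>>0. \<exists>N. \<forall>n\<ge>N. mean_square_close P \<epsilon> (v n) u)"

text \<open>
  The Cauchy property is the smallness of the discrepancy of \<open>X m\<close> and \<open>X
  n\<close>, as both indices tend to infinity independently; this is why the covariances are
  required to converge along pairs of indices.
\<close>

lemma chaos_limit_exists:
  fixes X :: "nat \<Rightarrow> 'a::euclidean_space \<Rightarrow> 'o \<Rightarrow> real"
  assumes P: "prob_space P" and U: "log_covariance U g" and X: "standard_approximation P U g X"
    and \<beta>: "0 < \<beta>" "\<beta>\<^sup>2 < real DIM('a)"
  obtains v u where "chaos_limit P \<beta> U X v u"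
    "\<And>n. chaos_integrable P \<beta> U (X n) U \<Longrightarrow> v n = chaos_transform P \<beta> (X n) U"
proof -
  have cf: "chaos_field P \<beta> U (X n)" for n by (rule standard_approximation_chaos_field[OF P U X \<beta>(2)])
  have "\<exists>w. chaos_extension P \<beta> U (X n) w \<and>
      (chaos_integrable P \<beta> U (X n) U \<longrightarrow> w = chaos_transform P \<beta> (X n) U)" for n
  proof -
    obtain w where "chaos_extension P \<beta> U (X n) w"
      "chaos_integrable P \<beta> U (X n) U \<Longrightarrow> w = chaos_transform P \<beta> (X n) U"
      by (rule chaos_extension_exists[OF cf[of n]]) (rule that)
    then show ?thesis by (intro exI[of _ w] conjI impI)
  qed
  then have "\<forall>n. \<exists>w. chaos_extension P \<beta> U (X n) w \<and>
      (chaos_integrable P \<beta> U (X n) U \<longrightarrow> w = chaos_transform P \<beta> (X n) U)" by (rule allI)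
  from choice[OF this] obtain v where v0: "\<forall>n. chaos_extension P \<beta> U (X n) (v n) \<and>
      (chaos_integrable P \<beta> U (X n) U \<longrightarrow> v n = chaos_transform P \<beta> (X n) U)" ..
  have v: "chaos_extension P \<beta> U (X n) (v n)" for n using v0 by simp
  have vU: "chaos_integrable P \<beta> U (X n) U \<Longrightarrow> v n = chaos_transform P \<beta> (X n) U" for n using v0 by simp
  have vR: "v n \<in> random_transforms P" for n using v[of n] by (simp add: chaos_extension_def)
  obtain C where C: "0 \<le> C"
    "\<And>n. AE z in lborel \<Otimes>\<^sub>M lborel. indicator (U \<times> U) z * chaos_kernel P \<beta> (X n) (X n) z \<le> C * log_majorant \<beta> U z"
    by (rule standard_approximation_dominated[OF X, of \<beta>]) (rule that)
  have cauchy: "\<exists>N. \<forall>i\<ge>N. \<forall>j\<ge>N. mean_square_close P \<epsilon> (v i) (v j)" if \<epsilon>: "0 < \<epsilon>" for \<epsilon>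
  proof -
    have small: "\<forall>\<^sub>F p in sequentially \<times>\<^sub>F sequentially. chaos_discrepancy P \<beta> U (X (fst p)) (X (snd p)) < \<epsilon> / 8"
    proof (rule eventually_chaos_discrepancy_small[OF U \<beta> cf cf])
      show "gaussian_pair P U (X (fst p)) (X (snd p))" for p :: "nat \<times> nat"
        by (rule standard_approximation_gaussian_pair[OF X])
      show "covariances_converge P U g (sequentially \<times>\<^sub>F sequentially) (\<lambda>p. X (fst p)) (\<lambda>p. X (fst p))"
        by (rule covariances_converge_compose[OF standard_approximation_diagonal_converges[OF X] filterlim_fst])
      show "covariances_converge P U g (sequentially \<times>\<^sub>F sequentially) (\<lambda>p. X (snd p)) (\<lambda>p. X (snd p))"
        by (rule covariances_converge_compose[OF standard_approximation_diagonal_converges[OF X] filterlim_snd])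
      show "covariances_converge P U g (sequentially \<times>\<^sub>F sequentially) (\<lambda>p. X (fst p)) (\<lambda>p. X (snd p))"
        by (rule standard_approximation_covariances_converge[OF X])
      show "0 \<le> C" by (rule C(1))
      show "AE z in lborel \<Otimes>\<^sub>M lborel. indicator (U \<times> U) z * chaos_kernel P \<beta> (X (fst p)) (X (fst p)) z
        \<le> C * log_majorant \<beta> U z" for p :: "nat \<times> nat" by (rule C(2))
      show "0 \<le> C" by (rule C(1))
      show "AE z in lborel \<Otimes>\<^sub>M lborel. indicator (U \<times> U) z * chaos_kernel P \<beta> (X (snd p)) (X (snd p)) z
        \<le> C * log_majorant \<beta> U z" for p :: "nat \<times> nat" by (rule C(2))
      show "0 < \<epsilon> / 8" using \<epsilon> by simp
    qed
    then obtain N where N: "\<And>i j. N \<le> i \<Longrightarrow> N \<le> j \<Longrightarrow> chaos_discrepancy P \<beta> U (X i) (X j) < \<epsilon> / 8"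
      by (auto simp: eventually_prod_sequentially)
    have "mean_square_close P \<epsilon> (v i) (v j)" if "N \<le> i" "N \<le> j" for i j
    proof (rule mean_square_close_mono)
      show "mean_square_close P (4 * chaos_discrepancy P \<beta> U (X i) (X j) + \<epsilon> / 2) (v i) (v j)"
        using \<epsilon> by (intro chaos_extension_close[OF cf cf standard_approximation_gaussian_pair[OF X] v v]) simp
      show "4 * chaos_discrepancy P \<beta> U (X i) (X j) + \<epsilon> / 2 \<le> \<epsilon>" using N[OF that] by simp
    qed
    then show ?thesis by (intro exI[of _ N] allI impI)
  qed
  obtain u where u: "u \<in> random_transforms P"
    "\<And>\<epsilon>. 0 < \<epsilon> \<Longrightarrow> \<exists>N. \<forall>j\<ge>N. mean_square_close P \<epsilon> (v j) u"
    by (rule random_transforms_complete[OF P vR cauchy]) (assumption, rule that, assumption+)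
  have "chaos_limit P \<beta> U X v u" unfolding chaos_limit_def using v u by (intro conjI allI impI) assumption+
  from that[OF this vU] show ?thesis .
qed

lemma chaos_limit_converges:
  fixes X :: "nat \<Rightarrow> 'a::euclidean_space \<Rightarrow> 'o \<Rightarrow> real"
  assumes P: "prob_space P" and lim: "chaos_limit P \<beta> U X v u" and s: "s < - real DIM('a) / 2"
  shows "converges_in_probability_sobolev P s (\<lambda>n \<omega>. synthesis (v n \<omega>)) (\<lambda>\<omega>. synthesis (u \<omega>))"
proof (rule mean_square_imp_in_probability[OF P s])
  show "v n \<in> random_transforms P" for n using lim by (simp add: chaos_limit_def chaos_extension_def)
  show "u \<in> random_transforms P" using lim by (simp add: chaos_limit_def)
  show "\<exists>N. \<forall>j\<ge>N. mean_square_close P \<epsilon> (v j) u" if "0 < \<epsilon>" for \<epsilon>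
    using lim that by (simp add: chaos_limit_def)
qed

lemma imaginary_chaos_limit_synthesis:
  fixes X :: "nat \<Rightarrow> 'a::euclidean_space \<Rightarrow> 'o \<Rightarrow> real"
  assumes P: "prob_space P" and X: "\<And>n. chaos_field P \<beta> U (X n)" and lim: "chaos_limit P \<beta> U X v u"
    and vU: "\<And>n. chaos_integrable P \<beta> U (X n) U \<Longrightarrow> v n = chaos_transform P \<beta> (X n) U"
  shows "imaginary_chaos_limit P U \<beta> X (\<lambda>\<omega>. synthesis (u \<omega>))"
  unfolding imaginary_chaos_limit_def
proof (intro exI[of _ "\<lambda>n \<omega>. synthesis (v n \<omega>)"] conjI allI impI)
  have v: "chaos_extension P \<beta> U (X n) (v n)" for n using lim by (simp add: chaos_limit_def)
  show "zero_extension P U (imaginary_chaos P \<beta> (X n)) (\<lambda>\<omega>. synthesis (v n \<omega>))" for n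
    by (rule zero_extension_synthesis[OF X v vU])
  show "converges_in_probability_sobolev P s (\<lambda>n \<omega>. synthesis (v n \<omega>)) (\<lambda>\<omega>. synthesis (u \<omega>))"
    if "s < - real DIM('a) / 2" for s by (rule chaos_limit_converges[OF P lim that])
qed

text \<open>
  The limit is the same for all versions of the extensions by zero of the approximating
  chaoses.
\<close>

lemma imaginary_chaos_limit_unique:
  fixes X :: "nat \<Rightarrow> 'a::euclidean_space \<Rightarrow> 'o \<Rightarrow> real"
  assumes P: "prob_space P" and X: "\<And>n. chaos_field P \<beta> U (X n)" and lim: "chaos_limit P \<beta> U X v u"
    and \<mu>: "imaginary_chaos_limit P U \<beta> X \<mu>"
  shows "AE \<omega> in P. \<mu> \<omega> = synthesis (u \<omega>)"
proof -
  obtain M where M: "\<forall>n. zero_extension P U (imaginary_chaos P \<beta> (X n)) (M n)"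
    "\<forall>s < - real DIM('a) / 2. converges_in_probability_sobolev P s M \<mu>"
    using \<mu> unfolding imaginary_chaos_limit_def by (elim exE conjE) (rule that)
  have s: "- real DIM('a) / 2 - 1 < - real DIM('a) / 2" by simp
  show ?thesis
  proof (rule converges_in_probability_sobolev_unique[OF P s])
    show "converges_in_probability_sobolev P (- real DIM('a) / 2 - 1) M \<mu>" using M(2) s by simp
    show "converges_in_probability_sobolev P (- real DIM('a) / 2 - 1) (\<lambda>n \<omega>. synthesis (v n \<omega>)) (\<lambda>\<omega>. synthesis (u \<omega>))"
      by (rule chaos_limit_converges[OF P lim s])
    show "AE \<omega> in P. M n \<omega> = synthesis (v n \<omega>)" for n
    proof (rule zero_extension_unique[OF X[of n]])
      show "chaos_extension P \<beta> U (X n) (v n)" using lim by (simp add: chaos_limit_def)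
      show "zero_extension P U (imaginary_chaos P \<beta> (X n)) (M n)" using M(1) by simp
    qed
  qed
qed

text \<open>
  The limit is approximated by transforms of chaoses on compact sets, which are random bounded
  functions; moreover, the sets may be taken to exhaust the volume of \<open>U\<close>.
\<close>

lemma chaos_limit_approximation:
  fixes X :: "nat \<Rightarrow> 'a::euclidean_space \<Rightarrow> 'o \<Rightarrow> real"
  assumes U: "open U" "bounded U" and X: "\<And>n. chaos_field P \<beta> U (X n)" and lim: "chaos_limit P \<beta> U X v u"
    and \<epsilon>: "0 < \<epsilon>"
  obtains n K where "compact K" "K \<subseteq> U" "mean_square_close P \<epsilon> (chaos_transform P \<beta> (X n) K) u"
    "measure lborel U - \<epsilon> < measure lborel K"
proof -
  obtain L :: "nat \<Rightarrow> 'a set" where L: "incseq L" "\<And>j. compact (L j)" "\<And>j. L j \<subseteq> U" "(\<Union>j. L j) = U"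
    by (rule compact_exhaustion[OF U(1)]) (rule that)
  have "0 < \<epsilon> / 4" using \<epsilon> by simp
  then have "\<exists>N. \<forall>n\<ge>N. mean_square_close P (\<epsilon> / 4) (v n) u" using lim by (simp add: chaos_limit_def)
  then obtain n where n: "mean_square_close P (\<epsilon> / 4) (v n) u" by blast
  have v: "chaos_extension P \<beta> U (X n) (v n)" using lim by (simp add: chaos_limit_def)
  have "(\<lambda>j. chaos_tail P \<beta> U (X n) (L j)) \<longlonglongrightarrow> 0" by (rule chaos_tail_tendsto[OF X L(1,2,4)])
  then have tail: "\<forall>\<^sub>F j in sequentially. chaos_tail P \<beta> U (X n) (L j) < \<epsilon> / 32"
    by (rule order_tendstoD) (use \<epsilon> in simp)
  have "(\<lambda>j. measure lborel (L j)) \<longlonglongrightarrow> measure lborel (\<Union>j. L j)"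
  proof (rule Lim_measure_incseq)
    show "range L \<subseteq> sets lborel" using L(2) by (auto intro: borel_compact)
    show "emeasure lborel (\<Union>j. L j) \<noteq> \<infinity>" unfolding L(4) using emeasure_bounded_finite[OF U(2)] by simp
  qed (rule L(1))
  then have vol: "\<forall>\<^sub>F j in sequentially. measure lborel U - \<epsilon> < measure lborel (L j)"
    unfolding L(4) by (rule order_tendstoD) (use \<epsilon> in simp)
  from eventually_conj[OF tail vol] obtain j where
    j: "chaos_tail P \<beta> U (X n) (L j) < \<epsilon> / 32" "measure lborel U - \<epsilon> < measure lborel (L j)"
    by (auto simp: eventually_sequentially)
  have LR: "chaos_transform P \<beta> (X n) (L j) \<in> random_transforms P"
    by (rule chaos_transform_random[OF chaos_field_continuous[OF X] chaos_integrable_compact[OF X L(2,3)]])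
  have close: "mean_square_close P (4 * chaos_tail P \<beta> U (X n) (L j) + \<epsilon> / 16) (chaos_transform P \<beta> (X n) (L j)) (v n)"
    using v L(2,3)[of j] \<epsilon> by (simp add: chaos_extension_def)
  have t0: "0 \<le> 4 * chaos_tail P \<beta> U (X n) (L j) + \<epsilon> / 16"
    using chaos_tail_nonneg[of P \<beta> U "X n" "L j"] \<epsilon> by simp
  have vR: "v n \<in> random_transforms P" using v by (simp add: chaos_extension_def)
  have uR: "u \<in> random_transforms P" using lim by (simp add: chaos_limit_def)
  have e0: "0 \<le> \<epsilon> / 4" using \<epsilon> by simp
  have "mean_square_close P \<epsilon> (chaos_transform P \<beta> (X n) (L j)) u"
  proof (rule mean_square_close_mono[OF random_transforms_triangle[OF LR vR uR close n t0 e0]])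
    show "2 * (4 * chaos_tail P \<beta> U (X n) (L j) + \<epsilon> / 16) + 2 * (\<epsilon> / 4) \<le> \<epsilon>" using j(1) \<epsilon> by simp
  qed
  from that[OF L(2,3) this j(2)] show ?thesis .
qed

text \<open>
  Along a sequence of such approximations with summable errors the pairings with all Schwartz
  functions converge almost surely, and the approximations vanish off \<open>U\<close>.
\<close>

lemma chaos_limit_supported:
  fixes X :: "nat \<Rightarrow> 'a::euclidean_space \<Rightarrow> 'o \<Rightarrow> real"
  assumes P: "prob_space P" and U: "open U" "bounded U" and X: "\<And>n. chaos_field P \<beta> U (X n)"
    and lim: "chaos_limit P \<beta> U X v u"
  shows "AE \<omega> in P. supported_on (synthesis (u \<omega>)) (closure U)"
proof -
  have "\<exists>p. compact (snd p) \<and> snd p \<subseteq> U \<and> mean_square_close P ((1 / 2) ^ k) (chaos_transform P \<beta> (X (fst p)) (snd p)) u"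
    for k :: nat
  proof -
    have "(0::real) < (1 / 2) ^ k" by simp
    from chaos_limit_approximation[OF U X lim this] obtain n K where
      "compact K" "K \<subseteq> U" "mean_square_close P ((1 / 2) ^ k) (chaos_transform P \<beta> (X n) K) u" .
    then show ?thesis by (intro exI[of _ "(n, K)"]) simp
  qed
  then have "\<forall>k::nat. \<exists>p. compact (snd p) \<and> snd p \<subseteq> U \<and>
    mean_square_close P ((1 / 2) ^ k) (chaos_transform P \<beta> (X (fst p)) (snd p)) u" by (rule allI)
  from choice[OF this] obtain p where p: "\<And>k::nat. compact (snd (p k))" "\<And>k::nat. snd (p k) \<subseteq> U"
    "\<And>k::nat. mean_square_close P ((1 / 2) ^ k) (chaos_transform P \<beta> (X (fst (p k))) (snd (p k))) u"
    by auto
  let ?V = "\<lambda>k. chaos_transform P \<beta> (X (fst (p k))) (snd (p k))"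
  have int: "chaos_integrable P \<beta> U (X (fst (p k))) (snd (p k))" for k
    by (rule chaos_integrable_compact[OF X p(1,2)])
  have VR: "?V k \<in> random_transforms P" for k
    by (rule chaos_transform_random[OF chaos_field_continuous[OF X] int])
  have uR: "u \<in> random_transforms P" using lim by (simp add: chaos_limit_def)
  have "AE \<omega> in P. \<forall>\<phi>\<in>schwartz_functions. (\<lambda>k. synthesis (?V k \<omega>) \<phi>) \<longlonglongrightarrow> synthesis (u \<omega>) \<phi>"
    by (rule mean_square_summable_imp_AE_tendsto[OF P VR uR p(3)])
  then show ?thesis
    using AE_space
  proof eventually_elim
    case (elim \<omega>)
    show ?case unfolding supported_on_def
    proof (intro ballI impI)
      fix \<phi> :: "'a \<Rightarrow> complex" assume \<phi>: "fun_support \<phi> \<inter> closure U = {}"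
      show "synthesis (u \<omega>) \<phi> = 0"
      proof (cases "\<phi> \<in> schwartz_functions")
        case True
        have zero: "\<phi> x = 0" if "x \<in> U" for x
        proof (rule ccontr)
          assume "\<phi> x \<noteq> 0"
          then have "x \<in> fun_support \<phi>" unfolding fun_support_def by (intro subsetD[OF closure_subset]) simp
          then show False using \<phi> subsetD[OF closure_subset that] by blast
        qed
        have "synthesis (?V k \<omega>) \<phi> = 0" for k
        proof -
          have "synthesis (?V k \<omega>) = fun_distribution (snd (p k)) (imaginary_chaos P \<beta> (X (fst (p k))) \<omega>)"
            by (rule fun_distribution_eq_synthesis[OF chaos_field_continuous[OF X] int elim(2), symmetric])
          moreover have "(LINT x:snd (p k)|lborel. imaginary_chaos P \<beta> (X (fst (p k))) \<omega> x * \<phi> x) =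
              (LINT x|(lborel::'a measure). (0::complex))"
            unfolding set_lebesgue_integral_def
            by (rule Bochner_Integration.integral_cong[OF refl]) (use p(2)[of k] zero in \<open>auto simp: indicator_def\<close>)
          ultimately show ?thesis by (simp add: fun_distribution_def)
        qed
        then have "(\<lambda>k. synthesis (?V k \<omega>) \<phi>) \<longlonglongrightarrow> 0" by simp
        moreover have "(\<lambda>k. synthesis (?V k \<omega>) \<phi>) \<longlonglongrightarrow> synthesis (u \<omega>) \<phi>" using elim(1) True by blast
        ultimately show ?thesis by (rule LIMSEQ_unique[rotated])
      qed (simp add: synthesis_def)
    qed
  qed
qed

lemma chaos_limits_eq:
  fixes X Y :: "nat \<Rightarrow> 'a::euclidean_space \<Rightarrow> 'o \<Rightarrow> real"
  assumes P: "prob_space P" and X: "\<And>n. chaos_field P \<beta> U (X n)" and Y: "\<And>n. chaos_field P \<beta> U (Y n)"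
    and XY: "\<And>n. gaussian_pair P U (X n) (Y n)"
    and v: "chaos_limit P \<beta> U X v u" and w: "chaos_limit P \<beta> U Y w y"
    and small: "\<And>\<epsilon>. 0 < \<epsilon> \<Longrightarrow> \<forall>\<^sub>F n in sequentially. chaos_discrepancy P \<beta> U (X n) (Y n) < \<epsilon>"
  shows "AE \<omega> in P. synthesis (u \<omega>) = synthesis (y \<omega>)"
proof (rule mean_square_close_0_imp_AE_eq[OF P])
  have vR: "v n \<in> random_transforms P" and wR: "w n \<in> random_transforms P" for n
    using v w by (simp_all add: chaos_limit_def chaos_extension_def)
  show uR: "u \<in> random_transforms P" and yR: "y \<in> random_transforms P"
    using v w by (simp_all add: chaos_limit_def)
  show "mean_square_close P 0 u y"
  proof (rule mean_square_close_0)
    fix \<epsilon> :: real assume \<epsilon>: "0 < \<epsilon>"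
    have e: "0 < \<epsilon> / 16" using \<epsilon> by simp
    have "\<exists>N. \<forall>n\<ge>N. mean_square_close P (\<epsilon> / 16) (v n) u" using v e by (simp add: chaos_limit_def)
    then obtain N1 where N1: "\<forall>n\<ge>N1. mean_square_close P (\<epsilon> / 16) (v n) u" ..
    have "\<exists>N. \<forall>n\<ge>N. mean_square_close P (\<epsilon> / 16) (w n) y" using w e by (simp add: chaos_limit_def)
    then obtain N2 where N2: "\<forall>n\<ge>N2. mean_square_close P (\<epsilon> / 16) (w n) y" ..
    have "0 < \<epsilon> / 64" using \<epsilon> by simp
    from small[OF this] obtain N3 where N3: "\<forall>n\<ge>N3. chaos_discrepancy P \<beta> U (X n) (Y n) < \<epsilon> / 64"
      by (auto simp: eventually_sequentially)
    define n where "n = max N1 (max N2 N3)"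
    have 1: "mean_square_close P (\<epsilon> / 16) u (v n)" by (rule mean_square_close_sym) (use N1 in \<open>simp add: n_def\<close>)
    have 2: "mean_square_close P (4 * chaos_discrepancy P \<beta> U (X n) (Y n) + \<epsilon> / 16) (v n) (w n)"
      by (rule chaos_extension_close[OF X Y XY]) (use v w e in \<open>simp_all add: chaos_limit_def\<close>)
    have 3: "mean_square_close P (\<epsilon> / 16) (w n) y" using N2 by (simp add: n_def)
    have d: "0 \<le> 4 * chaos_discrepancy P \<beta> U (X n) (Y n) + \<epsilon> / 16"
      using chaos_discrepancy_nonneg[of P \<beta> U "X n" "Y n"] e by simp
    have d3: "chaos_discrepancy P \<beta> U (X n) (Y n) < \<epsilon> / 64" using N3 by (simp add: n_def)
    note 12 = random_transforms_triangle[OF uR vR wR 1 2 less_imp_le[OF e] d]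
    have d': "0 \<le> 2 * (\<epsilon> / 16) + 2 * (4 * chaos_discrepancy P \<beta> U (X n) (Y n) + \<epsilon> / 16)" using d e by simp
    show "mean_square_close P \<epsilon> u y"
      by (rule mean_square_close_mono[OF random_transforms_triangle[OF uR wR yR 12 3 d' less_imp_le[OF e]]])
        (use d3 \<epsilon> in simp)
  qed
qed


text \<open>
  By Fubini's theorem, since the chaos has mean \<open>1\<close> at every point.
\<close>

lemma chaos_transform_mean:
  fixes X :: "'a::euclidean_space \<Rightarrow> 'o \<Rightarrow> real"
  assumes X: "continuous_gaussian_field P U X" and A: "chaos_integrable P \<beta> U X A"
  shows "(LINT \<omega>|P. chaos_transform P \<beta> X A \<omega> \<xi>) = fourier (\<lambda>x. indicator A x) \<xi>"
proof -
  interpret P: prob_space P using X by (simp add: continuous_gaussian_field_def)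
  interpret pair_sigma_finite P "lborel :: 'a measure" ..
  have Ab[measurable]: "A \<in> sets borel" and AU: "A \<subseteq> U" using A by (simp_all add: chaos_integrable_def)
  let ?e = "\<lambda>x::'a. cis (- 2 * pi * (x \<bullet> \<xi>))"
  let ?f = "\<lambda>\<omega> x. ?e x * (indicator A x * imaginary_chaos P \<beta> X \<omega> x)"
  note [measurable] = imaginary_chaos_jointly_measurable[OF X Ab AU, of \<beta>]
  have e[measurable]: "?e \<in> borel_measurable borel"
    by (intro borel_measurable_continuous_onI continuous_intros)
  have m: "case_prod ?f \<in> borel_measurable (P \<Otimes>\<^sub>M lborel)"
  proof -
    have "(\<lambda>z. ?e (snd z) * (case z of (\<omega>, x) \<Rightarrow> indicator A x * imaginary_chaos P \<beta> X \<omega> x)) \<in>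
      borel_measurable (P \<Otimes>\<^sub>M lborel)" by measurable
    then show ?thesis by (simp add: case_prod_beta')
  qed
  have norm: "cmod (?f \<omega> x) = indicator A x * chaos_modulus P \<beta> X x" for \<omega> x
    by (simp only: norm_mult[of "?e x"] norm_cis norm_indicator_chaos mult_1)
  have int: "integrable (P \<Otimes>\<^sub>M lborel) (case_prod ?f)"
  proof (rule Fubini_integrable[OF m])
    show "integrable P (\<lambda>\<omega>. LINT x|lborel. cmod (case (\<omega>, x) of (\<omega>, x) \<Rightarrow> ?f \<omega> x))"
      unfolding prod.case norm by simp
    show "AE \<omega> in P. integrable lborel (\<lambda>x. case (\<omega>, x) of (\<omega>, x) \<Rightarrow> ?f \<omega> x)"
      using AE_space
    proof eventually_elim
      case (elim \<omega>)
      have "integrable lborel (\<lambda>x. indicator A x * imaginary_chaos P \<beta> X \<omega> x)"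
        by (rule chaos_section_integrable[OF X A elim])
      then show ?case unfolding prod.case
      proof (rule Bochner_Integration.integrable_bound)
        have "(\<lambda>x. indicator A x * imaginary_chaos P \<beta> X \<omega> x) \<in> borel_measurable borel"
          by (rule chaos_section_measurable[OF X Ab AU elim])
        then show "?f \<omega> \<in> borel_measurable lborel" by measurable
        show "AE x in lborel. cmod (?f \<omega> x) \<le> cmod (indicator A x * imaginary_chaos P \<beta> X \<omega> x)"
          by (rule AE_I2) (simp only: norm norm_indicator_chaos order_refl)
      qed
    qed
  qed
  have inner: "(LINT \<omega>|P. ?f \<omega> x) = ?e x * indicator A x" for x
  proof (cases "x \<in> A")
    case True
    then have "(LINT \<omega>|P. imaginary_chaos P \<beta> X \<omega> x) = 1" using AU by (intro chaos_mean(2)[OF X]) auto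
    then show ?thesis using True by simp
  qed simp
  show ?thesis
    unfolding chaos_transform_def fourier_def
    by (simp only: Fubini_integral[OF int, symmetric] inner)
qed

lemma norm_expectation_le:
  fixes V :: "'o \<Rightarrow> complex"
  assumes P: "prob_space P" and V[measurable]: "V \<in> borel_measurable P" and B: "\<And>\<omega>. cmod (V \<omega>) \<le> B"
    and le: "(\<integral>\<^sup>+\<omega>. ennreal ((cmod (V \<omega>))\<^sup>2) \<partial>P) \<le> ennreal \<epsilon>" and \<epsilon>: "0 \<le> \<epsilon>"
  shows "(cmod (LINT \<omega>|P. V \<omega>))\<^sup>2 \<le> \<epsilon>"
proof -
  interpret prob_space P by (rule P)
  let ?X = "\<lambda>\<omega>. cmod (V \<omega>)"
  have iX: "integrable P ?X" by (rule integrable_const_bound[of _ B]) (use B in auto)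
  have iX2: "integrable P (\<lambda>\<omega>. (?X \<omega>)\<^sup>2)"
    by (rule integrable_const_bound[of _ "B\<^sup>2"]) (use B in \<open>auto intro!: power_mono\<close>)
  have "(expectation ?X)\<^sup>2 \<le> expectation (\<lambda>\<omega>. (?X \<omega>)\<^sup>2)"
    using variance_positive[of ?X] unfolding variance_eq[OF iX iX2] by simp
  moreover have "expectation (\<lambda>\<omega>. (?X \<omega>)\<^sup>2) \<le> \<epsilon>"
    using le \<epsilon> by (simp add: nn_integral_eq_integral[OF iX2])
  moreover have "(cmod (expectation V))\<^sup>2 \<le> (expectation ?X)\<^sup>2"
    by (rule power_mono[OF integral_norm_bound norm_ge_zero])
  ultimately show ?thesis by linarith
qed

text \<open>
  The phase is at most \<open>1 < \<pi> / 3\<close> on \<open>K\<close>, so that its cosine is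
  at least \<open>1 / 2\<close>.
\<close>

lemma fourier_indicator_low_frequency:
  fixes K :: "'a::euclidean_space set"
  assumes K: "compact K" and R: "\<And>x. x \<in> K \<Longrightarrow> norm x \<le> R" and \<xi>: "2 * pi * R * norm \<xi> \<le> 1"
  shows "measure lborel K / 2 \<le> cmod (fourier (\<lambda>x. indicator K x) \<xi>)"
proof -
  let ?e = "\<lambda>x::'a. cis (- 2 * pi * (x \<bullet> \<xi>))"
  have Kb[measurable]: "K \<in> sets borel" using K by (rule borel_compact)
  have iK: "integrable lborel (indicator K :: 'a \<Rightarrow> real)"
    using emeasure_compact_finite[OF K] by (simp add: integrable_indicator_iff)
  have e[measurable]: "?e \<in> borel_measurable borel"
    by (intro borel_measurable_continuous_onI continuous_intros)
  have int: "integrable lborel (\<lambda>x. ?e x * indicator K x)"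
    by (rule Bochner_Integration.integrable_bound[OF iK]) (simp_all add: norm_mult indicator_def)
  have low: "1 / 2 * indicator K x \<le> Re (?e x * indicator K x)" for x
  proof (cases "x \<in> K")
    case True
    have "\<bar>x \<bullet> \<xi>\<bar> \<le> norm x * norm \<xi>" by (rule Cauchy_Schwarz_ineq2)
    also have "\<dots> \<le> R * norm \<xi>" by (rule mult_right_mono[OF R[OF True] norm_ge_zero])
    finally have "2 * pi * \<bar>x \<bullet> \<xi>\<bar> \<le> 2 * pi * (R * norm \<xi>)" by (intro mult_left_mono) simp_all
    then have "2 * pi * \<bar>x \<bullet> \<xi>\<bar> \<le> 1" using \<xi> unfolding mult.assoc by linarith
    moreover have "\<bar>2 * pi * (x \<bullet> \<xi>)\<bar> = 2 * pi * \<bar>x \<bullet> \<xi>\<bar>" by (simp add: abs_mult)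
    ultimately have "\<bar>2 * pi * (x \<bullet> \<xi>)\<bar> \<le> pi / 3" using pi_gt3 by linarith
    then have "cos (pi / 3) \<le> cos \<bar>2 * pi * (x \<bullet> \<xi>)\<bar>"
      by (intro cos_monotone_0_pi_le) (simp_all)
    then show ?thesis using True by (simp add: cos_60)
  qed simp
  have "measure lborel K / 2 = (LINT x|lborel. 1 / 2 * indicator K x)" by simp
  also have "\<dots> \<le> (LINT x|lborel. Re (?e x * indicator K x))"
    by (rule integral_mono[OF integrable_mult_right[OF iK] integrable_Re[OF int] low])
  also have "\<dots> = Re (LINT x|lborel. ?e x * indicator K x)" by (rule integral_Re[OF int])
  also have "\<dots> \<le> cmod (LINT x|lborel. ?e x * indicator K x)" by (rule complex_Re_le_cmod)
  finally show ?thesis by (simp only: fourier_def)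
qed

text \<open>
  If the limit vanished almost surely then, at some arbitrarily low frequency, the transform
  of its approximation on a compact set would be small in mean square. Its mean would then be
  small as well, but this mean is at least half of the volume of the compact set.
\<close>

lemma chaos_limit_nontrivial:
  fixes X :: "nat \<Rightarrow> 'a::euclidean_space \<Rightarrow> 'o \<Rightarrow> real"
  assumes P: "prob_space P" and U: "open U" "bounded U" "U \<noteq> {}" and X: "\<And>n. chaos_field P \<beta> U (X n)"
    and lim: "chaos_limit P \<beta> U X v u"
  shows "\<not> (AE \<omega> in P. synthesis (u \<omega>) = (\<lambda>\<phi>. 0))"
proof
  assume zero: "AE \<omega> in P. synthesis (u \<omega>) = (\<lambda>\<phi>. 0)"
  interpret P: prob_space P by (rule P)
  interpret pair_sigma_finite P "lborel :: 'a measure" ..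
  have uR: "u \<in> random_transforms P" using lim by (simp add: chaos_limit_def)
  note [measurable] = random_transforms_measurable[OF uR]
  have s: "- real DIM('a) / 2 - 1 < - real DIM('a) / 2" by simp
  have "AE \<omega> in P. AE \<xi> in lborel. u \<omega> \<xi> = 0"
    using zero AE_space
  proof eventually_elim
    case (elim \<omega>)
    have "is_fourier_transform (synthesis (u \<omega>)) (u \<omega>)"
      by (rule is_fourier_transform_synthesis[OF weighted_L2_imp_temperate[OF random_transforms_weighted_L2[OF uR elim(2) s]]])
    then have "is_fourier_transform (\<lambda>\<phi>. 0) (u \<omega>)" unfolding elim(1) .
    moreover have "is_fourier_transform (\<lambda>\<phi>. 0) (\<lambda>_::'a. 0)" by (simp add: is_fourier_transform_def)
    ultimately show ?case by (rule fourier_transform_unique_AE)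
  qed
  moreover have "{z \<in> space (P \<Otimes>\<^sub>M lborel). u (fst z) (snd z) = 0} \<in> sets (P \<Otimes>\<^sub>M lborel)"
    using random_transforms_measurable[OF uR] unfolding case_prod_beta' by measurable
  ultimately have AE: "AE \<xi> in lborel. AE \<omega> in P. u \<omega> \<xi> = 0" by (simp only: AE_commute)
  from bounded_pos[THEN iffD1, OF U(2)] obtain R where R: "0 < R" "\<And>x. x \<in> U \<Longrightarrow> norm x \<le> R" by blast
  \<comment> \<open>on \<open>U\<close> the phase at frequencies below \<open>r\<close> has
    modulus at most \<open>1\<close>\<close>
  define r where "r = 1 / (2 * pi * R)"
  have r: "0 < r" using R(1) by (simp add: r_def)
  have null: "\<not> (AE x in lborel. x \<notin> V)" if "open V" "V \<noteq> {}" for V :: "'a set"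
  proof
    assume "AE x in lborel. x \<notin> V"
    then have "V \<in> null_sets lborel" using that(1) by (subst AE_iff_null_sets) simp_all
    then have "negligible V" by (simp add: negligible_iff_null_sets null_sets_completionI)
    then show False using open_not_negligible[OF that] by simp
  qed
  have "\<exists>\<xi>\<in>ball 0 r. AE \<omega> in P. u \<omega> \<xi> = 0"
  proof (rule ccontr)
    assume no: "\<not> (\<exists>\<xi>\<in>ball 0 r. AE \<omega> in P. u \<omega> \<xi> = 0)"
    have "AE \<xi> in lborel. \<xi> \<notin> ball (0::'a) r"
      by (rule AE_mp[OF AE]) (rule AE_I2, use no in blast)
    then show False using null[of "ball (0::'a) r"] r by simp
  qed
  then obtain \<xi> where \<xi>: "norm \<xi> < r" "AE \<omega> in P. u \<omega> \<xi> = 0" by auto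
  define m where "m = measure lborel U"
  have fin: "emeasure lborel U < \<infinity>" by (rule emeasure_bounded_finite[OF U(2)])
  have m: "0 < m"
  proof (rule ccontr)
    assume "\<not> 0 < m"
    then have "measure lborel U = 0" using measure_nonneg[of lborel U] by (simp add: m_def)
    then have "emeasure lborel U = 0" using fin by (simp add: emeasure_eq_ennreal_measure)
    then have "U \<in> null_sets lborel" using U(1) by (simp add: null_sets_def)
    then have "AE x in lborel. x \<notin> U" by (rule AE_not_in)
    then show False using null[OF U(1,3)] by simp
  qed
  \<comment> \<open>the mean is at least \<open>(m - \<epsilon>) / 2 \<ge> m / 4\<close>, but at
    most \<open>sqrt \<epsilon> \<le> m / 8\<close>\<close>
  define \<epsilon> where "\<epsilon> = min (m / 2) (m\<^sup>2 / 64)"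
  have \<epsilon>: "0 < \<epsilon>" "\<epsilon> \<le> m / 2" "\<epsilon> \<le> m\<^sup>2 / 64" using m by (simp_all add: \<epsilon>_def)
  from chaos_limit_approximation[OF U(1,2) X lim \<epsilon>(1)] obtain n K where
    K: "compact K" "K \<subseteq> U" and close: "mean_square_close P \<epsilon> (chaos_transform P \<beta> (X n) K) u"
    and vol: "measure lborel U - \<epsilon> < measure lborel K" .
  let ?V = "\<lambda>\<omega>. chaos_transform P \<beta> (X n) K \<omega> \<xi>"
  have cf: "continuous_gaussian_field P U (X n)" by (rule chaos_field_continuous[OF X])
  have int: "chaos_integrable P \<beta> U (X n) K" by (rule chaos_integrable_compact[OF X K])
  have Vm: "?V \<in> borel_measurable P" by (rule random_transforms_section[OF chaos_transform_random[OF cf int]])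
  have "(\<integral>\<^sup>+\<omega>. ennreal ((cmod (?V \<omega>))\<^sup>2) \<partial>P) = (\<integral>\<^sup>+\<omega>. ennreal ((cmod (?V \<omega> - u \<omega> \<xi>))\<^sup>2) \<partial>P)"
    by (rule nn_integral_cong_AE) (use \<xi>(2) in eventually_elim, simp)
  moreover have "(\<integral>\<^sup>+\<omega>. ennreal ((cmod (?V \<omega> - u \<omega> \<xi>))\<^sup>2) \<partial>P) \<le> ennreal \<epsilon>"
    using close by (simp add: mean_square_close_def)
  ultimately have "(\<integral>\<^sup>+\<omega>. ennreal ((cmod (?V \<omega>))\<^sup>2) \<partial>P) \<le> ennreal \<epsilon>" by (simp only:)
  from norm_expectation_le[OF P Vm norm_chaos_transform_le this less_imp_le[OF \<epsilon>(1)]]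
  have upper: "(cmod (fourier (\<lambda>x. indicator K x) \<xi>))\<^sup>2 \<le> \<epsilon>" by (simp only: chaos_transform_mean[OF cf int])
  have "2 * pi * R * norm \<xi> \<le> 1"
    using \<xi>(1) R(1) by (simp add: r_def field_simps)
  then have "measure lborel K / 2 \<le> cmod (fourier (\<lambda>x. indicator K x) \<xi>)"
    by (intro fourier_indicator_low_frequency[OF K(1), of R]) (use R(2) K(2) in auto)
  moreover have "m / 4 \<le> measure lborel K / 2" using vol \<epsilon>(2) by (simp add: m_def)
  ultimately have "m / 4 \<le> cmod (fourier (\<lambda>x. indicator K x) \<xi>)" by linarith
  from power_mono[OF this, of 2] m
  have "(m / 4)\<^sup>2 \<le> (cmod (fourier (\<lambda>x. indicator K x) \<xi>))\<^sup>2" by simp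
  moreover have "(m / 4)\<^sup>2 = m\<^sup>2 / 16" by (simp add: power_divide)
  moreover have "0 < m\<^sup>2" using m by simp
  ultimately show False using upper \<epsilon>(3) by linarith
qed

theorem theorem1p1:
  fixes U :: "'a::euclidean_space set"
    and g :: "'a \<Rightarrow> 'a \<Rightarrow> real"
    and Q :: "'q measure"
    and X :: "'q \<Rightarrow> 'a distribution"
    and P :: "'o measure"
    and Xn :: "nat \<Rightarrow> 'a \<Rightarrow> 'o \<Rightarrow> real"
    and \<beta> :: real
  assumes field: "log_correlated_field Q U g X"
    and prob: "prob_space P"
    and approx: "standard_approximation P U g Xn"
    and beta: "0 < \<beta>" "\<beta> < sqrt (real DIM('a))"
  shows "(\<exists>\<mu>. imaginary_chaos_limit P U \<beta> Xn \<mu> \<and>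
              \<not> (AE \<omega> in P. \<mu> \<omega> = (\<lambda>\<phi>. 0)) \<and>
              (AE \<omega> in P. supported_on (\<mu> \<omega>) (closure U))) \<and>
         (\<forall>Yn :: nat \<Rightarrow> 'a \<Rightarrow> 'o \<Rightarrow> real. \<forall>\<mu> \<nu>.
            standard_approximation P U g Yn \<and>
            jointly_centered_gaussian P (UNIV \<times> UNIV \<times> U)
              (\<lambda>(b, n, x). if b then Xn n x else Yn n x) \<and>
            converges_in_measure_on (U \<times> U) sequentially
              (\<lambda>n (x, y). covar P (Xn n x) (Yn n y)) (\<lambda>(x, y). log_kernel U g x y) \<and>
            imaginary_chaos_limit P U \<beta> Xn \<mu> \<and>
            imaginary_chaos_limit P U \<beta> Yn \<nu> \<longrightarrow>
            (AE \<omega> in P. \<mu> \<omega> = \<nu> \<omega>))"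
proof -
  have U: "log_covariance U g" using field by (simp add: log_correlated_field_def)
  have U': "open U" "bounded U" "U \<noteq> {}" using U by (simp_all add: log_covariance_def)
  have \<beta>: "\<beta>\<^sup>2 < real DIM('a)"
  proof -
    have "\<beta>\<^sup>2 < (sqrt (real DIM('a)))\<^sup>2" using beta by (intro power_strict_mono) simp_all
    then show ?thesis by simp
  qed
  have cf: "chaos_field P \<beta> U (Xn n)" for n by (rule standard_approximation_chaos_field[OF prob U approx \<beta>])
  obtain v u where lim: "chaos_limit P \<beta> U Xn v u"
    and vU: "\<And>n. chaos_integrable P \<beta> U (Xn n) U \<Longrightarrow> v n = chaos_transform P \<beta> (Xn n) U"
    by (rule chaos_limit_exists[OF prob U approx beta(1) \<beta>]) (rule that)
  have "AE \<omega> in P. \<mu> \<omega> = \<nu> \<omega>"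
    if Y: "standard_approximation P U g Yn"
      and joint: "jointly_centered_gaussian P (UNIV \<times> UNIV \<times> U) (\<lambda>(b, n, x). if b then Xn n x else Yn n x)"
      and cross: "converges_in_measure_on (U \<times> U) sequentially
              (\<lambda>n (x, y). covar P (Xn n x) (Yn n y)) (\<lambda>(x, y). log_kernel U g x y)"
      and \<mu>: "imaginary_chaos_limit P U \<beta> Xn \<mu>" and \<nu>: "imaginary_chaos_limit P U \<beta> Yn \<nu>"
    for Yn :: "nat \<Rightarrow> 'a \<Rightarrow> 'o \<Rightarrow> real" and \<mu> \<nu>
  proof -
    have cfY: "chaos_field P \<beta> U (Yn n)" for n by (rule standard_approximation_chaos_field[OF prob U Y \<beta>])
    obtain w y where limY: "chaos_limit P \<beta> U Yn w y"
      by (rule chaos_limit_exists[OF prob U Y beta(1) \<beta>]) (rule that)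
    have XY: "gaussian_pair P U (Xn n) (Yn n)" for n
      unfolding gaussian_pair_def
    proof (intro ballI allI)
      fix x z and a b :: real assume xz: "x \<in> U" "z \<in> U"
      from jointly_centered_gaussian_pair[OF joint, of "(True, n, x)" "(False, n, z)" a b] xz
      show "centered_gaussian P (\<lambda>\<omega>. a * Xn n x \<omega> + b * Yn n z \<omega>)" by simp
    qed
    obtain C where C: "0 \<le> C"
      "\<And>n. AE z in lborel \<Otimes>\<^sub>M lborel. indicator (U \<times> U) z * chaos_kernel P \<beta> (Xn n) (Xn n) z \<le> C * log_majorant \<beta> U z"
      by (rule standard_approximation_dominated[OF approx, of \<beta>]) (rule that)
    obtain D where D: "0 \<le> D"
      "\<And>n. AE z in lborel \<Otimes>\<^sub>M lborel. indicator (U \<times> U) z * chaos_kernel P \<beta> (Yn n) (Yn n) z \<le> D * log_majorant \<beta> U z"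
      by (rule standard_approximation_dominated[OF Y, of \<beta>]) (rule that)
    have "\<forall>\<^sub>F n in sequentially. chaos_discrepancy P \<beta> U (Xn n) (Yn n) < \<epsilon>" if "0 < \<epsilon>" for \<epsilon>
      by (rule eventually_chaos_discrepancy_small[OF U beta(1) \<beta> cf cfY XY
        standard_approximation_diagonal_converges[OF approx] standard_approximation_diagonal_converges[OF Y]
        converges_in_measure_imp_covariances_converge[OF cross] C D that])
    from chaos_limits_eq[OF prob cf cfY XY lim limY this]
    have "AE \<omega> in P. synthesis (u \<omega>) = synthesis (y \<omega>)" .
    moreover have "AE \<omega> in P. \<mu> \<omega> = synthesis (u \<omega>)" by (rule imaginary_chaos_limit_unique[OF prob cf lim \<mu>])
    moreover have "AE \<omega> in P. \<nu> \<omega> = synthesis (y \<omega>)" by (rule imaginary_chaos_limit_unique[OF prob cfY limY \<nu>])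
    ultimately show ?thesis by eventually_elim simp
  qed
  moreover have "imaginary_chaos_limit P U \<beta> Xn (\<lambda>\<omega>. synthesis (u \<omega>))"
    by (rule imaginary_chaos_limit_synthesis[OF prob cf lim vU])
  moreover have "\<not> (AE \<omega> in P. synthesis (u \<omega>) = (\<lambda>\<phi>. 0))"
    by (rule chaos_limit_nontrivial[OF prob U' cf lim])
  moreover have "AE \<omega> in P. supported_on (synthesis (u \<omega>)) (closure U)"
    by (rule chaos_limit_supported[OF prob U'(1,2) cf lim])
  ultimately show ?thesis by blast
qed

end
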